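(* Let $N$ be a simply connected non-singular $2$-step nilpotent Lie group endowed with a left invariant subFinsler metric $d$. Then there is $C>0$ such that $(N,d)$ is $(1,C)$-quasi isometric to its asymptotic cone.
   Context: Commutators: $[x,y]=x^{-1}y^{-1}xy$, and $[N,N]$ is the commutator subgroup of $N$. Non-singular: a simply connected $2$-step nilpotent Lie group $N$ is called non-singular if for all $z\in[N,N]$ and all $x\in N\setminus[N,N]$ there is $y\in N$ such that $[x,y]=z$. Left invariant subFinsler metric: let $\mathfrak{n}$ be the Lie algebra of $N$, $V\subset\mathfrak{n}$ a bracket generating vector subspace (for $2$-step $\mathfrak{n}$: $V+[V,V]=\mathfrak{n}$) and $\|\cdot\|$ a norm on $V$. An absolutely continuous curve $c:[a,b]\to N$ is horizontal if for almost all $t$ the derivative $\dot c(t)$, left-translated to the identity, lies in $V$; $\|\dot c(t)\|$ denotes the norm of this left-translated vector. Then $d(x,y)=\inf\int_a^b\|\dot c(t)\|\,dt$, the infimum being over horizontal curves $c:[a,b]\to N$ with $c(a)=x$, $c(b)=y$. Asymptotic cone: for a pointed proper metric space $(X,d,p)$, if the sequence $\{(X,\frac1n d,p)\}_{n\in\mathbb{N}}$ converges to a pointed metric space $(X_\infty,d_\infty,p_\infty)$ in the pointed Gromov-Hausdorff topology (i.e. for every $R>0$ the balls of radius $R$ around the base points converge in the Gromov-Hausdorff distance of compact metric spaces to the ball $B_{d_\infty}(p_\infty,R)$), then $(X_\infty,d_\infty,p_\infty)$ is called the asymptotic cone of $(X,d,p)$. Here it is taken for $(N,d,id)$; its existence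 and uniqueness up to isometry are known. $(1,C)$-quasi isometric: metric spaces $(X,d_X)$ and $(Y,d_Y)$ are $(1,C)$-quasi isometric if there is a map $f:X\to Y$ such that $|d_Y(f(x),f(x'))-d_X(x,x')|\le C$ for all $x,x'\in X$ and every point of $Y$ is within distance $C$ of $f(X)$. *)

theory Defs
  imports "HOL-Analysis.Analysis" "HOL-Algebra.Generated_Groups"
begin

section \<open>Lie groups\<close>

primrec Ck_on :: "nat \<Rightarrow> 'a::euclidean_space set \<Rightarrow> ('a \<Rightarrow> 'b::euclidean_space) \<Rightarrow> bool" where
  "Ck_on 0 S f \<longleftrightarrow> continuous_on S f"
| "Ck_on (Suc k) S f \<longleftrightarrow>
     f differentiable_on S \<and> (\<forall>v. Ck_on k S (\<lambda>x. frechet_derivative f (at x) v))"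

text \<open>Meant for open \<open>S\<close>: the derivative is the unrestricted one, not the one within \<open>S\<close>.\<close>

definition smooth_on :: "'a::euclidean_space set \<Rightarrow> ('a \<Rightarrow> 'b::euclidean_space) \<Rightarrow> bool" where
  "smooth_on S f \<longleftrightarrow> (\<forall>k. Ck_on k S f)"

text \<open>A chart is a pair \<open>(U, \<phi>)\<close>; the model space of the manifold is the Euclidean space \<open>'e\<close>.
  The Hausdorff property and second countability are imposed by the sort of the type of points.\<close>

type_synonym ('g, 'e) chart = "'g set \<times> ('g \<Rightarrow> 'e)"

definition smooth_atlas ::
  "('g::{t2_space, second_countable_topology}, 'e::euclidean_space) chart set \<Rightarrow> bool" where
  "smooth_atlas A \<longleftrightarrow>
     (\<forall>x. \<exists>(U, \<phi>) \<in> A. x \<in> U) \<and>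
     (\<forall>(U, \<phi>) \<in> A. open U \<and> open (\<phi> ` U) \<and> homeomorphism U (\<phi> ` U) \<phi> (inv_into U \<phi>)) \<and>
     (\<forall>(U, \<phi>) \<in> A. \<forall>(W, \<psi>) \<in> A. smooth_on (\<phi> ` (U \<inter> W)) (\<psi> \<circ> inv_into U \<phi>))"

definition lie_group ::
  "'g::{t2_space, second_countable_topology} monoid \<Rightarrow> ('g, 'e::euclidean_space) chart set \<Rightarrow> bool"
  where
  "lie_group N A \<longleftrightarrow>
     group N \<and> carrier N = UNIV \<and> smooth_atlas A \<and>
     continuous_on UNIV (\<lambda>(x, y). x \<otimes>\<^bsub>N\<^esub> y) \<and>
     continuous_on UNIV (\<lambda>x. inv\<^bsub>N\<^esub> x) \<and>
     (\<forall>(U, \<phi>) \<in> A. \<forall>(W, \<psi>) \<in> A. \<forall>(Z, \<zeta>) \<in> A.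
        smooth_on
          {(u, w). u \<in> \<phi> ` U \<and> w \<in> \<psi> ` W \<and> inv_into U \<phi> u \<otimes>\<^bsub>N\<^esub> inv_into W \<psi> w \<in> Z}
          (\<lambda>(u, w). \<zeta> (inv_into U \<phi> u \<otimes>\<^bsub>N\<^esub> inv_into W \<psi> w))) \<and>
     (\<forall>(U, \<phi>) \<in> A. \<forall>(Z, \<zeta>) \<in> A.
        smooth_on
          {u \<in> \<phi> ` U. inv\<^bsub>N\<^esub> (inv_into U \<phi> u) \<in> Z}
          (\<lambda>u. \<zeta> (inv\<^bsub>N\<^esub> (inv_into U \<phi> u))))"


section \<open>Two-step nilpotent and non-singular groups\<close>

definition commutator :: "('g, 'b) monoid_scheme \<Rightarrow> 'g \<Rightarrow> 'g \<Rightarrow> 'g" where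
  "commutator N x y = inv\<^bsub>N\<^esub> x \<otimes>\<^bsub>N\<^esub> inv\<^bsub>N\<^esub> y \<otimes>\<^bsub>N\<^esub> x \<otimes>\<^bsub>N\<^esub> y"

text \<open>The commutator subgroup \<open>[N, N]\<close> is \<^term>\<open>derived N (carrier N)\<close>; the library generates it by
  the elements \<open>x y x\<inverse> y\<inverse>\<close>, which gives the same subgroup.\<close>

definition two_step_nilpotent :: "('g, 'b) monoid_scheme \<Rightarrow> bool" where
  "two_step_nilpotent N \<longleftrightarrow>
     derived N (carrier N) \<noteq> {\<one>\<^bsub>N\<^esub>} \<and>
     (\<forall>x \<in> carrier N. \<forall>z \<in> derived N (carrier N). commutator N x z = \<one>\<^bsub>N\<^esub>)"

definition non_singular :: "('g, 'b) monoid_scheme \<Rightarrow> bool" where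
  "non_singular N \<longleftrightarrow>
     (\<forall>z \<in> derived N (carrier N). \<forall>x \<in> carrier N - derived N (carrier N).
        \<exists>y \<in> carrier N. commutator N x y = z)"


section \<open>The Lie algebra\<close>

text \<open>Fix a chart \<open>(U, \<phi>)\<close> around the identity. Its differential identifies the tangent space at the
  identity with \<open>'e\<close>, and \<open>'e\<close> plays the role of the Lie algebra. The left invariant vector field
  with value \<open>v\<close> at the identity is, in the chart, \<open>p \<mapsto> D\<^sub>y|\<^bsub>y = \<phi>(1)\<^esub> \<phi>(\<phi>\<inverse>(p) \<phi>\<inverse>(y)) v\<close>.\<close>

definition left_invariant_field ::
  "('g, 'b) monoid_scheme \<Rightarrow> ('g, 'e::euclidean_space) chart \<Rightarrow> 'e \<Rightarrow> 'e \<Rightarrow> 'e" where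
  "left_invariant_field N = (\<lambda>(U, \<phi>) v p.
     frechet_derivative (\<lambda>y. \<phi> (inv_into U \<phi> p \<otimes>\<^bsub>N\<^esub> inv_into U \<phi> y)) (at (\<phi> \<one>\<^bsub>N\<^esub>)) v)"

text \<open>The bracket of vector fields is \<open>[X, Y] = DY(X) - DX(Y)\<close> in coordinates, evaluated here at the
  identity, where the fields take the values \<open>u\<close> and \<open>v\<close>.\<close>

definition lie_bracket ::
  "('g, 'b) monoid_scheme \<Rightarrow> ('g, 'e::euclidean_space) chart \<Rightarrow> 'e \<Rightarrow> 'e \<Rightarrow> 'e" where
  "lie_bracket N ch u v =
     frechet_derivative (left_invariant_field N ch v) (at (snd ch \<one>\<^bsub>N\<^esub>)) u -
     frechet_derivative (left_invariant_field N ch u) (at (snd ch \<one>\<^bsub>N\<^esub>)) v"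

definition bracket_generating ::
  "('g, 'b) monoid_scheme \<Rightarrow> ('g, 'e::euclidean_space) chart \<Rightarrow> 'e set \<Rightarrow> bool" where
  "bracket_generating N ch V \<longleftrightarrow>
     (\<forall>x. \<exists>v \<in> V. \<exists>w \<in> span {lie_bracket N ch u u' |u u'. u \<in> V \<and> u' \<in> V}. x = v + w)"


section \<open>Left invariant subFinsler metrics\<close>

definition norm_on :: "'e::real_vector set \<Rightarrow> ('e \<Rightarrow> real) \<Rightarrow> bool" where
  "norm_on V \<nu> \<longleftrightarrow>
     (\<forall>v \<in> V. 0 \<le> \<nu> v \<and> (\<nu> v = 0 \<longleftrightarrow> v = 0)) \<and>
     (\<forall>v \<in> V. \<forall>r. \<nu> (r *\<^sub>R v) = \<bar>r\<bar> * \<nu> v) \<and>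
     (\<forall>v \<in> V. \<forall>w \<in> V. \<nu> (v + w) \<le> \<nu> v + \<nu> w)"

definition absolutely_continuous_curve :: "real \<Rightarrow> real \<Rightarrow> (real \<Rightarrow> 'e::real_normed_vector) \<Rightarrow> bool"
  where
  "absolutely_continuous_curve a b f \<longleftrightarrow>
     (\<forall>\<epsilon>>0. \<exists>\<delta>>0. \<forall>(n::nat) s t.
        (\<forall>i<n. a \<le> s i \<and> s i \<le> t i \<and> t i \<le> b) \<and>
        disjoint_family_on (\<lambda>i. {s i<..<t i}) {..<n} \<and>
        (\<Sum>i<n. t i - s i) < \<delta>
        \<longrightarrow> (\<Sum>i<n. norm (f (t i) - f (s i))) < \<epsilon>)"

text \<open>Absolute continuity of a curve in the manifold: the curve is continuous, and absolutely
  continuous in charts.\<close>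

definition absolutely_continuous_in ::
  "('g::topological_space, 'e::euclidean_space) chart set \<Rightarrow> real \<Rightarrow> real \<Rightarrow> (real \<Rightarrow> 'g) \<Rightarrow> bool"
  where
  "absolutely_continuous_in A a b c \<longleftrightarrow>
     continuous_on {a..b} c \<and>
     (\<forall>(U, \<phi>) \<in> A. \<forall>a' b'. a \<le> a' \<and> a' \<le> b' \<and> b' \<le> b \<and> c ` {a'..b'} \<subseteq> U
        \<longrightarrow> absolutely_continuous_curve a' b' (\<phi> \<circ> c))"

text \<open>The derivative of \<open>c\<close> at \<open>t\<close>, left-translated to the identity, is the derivative at \<open>s = t\<close> of
  \<open>s \<mapsto> c(t)\<inverse> c(s)\<close>, a curve through the identity; it is read in the chart at the identity.\<close>

definition left_translated ::
  "('g, 'b) monoid_scheme \<Rightarrow> ('g, 'e) chart \<Rightarrow> (real \<Rightarrow> 'g) \<Rightarrow> real \<Rightarrow> real \<Rightarrow> 'e" where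
  "left_translated N ch c t s = snd ch (inv\<^bsub>N\<^esub> (c t) \<otimes>\<^bsub>N\<^esub> c s)"

definition horizontal_curve ::
  "'g::topological_space monoid \<Rightarrow> ('g, 'e::euclidean_space) chart set \<Rightarrow> ('g, 'e) chart \<Rightarrow> 'e set \<Rightarrow>
   real \<Rightarrow> real \<Rightarrow> (real \<Rightarrow> 'g) \<Rightarrow> bool" where
  "horizontal_curve N A ch V a b c \<longleftrightarrow>
     absolutely_continuous_in A a b c \<and>
     (AE t in lebesgue. t \<in> {a..b} \<longrightarrow>
        (\<exists>v \<in> V. (left_translated N ch c t has_vector_derivative v) (at t within {a..b})))"

definition curve_length ::
  "('g, 'b) monoid_scheme \<Rightarrow> ('g, 'e::euclidean_space) chart \<Rightarrow> ('e \<Rightarrow> real) \<Rightarrow>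
   real \<Rightarrow> real \<Rightarrow> (real \<Rightarrow> 'g) \<Rightarrow> ennreal" where
  "curve_length N ch \<nu> a b c =
     (\<integral>\<^sup>+ t \<in> {a..b}. ennreal (\<nu> (vector_derivative (left_translated N ch c t) (at t within {a..b})))
        \<partial>lebesgue)"

definition subFinsler_dist ::
  "'g::topological_space monoid \<Rightarrow> ('g, 'e::euclidean_space) chart set \<Rightarrow> ('g, 'e) chart \<Rightarrow> 'e set \<Rightarrow>
   ('e \<Rightarrow> real) \<Rightarrow> 'g \<Rightarrow> 'g \<Rightarrow> real" where
  "subFinsler_dist N A ch V \<nu> x y =
     enn2real (Inf {curve_length N ch \<nu> a b c |a b c.
       a < b \<and> horizontal_curve N A ch V a b c \<and> c a = x \<and> c b = y})"


section \<open>Asymptotic cones and quasi-isometries\<close>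

definition proper_metric_space :: "'a set \<Rightarrow> ('a \<Rightarrow> 'a \<Rightarrow> real) \<Rightarrow> bool" where
  "proper_metric_space X d \<longleftrightarrow>
     Metric_space X d \<and>
     (\<forall>x \<in> X. \<forall>R. compactin (Metric_space.mtopology X d) (Metric_space.mcball X d x R))"

definition hausdorff_dist :: "('a \<Rightarrow> 'a \<Rightarrow> real) \<Rightarrow> 'a set \<Rightarrow> 'a set \<Rightarrow> real" where
  "hausdorff_dist d S T =
     Inf {r. 0 \<le> r \<and> (\<forall>x \<in> S. \<exists>y \<in> T. d x y \<le> r) \<and> (\<forall>y \<in> T. \<exists>x \<in> S. d x y \<le> r)}"

definition isometric_embedding ::
  "'a set \<Rightarrow> ('a \<Rightarrow> 'a \<Rightarrow> real) \<Rightarrow> 'b set \<Rightarrow> ('b \<Rightarrow> 'b \<Rightarrow> real) \<Rightarrow> ('a \<Rightarrow> 'b) \<Rightarrow> bool" where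
  "isometric_embedding X dX Z dZ f \<longleftrightarrow>
     f ` X \<subseteq> Z \<and> (\<forall>x \<in> X. \<forall>x' \<in> X. dZ (f x) (f x') = dX x x')"

text \<open>The infimum is over all metric spaces \<open>Z\<close> containing isometric copies of \<open>X\<close> and \<open>Y\<close>. Points
  of \<open>Z\<close> outside the two copies are irrelevant and the union of the copies injects into the sum
  type, so letting \<open>Z\<close> range over subsets of \<open>'a + 'b\<close> is no restriction.\<close>

definition gromov_hausdorff_dist ::
  "'a set \<Rightarrow> ('a \<Rightarrow> 'a \<Rightarrow> real) \<Rightarrow> 'b set \<Rightarrow> ('b \<Rightarrow> 'b \<Rightarrow> real) \<Rightarrow> real" where
  "gromov_hausdorff_dist X dX Y dY =
     Inf {hausdorff_dist dZ (f ` X) (g ` Y) |(Z :: ('a + 'b) set) dZ f g.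
       Metric_space Z dZ \<and> isometric_embedding X dX Z dZ f \<and> isometric_embedding Y dY Z dZ g}"

text \<open>The term of the sequence at \<open>n = 0\<close> is meaningless and does not affect the limit.\<close>

definition asymptotic_cone ::
  "'a set \<Rightarrow> ('a \<Rightarrow> 'a \<Rightarrow> real) \<Rightarrow> 'a \<Rightarrow> 'b set \<Rightarrow> ('b \<Rightarrow> 'b \<Rightarrow> real) \<Rightarrow> 'b \<Rightarrow> bool" where
  "asymptotic_cone X d p Y dY q \<longleftrightarrow>
     proper_metric_space X d \<and> p \<in> X \<and> proper_metric_space Y dY \<and> q \<in> Y \<and>
     (\<forall>R>0. (\<lambda>n::nat.
        gromov_hausdorff_dist
          (Metric_space.mcball X (\<lambda>x y. d x y / real n) p R) (\<lambda>x y. d x y / real n)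
          (Metric_space.mcball Y dY q R) dY) \<longlonglongrightarrow> 0)"

definition quasi_isometric_1 ::
  "real \<Rightarrow> 'a set \<Rightarrow> ('a \<Rightarrow> 'a \<Rightarrow> real) \<Rightarrow> 'b set \<Rightarrow> ('b \<Rightarrow> 'b \<Rightarrow> real) \<Rightarrow> bool" where
  "quasi_isometric_1 C X dX Y dY \<longleftrightarrow>
     (\<exists>f. f ` X \<subseteq> Y \<and>
        (\<forall>x \<in> X. \<forall>x' \<in> X. \<bar>dY (f x) (f x') - dX x x'\<bar> \<le> C) \<and>
        (\<forall>y \<in> Y. \<exists>x \<in> X. dY y (f x) \<le> C))"

end

theory Submission
  imports Defs "HOL-Library.Diagonal_Subsequence"
begin

text \<open>The exponential map identifies \<open>N\<close> with its Lie algebra under the law \<open>u * w = u + w + [u, w] / 2\<close>. The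
  subFinsler distance from \<open>0\<close> to \<open>x\<close> is the infimal total norm of the words in \<open>V\<close> whose product is \<open>x\<close>.
  Let \<open>\<zeta>\<close> project onto the derived algebra. Replacing every letter \<open>v\<close> by \<open>v - \<zeta> v\<close> gives a second left
  invariant metric, which is homogeneous under the dilations \<open>t\<close> on the kernel of \<open>\<zeta>\<close> and \<open>t\<^sup>2\<close> on its image, so it
  is its own asymptotic cone. The replacement changes the product of a word of length \<open>L\<close> by a central
  element of size \<open>O(L)\<close>. By non-singularity this element is a commutator of a bounded element with a
  prefix whose projection has size comparable to \<open>L\<close>; conjugating that prefix therefore corrects the
  product at bounded cost. Hence the two metrics differ by a bounded amount.\<close>

section \<open>Two-step nilpotent group laws on a vector space\<close>

text \<open>A prefix with large projection exists because the metric is anisotropic: the distance of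
  x from 0 is at most a multiple of |pr x| + sqrt |pr x| + sqrt |\<zeta> x|. If every prefix of an
  almost optimal word of length L had projection at most c L, the central part of its product would
  be of order at most L + c L^2; for small c the distance would then be at most L / 2 + O(sqrt L),
  which is impossible for long words. Non-singularity is a pointwise condition, whereas the
  correction needs a commutator partner of uniformly bounded size; compactness of unit spheres
  supplies the uniform constant. The cone in the theorem is an arbitrary pointed limit. Its
  approximations need not match base points, nor fit together for different radii. Hence it is shown
  that almost isometries of large balls move the centre by a bounded amount, and a subsequence is
  then taken. The group is given by smooth charts, so exp is built from second order estimates for
  the multiplication; simple connectedness makes it bijective.\<close>

locale nil2 =
  fixes b :: "'e::euclidean_space \<Rightarrow> 'e \<Rightarrow> 'e"
  assumes bil: "bilinear b" and b_self [simp]: "b u u = 0" and b_b [simp]: "b (b u v) w = 0"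
begin

sublocale b: bounded_bilinear b
  using bil by (simp add: bilinear_conv_bounded_bilinear)

lemma b_skew: "b v u = - b u v"
proof -
  have "b v u + b u v = 0"
    using b_self[of "u + v"] unfolding b.add_left b.add_right by simp
  then show ?thesis by (simp add: eq_neg_iff_add_eq_0)
qed

lemma b_b' [simp]: "b u (b v w) = 0"
  using b_skew[of u "b v w"] by simp

definition mul :: "'e \<Rightarrow> 'e \<Rightarrow> 'e" where "mul u w = u + w + (1/2) *\<^sub>R b u w"

lemma mul_assoc: "mul (mul u v) w = mul u (mul v w)"
  by (simp add: mul_def b.add_left b.add_right b.scaleR_left b.scaleR_right scaleR_add_right)

lemma mul_0 [simp]: "mul u 0 = u" "mul 0 u = u"
  by (simp_all add: mul_def b.zero_left b.zero_right)

lemma mul_minus [simp]: "mul u (- u) = 0" "mul (- u) u = 0"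
  by (simp_all add: mul_def b.minus_left b.minus_right)

lemma mul_cancel [simp]: "mul u (mul (- u) v) = v" "mul (- u) (mul u v) = v"
  by (simp_all flip: mul_assoc)

lemma minus_mul: "- mul u w = mul (- w) (- u)"
  by (simp add: mul_def b.minus_left b.minus_right b_skew[of u w])

lemma mul_scale_same: "mul (s *\<^sub>R u) (t *\<^sub>R u) = (s + t) *\<^sub>R u"
  by (simp add: mul_def b.scaleR_left b.scaleR_right scaleR_add_left)

primrec prodm :: "(nat \<Rightarrow> 'e) \<Rightarrow> nat \<Rightarrow> 'e" where
  "prodm f 0 = 0"
| "prodm f (Suc n) = mul (prodm f n) (f n)"

text \<open>Changing each factor by neighbouring terms of a sequence \<eta> changes the product at
  its two ends only. In the homotopy argument \<open>f\<close> and \<open>g\<close> are the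
  increments along neighbouring rows of a grid and \<eta> holds the increments between the
  rows.\<close>

lemma prodm_telescope:
  assumes "\<And>i. i < n \<Longrightarrow> g i = mul (mul (- \<eta> i) (f i)) (\<eta> (Suc i))"
  shows "prodm g n = mul (mul (- \<eta> 0) (prodm f n)) (\<eta> n)"
  using assms
proof (induction n)
  case (Suc n)
  then have "prodm g (Suc n) = mul (mul (mul (- \<eta> 0) (prodm f n)) (\<eta> n)) (mul (mul (- \<eta> n) (f n)) (\<eta> (Suc n)))"
    by simp
  then show ?case by (simp add: mul_assoc)
qed simp

lemma prodm_const: "(\<And>i. i < n \<Longrightarrow> f i = v) \<Longrightarrow> prodm f n = real n *\<^sub>R v"
proof (induction n)
  case (Suc n)
  then show ?case using mul_scale_same[of "real n" v 1] by (simp add: add.commute)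
qed simp

lemma mul_bound:
  obtains B where "0 < B" "\<And>u w. norm (b u w) \<le> B * norm u * norm w"
    "\<And>u w. norm (mul u w) \<le> norm u + norm w + B * norm u * norm w"
proof -
  obtain B where B: "0 < B" "\<And>u w. norm (b u w) \<le> norm u * norm w * B"
    using b.pos_bounded by blast
  have bb: "norm (b u w) \<le> B * norm u * norm w" for u w using B(2)[of u w] by (simp add: mult_ac)
  have "norm (mul u w) \<le> norm u + norm w + B * norm u * norm w" for u w
  proof -
    have "norm (mul u w) \<le> norm u + norm w + (1/2) * norm (b u w)"
      unfolding mul_def using norm_triangle_ineq[of "u + w" "(1/2) *\<^sub>R b u w"] norm_triangle_ineq[of u w] by simp
    then show ?thesis using bb[of u w] norm_ge_zero[of "b u w"] by linarith
  qed
  then show ?thesis using that B(1) bb by blast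
qed

end

section \<open>The exponential map in local coordinates\<close>

text \<open>\<open>k\<close> is an inverse chart with the identity moved to 0, and \<open>m\<close>
  is the multiplication read in it. Smoothness enters through \<open>m_est\<close>: the map (u, w)
  -> m u w - u - w is Lipschitz with constant \<open>K * \<rho>\<close> on the ball of radius
  \<rho>, as for a C^2 map whose derivative at 0 is addition.\<close>

locale local_coordinates = group N for N :: "'g::t2_space monoid" (structure) +
  fixes k :: "'e::euclidean_space \<Rightarrow> 'g" and D :: "'e set" and m :: "'e \<Rightarrow> 'e \<Rightarrow> 'e" and r K :: real
  assumes carrier_UNIV [simp]: "carrier N = UNIV"
    and cont_mult: "continuous_on UNIV (\<lambda>(x, y). x \<otimes> y)"
    and cont_inv: "continuous_on UNIV (\<lambda>x. inv x)"
    and open_D: "open D" and cont_k: "continuous_on D k" and inj_k: "inj_on k D"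
    and open_k: "\<And>T. open T \<Longrightarrow> T \<subseteq> D \<Longrightarrow> open (k ` T)"
    and r_pos: "0 < r" and K_pos: "0 < K" and cball_D: "cball 0 r \<subseteq> D"
    and k_0: "k 0 = \<one>"
    and m_0: "\<And>u. norm u \<le> r \<Longrightarrow> m u 0 = u" "\<And>u. norm u \<le> r \<Longrightarrow> m 0 u = u"
    and m_D: "\<And>u w. norm u \<le> r \<Longrightarrow> norm w \<le> r \<Longrightarrow> m u w \<in> D"
    and k_m: "\<And>u w. norm u \<le> r \<Longrightarrow> norm w \<le> r \<Longrightarrow> k u \<otimes> k w = k (m u w)"
    and m_est: "\<And>u w u' w' \<rho>. norm u \<le> \<rho> \<Longrightarrow> norm w \<le> \<rho> \<Longrightarrow> norm u' \<le> \<rho> \<Longrightarrow> norm w' \<le> \<rho> \<Longrightarrow> \<rho> \<le> r \<Longrightarrow>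
      norm (m u w - m u' w' - (u - u') - (w - w')) \<le> K * \<rho> * (norm (u - u') + norm (w - w'))"
begin

definition sq :: "'e \<Rightarrow> 'e" where "sq u = m u u"

text \<open>The bound \<open>4 * K * r1 \<le> 1\<close> keeps the accumulated error of i squarings
  below the main term 2^i, as long as all points stay within \<open>r1\<close>.\<close>

definition r1 :: real where "r1 = min r (1 / (4 * K))"

lemma r1: "0 < r1" "r1 \<le> r" "4 * K * r1 \<le> 1"
  using r_pos K_pos by (auto simp: r1_def min_def field_simps)

lemma sq_0 [simp]: "sq 0 = 0"
  using m_0 r_pos by (simp add: sq_def)

lemma sq_est:
  assumes "norm x \<le> \<rho>" "norm x' \<le> \<rho>" "\<rho> \<le> r"
  shows "norm (sq x - sq x' - 2 *\<^sub>R (x - x')) \<le> 2 * K * \<rho> * norm (x - x')"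
proof -
  have "sq x - sq x' - 2 *\<^sub>R (x - x') = m x x - m x' x' - (x - x') - (x - x')"
    by (simp add: sq_def scaleR_2)
  then show ?thesis
    using m_est[OF assms(1,1,2,2,3)] by simp
qed

lemma iterate_sq_0 [simp]: "(sq ^^ i) 0 = 0"
  by (induction i) auto

text \<open>The constant is stable under one more squaring. In units of
  \<open>K * 4 ^ i * \<rho> * norm (a - a')\<close>, the old error is doubled to 8, and squaring at
  scale \<open>2 * 2 ^ i * \<rho>\<close> adds another 8; the sum 16 is
  \<open>4 * 4\<close>.\<close>

lemma iterate_sq_est:
  assumes "norm a \<le> \<rho>" "norm a' \<le> \<rho>" "2 ^ i * \<rho> \<le> r1"
  shows "norm ((sq ^^ i) a - (sq ^^ i) a' - 2 ^ i *\<^sub>R (a - a')) \<le> 4 * K * 4 ^ i * \<rho> * norm (a - a')"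
  using assms
proof (induction i arbitrary: a a')
  case 0
  have "0 \<le> \<rho>" using 0(1) norm_ge_zero order_trans by blast
  then show ?case using K_pos by simp
next
  case (Suc i)
  have rho: "0 \<le> \<rho>" using Suc.prems(1) norm_ge_zero order_trans by blast
  have four: "(4::real) ^ i = 2 ^ i * 2 ^ i" by (simp flip: power_mult_distrib)
  have small: "2 ^ i * \<rho> \<le> r1" "2 * (2 ^ i * \<rho>) \<le> r1"
    using Suc.prems(3) rho by (auto intro: order_trans[rotated])
  have lip: "norm ((sq ^^ i) x - (sq ^^ i) x') \<le> 2 * 2 ^ i * norm (x - x')"
    if "norm x \<le> \<rho>" "norm x' \<le> \<rho>" for x x'
  proof -
    have "4 * K * 4 ^ i * \<rho> * norm (x - x') = (4 * K * (2 ^ i * \<rho>)) * (2 ^ i * norm (x - x'))"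
      by (simp add: mult_ac four)
    also have "\<dots> \<le> 1 * (2 ^ i * norm (x - x'))"
    proof (rule mult_right_mono)
      have "4 * K * (2 ^ i * \<rho>) \<le> 4 * K * r1" using small K_pos by (intro mult_left_mono) auto
      then show "4 * K * (2 ^ i * \<rho>) \<le> 1" using r1 by linarith
    qed auto
    finally have "norm ((sq ^^ i) x - (sq ^^ i) x' - 2 ^ i *\<^sub>R (x - x')) \<le> 2 ^ i * norm (x - x')"
      using Suc.IH[OF that small(1)] by linarith
    then show ?thesis
      using norm_triangle_sub[of "(sq ^^ i) x - (sq ^^ i) x'" "2 ^ i *\<^sub>R (x - x')"] by simp
  qed
  have bd: "norm ((sq ^^ i) x) \<le> 2 * (2 ^ i * \<rho>)" if "norm x \<le> \<rho>" for x
  proof -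
    have "norm ((sq ^^ i) x) \<le> 2 * 2 ^ i * norm x"
      using lip[OF that, of 0] rho by simp
    also have "\<dots> \<le> 2 * 2 ^ i * \<rho>" using that by (intro mult_left_mono) auto
    finally show ?thesis by simp
  qed
  let ?x = "(sq ^^ i) a" and ?x' = "(sq ^^ i) a'"
  have 1: "norm (sq ?x - sq ?x' - 2 *\<^sub>R (?x - ?x')) \<le> 2 * K * (2 * (2 ^ i * \<rho>)) * norm (?x - ?x')"
    using sq_est[OF bd bd] Suc.prems small r1 by simp
  also have "\<dots> \<le> 2 * K * (2 * (2 ^ i * \<rho>)) * (2 * 2 ^ i * norm (a - a'))"
    using lip[OF Suc.prems(1,2)] K_pos rho by (intro mult_left_mono) auto
  also have "\<dots> = 8 * K * 4 ^ i * \<rho> * norm (a - a')"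
    by (simp add: mult_ac four)
  finally have 1: "norm (sq ?x - sq ?x' - 2 *\<^sub>R (?x - ?x')) \<le> 8 * K * 4 ^ i * \<rho> * norm (a - a')" .
  have 2: "norm (2 *\<^sub>R (?x - ?x' - 2 ^ i *\<^sub>R (a - a'))) \<le> 2 * (4 * K * 4 ^ i * \<rho> * norm (a - a'))"
    unfolding norm_scaleR abs_numeral using Suc.IH[OF Suc.prems(1,2) small(1)] by linarith
  have "sq ?x - sq ?x' - 2 ^ Suc i *\<^sub>R (a - a') =
      (sq ?x - sq ?x' - 2 *\<^sub>R (?x - ?x')) + 2 *\<^sub>R (?x - ?x' - 2 ^ i *\<^sub>R (a - a'))"
    by (simp add: algebra_simps)
  then have "norm (sq ?x - sq ?x' - 2 ^ Suc i *\<^sub>R (a - a')) \<le>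
      norm (sq ?x - sq ?x' - 2 *\<^sub>R (?x - ?x')) + norm (2 *\<^sub>R (?x - ?x' - 2 ^ i *\<^sub>R (a - a')))"
    by (metis norm_triangle_ineq)
  also have "\<dots> \<le> 16 * K * 4 ^ i * \<rho> * norm (a - a')"
    using 1 2 by linarith
  finally show ?case by simp
qed

lemma iterate_sq_lip:
  assumes "norm a \<le> \<rho>" "norm a' \<le> \<rho>" "2 ^ i * \<rho> \<le> r1"
  shows "norm ((sq ^^ i) a - (sq ^^ i) a') \<le> 2 * 2 ^ i * norm (a - a')"
proof -
  have four: "(4::real) ^ i = 2 ^ i * 2 ^ i" by (simp flip: power_mult_distrib)
  have "4 * K * 4 ^ i * \<rho> * norm (a - a') = (4 * K * (2 ^ i * \<rho>)) * (2 ^ i * norm (a - a'))"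
    by (simp add: mult_ac four)
  also have "\<dots> \<le> 1 * (2 ^ i * norm (a - a'))"
  proof (rule mult_right_mono)
    have "4 * K * (2 ^ i * \<rho>) \<le> 4 * K * r1" using assms(3) K_pos by (intro mult_left_mono) auto
    then show "4 * K * (2 ^ i * \<rho>) \<le> 1" using r1 by linarith
  qed auto
  finally have "norm ((sq ^^ i) a - (sq ^^ i) a' - 2 ^ i *\<^sub>R (a - a')) \<le> 2 ^ i * norm (a - a')"
    using iterate_sq_est[OF assms] by linarith
  then show ?thesis
    using norm_triangle_sub[of "(sq ^^ i) a - (sq ^^ i) a'" "2 ^ i *\<^sub>R (a - a')"] by simp
qed

lemma iterate_sq_bd:
  assumes "norm a \<le> \<rho>" "2 ^ i * \<rho> \<le> r1"
  shows "norm ((sq ^^ i) a) \<le> 2 * 2 ^ i * \<rho>"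
proof -
  have rho: "0 \<le> \<rho>" using assms(1) norm_ge_zero order_trans by blast
  have "norm ((sq ^^ i) a) \<le> 2 * 2 ^ i * norm a"
    using iterate_sq_lip[OF assms(1) _ assms(2), of 0] rho by simp
  also have "\<dots> \<le> 2 * 2 ^ i * \<rho>" using assms by (intro mult_left_mono) auto
  finally show ?thesis .
qed

lemma k_iterate_sq:
  assumes "norm a \<le> \<rho>" "2 ^ i * \<rho> \<le> r1"
  shows "k ((sq ^^ i) a) = k a [^] ((2::nat) ^ i)"
  using assms(2)
proof (induction i)
  case (Suc i)
  have rho: "0 \<le> \<rho>" using assms(1) norm_ge_zero order_trans by blast
  have small: "2 ^ i * \<rho> \<le> r1"
    using Suc.prems rho by (auto intro: order_trans[rotated])
  have "norm ((sq ^^ i) a) \<le> r"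
    using iterate_sq_bd[OF assms(1) small] Suc.prems r1 by simp
  then have "k ((sq ^^ Suc i) a) = k ((sq ^^ i) a) \<otimes> k ((sq ^^ i) a)"
    by (simp add: sq_def k_m)
  then show ?case
    using Suc.IH[OF small] by (simp add: nat_pow_mult mult_2)
qed simp

text \<open>Half of \<open>r1\<close>, because the iteration estimates are applied with radius 2 |v|
  / 2^j when successive approximations are compared, and later to sequences that are merely close to
  v after rescaling.\<close>

definition r2 :: real where "r2 = r1 / 2"

lemma r2: "0 < r2" "r2 < r1" "2 * r2 = r1" "r2 \<le> r" "8 * K * r2 \<le> 1"
  using r1 by (auto simp: r2_def)

text \<open>The exponential map in coordinates: \<open>exp v\<close> is the limit of \<open>(v / 2\<^sup>j)\<close> squared \<open>j\<close> times in the group.\<close>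

definition xp :: "'e \<Rightarrow> 'e" where "xp v = lim (\<lambda>j. (sq ^^ j) (v /\<^sub>R 2 ^ j))"

text \<open>With x = v / 2^(j+1), consecutive terms are the j-fold squares of \<open>sq x\<close>
  and of 2 x. These two points differ by O(4^-j), and j squarings enlarge the difference by a factor
  of order 2^j, so the increments are summable.\<close>

lemma xp_tendsto:
  assumes v: "norm v \<le> r2"
  shows "(\<lambda>j. (sq ^^ j) (v /\<^sub>R 2 ^ j)) \<longlonglongrightarrow> xp v"
proof -
  define e where "e = (\<lambda>j. (sq ^^ j) (v /\<^sub>R 2 ^ j))"
  have step: "norm (e (Suc j) - e j) \<le> K * (norm v)\<^sup>2 * (1 / 2) ^ j" for j
  proof -
    define x where "x = v /\<^sub>R 2 ^ Suc j"
    have nx: "norm x = norm v / (2 * 2 ^ j)" by (simp add: x_def field_simps)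
    also have "\<dots> \<le> norm v" using mult_left_mono[of 1 "2 * 2 ^ j" "norm v"] one_le_power[of "2::real" "Suc j"]
      by (simp add: divide_le_eq)
    finally have xr: "norm x \<le> r2" using v by simp
    have 1: "norm (sq x - 2 *\<^sub>R x) \<le> 2 * K * norm x * norm x"
      using sq_est[of x "norm x" 0] xr r2 by simp
    also have "\<dots> \<le> 1 * norm x"
    proof (rule mult_right_mono)
      have "8 * K * norm x \<le> 8 * K * r2" using xr K_pos by (intro mult_left_mono) auto
      then show "2 * K * norm x \<le> 1" using r2 K_pos mult_nonneg_nonneg[of K "norm x"] by linarith
    qed auto
    finally have "norm (sq x) \<le> 3 * norm x"
      using norm_triangle_sub[of "sq x" "2 *\<^sub>R x"] by simp
    then have sqx: "norm (sq x) \<le> 2 * (norm v / 2 ^ j)"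
    proof -
      define t where "t = norm v / 2 ^ j"
      have "0 \<le> t" "norm x = t / 2" unfolding t_def using nx by simp_all
      then have "norm (sq x) \<le> 2 * t" using \<open>norm (sq x) \<le> 3 * norm x\<close> by linarith
      then show ?thesis by (simp only: t_def)
    qed
    have x2: "2 *\<^sub>R x = v /\<^sub>R 2 ^ j" by (simp add: x_def)
    have "e (Suc j) - e j = (sq ^^ j) (sq x) - (sq ^^ j) (2 *\<^sub>R x)"
      unfolding x2 by (simp add: e_def x_def funpow_swap1)
    also have "norm \<dots> \<le> 2 * 2 ^ j * norm (sq x - 2 *\<^sub>R x)"
    proof (rule iterate_sq_lip[of _ "2 * (norm v / 2 ^ j)"])
      show "norm (2 *\<^sub>R x) \<le> 2 * (norm v / 2 ^ j)" using nx by (simp add: field_simps)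
      show "2 ^ j * (2 * (norm v / 2 ^ j)) \<le> r1" using v r2 by simp
    qed (rule sqx)
    also have "\<dots> \<le> 2 * 2 ^ j * (2 * K * norm x * norm x)"
      using 1 by (intro mult_left_mono) auto
    also have "\<dots> = K * (norm v)\<^sup>2 * (1 / 2) ^ j"
      unfolding nx by (simp add: field_simps power2_eq_square)
    finally show ?thesis .
  qed
  have "summable (\<lambda>j. K * (norm v)\<^sup>2 * (1 / 2) ^ j)"
    by (intro summable_mult summable_geometric) auto
  then have "summable (\<lambda>j. e (Suc j) - e j)"
    by (rule summable_comparison_test'[where N = 0]) (use step in auto)
  then have "convergent (\<lambda>n. \<Sum>j<n. e (Suc j) - e j)"
    by (simp add: summable_iff_convergent)
  then have "convergent (\<lambda>n. e n - e 0)" by (simp add: sum_lessThan_telescope)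
  then obtain l where "(\<lambda>n. e n - e 0) \<longlonglongrightarrow> l" by (auto simp: convergent_def)
  from tendsto_add[OF this tendsto_const[of "e 0"]] have "convergent e"
    by (auto simp: convergent_def)
  then show ?thesis unfolding xp_def e_def by (rule convergent_LIMSEQ_iff[THEN iffD1])
qed

text \<open>Pass to the limit in \<open>iterate_sq_est\<close> with radius
  \<open>\<rho> / 2 ^ j\<close>: the factor 4^j is cancelled by the radius and the rescaled
  difference. So \<open>xp\<close> is tangent to the identity at 0, with an error that is itself
  Lipschitz.\<close>

lemma xp_est:
  assumes "norm v \<le> \<rho>" "norm v' \<le> \<rho>" "\<rho> \<le> r2"
  shows "norm (xp v - xp v' - (v - v')) \<le> 4 * K * \<rho> * norm (v - v')"
proof -
  have v: "norm v \<le> r2" "norm v' \<le> r2" using assms by auto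
  have "(\<lambda>j. norm ((sq ^^ j) (v /\<^sub>R 2 ^ j) - (sq ^^ j) (v' /\<^sub>R 2 ^ j) - (v - v')))
      \<longlonglongrightarrow> norm (xp v - xp v' - (v - v'))"
    by (intro tendsto_intros xp_tendsto v)
  then show ?thesis
  proof (rule Lim_bounded, intro allI impI)
    fix j :: nat
    have four: "(4::real) ^ j = 2 ^ j * 2 ^ j" by (simp flip: power_mult_distrib)
    have "norm ((sq ^^ j) (v /\<^sub>R 2 ^ j) - (sq ^^ j) (v' /\<^sub>R 2 ^ j) - 2 ^ j *\<^sub>R (v /\<^sub>R 2 ^ j - v' /\<^sub>R 2 ^ j))
      \<le> 4 * K * 4 ^ j * (\<rho> / 2 ^ j) * norm (v /\<^sub>R 2 ^ j - v' /\<^sub>R 2 ^ j)"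
    proof (rule iterate_sq_est)
      show "norm (v /\<^sub>R 2 ^ j) \<le> \<rho> / 2 ^ j" "norm (v' /\<^sub>R 2 ^ j) \<le> \<rho> / 2 ^ j"
        using assms by (simp_all add: field_simps)
      show "2 ^ j * (\<rho> / 2 ^ j) \<le> r1" using assms r2 by simp
    qed
    moreover have "norm (v /\<^sub>R 2 ^ j - v' /\<^sub>R 2 ^ j) = norm (v - v') / 2 ^ j"
      unfolding scaleR_diff_right[symmetric] norm_scaleR by (simp add: divide_inverse mult.commute)
    moreover have "2 ^ j *\<^sub>R (v /\<^sub>R 2 ^ j - v' /\<^sub>R 2 ^ j) = v - v'"
      unfolding scaleR_diff_right[symmetric] by simp
    ultimately show "norm ((sq ^^ j) (v /\<^sub>R 2 ^ j) - (sq ^^ j) (v' /\<^sub>R 2 ^ j) - (v - v'))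
      \<le> 4 * K * \<rho> * norm (v - v')"
      by (simp add: four)
  qed
qed

lemma xp_0 [simp]: "xp 0 = 0"
  using xp_tendsto[of 0] r2 by (simp add: LIMSEQ_const_iff)

lemma xp_lip:
  assumes "norm v \<le> r2" "norm v' \<le> r2"
  shows "norm (xp v - xp v') \<le> 2 * norm (v - v')" "norm (v - v') \<le> 2 * norm (xp v - xp v')"
proof -
  have "4 * K * r2 * norm (v - v') \<le> 1 / 2 * norm (v - v')"
    using r2 by (intro mult_right_mono) auto
  then have *: "norm (xp v - xp v' - (v - v')) \<le> 1 / 2 * norm (v - v')"
    using xp_est[OF assms order_refl] by linarith
  show "norm (xp v - xp v') \<le> 2 * norm (v - v')" "norm (v - v') \<le> 2 * norm (xp v - xp v')"
    using * norm_triangle_sub[of "xp v - xp v'" "v - v'"]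
      norm_triangle_sub[of "v - v'" "xp v - xp v'"] norm_ge_zero[of "v - v'"]
    by (auto simp: norm_minus_commute)
qed

lemma xp_bd: "norm v \<le> r2 \<Longrightarrow> norm (xp v) \<le> 2 * norm v"
  using xp_lip(1)[of v 0] r2 by simp

lemma xp_in_D: "norm v \<le> r2 \<Longrightarrow> norm (xp v) \<le> r \<and> xp v \<in> D"
proof -
  assume v: "norm v \<le> r2"
  then have "norm (xp v) \<le> r" using xp_bd[OF v] r2 r1 by linarith
  then show ?thesis using cball_D by auto
qed

lemma continuous_xp: "continuous_on (cball 0 r2) xp"
  unfolding continuous_on_iff
proof (intro ballI allI impI)
  fix x :: 'e and e :: real assume "x \<in> cball 0 r2" "0 < e"
  then show "\<exists>d>0. \<forall>x'\<in>cball 0 r2. dist x' x < d \<longrightarrow> dist (xp x') (xp x) < e"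
    using le_less_trans[OF xp_lip(1)] by (intro exI[of _ "e / 2"]) (simp add: dist_norm)
qed

lemma isCont_k: "u \<in> D \<Longrightarrow> isCont k u"
  using cont_k open_D by (simp add: continuous_on_eq_continuous_at)

text \<open>Only the first order behaviour of \<open>a\<close> matters: j squarings enlarge the
  difference of \<open>a j\<close> and v / 2^j by a factor of at most \<open>2 * 2 ^ j\<close>, and
  the enlarged difference still tends to 0. Limits of powers of products are evaluated this
  way.\<close>

lemma power_limit_small:
  assumes v: "norm v \<le> r2" and a: "(\<lambda>j. 2 ^ j *\<^sub>R a j) \<longlonglongrightarrow> v"
  shows "(\<lambda>j. k (a j) [^] ((2::nat) ^ j)) \<longlonglongrightarrow> k (xp v)"
proof -
  have "(\<lambda>j. norm (2 ^ j *\<^sub>R a j)) \<longlonglongrightarrow> norm v" by (intro tendsto_intros a)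
  moreover have "norm v < r1" using v r2 by simp
  ultimately have ev: "\<forall>\<^sub>F j in sequentially. norm (2 ^ j *\<^sub>R a j) < r1"
    by (rule order_tendstoD(2))
  have "(\<lambda>j. (sq ^^ j) (a j) - (sq ^^ j) (v /\<^sub>R 2 ^ j)) \<longlonglongrightarrow> 0"
  proof (rule Lim_null_comparison)
    show "(\<lambda>j. 2 * norm (2 ^ j *\<^sub>R a j - v)) \<longlonglongrightarrow> 0"
      by (rule tendsto_eq_intros a refl | simp)+
    show "\<forall>\<^sub>F j in sequentially. norm ((sq ^^ j) (a j) - (sq ^^ j) (v /\<^sub>R 2 ^ j)) \<le> 2 * norm (2 ^ j *\<^sub>R a j - v)"
      using ev
    proof eventually_elim
      case (elim j)
      have "norm ((sq ^^ j) (a j) - (sq ^^ j) (v /\<^sub>R 2 ^ j)) \<le> 2 * 2 ^ j * norm (a j - v /\<^sub>R 2 ^ j)"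
      proof (rule iterate_sq_lip[of _ "r1 / 2 ^ j"])
        show "norm (a j) \<le> r1 / 2 ^ j" using elim by (simp add: field_simps)
        show "norm (v /\<^sub>R 2 ^ j) \<le> r1 / 2 ^ j" using v r2 by (simp add: field_simps)
      qed simp
      also have "\<dots> = 2 * norm (2 ^ j *\<^sub>R (a j - v /\<^sub>R 2 ^ j))" by simp
      finally show ?case by (simp add: scaleR_diff_right)
    qed
  qed
  from tendsto_add[OF this xp_tendsto[OF v]] have "(\<lambda>j. (sq ^^ j) (a j)) \<longlonglongrightarrow> xp v" by simp
  then have "(\<lambda>j. k ((sq ^^ j) (a j))) \<longlonglongrightarrow> k (xp v)"
    using isCont_tendsto_compose[OF isCont_k[OF conjunct2[OF xp_in_D[OF v]]]] by blast
  moreover have "\<forall>\<^sub>F j in sequentially. k ((sq ^^ j) (a j)) = k (a j) [^] ((2::nat) ^ j)"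
    using ev
  proof eventually_elim
    case (elim j)
    show ?case
    proof (rule k_iterate_sq[of _ "r1 / 2 ^ j"])
      show "norm (a j) \<le> r1 / 2 ^ j" using elim by (simp add: field_simps)
    qed simp
  qed
  ultimately show ?thesis by (rule Lim_transform_eventually)
qed

lemma tendsto_mult':
  assumes "(f \<longlongrightarrow> a) F" "(g \<longlongrightarrow> b) F"
  shows "((\<lambda>x. f x \<otimes> g x) \<longlongrightarrow> a \<otimes> b) F"
proof -
  have "isCont (\<lambda>(x, y). x \<otimes> y) (a, b)"
    using cont_mult continuous_on_eq_continuous_at[OF open_UNIV] by blast
  have "((\<lambda>x. (f x, g x)) \<longlongrightarrow> (a, b)) F" by (intro tendsto_Pair assms)
  from isCont_tendsto_compose[OF \<open>isCont _ _\<close> this] show ?thesis by (simp only: case_prod_conv)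
qed

lemma tendsto_inv':
  assumes "(f \<longlongrightarrow> a) F"
  shows "((\<lambda>x. inv (f x)) \<longlongrightarrow> inv a) F"
proof -
  have "isCont (\<lambda>x. inv x) a"
    using cont_inv by (simp add: continuous_on_eq_continuous_at)
  from isCont_tendsto_compose[OF this assms] show ?thesis .
qed

lemma tendsto_pow':
  assumes "(f \<longlongrightarrow> a) F"
  shows "((\<lambda>x. f x [^] (n::nat)) \<longlongrightarrow> a [^] n) F"
  by (induction n) (auto intro: tendsto_mult' assms)

lemma pow_2: "y [^] (2::nat) = y \<otimes> y"
  using nat_pow_mult[of y 1 1] by (simp add: numeral_2_eq_2)

text \<open>Shifting the index of the defining sequence by one exhibits its terms for v as squares
  of the terms for v / 2.\<close>

lemma xp_half:
  assumes v: "norm v \<le> r2"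
  shows "k (xp v) = k (xp (v /\<^sub>R 2)) [^] (2::nat)"
proof -
  define b where "b = (\<lambda>j. (sq ^^ j) (v /\<^sub>R 2 /\<^sub>R 2 ^ j))"
  have v2: "norm (v /\<^sub>R 2) \<le> r2" using v r2 by simp
  have "(\<lambda>j. (sq ^^ Suc j) (v /\<^sub>R 2 ^ Suc j)) \<longlonglongrightarrow> xp v"
    by (rule LIMSEQ_Suc[OF xp_tendsto[OF v]])
  moreover have "(sq ^^ Suc j) (v /\<^sub>R 2 ^ Suc j) = sq (b j)" for j
    by (simp add: b_def)
  ultimately have "(\<lambda>j. sq (b j)) \<longlonglongrightarrow> xp v" by simp
  then have 1: "(\<lambda>j. k (sq (b j))) \<longlonglongrightarrow> k (xp v)"
    using isCont_tendsto_compose[OF isCont_k[OF conjunct2[OF xp_in_D[OF v]]]] by blast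
  have eq: "k (sq (b j)) = k (b j) \<otimes> k (b j)" for j
  proof -
    have "norm (b j) \<le> 2 * 2 ^ j * (r2 / 2 / 2 ^ j)"
      unfolding b_def
    proof (rule iterate_sq_bd)
      show "norm (v /\<^sub>R 2 /\<^sub>R 2 ^ j) \<le> r2 / 2 / 2 ^ j" using v by (simp add: field_simps)
      show "2 ^ j * (r2 / 2 / 2 ^ j) \<le> r1" using r2 by simp
    qed
    also have "\<dots> \<le> r" using r2 by simp
    finally have "norm (b j) \<le> r" .
    then show ?thesis by (simp add: k_m sq_def)
  qed
  have "(\<lambda>j. k (b j)) \<longlonglongrightarrow> k (xp (v /\<^sub>R 2))"
    unfolding b_def
    using isCont_tendsto_compose[OF isCont_k[OF conjunct2[OF xp_in_D[OF v2]]] xp_tendsto[OF v2]] .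
  then have "(\<lambda>j. k (b j) \<otimes> k (b j)) \<longlonglongrightarrow> k (xp (v /\<^sub>R 2)) \<otimes> k (xp (v /\<^sub>R 2))"
    by (intro tendsto_mult')
  then have "k (xp v) = k (xp (v /\<^sub>R 2)) \<otimes> k (xp (v /\<^sub>R 2))"
    by (rule LIMSEQ_unique[OF 1[unfolded eq]])
  then show ?thesis by (simp only: pow_2)
qed

end

section \<open>The global exponential map\<close>

context local_coordinates begin

lemma ex_scale: "\<exists>j. norm (v::'e) < r2 * 2 ^ j"
proof -
  obtain n where "norm v / r2 < 2 ^ n" using real_arch_pow[of 2 "norm v / r2"] by auto
  then show ?thesis using r2 by (auto simp: field_simps)
qed

text \<open>Outside the small ball, exp v is the 2^j-th power of exp (v / 2^j). The least j merely
  fixes a choice; by \<open>gexp_eq\<close> every j that brings v into the ball gives the same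
  value.\<close>

definition gexp :: "'e \<Rightarrow> 'g" where
  "gexp v = (let j = (LEAST j. norm v \<le> r2 * 2 ^ j) in k (xp (v /\<^sub>R 2 ^ j)) [^] ((2::nat) ^ j))"

lemma norm_scale_le: "norm v \<le> r2 * 2 ^ j \<Longrightarrow> norm (v /\<^sub>R 2 ^ j) \<le> r2"
  by (simp add: divide_inverse[symmetric] field_simps)

lemma gexp_eq:
  assumes "norm v \<le> r2 * 2 ^ j"
  shows "gexp v = k (xp (v /\<^sub>R 2 ^ j)) [^] ((2::nat) ^ j)"
proof -
  define i where "i = (LEAST j. norm v \<le> r2 * 2 ^ j)"
  have i: "norm v \<le> r2 * 2 ^ i" unfolding i_def using assms by (rule LeastI)
  have ij: "i \<le> j" unfolding i_def using assms by (rule Least_le)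
  have "k (xp (v /\<^sub>R 2 ^ (i + n))) [^] ((2::nat) ^ (i + n)) = k (xp (v /\<^sub>R 2 ^ i)) [^] ((2::nat) ^ i)" for n
  proof (induction n)
    case (Suc n)
    have "r2 * 2 ^ i \<le> r2 * 2 ^ (i + n)" using r2 by (intro mult_left_mono power_increasing) auto
    then have "norm (v /\<^sub>R 2 ^ (i + n)) \<le> r2" using i by (intro norm_scale_le) linarith
    then have "k (xp (v /\<^sub>R 2 ^ (i + n))) = k (xp (v /\<^sub>R 2 ^ (i + n) /\<^sub>R 2)) [^] (2::nat)"
      by (rule xp_half)
    moreover have "v /\<^sub>R 2 ^ (i + n) /\<^sub>R 2 = v /\<^sub>R 2 ^ (i + Suc n)" by simp
    ultimately have "k (xp (v /\<^sub>R 2 ^ (i + n))) [^] ((2::nat) ^ (i + n)) = k (xp (v /\<^sub>R 2 ^ (i + Suc n))) [^] ((2::nat) * 2 ^ (i + n))"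
      by (simp only: nat_pow_pow carrier_UNIV UNIV_I)
    then show ?case using Suc by (simp only: add_Suc_right power_Suc)
  qed simp
  from this[of "j - i"] ij show ?thesis unfolding gexp_def Let_def i_def[symmetric] by simp
qed

lemma gexp_small: "norm v \<le> r2 \<Longrightarrow> gexp v = k (xp v)"
  using gexp_eq[of v 0] by simp

lemma gexp_0 [simp]: "gexp 0 = \<one>"
  using gexp_small[of 0] r2 k_0 by simp

lemma gexp_limit:
  assumes "(\<lambda>j. 2 ^ j *\<^sub>R a j) \<longlonglongrightarrow> v"
  shows "(\<lambda>j. k (a j) [^] ((2::nat) ^ j)) \<longlonglongrightarrow> gexp v"
proof -
  obtain J where J: "norm v < r2 * 2 ^ J" using ex_scale by blast
  have "(\<lambda>i. 2 ^ (i + J) *\<^sub>R a (i + J)) \<longlonglongrightarrow> v" by (rule LIMSEQ_ignore_initial_segment[OF assms])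
  then have "(\<lambda>i. (2 ^ (i + J) *\<^sub>R a (i + J)) /\<^sub>R 2 ^ J) \<longlonglongrightarrow> v /\<^sub>R 2 ^ J" by (intro tendsto_intros)
  moreover have "(2 ^ (i + J) *\<^sub>R a (i + J)) /\<^sub>R 2 ^ J = 2 ^ i *\<^sub>R a (i + J)" for i
    by (simp add: power_add)
  ultimately have "(\<lambda>i. 2 ^ i *\<^sub>R a (i + J)) \<longlonglongrightarrow> v /\<^sub>R 2 ^ J" by (simp only:)
  moreover have "norm (v /\<^sub>R 2 ^ J) \<le> r2" using J by (intro norm_scale_le) simp
  ultimately have "(\<lambda>i. k (a (i + J)) [^] ((2::nat) ^ i)) \<longlonglongrightarrow> k (xp (v /\<^sub>R 2 ^ J))"
    by (intro power_limit_small)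
  then have "(\<lambda>i. (k (a (i + J)) [^] ((2::nat) ^ i)) [^] ((2::nat) ^ J)) \<longlonglongrightarrow> k (xp (v /\<^sub>R 2 ^ J)) [^] ((2::nat) ^ J)"
    by (rule tendsto_pow')
  then have "(\<lambda>i. k (a (i + J)) [^] ((2::nat) ^ (i + J))) \<longlonglongrightarrow> gexp v"
    using J by (simp only: nat_pow_pow carrier_UNIV UNIV_I power_add gexp_eq[OF less_imp_le[OF J]])
  then show ?thesis by (rule LIMSEQ_offset)
qed

lemma isCont_xp: "norm v < r2 \<Longrightarrow> isCont xp v"
proof -
  assume "norm v < r2"
  moreover have "continuous_on (ball 0 r2) xp"
    by (rule continuous_on_subset[OF continuous_xp]) auto
  ultimately show ?thesis by (simp add: continuous_on_eq_continuous_at)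
qed

lemma isCont_gexp: "isCont gexp v"
proof -
  obtain J where J: "norm v < r2 * 2 ^ J" using ex_scale by blast
  have small: "norm (v /\<^sub>R 2 ^ J) < r2"
    using J by (simp add: divide_inverse[symmetric] field_simps)
  have "((\<lambda>u. xp (u /\<^sub>R 2 ^ J)) \<longlongrightarrow> xp (v /\<^sub>R 2 ^ J)) (at v)"
    by (rule isCont_tendsto_compose[OF isCont_xp[OF small]]) (intro tendsto_intros)
  then have "((\<lambda>u. k (xp (u /\<^sub>R 2 ^ J))) \<longlongrightarrow> k (xp (v /\<^sub>R 2 ^ J))) (at v)"
    by (rule isCont_tendsto_compose[OF isCont_k, rotated]) (use xp_in_D small in auto)
  then have "((\<lambda>u. k (xp (u /\<^sub>R 2 ^ J)) [^] ((2::nat) ^ J)) \<longlongrightarrow> k (xp (v /\<^sub>R 2 ^ J)) [^] ((2::nat) ^ J)) (at v)"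
    by (rule tendsto_pow')
  then have "(gexp \<longlongrightarrow> k (xp (v /\<^sub>R 2 ^ J)) [^] ((2::nat) ^ J)) (at v)"
  proof (rule Lim_transform_eventually)
    have "\<forall>\<^sub>F u in at v. u \<in> ball 0 (r2 * 2 ^ J)"
      by (rule eventually_at_in_open') (use J in auto)
    then show "\<forall>\<^sub>F u in at v. k (xp (u /\<^sub>R 2 ^ J)) [^] ((2::nat) ^ J) = gexp u"
      by eventually_elim (rule gexp_eq[symmetric], simp)
  qed
  then show ?thesis using gexp_eq[OF less_imp_le[OF J]] by (simp add: isCont_def)
qed

lemma tendsto_gexp: "(f \<longlongrightarrow> a) F \<Longrightarrow> ((\<lambda>x. gexp (f x)) \<longlongrightarrow> gexp a) F"
  by (rule isCont_tendsto_compose[OF isCont_gexp])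

lemma gexp_pow2: "gexp (2 ^ j *\<^sub>R v) = gexp v [^] ((2::nat) ^ j)"
proof -
  obtain J where J: "norm v < r2 * 2 ^ J" using ex_scale by blast
  have "norm (2 ^ j *\<^sub>R v) \<le> r2 * 2 ^ (J + j)" using J by (simp add: power_add)
  then have "gexp (2 ^ j *\<^sub>R v) = k (xp ((2 ^ j *\<^sub>R v) /\<^sub>R 2 ^ (J + j))) [^] ((2::nat) ^ (J + j))" by (rule gexp_eq)
  moreover have "(2 ^ j *\<^sub>R v) /\<^sub>R 2 ^ (J + j) = v /\<^sub>R 2 ^ J" by (simp add: power_add)
  ultimately show ?thesis
    by (simp only: gexp_eq[OF less_imp_le[OF J]] nat_pow_pow carrier_UNIV UNIV_I power_add)
qed

lemma gexp_scale2: "gexp (v /\<^sub>R 2 ^ j) [^] ((2::nat) ^ j) = gexp v"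
  using gexp_pow2[of j "v /\<^sub>R 2 ^ j"] by simp

lemma tendsto_half_pow: "(\<lambda>j. c * (1 / 2 :: real) ^ j) \<longlonglongrightarrow> 0"
  by (intro tendsto_mult_right_zero LIMSEQ_power_zero) simp

lemma eventually_half_pow: "0 < e \<Longrightarrow> \<forall>\<^sub>F j in sequentially. c * (1 / 2 :: real) ^ j < e"
  using order_tendstoD(2)[OF tendsto_half_pow] .

lemma norm_half_pow: "norm (v /\<^sub>R 2 ^ j) = norm v * (1 / 2 :: real) ^ j"
  by (simp add: power_one_over inverse_eq_divide)

lemma m_sum_est:
  assumes "norm x \<le> r" "norm y \<le> r"
  shows "norm (m x y - x - y) \<le> K * (norm x + norm y)\<^sup>2"
proof -
  have "norm (m x y - m 0 0 - (x - 0) - (y - 0)) \<le> K * max (norm x) (norm y) * (norm (x - 0) + norm (y - 0))"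
    by (rule m_est) (use assms r_pos in \<open>auto intro: le_max_iff_disj[THEN iffD2]\<close>)
  also have "\<dots> \<le> K * (norm x + norm y) * (norm x + norm y)"
    using K_pos by (intro mult_mono) (auto simp: max_def)
  finally show ?thesis using m_0 r_pos by (simp add: power2_eq_square mult.assoc)
qed

text \<open>The Lie product formula: in coordinates the product of the two small factors is (u + w)
  / 2^j + O(4^-j), so \<open>gexp_limit\<close> applies.\<close>

lemma gexp_product_limit:
  "(\<lambda>j. (gexp (u /\<^sub>R 2 ^ j) \<otimes> gexp (w /\<^sub>R 2 ^ j)) [^] ((2::nat) ^ j)) \<longlonglongrightarrow> gexp (u + w)"
proof -
  define x where "x = (\<lambda>j. xp (u /\<^sub>R 2 ^ j))"
  define y where "y = (\<lambda>j. xp (w /\<^sub>R 2 ^ j))"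
  define s where "s = norm u + norm w"
  have "\<forall>\<^sub>F j in sequentially. s * (1/2) ^ j < r2" using r2 by (intro eventually_half_pow)
  then have ev: "\<forall>\<^sub>F j in sequentially. norm (u /\<^sub>R 2 ^ j) \<le> r2 \<and> norm (w /\<^sub>R 2 ^ j) \<le> r2"
    by eventually_elim
      (unfold norm_half_pow s_def distrib_right, auto intro: order_trans[rotated, OF less_imp_le])
  have "(\<lambda>j. 2 ^ j *\<^sub>R m (x j) (y j) - (u + w)) \<longlonglongrightarrow> 0"
  proof (rule Lim_null_comparison[OF _ tendsto_half_pow])
    show "\<forall>\<^sub>F j in sequentially. norm (2 ^ j *\<^sub>R m (x j) (y j) - (u + w)) \<le> (K * (2 * s)\<^sup>2 + 4 * K * s\<^sup>2) * (1 / 2) ^ j"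
      using ev
    proof eventually_elim
      case (elim j)
      let ?h = "(1 / 2 :: real) ^ j"
      have h: "2 ^ j * ?h = 1" "0 \<le> ?h" by (simp_all flip: power_mult_distrib)
      have xb: "norm (x j) \<le> 2 * norm u * ?h" "norm (x j) \<le> r"
        using xp_bd[of "u /\<^sub>R 2 ^ j"] xp_in_D[of "u /\<^sub>R 2 ^ j"] elim unfolding x_def norm_half_pow by auto
      have yb: "norm (y j) \<le> 2 * norm w * ?h" "norm (y j) \<le> r"
        using xp_bd[of "w /\<^sub>R 2 ^ j"] xp_in_D[of "w /\<^sub>R 2 ^ j"] elim unfolding y_def norm_half_pow by auto
      have "norm (m (x j) (y j) - x j - y j) \<le> K * (norm (x j) + norm (y j))\<^sup>2"
        using xb yb by (intro m_sum_est)
      also have "\<dots> \<le> K * (2 * s * ?h)\<^sup>2"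
        using xb yb K_pos by (intro mult_left_mono power_mono) (auto simp: s_def algebra_simps)
      finally have 1: "norm (m (x j) (y j) - x j - y j) \<le> K * (2 * s)\<^sup>2 * ?h\<^sup>2"
        by (simp add: power_mult_distrib)
      have sub: "norm (xp z - z) \<le> 4 * K * (norm z)\<^sup>2" if "norm z \<le> r2" for z
        using xp_est[of z "norm z" 0] that by (simp add: power2_eq_square)
      have "norm (x j - u /\<^sub>R 2 ^ j) \<le> 4 * K * (norm u)\<^sup>2 * ?h\<^sup>2"
        using sub[of "u /\<^sub>R 2 ^ j"] elim unfolding x_def norm_half_pow by (simp add: power_mult_distrib)
      moreover have "norm (y j - w /\<^sub>R 2 ^ j) \<le> 4 * K * (norm w)\<^sup>2 * ?h\<^sup>2"
        using sub[of "w /\<^sub>R 2 ^ j"] elim unfolding y_def norm_half_pow by (simp add: power_mult_distrib)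
      moreover have "4 * K * (norm u)\<^sup>2 * ?h\<^sup>2 + 4 * K * (norm w)\<^sup>2 * ?h\<^sup>2 \<le> 4 * K * s\<^sup>2 * ?h\<^sup>2"
        unfolding s_def power2_sum using K_pos
        by (simp add: distrib_left distrib_right)
      moreover have "norm (m (x j) (y j) - u /\<^sub>R 2 ^ j - w /\<^sub>R 2 ^ j) \<le>
        norm (m (x j) (y j) - x j - y j) + norm (x j - u /\<^sub>R 2 ^ j) + norm (y j - w /\<^sub>R 2 ^ j)"
        using norm_triangle_ineq[of "m (x j) (y j) - x j - y j" "(x j - u /\<^sub>R 2 ^ j) + (y j - w /\<^sub>R 2 ^ j)"]
          norm_triangle_ineq[of "x j - u /\<^sub>R 2 ^ j" "y j - w /\<^sub>R 2 ^ j"]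
        by (simp add: algebra_simps)
      ultimately have "norm (m (x j) (y j) - u /\<^sub>R 2 ^ j - w /\<^sub>R 2 ^ j) \<le> (K * (2 * s)\<^sup>2 + 4 * K * s\<^sup>2) * ?h\<^sup>2"
        using 1 by (simp add: distrib_right)
      then have "2 ^ j * norm (m (x j) (y j) - u /\<^sub>R 2 ^ j - w /\<^sub>R 2 ^ j) \<le> 2 ^ j * ((K * (2 * s)\<^sup>2 + 4 * K * s\<^sup>2) * ?h\<^sup>2)"
        by (intro mult_left_mono) auto
      also have "\<dots> = (K * (2 * s)\<^sup>2 + 4 * K * s\<^sup>2) * ?h * (2 ^ j * ?h)"
        by (simp only: power2_eq_square mult_ac)
      finally have "2 ^ j * norm (m (x j) (y j) - u /\<^sub>R 2 ^ j - w /\<^sub>R 2 ^ j) \<le> (K * (2 * s)\<^sup>2 + 4 * K * s\<^sup>2) * ?h"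
        unfolding h by simp
      moreover have "2 ^ j *\<^sub>R m (x j) (y j) - (u + w) = 2 ^ j *\<^sub>R (m (x j) (y j) - u /\<^sub>R 2 ^ j - w /\<^sub>R 2 ^ j)"
        by (simp add: scaleR_diff_right)
      ultimately show ?case by (simp only: norm_scaleR) simp
    qed
  qed
  then have "(\<lambda>j. 2 ^ j *\<^sub>R m (x j) (y j)) \<longlonglongrightarrow> u + w" by (simp add: LIM_zero_cancel)
  from gexp_limit[OF this] show ?thesis
  proof (rule Lim_transform_eventually)
    show "\<forall>\<^sub>F j in sequentially. k (m (x j) (y j)) [^] ((2::nat) ^ j) = (gexp (u /\<^sub>R 2 ^ j) \<otimes> gexp (w /\<^sub>R 2 ^ j)) [^] ((2::nat) ^ j)"
      using ev by eventually_elim (simp only: x_def y_def gexp_small k_m[symmetric] xp_in_D)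
  qed
qed

end

section \<open>Commutators in a group of nilpotency class two\<close>

locale two_step_coordinates = local_coordinates N k D m r K
  for N :: "'g::t2_space monoid" (structure) and k :: "'e::euclidean_space \<Rightarrow> 'g" and D m r K +
  assumes commutator_central: "commutator N x y \<otimes> z = z \<otimes> commutator N x y"
begin

abbreviation "cm \<equiv> commutator N"

lemma inv_cancel [simp]: "x \<otimes> (inv x \<otimes> y) = y" "inv x \<otimes> (x \<otimes> y) = y"
  by (simp_all flip: m_assoc)

lemma swap: "x \<otimes> y = y \<otimes> x \<otimes> cm x y"
  by (simp add: commutator_def m_assoc)

lemma cm_eqI: "x \<otimes> y = y \<otimes> x \<otimes> c \<Longrightarrow> cm x y = c"
  by (simp add: commutator_def m_assoc)

lemma cm_swap: "cm y x = inv (cm x y)"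
  by (simp add: commutator_def m_assoc inv_mult_group)

text \<open>Centrality of commutators makes the commutator a homomorphism in each argument; the
  bilinearity of the bracket starts here.\<close>

lemma cm_mult_right: "cm x (y \<otimes> z) = cm x y \<otimes> cm x z"
proof (rule cm_eqI)
  have "x \<otimes> (y \<otimes> z) = y \<otimes> x \<otimes> (cm x y \<otimes> z)" using swap[of x y] by (simp flip: m_assoc)
  also have "\<dots> = y \<otimes> (x \<otimes> z) \<otimes> cm x y" by (simp only: commutator_central[of x y z] m_assoc carrier_UNIV UNIV_I)
  also have "\<dots> = y \<otimes> (z \<otimes> x \<otimes> cm x z) \<otimes> cm x y" by (simp only: swap[of x z])
  also have "\<dots> = (y \<otimes> z) \<otimes> x \<otimes> (cm x y \<otimes> cm x z)" using commutator_central[of x y "cm x z"] by (simp add: m_assoc)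
  finally show "x \<otimes> (y \<otimes> z) = (y \<otimes> z) \<otimes> x \<otimes> (cm x y \<otimes> cm x z)" .
qed

lemma cm_mult_left: "cm (y \<otimes> z) x = cm y x \<otimes> cm z x"
proof (rule cm_eqI)
  have "y \<otimes> z \<otimes> x = y \<otimes> (x \<otimes> z \<otimes> cm z x)" using swap[of z x] by (simp add: m_assoc)
  also have "\<dots> = (y \<otimes> x) \<otimes> (z \<otimes> cm z x)" by (simp add: m_assoc)
  also have "\<dots> = x \<otimes> y \<otimes> cm y x \<otimes> (z \<otimes> cm z x)" by (simp only: swap[of y x])
  also have "\<dots> = x \<otimes> y \<otimes> (cm y x \<otimes> z) \<otimes> cm z x" by (simp add: m_assoc)
  also have "\<dots> = x \<otimes> (y \<otimes> z) \<otimes> (cm y x \<otimes> cm z x)" by (simp only: commutator_central[of y x z] m_assoc carrier_UNIV UNIV_I)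
  finally show "y \<otimes> z \<otimes> x = x \<otimes> (y \<otimes> z) \<otimes> (cm y x \<otimes> cm z x)" .
qed

lemma cm_one [simp]: "cm x \<one> = \<one>" "cm \<one> x = \<one>"
  by (simp_all add: commutator_def)

lemma cm_self [simp]: "cm x x = \<one>"
  by (simp add: commutator_def m_assoc)

lemma cm_pow_right: "cm x (y [^] (n::nat)) = cm x y [^] n"
  by (induction n) (simp_all add: cm_mult_right)

lemma cm_pow_left: "cm (y [^] (n::nat)) x = cm y x [^] n"
  by (induction n) (simp_all add: cm_mult_left)

lemma cm_cm [simp]: "cm x (cm y z) = \<one>" "cm (cm y z) x = \<one>"
  by (rule cm_eqI, simp add: commutator_central[of y z x])+

lemma cm_pow_central: "cm x y [^] (n::nat) \<otimes> z = z \<otimes> cm x y [^] n"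
  using commutator_central[of x "y [^] n" z] by (simp add: cm_pow_right)

text \<open>Collection in class two: moving the new factor x across \<open>y [^] n\<close> produces
  \<open>cm y x [^] n\<close>, and these exponents add up to the triangular number.\<close>

lemma pow_mult_two_step: "(x \<otimes> y) [^] (n::nat) = x [^] n \<otimes> y [^] n \<otimes> cm y x [^] (\<Sum>i<n. i)"
proof (induction n)
  case (Suc n)
  have "(x \<otimes> y) [^] Suc n = x [^] n \<otimes> y [^] n \<otimes> (cm y x [^] (\<Sum>i<n. i) \<otimes> (x \<otimes> y))"
    using Suc by (simp add: m_assoc)
  also have "\<dots> = x [^] n \<otimes> (y [^] n \<otimes> x) \<otimes> y \<otimes> cm y x [^] (\<Sum>i<n. i)"
    by (simp only: cm_pow_central[of y x "\<Sum>i<n. i" "x \<otimes> y"] m_assoc carrier_UNIV UNIV_I)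
  also have "y [^] n \<otimes> x = x \<otimes> y [^] n \<otimes> cm y x [^] n"
    using swap[of "y [^] n" x] by (simp add: cm_pow_left)
  also have "x [^] n \<otimes> (x \<otimes> y [^] n \<otimes> cm y x [^] n) \<otimes> y \<otimes> cm y x [^] (\<Sum>i<n. i)
     = (x [^] n \<otimes> x) \<otimes> y [^] n \<otimes> (cm y x [^] n \<otimes> y) \<otimes> cm y x [^] (\<Sum>i<n. i)"
    by (simp add: m_assoc)
  also have "\<dots> = (x [^] n \<otimes> x) \<otimes> (y [^] n \<otimes> y) \<otimes> (cm y x [^] n \<otimes> cm y x [^] (\<Sum>i<n. i))"
    by (simp only: cm_pow_central[of y x n y] m_assoc carrier_UNIV UNIV_I)
  finally show ?case by (simp add: nat_pow_mult add.commute)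
qed simp

text \<open>Limit of \<open>(x y)\<^sup>n = x\<^sup>n y\<^sup>n [y, x]\<^bsup>n(n-1)/2\<^esup>\<close> with \<open>x = exp (u / 2\<^sup>j)\<close>, \<open>y = exp (w / 2\<^sup>j)\<close> and \<open>n = 2\<^sup>j\<close>.\<close>

lemma gexp_add: "gexp (u + w) = gexp u \<otimes> gexp w \<otimes> cm (gexp w) (gexp (u /\<^sub>R 2))"
proof -
  define x where "x = (\<lambda>j. gexp (u /\<^sub>R 2 ^ j))"
  define y where "y = (\<lambda>j. gexp (w /\<^sub>R 2 ^ j))"
  have tri: "(\<Sum>i<2 * M. i) = (2 * M - 1) * M" for M :: nat
    by (induction M) (auto simp: algebra_simps)
  \<comment> \<open>The exponent (2M - 1) M is split between the arguments of the commutator. The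
    M-th power of x is exactly exp (u / 2); the (2M - 1)-th power of y is exp w up to one factor inv
    y, which tends to the identity.\<close>
  have eq: "(x (Suc j) \<otimes> y (Suc j)) [^] ((2::nat) ^ Suc j) = gexp u \<otimes> gexp w \<otimes> cm (gexp w \<otimes> inv (y (Suc j))) (gexp (u /\<^sub>R 2))" for j
  proof -
    let ?x = "x (Suc j)" and ?y = "y (Suc j)" and ?M = "(2::nat) ^ j"
    have pow: "?x [^] (2 * ?M) = gexp u" "?y [^] (2 * ?M) = gexp w"
      unfolding x_def y_def using gexp_scale2[of "Suc j"] by (simp_all only: power_Suc)
    have "?x [^] ?M = gexp (u /\<^sub>R 2)"
      unfolding x_def using gexp_scale2[of j "u /\<^sub>R 2"] by (simp add: mult.commute)
    moreover have "?y [^] (2 * ?M - 1) = gexp w \<otimes> inv ?y"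
    proof -
      have "?y [^] (2 * ?M - 1) \<otimes> ?y = ?y [^] (Suc (2 * ?M - 1))" by (simp only: nat_pow_Suc)
      also have "\<dots> = gexp w" using pow by simp
      finally show ?thesis by (metis inv_solve_right carrier_UNIV UNIV_I)
    qed
    moreover have "(?x \<otimes> ?y) [^] (2 * ?M) = ?x [^] (2 * ?M) \<otimes> ?y [^] (2 * ?M) \<otimes> cm ?y ?x [^] ((2 * ?M - 1) * ?M)"
      unfolding pow_mult_two_step tri ..
    moreover have "cm ?y ?x [^] ((2 * ?M - 1) * ?M) = cm (?y [^] (2 * ?M - 1)) (?x [^] ?M)"
      by (simp only: cm_pow_left cm_pow_right nat_pow_pow carrier_UNIV UNIV_I mult.commute)
    ultimately show ?thesis by (simp only: pow power_Suc)
  qed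
  have "(\<lambda>j. w /\<^sub>R 2 ^ j) \<longlonglongrightarrow> 0"
    by (rule tendsto_norm_zero_cancel) (unfold norm_half_pow, rule tendsto_half_pow)
  from tendsto_gexp[OF LIMSEQ_Suc[OF this]] have "(\<lambda>j. y (Suc j)) \<longlonglongrightarrow> \<one>" by (simp only: y_def gexp_0)
  then have "(\<lambda>j. gexp u \<otimes> gexp w \<otimes> cm (gexp w \<otimes> inv (y (Suc j))) (gexp (u /\<^sub>R 2)))
    \<longlonglongrightarrow> gexp u \<otimes> gexp w \<otimes> cm (gexp w \<otimes> inv \<one>) (gexp (u /\<^sub>R 2))"
    unfolding commutator_def by (intro tendsto_mult' tendsto_inv' tendsto_const)
  moreover have "(\<lambda>j. gexp u \<otimes> gexp w \<otimes> cm (gexp w \<otimes> inv (y (Suc j))) (gexp (u /\<^sub>R 2))) \<longlonglongrightarrow> gexp (u + w)"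
    using LIMSEQ_Suc[OF gexp_product_limit[of u w]] unfolding x_def[symmetric] eq[symmetric] by (simp only: x_def y_def)
  ultimately show ?thesis using LIMSEQ_unique by fastforce
qed

end

lemma nat_floor_dyadic_tendsto:
  assumes "0 \<le> (t::real)"
  shows "(\<lambda>k. real (nat \<lfloor>2 ^ k * t\<rfloor>) / 2 ^ k) \<longlonglongrightarrow> t"
proof (rule LIM_zero_cancel, rule Lim_null_comparison)
  show "(\<lambda>k. (1 / 2 :: real) ^ k) \<longlonglongrightarrow> 0" by (intro LIMSEQ_power_zero) simp
  show "\<forall>\<^sub>F k in sequentially. norm (real (nat \<lfloor>2 ^ k * t\<rfloor>) / 2 ^ k - t) \<le> (1 / 2) ^ k"
  proof (intro always_eventually allI)
    fix k :: nat
    have nn: "0 \<le> \<lfloor>2 ^ k * t\<rfloor>" using assms by simp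
    have "real (nat \<lfloor>2 ^ k * t\<rfloor>) / 2 ^ k - t = (of_int \<lfloor>2 ^ k * t\<rfloor> - 2 ^ k * t) / 2 ^ k"
      using nn by (simp add: diff_divide_distrib)
    also have "norm \<dots> \<le> 1 / 2 ^ k"
    proof -
      have "\<bar>of_int \<lfloor>2 ^ k * t\<rfloor> - 2 ^ k * t\<bar> \<le> 1" by linarith
      then show ?thesis by (simp add: divide_right_mono)
    qed
    finally show "norm (real (nat \<lfloor>2 ^ k * t\<rfloor>) / 2 ^ k - t) \<le> (1 / 2) ^ k" by (simp add: power_one_over)
  qed
qed

lemma continuous_eq_on_dyadics:
  fixes f g :: "real \<Rightarrow> 'a::t2_space"
  assumes "\<And>t. isCont f t" "\<And>t. isCont g t" "\<And>n k. f (real n / 2 ^ k) = g (real n / 2 ^ k)" "0 \<le> t"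
  shows "f t = g t"
  using isCont_tendsto_compose[OF assms(1) nat_floor_dyadic_tendsto[OF assms(4)]]
    isCont_tendsto_compose[OF assms(2) nat_floor_dyadic_tendsto[OF assms(4)]]
  unfolding assms(3) by (rule LIMSEQ_unique)

section \<open>The bracket obtained from group commutators\<close>

context two_step_coordinates begin

definition C :: "'e \<Rightarrow> 'e \<Rightarrow> 'g" where "C u w = cm (gexp u) (gexp w)"

lemma C_add_right: "C u (w + w') = C u w \<otimes> C u w'"
  unfolding C_def gexp_add[of w w'] by (simp add: cm_mult_right)

lemma C_add_left: "C (u + u') w = C u w \<otimes> C u' w"
  unfolding C_def gexp_add[of u u'] by (simp add: cm_mult_left)

lemma C_0 [simp]: "C u 0 = \<one>" "C 0 u = \<one>"
  by (simp_all add: C_def)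

lemma C_self [simp]: "C u u = \<one>"
  by (simp add: C_def)

lemma pow_commute: "x \<otimes> x [^] (n::nat) = x [^] n \<otimes> x"
  using nat_pow_mult[of x 1 n] nat_pow_mult[of x n 1] by simp

lemma C_minus: "C u (- w) = inv (C u w)" "C (- u) w = inv (C u w)"
proof -
  have "C u (- w) \<otimes> C u w = \<one>" "C (- u) w \<otimes> C u w = \<one>"
    using C_add_right[of u "- w" w] C_add_left[of "- u" u w] by simp_all
  then show "C u (- w) = inv (C u w)" "C (- u) w = inv (C u w)"
    by (auto intro: inv_equality[symmetric])
qed

lemma C_nat: "C (real n *\<^sub>R u) w = C u (real n *\<^sub>R w)"
proof -
  have "C (real n *\<^sub>R u) w = C u w [^] n"
    by (induction n) (simp_all add: scaleR_add_left C_add_left pow_commute)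
  moreover have "C u (real n *\<^sub>R w) = C u w [^] n"
    by (induction n) (simp_all add: scaleR_add_left C_add_right pow_commute)
  ultimately show ?thesis by simp
qed

lemma isCont_C_left: "isCont (\<lambda>t. C (t *\<^sub>R u) w) t"
  unfolding isCont_def C_def commutator_def
  by (intro tendsto_mult' tendsto_inv' tendsto_gexp tendsto_intros)

lemma isCont_C_right: "isCont (\<lambda>t. C u (t *\<^sub>R w)) t"
  unfolding isCont_def C_def commutator_def
  by (intro tendsto_mult' tendsto_inv' tendsto_gexp tendsto_intros)

text \<open>Multiplicativity in both arguments gives the identity for integers and, by moving 1 /
  2^k across, for dyadic factors. Continuity extends it to nonnegative reals and inversion to
  negative ones.\<close>

lemma C_scale: "C (t *\<^sub>R u) w = C u (t *\<^sub>R w)"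
proof -
  have dy: "C ((real n / 2 ^ k) *\<^sub>R u) w = C u ((real n / 2 ^ k) *\<^sub>R w)" for n k
  proof -
    have "C ((1 / 2 ^ k) *\<^sub>R u) v = C u ((1 / 2 ^ k) *\<^sub>R v)" for v
      using C_nat[of "2 ^ k" "(1 / 2 ^ k) *\<^sub>R u" "(1 / 2 ^ k) *\<^sub>R v"] by simp
    from this[of "real n *\<^sub>R w"] C_nat[of n "(1 / 2 ^ k) *\<^sub>R u" w] show ?thesis by simp
  qed
  have pos: "C (t *\<^sub>R u) w = C u (t *\<^sub>R w)" if "0 \<le> t" for t
    using continuous_eq_on_dyadics[OF isCont_C_left isCont_C_right dy that] .
  show ?thesis
  proof (cases "0 \<le> t")
    case False
    then show ?thesis using pos[of "- t"] C_minus(2)[of "(- t) *\<^sub>R u" w] C_minus(1)[of u "(- t) *\<^sub>R w"] by simp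
  qed (rule pos)
qed

lemma C_same: "C (s *\<^sub>R u) (t *\<^sub>R u) = \<one>"
proof -
  have pos: "C u (t *\<^sub>R u) = \<one>" if "0 \<le> t" for t
    using C_scale[of "sqrt t" u "sqrt t *\<^sub>R u"] that by simp
  have "C u (t *\<^sub>R u) = \<one>" for t
  proof (cases "0 \<le> t")
    case False
    then show ?thesis using pos[of "- t"] C_minus(1)[of u "(- t) *\<^sub>R u"] by simp
  qed (rule pos)
  then show ?thesis by (simp add: C_scale)
qed

lemma scaleR_half: "(s *\<^sub>R u) /\<^sub>R 2 = (s / 2) *\<^sub>R (u::'e)"
  unfolding divide_inverse scaleR_scaleR by (simp only: mult.commute)

lemma gexp_add_same: "gexp ((s + t) *\<^sub>R u) = gexp (s *\<^sub>R u) \<otimes> gexp (t *\<^sub>R u)"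
  unfolding scaleR_add_left gexp_add scaleR_half C_def[symmetric] C_same by simp

lemma gexp_nat: "gexp (real n *\<^sub>R v) = gexp v [^] n"
proof (induction n)
  case (Suc n)
  then show ?case using gexp_add_same[of 1 "real n" v]
    by (simp add: pow_commute)
qed simp

lemma gexp_minus: "gexp (- v) = inv (gexp v)"
  using gexp_add_same[of "- 1" 1 v] by (intro inv_equality[symmetric]) auto

lemma gexp_inj_small: "norm u \<le> r2 \<Longrightarrow> norm v \<le> r2 \<Longrightarrow> gexp u = gexp v \<Longrightarrow> u = v"
proof -
  assume uv: "norm u \<le> r2" "norm v \<le> r2" "gexp u = gexp v"
  then have "xp u = xp v" using inj_k xp_in_D by (auto simp: gexp_small dest: inj_onD)
  then show "u = v" using xp_lip(2)[OF uv(1,2)] by simp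
qed

text \<open>Near 0 \<open>xp\<close> is continuous and injective, hence open by invariance of
  domain, and \<open>k\<close> is open on its domain.\<close>

lemma gexp_open_small:
  assumes "open T" "T \<subseteq> ball 0 r2"
  shows "open (gexp ` T)"
proof -
  have T: "\<And>x. x \<in> T \<Longrightarrow> norm x \<le> r2" using assms(2) by (auto simp: subset_iff intro: less_imp_le)
  have "open (xp ` T)"
  proof (rule invariance_of_domain[OF _ assms(1)])
    show "continuous_on T xp" by (rule continuous_on_subset[OF continuous_xp]) (use assms in auto)
    show "inj_on xp T"
    proof (rule inj_onI)
      fix x y assume "x \<in> T" "y \<in> T" "xp x = xp y"
      then show "x = y" using xp_lip(2)[of x y] T by auto
    qed
  qed
  then have "open (k ` xp ` T)" using T xp_in_D by (intro open_k) auto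
  moreover have "gexp ` T = k ` xp ` T" using T by (auto simp: image_iff gexp_small)
  ultimately show ?thesis by simp
qed

text \<open>At the small times t0 / 2^j the values have small logarithms l j. Local injectivity of
  exp forces l j = 2 l (j + 1), so \<gamma> follows exp along the line of l 0 at all nonnegative
  dyadic multiples of t0, hence at all times by continuity and inversion.\<close>

lemma one_parameter_subgroup:
  fixes \<gamma> :: "real \<Rightarrow> 'g"
  assumes hom: "\<And>s t. \<gamma> (s + t) = \<gamma> s \<otimes> \<gamma> t" and cont: "\<And>t. isCont \<gamma> t"
  obtains v where "\<And>t. \<gamma> t = gexp (t *\<^sub>R v)"
proof -
  have g0: "\<gamma> 0 = \<one>" using hom[of 0 0] by (metis add_0 carrier_UNIV UNIV_I l_cancel_one')
  have gm: "\<gamma> (- t) = inv (\<gamma> t)" for t using hom[of "- t" t] g0 by (intro inv_equality[symmetric]) auto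
  have gn: "\<gamma> (real n * t) = \<gamma> t [^] n" for n t
    by (induction n) (simp_all add: g0 hom distrib_right pow_commute)
  \<comment> \<open>The radius is \<open>r2 / 2\<close> so that doubling a logarithm from this ball
    stays where exp is injective.\<close>
  define T :: "'e set" where "T = ball 0 (r2 / 2)"
  have "open (gexp ` T)" unfolding T_def using r2 by (intro gexp_open_small) auto
  moreover have "\<gamma> 0 \<in> gexp ` T" unfolding g0 T_def using r2 by (auto intro!: image_eqI[of _ _ 0])
  ultimately have "\<forall>\<^sub>F t in at 0. \<gamma> t \<in> gexp ` T"
    using cont[of 0] by (auto simp: isCont_def dest: topological_tendstoD)
  then obtain \<delta> where \<delta>: "0 < \<delta>" "\<And>t. t \<noteq> 0 \<Longrightarrow> \<bar>t\<bar> < \<delta> \<Longrightarrow> \<gamma> t \<in> gexp ` T"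
    by (auto simp: eventually_at dist_real_def)
  define t0 where "t0 = \<delta> / 2"
  have t0: "0 < t0" "t0 < \<delta>" using \<delta> by (auto simp: t0_def)
  have "\<exists>l. norm l < r2 / 2 \<and> gexp l = \<gamma> (t0 / 2 ^ j)" for j :: nat
  proof -
    have "t0 / 2 ^ j \<le> t0" using t0 by (simp add: divide_le_eq)
    then have "\<gamma> (t0 / 2 ^ j) \<in> gexp ` T" using t0 by (intro \<delta>(2)) auto
    then show ?thesis by (auto simp: T_def)
  qed
  then obtain l where l: "\<And>j. norm (l j) < r2 / 2" "\<And>j. gexp (l j) = \<gamma> (t0 / 2 ^ j)" by metis
  have step: "l j = 2 *\<^sub>R l (Suc j)" for j
  proof (rule gexp_inj_small)
    show "norm (l j) \<le> r2" "norm (2 *\<^sub>R l (Suc j)) \<le> r2" using l(1)[of j] l(1)[of "Suc j"] r2 by auto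
    show "gexp (l j) = gexp (2 *\<^sub>R l (Suc j))"
      using gexp_pow2[of 1 "l (Suc j)"] gn[of 2 "t0 / 2 ^ Suc j"] by (simp add: l(2))
  qed
  have lj: "l 0 = 2 ^ j *\<^sub>R l j" for j
  proof (induction j)
    case (Suc j)
    have "2 ^ j *\<^sub>R l j = 2 ^ Suc j *\<^sub>R l (Suc j)" by (subst step) (simp add: mult.commute)
    then show ?case using Suc by simp
  qed simp
  have dy: "\<gamma> ((real n / 2 ^ k) * t0) = gexp ((real n / 2 ^ k) *\<^sub>R l 0)" for n k
  proof -
    have "\<gamma> ((real n / 2 ^ k) * t0) = gexp (l k) [^] n" using gn[of n "t0 / 2 ^ k"] by (simp add: l(2))
    also have "\<dots> = gexp (real n *\<^sub>R l k)" by (simp add: gexp_nat)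
    also have "real n *\<^sub>R l k = (real n / 2 ^ k) *\<^sub>R l 0" unfolding lj[of k] by simp
    finally show ?thesis .
  qed
  have c1: "isCont (\<lambda>t. \<gamma> (t * t0)) t" for t
    unfolding isCont_def by (rule isCont_tendsto_compose[OF cont]) (intro tendsto_intros)
  have c2: "isCont (\<lambda>t. gexp (t *\<^sub>R l 0)) t" for t
    unfolding isCont_def by (intro tendsto_gexp tendsto_intros)
  have pos: "\<gamma> (t * t0) = gexp (t *\<^sub>R l 0)" if "0 \<le> t" for t
    using continuous_eq_on_dyadics[OF c1 c2 dy that] .
  have all: "\<gamma> (t * t0) = gexp (t *\<^sub>R l 0)" for t
  proof (cases "0 \<le> t")
    case False
    then have "\<gamma> (- (t * t0)) = gexp (- (t *\<^sub>R l 0))" using pos[of "- t"] by simp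
    then have "inv (inv (\<gamma> (t * t0))) = inv (inv (gexp (t *\<^sub>R l 0)))" by (simp only: gm gexp_minus)
    then show ?thesis by simp
  qed (rule pos)
  show ?thesis
  proof (rule that)
    fix t
    show "\<gamma> t = gexp (t *\<^sub>R ((1 / t0) *\<^sub>R l 0))" using all[of "t / t0"] t0 by simp
  qed
qed

text \<open>At this stage exp is known to be injective near 0 only, but a short piece of a line
  already determines its direction.\<close>

lemma gexp_line_inj:
  assumes "\<And>t. gexp (t *\<^sub>R v) = gexp (t *\<^sub>R v')"
  shows "v = v'"
proof -
  define t where "t = r2 / (1 + norm v + norm v')"
  have t: "0 < t" unfolding t_def using r2 by (intro divide_pos_pos) (auto simp: add_pos_nonneg)
  have "norm (t *\<^sub>R v) \<le> r2" "norm (t *\<^sub>R v') \<le> r2"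
    unfolding t_def using r2 by (auto simp: divide_le_eq add_pos_nonneg mult_left_le)
  from gexp_inj_small[OF this assms] show ?thesis using t by simp
qed

text \<open>The generator of the one-parameter subgroup t -> [exp u, exp (t w)]. It is defined by
  the group alone; the comparison with the bracket of vector fields in the chart comes
  later.\<close>

definition br :: "'e \<Rightarrow> 'e \<Rightarrow> 'e" where "br u w = (SOME v. \<forall>t. C u (t *\<^sub>R w) = gexp (t *\<^sub>R v))"

lemma C_br: "C u (t *\<^sub>R w) = gexp (t *\<^sub>R br u w)"
proof -
  obtain v where "\<And>t. C u (t *\<^sub>R w) = gexp (t *\<^sub>R v)"
    by (rule one_parameter_subgroup[of "\<lambda>t. C u (t *\<^sub>R w)"])
      (auto simp: scaleR_add_left C_add_right isCont_C_right)
  then have "\<exists>v. \<forall>t. C u (t *\<^sub>R w) = gexp (t *\<^sub>R v)" by blast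
  from someI_ex[OF this] show ?thesis unfolding br_def by blast
qed

lemma br_eqI: "(\<And>t. C u (t *\<^sub>R w) = gexp (t *\<^sub>R v)) \<Longrightarrow> br u w = v"
  by (rule gexp_line_inj) (simp flip: C_br)

lemma C_eq_br: "C u w = gexp (br u w)"
  using C_br[of u 1 w] by simp

lemma C_br_left [simp]: "C (t *\<^sub>R br u w) x = \<one>"
  unfolding C_def C_br[symmetric] by (simp add: C_def)

lemma C_br_left' [simp]: "C (br u w) x = \<one>"
  using C_br_left[of 1] by simp

lemma gexp_add_br: "gexp (v + t *\<^sub>R br u w) = gexp v \<otimes> gexp (t *\<^sub>R br u w)"
  using gexp_add[of v "t *\<^sub>R br u w"] C_br_left[of t u w "v /\<^sub>R 2"] by (simp add: C_def)

lemma br_add_right: "br u (w + w') = br u w + br u w'"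
  by (rule br_eqI) (simp add: scaleR_add_right C_add_right C_br gexp_add_br)

lemma br_add_left: "br (u + u') w = br u w + br u' w"
  by (rule br_eqI) (simp only: C_add_left, simp only: scaleR_add_right C_br gexp_add_br)

lemma br_scale: "br u (s *\<^sub>R w) = s *\<^sub>R br u w" "br (s *\<^sub>R u) w = s *\<^sub>R br u w"
  by (rule br_eqI, simp only: scaleR_scaleR C_br mult.commute,
      rule br_eqI, simp only: C_scale, simp only: scaleR_scaleR C_br mult.commute)

lemma bilinear_br: "bilinear br"
  unfolding bilinear_def by (auto intro!: linearI simp: br_add_right br_add_left br_scale)

lemma br_self: "br u u = 0"
  by (rule br_eqI) (use C_same[where s = 1 and u = u] in simp)

lemma br_br: "br (br u w) x = 0"
  by (rule br_eqI) simp

text \<open>In class two this is the whole Baker-Campbell-Hausdorff formula. It follows from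
  \<open>gexp_add\<close>, because the exponential of the half bracket is the inverse of the
  commutator factor there.\<close>

lemma gexp_mult: "gexp u \<otimes> gexp w = gexp (u + w + (1/2) *\<^sub>R br u w)"
proof -
  have "gexp (u + w + (1/2) *\<^sub>R br u w) = gexp u \<otimes> gexp w \<otimes> C w (u /\<^sub>R 2) \<otimes> gexp ((1/2) *\<^sub>R br u w)"
    by (simp only: gexp_add_br[of "u + w" "1/2" u w] gexp_add[of u w] C_def)
  also have "gexp ((1/2) *\<^sub>R br u w) = C u ((1/2) *\<^sub>R w)" by (rule C_br[symmetric])
  also have "\<dots> = C (u /\<^sub>R 2) w" using C_scale[of "1/2" u w] by (simp add: inverse_eq_divide)
  also have "\<dots> = inv (C w (u /\<^sub>R 2))" unfolding C_def by (rule cm_swap)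
  finally show ?thesis by (simp add: m_assoc)
qed

end

section \<open>Simply connected groups\<close>

locale simply_connected_coordinates = two_step_coordinates N k D m r K
  for N :: "'g::t2_space monoid" (structure) and k :: "'e::euclidean_space \<Rightarrow> 'g" and D m r K +
  assumes sc: "simply_connected (UNIV :: 'g set)"
begin

sublocale nil2 br
  by unfold_locales (simp_all add: bilinear_br br_self br_br)

lemma gexp_mul: "gexp (mul u w) = gexp u \<otimes> gexp w"
  by (simp add: gexp_mult mul_def)

text \<open>Simple connectedness here means that any two loops are freely homotopic. For two
  constant loops, the trace of the base point under the homotopy is a path joining them.\<close>

lemma connected_UNIV_group: "connected (UNIV :: 'g set)"
proof (rule path_connected_imp_connected, unfold path_connected_def, intro ballI)
  fix x y :: 'g
  have "homotopic_loops UNIV (\<lambda>_. x) (\<lambda>_. y)"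
    using sc unfolding simply_connected_def by (auto simp: path_def pathstart_def pathfinish_def)
  then obtain h where h: "continuous_on ({0..1::real} \<times> {0..1::real}) h" "\<forall>t\<in>{0..1}. h (0, t) = x" "\<forall>t\<in>{0..1}. h (1, t) = y"
    unfolding homotopic_loops by blast
  have "continuous_on {0..1} (\<lambda>t. h (t, 0))"
    by (rule continuous_on_compose2[OF h(1)]) (auto intro!: continuous_intros)
  then show "\<exists>g. path g \<and> path_image g \<subseteq> UNIV \<and> pathstart g = x \<and> pathfinish g = y"
    using h by (intro exI[of _ "\<lambda>t. h (t, 0)"]) (auto simp: path_def pathstart_def pathfinish_def)
qed

lemma open_translate: "open T \<Longrightarrow> open ((\<lambda>y. x \<otimes> y) ` T)"
proof -
  assume T: "open T"
  have "continuous_on UNIV (\<lambda>y. inv x \<otimes> y)"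
    unfolding continuous_on_def by (auto intro!: tendsto_mult' tendsto_intros)
  then have "open ((\<lambda>y. inv x \<otimes> y) -` T)" using T continuous_on_open_vimage open_UNIV by fastforce
  moreover have "(\<lambda>y. inv x \<otimes> y) -` T = (\<lambda>y. x \<otimes> y) ` T"
    by (force simp: image_iff)
  ultimately show ?thesis by simp
qed

text \<open>By \<open>gexp_mul\<close> and \<open>gexp_minus\<close> the image of exp is a subgroup,
  and it contains a neighbourhood of the identity. Translates of that neighbourhood show that the
  image and its complement are both open.\<close>

lemma surj_gexp: "range gexp = UNIV"
proof -
  define G where "G = gexp ` ball 0 r2"
  have G: "open G" "\<one> \<in> G" "G \<subseteq> range gexp"
  proof -
    show "open G" unfolding G_def by (rule gexp_open_small) auto
    have "gexp 0 \<in> G" unfolding G_def by (rule imageI) (use r2 in simp)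
    then show "\<one> \<in> G" by simp
  qed (auto simp: G_def)
  have nb: "open ((\<lambda>y. x \<otimes> y) ` G)" "x \<in> (\<lambda>y. x \<otimes> y) ` G" for x
    using G by (auto intro: open_translate intro!: image_eqI[of _ _ \<one>])
  have 1: "open (range gexp)"
  proof (subst open_subopen, intro ballI)
    fix x assume "x \<in> range gexp"
    then obtain u where u: "x = gexp u" by blast
    have "(\<lambda>y. x \<otimes> y) ` G \<subseteq> range gexp"
    proof clarify
      fix y assume "y \<in> G"
      then obtain w where "y = gexp w" unfolding G_def by blast
      then show "x \<otimes> y \<in> range gexp" using u gexp_mul[of u w] by (metis rangeI)
    qed
    then show "\<exists>T. open T \<and> x \<in> T \<and> T \<subseteq> range gexp"
      using nb[of x] by (intro exI[of _ "(\<lambda>y. x \<otimes> y) ` G"] conjI)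
  qed
  have 2: "open (- range gexp)"
  proof (subst open_subopen, intro ballI)
    fix x assume x: "x \<in> - range gexp"
    have "(\<lambda>y. x \<otimes> y) ` G \<subseteq> - range gexp"
    proof clarify
      fix y u assume "y \<in> G" and eq: "x \<otimes> y = gexp u"
      then obtain w where "y = gexp w" unfolding G_def by blast
      then have "gexp (mul u (- w)) = x" by (simp only: gexp_mul gexp_minus eq[symmetric] m_assoc carrier_UNIV UNIV_I r_inv r_one)
      then show False using x by blast
    qed
    then show "\<exists>T. open T \<and> x \<in> T \<and> T \<subseteq> - range gexp"
      using nb[of x] by (intro exI[of _ "(\<lambda>y. x \<otimes> y) ` G"] conjI)
  qed
  have "range gexp \<inter> UNIV = {} \<or> - range gexp \<inter> UNIV = {}"
    by (rule connectedD[OF connected_UNIV_group 1 2]) auto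
  then show ?thesis by auto
qed

text \<open>Lift a null homotopy of the loop \<open>t \<mapsto> exp (t x)\<close> step by step on a fine grid: the increments have small
  logarithms, whose product telescopes over each grid square, so that the lift of the loop closes up.\<close>

lemma kernel_trivial:
  assumes x: "gexp x = \<one>"
  shows "x = 0"
proof -
  let ?S = "{0..1::real} \<times> {0..1::real}"
  have path: "path (\<lambda>t. gexp (t *\<^sub>R x))" "path (\<lambda>t::real. \<one>)"
    unfolding path_def continuous_on_def by (auto intro!: tendsto_gexp tendsto_intros)
  have "homotopic_loops UNIV (\<lambda>t. gexp (t *\<^sub>R x)) (\<lambda>_. \<one>)"
    using sc path x unfolding simply_connected_def by (auto simp: pathstart_def pathfinish_def)
  then obtain h where cont_h: "continuous_on ?S h"
    and h0: "\<And>t. t \<in> {0..1} \<Longrightarrow> h (0, t) = gexp (t *\<^sub>R x)" and h1: "\<And>t. t \<in> {0..1} \<Longrightarrow> h (1, t) = \<one>"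
    and loop: "\<And>t. t \<in> {0..1} \<Longrightarrow> h (t, 1) = h (t, 0)"
    unfolding homotopic_loops pathstart_def pathfinish_def comp_def by blast
  obtain B where B: "0 < B" "\<And>u w. norm (mul u w) \<le> norm u + norm w + B * norm u * norm w"
    using mul_bound by metis
  \<comment> \<open>Small enough that the product of three logarithms of norm below \<epsilon>,
    which occurs when an increment is carried across a grid square, stays in the ball where exp is
    injective; (4 + B)^2 is a convenient bound for the linear and bracket terms together.\<close>
  define \<epsilon> where "\<epsilon> = min 1 (r2 / (4 + B)\<^sup>2)"
  have "0 < (4 + B)\<^sup>2" using B by simp
  have "r2 / (4 + B)\<^sup>2 \<le> r2 / 1" using B r2 by (intro divide_left_mono) (auto simp: one_le_power)
  moreover have "\<epsilon> * (4 + B)\<^sup>2 \<le> r2 / (4 + B)\<^sup>2 * (4 + B)\<^sup>2"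
    unfolding \<epsilon>_def by (intro mult_right_mono) auto
  moreover have "0 < r2 / (4 + B)\<^sup>2" using r2 \<open>0 < (4 + B)\<^sup>2\<close> by simp
  ultimately have eps: "0 < \<epsilon>" "\<epsilon> \<le> 1" "\<epsilon> * (4 + B)\<^sup>2 \<le> r2" "\<epsilon> \<le> r2"
    using \<open>0 < (4 + B)\<^sup>2\<close> by (auto simp: \<epsilon>_def)
  have triple: "norm (mul (mul u v) w) \<le> r2" if "norm u < \<epsilon>" "norm v < \<epsilon>" "norm w < \<epsilon>" for u v w
  proof -
    have 1: "norm (mul u v) \<le> \<epsilon> * (2 + B)"
    proof -
      have "B * norm u * norm v \<le> B * \<epsilon> * 1" using that eps B by (intro mult_mono) auto
      then show ?thesis using B(2)[of u v] that by (simp add: algebra_simps)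
    qed
    have "B * norm (mul u v) * norm w \<le> B * (\<epsilon> * (2 + B)) * 1" using 1 that eps B by (intro mult_mono) auto
    then have "norm (mul (mul u v) w) \<le> \<epsilon> * (2 + B) + \<epsilon> + B * (\<epsilon> * (2 + B))"
      using B(2)[of "mul u v" w] 1 that by linarith
    also have "\<dots> \<le> \<epsilon> * (4 + B)\<^sup>2" using eps B by (simp add: algebra_simps power2_eq_square)
    finally show ?thesis using eps by simp
  qed
  define G where "G = gexp ` ball 0 \<epsilon>"
  have G: "open G" "\<one> \<in> G"
  proof -
    show "open G" unfolding G_def by (rule gexp_open_small) (use eps in auto)
    have "gexp 0 \<in> G" unfolding G_def by (rule imageI) (use eps in simp)
    then show "\<one> \<in> G" by simp
  qed
  \<comment> \<open>Open sets on which any two values of \<open>h\<close> differ by an element of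
    \<open>G\<close>. A Lebesgue number of this cover bounds the mesh of the grid.\<close>
  define \<G> where "\<G> = {T. open T \<and> (\<forall>p \<in> T \<inter> ?S. \<forall>q \<in> T \<inter> ?S. inv (h p) \<otimes> h q \<in> G)}"
  have cover: "\<exists>T\<in>\<G>. p0 \<in> T" if p0: "p0 \<in> ?S" for p0
  proof -
    have "((\<lambda>z. inv (fst z) \<otimes> snd z) \<longlongrightarrow> inv (h p0) \<otimes> h p0) (at (h p0, h p0))"
      by (intro tendsto_mult' tendsto_inv' tendsto_eq_intros) auto
    moreover have "inv (h p0) \<otimes> h p0 = \<one>" by simp
    ultimately have "\<forall>\<^sub>F z in at (h p0, h p0). inv (fst z) \<otimes> snd z \<in> G"
      using G topological_tendstoD by fastforce
    then obtain W where W: "open W" "(h p0, h p0) \<in> W" "\<forall>z\<in>W. z \<noteq> (h p0, h p0) \<longrightarrow> inv (fst z) \<otimes> snd z \<in> G"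
      unfolding eventually_at_topological by blast
    have W': "\<forall>z\<in>W. inv (fst z) \<otimes> snd z \<in> G" using W(3) G by (metis fst_conv snd_conv l_inv carrier_UNIV UNIV_I)
    obtain A1 A2 where A: "open A1" "open A2" "h p0 \<in> A1" "h p0 \<in> A2" "A1 \<times> A2 \<subseteq> W"
      using open_prod_elim[OF W(1,2)] by (metis mem_Sigma_iff)
    then obtain T where "open T" "p0 \<in> T" "\<forall>y\<in>?S. y \<in> T \<longrightarrow> h y \<in> A1 \<inter> A2"
      using cont_h p0 unfolding continuous_on_topological by (metis IntI open_Int)
    moreover have "inv a \<otimes> c \<in> G" if "a \<in> A1 \<inter> A2" "c \<in> A1 \<inter> A2" for a c
      using W' A(5) that by force
    ultimately show ?thesis unfolding \<G>_def by (intro bexI[of _ T]) auto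
  qed
  have "compact ?S" by (intro compact_Times) auto
  then obtain \<delta> where \<delta>: "0 < \<delta>" "\<And>p. p \<in> ?S \<Longrightarrow> \<exists>T\<in>\<G>. ball p \<delta> \<subseteq> T"
    by (rule Heine_Borel_lemma[of ?S \<G>]) (use cover in \<open>auto simp: \<G>_def\<close>)
  have near: "inv (h p) \<otimes> h q \<in> G" if "p \<in> ?S" "q \<in> ?S" "dist p q < \<delta>" for p q
    using \<delta>(2)[OF that(1)] that \<delta>(1) unfolding \<G>_def by (fastforce simp: subset_iff)
  obtain n where n: "1 / \<delta> + norm x / \<epsilon> < real n" using reals_Archimedean2 by blast
  have npos: "0 < real n" using n \<delta>(1) eps by (metis add_nonneg_nonneg divide_nonneg_pos less_eq_real_def norm_ge_zero order_le_less_trans zero_le_divide_1_iff)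
  have n1: "1 / real n < \<delta>"
  proof -
    have "1 / \<delta> < real n" using n eps by (smt (verit) divide_nonneg_pos norm_ge_zero)
    then show ?thesis using \<delta> npos by (simp add: field_simps)
  qed
  have n2: "norm ((1 / real n) *\<^sub>R x) < \<epsilon>"
  proof -
    have "norm x / \<epsilon> < real n" using n \<delta> by (smt (verit) divide_nonneg_pos)
    then show ?thesis using eps npos by (simp add: field_simps)
  qed
  define H where "H = (\<lambda>i j. h (real i / real n, real j / real n))"
  have unit: "real i / real n \<in> {0..1}" if "i \<le> n" for i using that npos by simp
  have "\<exists>v. norm v < \<epsilon> \<and> gexp v = inv (H i j) \<otimes> H i (Suc j)" if "i \<le> n" "j < n" for i j
  proof -
    have "inv (H i j) \<otimes> H i (Suc j) \<in> G"
      unfolding H_def using that unit[of i] unit[of j] unit[of "Suc j"] n1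
      by (intro near) (auto simp: dist_Pair_Pair dist_real_def diff_divide_distrib[symmetric])
    then show ?thesis by (auto simp: G_def)
  qed
  then obtain f where f: "\<And>i j. i \<le> n \<Longrightarrow> j < n \<Longrightarrow> norm (f i j) < \<epsilon> \<and> gexp (f i j) = inv (H i j) \<otimes> H i (Suc j)"
    by metis
  have "\<exists>v. norm v < \<epsilon> \<and> gexp v = inv (H i j) \<otimes> H (Suc i) j" if "i < n" "j \<le> n" for i j
  proof -
    have "inv (H i j) \<otimes> H (Suc i) j \<in> G"
      unfolding H_def using that unit[of i] unit[of j] unit[of "Suc i"] n1
      by (intro near) (auto simp: dist_Pair_Pair dist_real_def diff_divide_distrib[symmetric])
    then show ?thesis by (auto simp: G_def)
  qed
  then obtain \<eta> where \<eta>: "\<And>i j. i < n \<Longrightarrow> j \<le> n \<Longrightarrow> norm (\<eta> i j) < \<epsilon> \<and> gexp (\<eta> i j) = inv (H i j) \<otimes> H (Suc i) j"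
    by metis
  \<comment> \<open>Both sides have the same exponential, because the group increments around a grid
    square cancel. Both are small, so they agree before exponentiation.\<close>
  have step: "f (Suc i) j = mul (mul (- \<eta> i j) (f i j)) (\<eta> i (Suc j))" if "i < n" "j < n" for i j
  proof (rule gexp_inj_small)
    show "norm (f (Suc i) j) \<le> r2" using f[of "Suc i" j] that eps by simp
    show "norm (mul (mul (- \<eta> i j) (f i j)) (\<eta> i (Suc j))) \<le> r2"
      using that f[of i j] \<eta>[of i j] \<eta>[of i "Suc j"] by (intro triple) auto
    show "gexp (f (Suc i) j) = gexp (mul (mul (- \<eta> i j) (f i j)) (\<eta> i (Suc j)))"
      using that f[of i j] f[of "Suc i" j] \<eta>[of i j] \<eta>[of i "Suc j"]
      by (simp add: gexp_mul gexp_minus inv_mult_group m_assoc)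
  qed
  have closed: "\<eta> i n = \<eta> i 0" if "i < n" for i
  proof (rule gexp_inj_small)
    show "norm (\<eta> i n) \<le> r2" "norm (\<eta> i 0) \<le> r2" using \<eta>[of i n] \<eta>[of i 0] that eps by auto
    have "H j n = H j 0" if "j \<le> n" for j using loop[OF unit[OF that]] npos by (simp add: H_def)
    then show "gexp (\<eta> i n) = gexp (\<eta> i 0)" using \<eta>[of i n] \<eta>[of i 0] that by simp
  qed
  \<comment> \<open>Descent from the last row, where \<open>h\<close> is constant. The products of
    neighbouring rows are conjugate by \<open>\<eta> i 0\<close>, since the rows are loops and the
    two outer increments between them agree.\<close>
  have "prodm (f (n - d)) n = 0" if "d \<le> n" for d
    using that
  proof (induction d)
    case 0
    have "f n j = 0" if "j < n" for j
    proof (rule gexp_inj_small)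
      show "norm (f n j) \<le> r2" using f[of n j] that eps by simp
      show "gexp (f n j) = gexp 0" using f[of n j] that h1 unit[of j] unit[of "Suc j"] npos by (simp add: H_def)
    qed (use r2 in simp)
    then have "prodm (f n) n = real n *\<^sub>R 0" by (rule prodm_const)
    then show ?case by simp
  next
    case (Suc d)
    define i where "i = n - Suc d"
    have i: "i < n" "Suc i = n - d" using Suc.prems by (auto simp: i_def)
    have "prodm (f (Suc i)) n = mul (mul (- \<eta> i 0) (prodm (f i) n)) (\<eta> i n)"
      by (rule prodm_telescope) (rule step[OF i(1)])
    then have "mul (\<eta> i 0) (mul (mul (- \<eta> i 0) (prodm (f i) n)) (\<eta> i 0)) = mul (\<eta> i 0) 0"
      using Suc i closed[of i] by simp
    then have "mul (mul (prodm (f i) n) (\<eta> i 0)) (- \<eta> i 0) = mul (\<eta> i 0) (- \<eta> i 0)" by (simp add: mul_assoc)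
    then show ?case by (simp add: mul_assoc i_def)
  qed
  from this[of n] have "prodm (f 0) n = 0" by simp
  moreover have "prodm (f 0) n = real n *\<^sub>R ((1 / real n) *\<^sub>R x)"
  proof (rule prodm_const)
    fix j assume j: "j < n"
    show "f 0 j = (1 / real n) *\<^sub>R x"
    proof (rule gexp_inj_small)
      show "norm (f 0 j) \<le> r2" using f[of 0 j] j eps by simp
      show "norm ((1 / real n) *\<^sub>R x) \<le> r2" using n2 eps by linarith
      have "gexp (f 0 j) = inv (gexp ((real j / real n) *\<^sub>R x)) \<otimes> gexp ((real (Suc j) / real n) *\<^sub>R x)"
        using f[of 0 j] j h0 unit[of j] unit[of "Suc j"] by (simp add: H_def)
      also have "real (Suc j) / real n = real j / real n + 1 / real n" by (simp add: add_divide_distrib)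
      finally show "gexp (f 0 j) = gexp ((1 / real n) *\<^sub>R x)" by (simp only: gexp_add_same inv_cancel)
    qed
  qed
  ultimately show ?thesis using npos by simp
qed

lemma inj_gexp: "inj gexp"
proof (rule injI)
  fix u w assume "gexp u = gexp w"
  then have "gexp (mul (- u) w) = \<one>" by (simp add: gexp_mul gexp_minus)
  then have "mul (- u) w = 0" by (rule kernel_trivial)
  then have "mul u (mul (- u) w) = u" by simp
  then show "u = w" by simp
qed

end

section \<open>Charts of a Lie group\<close>

lemma differentiable_imp_lipschitz_at:
  assumes "f differentiable (at x0)"
  obtains d K where "0 < d" "0 < K" "\<And>x. norm (x - x0) < d \<Longrightarrow> norm (f x - f x0) \<le> K * norm (x - x0)"
proof -
  obtain f' where f': "(f has_derivative f') (at x0)" using assms by (auto simp: differentiable_def)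
  interpret bounded_linear f' using f' by (rule has_derivative_bounded_linear)
  obtain B where B: "0 < B" "\<And>x. norm (f' x) \<le> norm x * B" using pos_bounded by blast
  from has_derivative_at_alt[THEN iffD1, OF f'] obtain d where d: "0 < d"
    "\<And>y. norm (y - x0) < d \<Longrightarrow> norm (f y - f x0 - f' (y - x0)) \<le> 1 * norm (y - x0)"
    by (metis zero_less_one)
  show ?thesis
  proof (rule that)
    show "0 < d" "0 < B + 1" using d B by auto
    fix x assume x: "norm (x - x0) < d"
    have "norm (f x - f x0) \<le> norm (f x - f x0 - f' (x - x0)) + norm (f' (x - x0))"
      using norm_triangle_sub[of "f x - f x0" "f' (x - x0)"] by (simp add: add.commute)
    then show "norm (f x - f x0) \<le> (B + 1) * norm (x - x0)"
      using d(2)[OF x] B(2)[of "x - x0"] by (simp add: algebra_simps)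
  qed
qed

text \<open>The mean value inequality for f minus its derivative at x0. Differentiability at x0 of x
  -> Df(x) i, for each basis vector i, bounds the operator norm of Df(z) - Df(x0) by a multiple of
  the distance of z from x0.\<close>

lemma C2_difference_estimate:
  fixes f :: "'a::euclidean_space \<Rightarrow> 'b::euclidean_space"
  assumes M: "open M" "x0 \<in> M" and f: "f differentiable_on M"
    and df: "\<And>v. (\<lambda>x. frechet_derivative f (at x) v) differentiable (at x0)"
  obtains r K where "0 < r" "0 < K" "cball x0 r \<subseteq> M"
    "\<And>x y \<rho>. norm (x - x0) \<le> \<rho> \<Longrightarrow> norm (y - x0) \<le> \<rho> \<Longrightarrow> \<rho> \<le> r \<Longrightarrow>
      norm (f x - f y - frechet_derivative f (at x0) (x - y)) \<le> K * \<rho> * norm (x - y)"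
proof -
  let ?D = "\<lambda>x. frechet_derivative f (at x)"
  have fD: "(f has_derivative ?D x) (at x)" if "x \<in> M" for x
    using f M(1) that by (simp add: differentiable_on_eq_differentiable_at frechet_derivative_works)
  have "\<exists>d K. 0 < d \<and> 0 < K \<and> (\<forall>x. norm (x - x0) < d \<longrightarrow> norm (?D x i - ?D x0 i) \<le> K * norm (x - x0))" for i
    using differentiable_imp_lipschitz_at[OF df[of i]] by metis
  then obtain d Ki where d: "\<And>i. 0 < d i" "\<And>i. 0 < Ki i"
    "\<And>i x. norm (x - x0) < d i \<Longrightarrow> norm (?D x i - ?D x0 i) \<le> Ki i * norm (x - x0)"
    by metis
  obtain e where e: "0 < e" "cball x0 e \<subseteq> M" using M open_contains_cball by blast
  define r where "r = min e (Min (d ` Basis) / 2)"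
  define K where "K = (\<Sum>i\<in>(Basis::'a set). Ki i)"
  have r: "0 < r" "r \<le> e" "\<And>i. i \<in> Basis \<Longrightarrow> r < d i"
  proof -
    have m: "0 < Min (d ` Basis)" using d(1) by (subst Min_gr_iff) auto
    then show "0 < r" "r \<le> e" using e by (auto simp: r_def)
    fix i :: 'a assume "i \<in> Basis"
    then have "Min (d ` Basis) \<le> d i" by (intro Min_le) auto
    moreover have "r \<le> Min (d ` Basis) / 2" unfolding r_def by (rule min.cobounded2)
    ultimately show "r < d i" using m by linarith
  qed
  have K: "0 < K" unfolding K_def using d(2) by (intro sum_pos) auto
  show ?thesis
  proof (rule that[OF r(1) K])
    show "cball x0 r \<subseteq> M" using e r by auto
    fix x y \<rho> assume xy: "norm (x - x0) \<le> \<rho>" "norm (y - x0) \<le> \<rho>" "\<rho> \<le> r"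
    let ?S = "cball x0 \<rho>"
    have sub: "z \<in> M" "norm (z - x0) \<le> \<rho>" if "z \<in> ?S" for z
    proof -
      have "dist x0 z \<le> \<rho>" using that by simp
      then show "norm (z - x0) \<le> \<rho>" by (simp add: dist_commute flip: dist_norm)
      have "z \<in> cball x0 e" using \<open>dist x0 z \<le> \<rho>\<close> xy(3) r(2) by simp
      then show "z \<in> M" using e(2) by blast
    qed
    have der: "((\<lambda>z. f z - ?D x0 z) has_derivative (\<lambda>v. ?D z v - ?D x0 v)) (at z within ?S)" if "z \<in> ?S" for z
      by (rule has_derivative_diff[OF has_derivative_at_withinI[OF fD[OF sub(1)[OF that]]]
          bounded_linear_imp_has_derivative[OF has_derivative_bounded_linear[OF fD[OF M(2)]]]])
    have on: "onorm (\<lambda>v. ?D z v - ?D x0 v) \<le> K * \<rho>" if z: "z \<in> ?S" for z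
    proof (rule onorm_bound)
      show "0 \<le> K * \<rho>" using K xy(1) norm_ge_zero[of "x - x0"] by (intro mult_nonneg_nonneg) linarith+
      fix v
      interpret L: bounded_linear "\<lambda>v. ?D z v - ?D x0 v"
        using der[OF z] by (rule has_derivative_bounded_linear)
      have "?D z v - ?D x0 v = (\<Sum>i\<in>Basis. (v \<bullet> i) *\<^sub>R (?D z i - ?D x0 i))"
        using L.sum[of "\<lambda>i. (v \<bullet> i) *\<^sub>R i" Basis] by (simp add: L.scaleR euclidean_representation)
      also have "norm \<dots> \<le> (\<Sum>i\<in>Basis. norm v * (Ki i * \<rho>))"
      proof (rule sum_norm_le)
        fix i :: 'a assume i: "i \<in> Basis"
        have "norm (?D z i - ?D x0 i) \<le> Ki i * norm (z - x0)"
          using sub(2)[OF z] r(3)[OF i] xy by (intro d(3)) linarith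
        also have "\<dots> \<le> Ki i * \<rho>" using sub(2)[OF z] d(2)[of i] by (intro mult_left_mono) auto
        finally show "norm ((v \<bullet> i) *\<^sub>R (?D z i - ?D x0 i)) \<le> norm v * (Ki i * \<rho>)"
          unfolding norm_scaleR using Basis_le_norm[OF i, of v] by (intro mult_mono) auto
      qed
      also have "\<dots> = K * \<rho> * norm v" by (simp add: K_def sum_distrib_left sum_distrib_right mult_ac)
      finally show "norm (?D z v - ?D x0 v) \<le> K * \<rho> * norm v" .
    qed
    have "norm ((f x - ?D x0 x) - (f y - ?D x0 y)) \<le> K * \<rho> * norm (x - y)"
      by (rule differentiable_bound[OF convex_cball der on]) (use xy in \<open>simp_all add: dist_commute flip: dist_norm\<close>)
    moreover have "?D x0 (x - y) = ?D x0 x - ?D x0 y"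
      using has_derivative_bounded_linear[OF fD[OF M(2)]] by (simp add: bounded_linear.linear linear_diff)
    then have "f x - f y - ?D x0 (x - y) = (f x - ?D x0 x) - (f y - ?D x0 y)" by simp
    ultimately show "norm (f x - f y - ?D x0 (x - y)) \<le> K * \<rho> * norm (x - y)" by (simp only:)
  qed
qed

lemma smooth_on_C2:
  assumes "smooth_on M f" "open M" "x0 \<in> M"
  shows "f differentiable_on M" "(\<lambda>x. frechet_derivative f (at x) v) differentiable (at x0)"
proof -
  have "Ck_on (Suc (Suc 0)) M f" using assms by (simp only: smooth_on_def)
  then show "f differentiable_on M" "(\<lambda>x. frechet_derivative f (at x) v) differentiable (at x0)"
    using assms(2,3) by (simp_all add: differentiable_on_eq_differentiable_at)
qed

lemma C2_lipschitz:
  fixes f :: "'a::euclidean_space \<Rightarrow> 'b::euclidean_space"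
  assumes "smooth_on M f" "open M" "x0 \<in> M"
  obtains r L where "0 < r" "0 < L" "cball x0 r \<subseteq> M"
    "\<And>x y. x \<in> cball x0 r \<Longrightarrow> y \<in> cball x0 r \<Longrightarrow> norm (f x - f y) \<le> L * norm (x - y)"
proof -
  obtain r K where r: "0 < r" "0 < K" "cball x0 r \<subseteq> M"
    "\<And>x y \<rho>. norm (x - x0) \<le> \<rho> \<Longrightarrow> norm (y - x0) \<le> \<rho> \<Longrightarrow> \<rho> \<le> r \<Longrightarrow>
      norm (f x - f y - frechet_derivative f (at x0) (x - y)) \<le> K * \<rho> * norm (x - y)"
    using C2_difference_estimate[OF assms(2,3) smooth_on_C2(1)[OF assms] smooth_on_C2(2)[OF assms]] by metis
  have "f differentiable (at x0)" using smooth_on_C2(1)[OF assms] assms by (simp add: differentiable_on_eq_differentiable_at)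
  then have "bounded_linear (frechet_derivative f (at x0))"
    unfolding frechet_derivative_works by (rule has_derivative_bounded_linear)
  then obtain B where B: "0 < B" "\<And>v. norm (frechet_derivative f (at x0) v) \<le> norm v * B"
    using bounded_linear.pos_bounded by blast
  show ?thesis
  proof (rule that[of r "K * r + B"])
    fix x y assume "x \<in> cball x0 r" "y \<in> cball x0 r"
    then have "norm (f x - f y - frechet_derivative f (at x0) (x - y)) \<le> K * r * norm (x - y)"
      by (intro r) (simp_all add: dist_commute flip: dist_norm)
    then show "norm (f x - f y) \<le> (K * r + B) * norm (x - y)"
      using norm_triangle_sub[of "f x - f y" "frechet_derivative f (at x0) (x - y)"] B(2)[of "x - y"]
      by (simp add: algebra_simps)
  qed (use r B in \<open>auto intro: add_pos_pos\<close>)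
qed

locale lie_group_chart =
  fixes N :: "'g::{t2_space, second_countable_topology} monoid" (structure)
    and A :: "('g, 'e::euclidean_space) chart set" and U :: "'g set" and \<phi> :: "'g \<Rightarrow> 'e"
  assumes lie: "lie_group N A" and chart: "(U, \<phi>) \<in> A" and one_U: "\<one> \<in> U"
begin

sublocale group N using lie by (simp add: lie_group_def)

lemma carrier_UNIV' [simp]: "carrier N = UNIV" using lie by (simp add: lie_group_def)

lemma chartD:
  assumes "(W, \<psi>) \<in> A"
  shows "open W" "open (\<psi> ` W)" "homeomorphism W (\<psi> ` W) \<psi> (inv_into W \<psi>)"
    "continuous_on W \<psi>" "continuous_on (\<psi> ` W) (inv_into W \<psi>)" "inj_on \<psi> W"
    "\<And>x. x \<in> W \<Longrightarrow> inv_into W \<psi> (\<psi> x) = x"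
proof -
  have "\<forall>(U, \<phi>) \<in> A. open U \<and> open (\<phi> ` U) \<and> homeomorphism U (\<phi> ` U) \<phi> (inv_into U \<phi>)"
    using lie unfolding lie_group_def smooth_atlas_def by blast
  with assms show *: "open W" "open (\<psi> ` W)" "homeomorphism W (\<psi> ` W) \<psi> (inv_into W \<psi>)" by blast+
  then show "continuous_on W \<psi>" "continuous_on (\<psi> ` W) (inv_into W \<psi>)"
    "\<And>x. x \<in> W \<Longrightarrow> inv_into W \<psi> (\<psi> x) = x" by (auto simp: homeomorphism_def)
  then show "inj_on \<psi> W" by (metis inj_onI)
qed

lemma chart_ex: "\<exists>W \<psi>. (W, \<psi>) \<in> A \<and> x \<in> W"
  using lie unfolding lie_group_def smooth_atlas_def by fast

lemma cont_mult': "continuous_on UNIV (\<lambda>(x, y). x \<otimes> y)" and cont_inv': "continuous_on UNIV (\<lambda>x. inv x)"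
  using lie unfolding lie_group_def by blast+

definition mult_dom where
  "mult_dom W1 \<psi>1 W2 \<psi>2 W3 = {(u, w). u \<in> \<psi>1 ` W1 \<and> w \<in> \<psi>2 ` W2 \<and> inv_into W1 \<psi>1 u \<otimes> inv_into W2 \<psi>2 w \<in> W3}"

lemma smooth_mult:
  assumes "(W1, \<psi>1) \<in> A" "(W2, \<psi>2) \<in> A" "(W3, \<psi>3) \<in> A"
  shows "smooth_on (mult_dom W1 \<psi>1 W2 \<psi>2 W3) (\<lambda>(u, w). \<psi>3 (inv_into W1 \<psi>1 u \<otimes> inv_into W2 \<psi>2 w))"
proof -
  have "\<forall>(U, \<phi>) \<in> A. \<forall>(W, \<psi>) \<in> A. \<forall>(Z, \<zeta>) \<in> A.
        smooth_on
          {(u, w). u \<in> \<phi> ` U \<and> w \<in> \<psi> ` W \<and> inv_into U \<phi> u \<otimes> inv_into W \<psi> w \<in> Z}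
          (\<lambda>(u, w). \<zeta> (inv_into U \<phi> u \<otimes> inv_into W \<psi> w))"
    using lie unfolding lie_group_def by blast
  with assms show ?thesis unfolding mult_dom_def by blast
qed

lemma open_mult_dom:
  assumes "(W1, \<psi>1) \<in> A" "(W2, \<psi>2) \<in> A" "open W3"
  shows "open (mult_dom W1 \<psi>1 W2 \<psi>2 W3)"
proof -
  have c: "continuous_on (\<psi>1 ` W1 \<times> \<psi>2 ` W2) (\<lambda>p. inv_into W1 \<psi>1 (fst p) \<otimes> inv_into W2 \<psi>2 (snd p))"
  proof -
    have "continuous_on (\<psi>1 ` W1 \<times> \<psi>2 ` W2) (\<lambda>p. (inv_into W1 \<psi>1 (fst p), inv_into W2 \<psi>2 (snd p)))"
      by (intro continuous_on_Pair continuous_on_compose2[OF chartD(5)[OF assms(1)]]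
          continuous_on_compose2[OF chartD(5)[OF assms(2)]] continuous_intros) auto
    from continuous_on_compose2[OF cont_mult' this] show ?thesis by simp
  qed
  have "open (\<psi>1 ` W1 \<times> \<psi>2 ` W2)" using chartD(2)[OF assms(1)] chartD(2)[OF assms(2)] by (rule open_Times)
  from continuous_open_preimage[OF c this assms(3)] show ?thesis
    by (rule back_subst[where P = "open"]) (auto simp: mult_dom_def)
qed

text \<open>Left translations are locally Lipschitz between arbitrary charts. This is what transfers
  absolute continuity between a chart and exponential coordinates.\<close>

lemma mult_lipschitz:
  assumes ch: "(W1, \<psi>1) \<in> A" "(W2, \<psi>2) \<in> A" "(W3, \<psi>3) \<in> A" and gh: "g \<in> W1" "h \<in> W2" "g \<otimes> h \<in> W3"
  obtains T L where "open T" "h \<in> T" "T \<subseteq> W2" "0 < L"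
    "\<And>x y. x \<in> T \<Longrightarrow> y \<in> T \<Longrightarrow> g \<otimes> x \<in> W3 \<and> norm (\<psi>3 (g \<otimes> x) - \<psi>3 (g \<otimes> y)) \<le> L * norm (\<psi>2 x - \<psi>2 y)"
proof -
  let ?M = "mult_dom W1 \<psi>1 W2 \<psi>2 W3" and ?f = "\<lambda>(u, w). \<psi>3 (inv_into W1 \<psi>1 u \<otimes> inv_into W2 \<psi>2 w)"
  have in_M: "(\<psi>1 g, \<psi>2 h) \<in> ?M" using gh chartD(7)[OF ch(1)] chartD(7)[OF ch(2)] by (auto simp: mult_dom_def)
  obtain r L where r: "0 < r" "0 < L" "cball (\<psi>1 g, \<psi>2 h) r \<subseteq> ?M"
    "\<And>x y. x \<in> cball (\<psi>1 g, \<psi>2 h) r \<Longrightarrow> y \<in> cball (\<psi>1 g, \<psi>2 h) r \<Longrightarrow> norm (?f x - ?f y) \<le> L * norm (x - y)"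
    using C2_lipschitz[OF smooth_mult[OF ch] open_mult_dom[OF ch(1,2) chartD(1)[OF ch(3)]] in_M] by metis
  define T where "T = W2 \<inter> \<psi>2 -` ball (\<psi>2 h) r"
  show ?thesis
  proof (rule that)
    show "open T" unfolding T_def
      by (rule continuous_open_preimage[OF chartD(4)[OF ch(2)] chartD(1)[OF ch(2)]]) simp
    show "h \<in> T" "T \<subseteq> W2" using gh r(1) by (auto simp: T_def)
    show "0 < L" by fact
    fix x y assume xy: "x \<in> T" "y \<in> T"
    have in_ball: "(\<psi>1 g, \<psi>2 z) \<in> cball (\<psi>1 g, \<psi>2 h) r" if "z \<in> T" for z
      using that by (auto simp: T_def dist_Pair_Pair)
    have f: "?f (\<psi>1 g, \<psi>2 z) = \<psi>3 (g \<otimes> z)" "g \<otimes> z \<in> W3" if "z \<in> T" for z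
    proof -
      have "(\<psi>1 g, \<psi>2 z) \<in> ?M" using r(3) in_ball[OF that] by blast
      then show "?f (\<psi>1 g, \<psi>2 z) = \<psi>3 (g \<otimes> z)" "g \<otimes> z \<in> W3"
        using that gh chartD(7)[OF ch(1)] chartD(7)[OF ch(2)] by (auto simp: T_def mult_dom_def)
    qed
    show "g \<otimes> x \<in> W3 \<and> norm (\<psi>3 (g \<otimes> x) - \<psi>3 (g \<otimes> y)) \<le> L * norm (\<psi>2 x - \<psi>2 y)"
      using r(4)[OF in_ball[OF xy(1)] in_ball[OF xy(2)]] unfolding f(1)[OF xy(1)] f(1)[OF xy(2)]
      using f(2)[OF xy(1)] by (simp add: norm_Pair)
  qed
qed

definition ctr :: 'e where "ctr = \<phi> \<one>"
definition kk :: "'e \<Rightarrow> 'g" where "kk u = inv_into U \<phi> (ctr + u)"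
definition DD :: "'e set" where "DD = {u. ctr + u \<in> \<phi> ` U}"
definition mm :: "'e \<Rightarrow> 'e \<Rightarrow> 'e" where "mm u w = \<phi> (kk u \<otimes> kk w) - ctr"
text \<open>The multiplication in untranslated chart coordinates, to which the smoothness of the
  group applies directly; \<open>mm\<close> is \<open>mu\<close> with the identity moved to
  0.\<close>

definition mu :: "'e \<times> 'e \<Rightarrow> 'e" where "mu = (\<lambda>(u, w). \<phi> (inv_into U \<phi> u \<otimes> inv_into U \<phi> w))"
definition MM where "MM = mult_dom U \<phi> U \<phi> U"

lemma mm_mu: "mm u w = mu (ctr + u, ctr + w) - ctr"
  by (simp add: mm_def mu_def kk_def)

lemma MM: "open MM" "smooth_on MM mu" "(ctr, ctr) \<in> MM"
  "\<And>p. p \<in> \<phi> ` U \<Longrightarrow> (p, ctr) \<in> MM" "\<And>p. p \<in> \<phi> ` U \<Longrightarrow> (ctr, p) \<in> MM"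
  "\<And>p. p \<in> \<phi> ` U \<Longrightarrow> mu (p, ctr) = p" "\<And>p. p \<in> \<phi> ` U \<Longrightarrow> mu (ctr, p) = p"
  unfolding MM_def mu_def
  using open_mult_dom[OF chart chart chartD(1)[OF chart]] smooth_mult[OF chart chart chart] one_U chartD(7)[OF chart]
  by (auto simp: mult_dom_def ctr_def)

lemma kk_phi: "g \<in> U \<Longrightarrow> kk (\<phi> g - ctr) = g"
  by (simp add: kk_def chartD(7)[OF chart])

lemma mu_has_derivative: "p \<in> MM \<Longrightarrow> (mu has_derivative frechet_derivative mu (at p)) (at p)"
  using smooth_on_C2(1)[OF MM(2,1,3)] MM(1) by (simp add: differentiable_on_eq_differentiable_at frechet_derivative_works)

lemma mu_derivative_fst:
  assumes "p \<in> \<phi> ` U"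
  shows "((\<lambda>q. mu (q, ctr)) has_derivative (\<lambda>v. frechet_derivative mu (at (p, ctr)) (v, 0))) (at p)"
    and "frechet_derivative mu (at (p, ctr)) (v, 0) = v"
proof -
  show 1: "((\<lambda>q. mu (q, ctr)) has_derivative (\<lambda>v. frechet_derivative mu (at (p, ctr)) (v, 0))) (at p)"
    by (rule has_derivative_compose[of "\<lambda>q. (q, ctr)", OF _ mu_has_derivative[OF MM(4)[OF assms]]])
      (auto intro!: derivative_eq_intros)
  have "((\<lambda>q. q) has_derivative (\<lambda>v. frechet_derivative mu (at (p, ctr)) (v, 0))) (at p)"
    by (rule has_derivative_transform_within_open[OF 1 chartD(2)[OF chart] assms]) (rule MM(6))
  from has_derivative_unique[OF this has_derivative_ident] show "frechet_derivative mu (at (p, ctr)) (v, 0) = v"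
    by metis
qed

lemma mu_derivative_snd:
  assumes "(p, q) \<in> MM"
  shows "((\<lambda>y. mu (p, y)) has_derivative (\<lambda>v. frechet_derivative mu (at (p, q)) (0, v))) (at q)"
  by (rule has_derivative_compose[of "\<lambda>y. (p, y)", OF _ mu_has_derivative[OF assms]])
    (auto intro!: derivative_eq_intros)

lemma mu_derivative_snd_ctr:
  assumes "q \<in> \<phi> ` U"
  shows "frechet_derivative mu (at (ctr, q)) (0, v) = v"
proof -
  have "((\<lambda>q. q) has_derivative (\<lambda>v. frechet_derivative mu (at (ctr, q)) (0, v))) (at q)"
    by (rule has_derivative_transform_within_open[OF mu_derivative_snd[OF MM(5)[OF assms]] chartD(2)[OF chart] assms]) (rule MM(7))
  from has_derivative_unique[OF this has_derivative_ident] show ?thesis by metis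
qed

lemma ctr_in: "ctr \<in> \<phi> ` U" using one_U by (simp add: ctr_def)

lemma mu_derivative_ctr: "frechet_derivative mu (at (ctr, ctr)) (u, w) = u + w"
proof -
  have "linear (frechet_derivative mu (at (ctr, ctr)))"
    using mu_has_derivative[OF MM(3)] by (rule has_derivative_linear)
  from linear_add[OF this, of "(u, 0)" "(0, w)"] show ?thesis
    using mu_derivative_fst(2)[OF ctr_in] mu_derivative_snd_ctr[OF ctr_in] by simp
qed

text \<open>The second order estimate for \<open>mu\<close> at the identity is \<open>m_est\<close>,
  because the derivative there is addition. Radius and constant change by a factor 2, as the norm of
  a pair is bounded by the sum of the norms of its entries.\<close>

lemma local_coordinates_ex: "\<exists>r K. local_coordinates N kk DD mm r K"
proof -
  obtain r K where r: "0 < r" "0 < K" "cball (ctr, ctr) r \<subseteq> MM"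
    "\<And>x y \<rho>. norm (x - (ctr, ctr)) \<le> \<rho> \<Longrightarrow> norm (y - (ctr, ctr)) \<le> \<rho> \<Longrightarrow> \<rho> \<le> r \<Longrightarrow>
      norm (mu x - mu y - frechet_derivative mu (at (ctr, ctr)) (x - y)) \<le> K * \<rho> * norm (x - y)"
    using C2_difference_estimate[OF MM(1,3) smooth_on_C2(1)[OF MM(2,1,3)] smooth_on_C2(2)[OF MM(2,1,3)]] by metis
  have in_MM: "(ctr + u, ctr + w) \<in> MM" if "norm u \<le> r / 2" "norm w \<le> r / 2" for u w
  proof -
    have "dist (ctr, ctr) (ctr + u, ctr + w) \<le> norm u + norm w"
      by (simp add: dist_norm norm_Pair sqrt_sum_squares_le_sum)
    then show ?thesis using that r(3) by (auto simp: subset_iff)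
  qed
  have U: "ctr + u \<in> \<phi> ` U" if "norm u \<le> r / 2" for u
    using in_MM[OF that that] by (auto simp: MM_def mult_dom_def)
  have prod: "kk u \<otimes> kk w \<in> U" if "norm u \<le> r / 2" "norm w \<le> r / 2" for u w
    using in_MM[OF that] by (auto simp: MM_def mult_dom_def kk_def)
  have "local_coordinates N kk DD mm (r / 2) (2 * K)"
  proof (unfold_locales)
    show "carrier N = UNIV" by simp
    show "continuous_on UNIV (\<lambda>(x, y). x \<otimes> y)" "continuous_on UNIV (\<lambda>x. inv x)"
      by (rule cont_mult' cont_inv')+
    have DD': "DD = (\<lambda>u. ctr + u) -` (\<phi> ` U)" by (auto simp: DD_def)
    show "open DD" unfolding DD' by (intro continuous_open_vimage chartD(2)[OF chart]) (auto intro!: continuous_intros)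
    show "continuous_on DD kk" unfolding kk_def
      by (rule continuous_on_compose2[OF chartD(5)[OF chart]]) (auto simp: DD_def intro!: continuous_intros)
    show "inj_on kk DD"
    proof (rule inj_onI)
      fix x y assume "x \<in> DD" "y \<in> DD" "kk x = kk y"
      then have "ctr + x = ctr + y" unfolding DD_def kk_def by (intro inv_into_injective[of U \<phi>]) auto
      then show "x = y" by simp
    qed
    show "open (kk ` T)" if "open T" "T \<subseteq> DD" for T
    proof -
      have "open (U \<inter> \<phi> -` ((\<lambda>u. ctr + u) ` T))"
        using open_translation[OF that(1), of ctr]
        by (intro continuous_open_preimage chartD(4)[OF chart] chartD(1)[OF chart])
      moreover have "U \<inter> \<phi> -` ((\<lambda>u. ctr + u) ` T) = kk ` T"
      proof (intro equalityI subsetI)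
        fix g assume "g \<in> U \<inter> \<phi> -` ((\<lambda>u. ctr + u) ` T)"
        then obtain u where "u \<in> T" "\<phi> g = ctr + u" "g \<in> U" by auto
        then show "g \<in> kk ` T" using kk_phi[of g] by auto
      next
        fix g assume "g \<in> kk ` T"
        then obtain u where u: "u \<in> T" "g = kk u" by auto
        then have "ctr + u \<in> \<phi> ` U" using that by (auto simp: DD_def)
        then show "g \<in> U \<inter> \<phi> -` ((\<lambda>u. ctr + u) ` T)"
          using u by (auto simp: kk_def inv_into_into f_inv_into_f)
      qed
      ultimately show ?thesis by simp
    qed
    show "0 < r / 2" "0 < 2 * K" using r by auto
    show "cball 0 (r / 2) \<subseteq> DD" using U by (auto simp: DD_def)
    show "kk 0 = \<one>" using kk_phi[OF one_U] by (simp add: ctr_def)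
    fix u w :: 'e assume u: "norm u \<le> r / 2"
    show "mm u 0 = u" "mm 0 u = u" using MM(6,7)[OF U[OF u]] by (simp_all add: mm_mu)
    assume w: "norm w \<le> r / 2"
    show "mm u w \<in> DD" using prod[OF u w] by (simp add: DD_def mm_def)
    show "kk u \<otimes> kk w = kk (mm u w)" using kk_phi[OF prod[OF u w]] by (simp add: mm_def)
  next
    fix u w u' w' :: 'e and \<rho>
    assume *: "norm u \<le> \<rho>" "norm w \<le> \<rho>" "norm u' \<le> \<rho>" "norm w' \<le> \<rho>" "\<rho> \<le> r / 2"
    have nP: "norm (x, y) \<le> norm x + norm y" for x y :: 'e
      by (simp add: norm_Pair sqrt_sum_squares_le_sum)
    have "norm (mu (ctr + u, ctr + w) - mu (ctr + u', ctr + w') -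
        frechet_derivative mu (at (ctr, ctr)) ((ctr + u, ctr + w) - (ctr + u', ctr + w')))
      \<le> K * (2 * \<rho>) * norm ((ctr + u, ctr + w) - (ctr + u', ctr + w'))"
      using * nP[of u w] nP[of u' w'] by (intro r(4)) auto
    also have "\<dots> \<le> K * (2 * \<rho>) * (norm (u - u') + norm (w - w'))"
    proof (rule mult_left_mono)
      have "0 \<le> \<rho>" using *(1) norm_ge_zero order_trans by blast
      then show "0 \<le> K * (2 * \<rho>)" using r(2) by simp
    qed (use nP[of "u - u'" "w - w'"] in simp)
    finally show "norm (mm u w - mm u' w' - (u - u') - (w - w')) \<le> 2 * K * \<rho> * (norm (u - u') + norm (w - w'))"
      by (simp add: mm_mu mu_derivative_ctr algebra_simps)
  qed
  then show ?thesis by blast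
qed

end

section \<open>Agreement of the chart bracket with the group bracket\<close>

locale two_step_lie_group = lie_group_chart N A U \<phi>
  for N :: "'g::{t2_space, second_countable_topology} monoid" (structure)
    and A :: "('g, 'e::euclidean_space) chart set" and U :: "'g set" and \<phi> :: "'g \<Rightarrow> 'e" +
  assumes sc_group: "simply_connected (UNIV :: 'g set)" and two_step: "two_step_nilpotent N"
begin

text \<open>Radius and constant of one choice of local coordinates, packed in a pair so that they
  are available as fixed terms for the instantiation below.\<close>

definition rK :: "real \<times> real" where "rK = (SOME p. local_coordinates N kk DD mm (fst p) (snd p))"

text \<open>The element x^-1 y^-1 x y is the generator h1 h2 h1^-1 h2^-1 of the derived subgroup at
  the inverses of x and y.\<close>

lemma commutator_in_derived: "commutator N x y \<in> derived N (carrier N)"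
proof -
  have "inv x \<otimes> inv y \<otimes> inv (inv x) \<otimes> inv (inv y) \<in> (\<Union>h1\<in>carrier N. \<Union>h2\<in>carrier N. {h1 \<otimes> h2 \<otimes> inv h1 \<otimes> inv h2})"
    by (intro UN_I[of "inv x"] UN_I[of "inv y"] singletonI) simp_all
  from generate.incl[OF this] show ?thesis unfolding derived_def commutator_def by simp
qed

sublocale simply_connected_coordinates N kk DD mm "fst rK" "snd rK"
proof (intro simply_connected_coordinates.intro two_step_coordinates.intro
    simply_connected_coordinates_axioms.intro two_step_coordinates_axioms.intro)
  obtain r K where "local_coordinates N kk DD mm r K" using local_coordinates_ex by blast
  then have "\<exists>p. local_coordinates N kk DD mm (fst p) (snd p)" by (intro exI[of _ "(r, K)"]) simp
  then show "local_coordinates N kk DD mm (fst rK) (snd rK)" unfolding rK_def by (rule someI_ex)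
  show "simply_connected (UNIV :: 'g set)" by (rule sc_group)
  fix x y z
  have "commutator N z (commutator N x y) = \<one>"
    using two_step commutator_in_derived unfolding two_step_nilpotent_def by simp
  moreover have "z \<otimes> w = w \<otimes> z \<otimes> commutator N z w" for w
  proof -
    have cancel: "a \<otimes> (inv a \<otimes> b) = b" for a b by (simp flip: m_assoc)
    show ?thesis by (simp add: commutator_def m_assoc cancel)
  qed
  ultimately show "commutator N x y \<otimes> z = z \<otimes> commutator N x y" by simp
qed

lemma phi_gexp:
  assumes "norm v \<le> r2"
  shows "gexp v \<in> U" "\<phi> (gexp v) = ctr + xp v"
proof -
  have "ctr + xp v \<in> \<phi> ` U" using xp_in_D[OF assms] by (simp add: DD_def)
  then show "gexp v \<in> U" "\<phi> (gexp v) = ctr + xp v"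
    by (simp_all add: gexp_small[OF assms] kk_def inv_into_into f_inv_into_f)
qed

text \<open>\<open>dd w (p, ctr)\<close> is the value at p of the left invariant field that equals w
  at the identity. Its derivative \<open>hess w\<close> at the identity contains the mixed second
  derivative of the multiplication, as \<open>hess w (u, 0)\<close>.\<close>

definition dd where "dd w p = frechet_derivative mu (at p) (0, w)"
definition hess where "hess w = frechet_derivative (dd w) (at (ctr, ctr))"

lemma dd_has_derivative: "(dd w has_derivative hess w) (at (ctr, ctr))"
  using smooth_on_C2(2)[OF MM(2,1,3), of "(0, w)"]
  unfolding hess_def frechet_derivative_works by (simp add: dd_def[abs_def])

lemma hess_snd: "hess w (0, v) = 0"
proof -
  have 1: "((\<lambda>q. dd w (ctr, q)) has_derivative (\<lambda>v. hess w (0, v))) (at ctr)"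
    by (rule has_derivative_compose[of "\<lambda>q. (ctr, q)", OF _ dd_has_derivative]) (auto intro!: derivative_eq_intros)
  have "((\<lambda>q. w) has_derivative (\<lambda>v. hess w (0, v))) (at ctr)"
    by (rule has_derivative_transform_within_open[OF 1 chartD(2)[OF chart] ctr_in])
      (simp add: dd_def mu_derivative_snd_ctr)
  from has_derivative_unique[OF this has_derivative_const] show ?thesis by metis
qed

lemma lie_bracket_hess: "lie_bracket N (U, \<phi>) u w = hess w (u, 0) - hess u (w, 0)"
proof -
  have field: "left_invariant_field N (U, \<phi>) v p = dd v (p, ctr)" if "p \<in> \<phi> ` U" for p v
  proof -
    have "(\<lambda>y. \<phi> (inv_into U \<phi> p \<otimes> inv_into U \<phi> y)) = (\<lambda>y. mu (p, y))" by (simp add: mu_def)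
    then show ?thesis
      using frechet_derivative_at[OF mu_derivative_snd[OF MM(4)[OF that]]]
      unfolding left_invariant_field_def dd_def by (simp add: ctr_def[symmetric] fun_eq_iff)
  qed
  have "frechet_derivative (left_invariant_field N (U, \<phi>) v) (at ctr) = (\<lambda>u. hess v (u, 0))" for v
  proof -
    have 1: "((\<lambda>p. dd v (p, ctr)) has_derivative (\<lambda>u. hess v (u, 0))) (at ctr)"
      by (rule has_derivative_compose[of "\<lambda>q. (q, ctr)", OF _ dd_has_derivative]) (auto intro!: derivative_eq_intros)
    have "(left_invariant_field N (U, \<phi>) v has_derivative (\<lambda>u. hess v (u, 0))) (at ctr)"
      by (rule has_derivative_transform_within_open[OF 1 chartD(2)[OF chart] ctr_in]) (simp add: field)
    then show ?thesis by (simp add: frechet_derivative_at[symmetric])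
  qed
  then show ?thesis by (simp add: lie_bracket_def ctr_def[symmetric])
qed

lemma norm_divideR_le: "0 < c \<Longrightarrow> norm (x /\<^sub>R c) \<le> e \<longleftrightarrow> norm (x::'e) \<le> e * c"
  by (simp add: divide_inverse[symmetric] pos_divide_le_eq mult.commute[of "inverse c"])

text \<open>Products with the identity carry no error, so the quadratic term is the mixed second
  derivative. It is found by the mean value inequality along \<tau> -> (s u, \<tau> w) on [0, s],
  where \<open>dd w\<close> is controlled through its differentiability at the identity.\<close>

lemma second_order_expansion:
  "((\<lambda>s. (mm (s *\<^sub>R u) (s *\<^sub>R w) - s *\<^sub>R u - s *\<^sub>R w) /\<^sub>R s\<^sup>2) \<longlongrightarrow> hess w (u, 0)) (at_right 0)"
proof (rule tendstoI)
  fix \<epsilon> :: real assume "0 < \<epsilon>"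
  define c where "c = norm u + norm w + 1"
  have c: "0 < c" by (simp add: c_def add_nonneg_pos)
  define e where "e = \<epsilon> / (2 * c)"
  have e: "0 < e" using \<open>0 < \<epsilon>\<close> c by (simp add: e_def)
  from has_derivative_at_alt[THEN iffD1, OF dd_has_derivative[of w]] e obtain d where d: "0 < d"
    "\<And>y. norm (y - (ctr, ctr)) < d \<Longrightarrow> norm (dd w y - dd w (ctr, ctr) - hess w (y - (ctr, ctr))) \<le> e * norm (y - (ctr, ctr))"
    by blast
  obtain d2 where d2: "0 < d2" "ball (ctr, ctr) d2 \<subseteq> MM" using MM(1,3) open_contains_ball by blast
  interpret h: bounded_linear "hess w" using dd_has_derivative by (rule has_derivative_bounded_linear)
  have main: "dist ((mm (s *\<^sub>R u) (s *\<^sub>R w) - s *\<^sub>R u - s *\<^sub>R w) /\<^sub>R s\<^sup>2) (hess w (u, 0)) < \<epsilon>"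
    if s: "0 < s" "s < min d d2 / c" for s
  proof -
    have pt: "norm ((ctr + s *\<^sub>R u, ctr + \<tau> *\<^sub>R w) - (ctr, ctr)) \<le> s * c" if "\<tau> \<in> {0..s}" for \<tau>
    proof -
      have "norm (s *\<^sub>R u, \<tau> *\<^sub>R w) \<le> norm (s *\<^sub>R u) + norm (\<tau> *\<^sub>R w)"
        unfolding norm_Pair by (rule sqrt_sum_squares_le_sum) auto
      also have "\<dots> \<le> s * norm u + s * norm w" using that s by (auto intro!: add_mono mult_right_mono)
      also have "\<dots> \<le> s * c" using s by (simp add: c_def algebra_simps)
      finally show ?thesis by simp
    qed
    have sc: "s * c < d" "s * c < d2" using s c by (auto simp: field_simps)
    have in_MM: "(ctr + s *\<^sub>R u, ctr + \<tau> *\<^sub>R w) \<in> MM" if "\<tau> \<in> {0..s}" for \<tau>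
      using pt[OF that] sc d2(2) by (auto simp: subset_iff dist_norm norm_minus_commute)
    have su: "ctr + s *\<^sub>R u \<in> \<phi> ` U" using in_MM[of 0] s by (auto simp: MM_def mult_dom_def)
    \<comment> \<open>The expected increment is subtracted, so that the derivative of
      \<open>g\<close> is the first order remainder of \<open>dd w\<close> at the identity, of norm
      at most \<open>e * (s * c)\<close>.\<close>
    define g where "g = (\<lambda>\<tau>. mu (ctr + s *\<^sub>R u, ctr + \<tau> *\<^sub>R w) - \<tau> *\<^sub>R (w + s *\<^sub>R hess w (u, 0)))"
    define g' where "g' = (\<lambda>\<tau>. dd w (ctr + s *\<^sub>R u, ctr + \<tau> *\<^sub>R w) - (w + s *\<^sub>R hess w (u, 0)))"
    have der: "(g has_derivative (\<lambda>h. h *\<^sub>R g' \<tau>)) (at \<tau> within {0..s})" if \<tau>: "\<tau> \<in> {0..s}" for \<tau>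
    proof -
      have "((\<lambda>\<tau>. mu (ctr + s *\<^sub>R u, ctr + \<tau> *\<^sub>R w)) has_derivative
          (\<lambda>h. frechet_derivative mu (at (ctr + s *\<^sub>R u, ctr + \<tau> *\<^sub>R w)) (0, h *\<^sub>R w))) (at \<tau> within {0..s})"
        by (rule has_derivative_compose[of "\<lambda>\<tau>. ctr + \<tau> *\<^sub>R w", OF _ mu_derivative_snd[OF in_MM[OF \<tau>]]])
          (auto intro!: derivative_eq_intros)
      moreover have "frechet_derivative mu (at (ctr + s *\<^sub>R u, ctr + \<tau> *\<^sub>R w)) (0, h *\<^sub>R w) = h *\<^sub>R dd w (ctr + s *\<^sub>R u, ctr + \<tau> *\<^sub>R w)" for h
        unfolding dd_def
        using linear_scale[OF has_derivative_linear[OF mu_has_derivative[OF in_MM[OF \<tau>]]], of h "(0, w)"] by simp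
      ultimately have "((\<lambda>\<tau>. mu (ctr + s *\<^sub>R u, ctr + \<tau> *\<^sub>R w)) has_derivative
          (\<lambda>h. h *\<^sub>R dd w (ctr + s *\<^sub>R u, ctr + \<tau> *\<^sub>R w))) (at \<tau> within {0..s})" by simp
      then show ?thesis unfolding g_def g'_def
        by (auto intro!: derivative_eq_intros simp: scaleR_diff_right)
    qed
    have on: "onorm (\<lambda>h. h *\<^sub>R g' \<tau>) \<le> e * (s * c)" if \<tau>: "\<tau> \<in> {0..s}" for \<tau>
    proof (rule onorm_bound)
      show "0 \<le> e * (s * c)" using e s c by simp
      fix h :: real
      have "hess w ((ctr + s *\<^sub>R u, ctr + \<tau> *\<^sub>R w) - (ctr, ctr)) = hess w (s *\<^sub>R (u, 0) + (0, \<tau> *\<^sub>R w))" by simp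
      also have "\<dots> = s *\<^sub>R hess w (u, 0)" by (simp only: h.add h.scaleR hess_snd) simp
      finally have hess_eq: "hess w ((ctr + s *\<^sub>R u, ctr + \<tau> *\<^sub>R w) - (ctr, ctr)) = s *\<^sub>R hess w (u, 0)" .
      have "dd w (ctr, ctr) = w" by (simp add: dd_def mu_derivative_ctr)
      then have "norm (g' \<tau>) \<le> e * norm ((ctr + s *\<^sub>R u, ctr + \<tau> *\<^sub>R w) - (ctr, ctr))"
        using d(2)[of "(ctr + s *\<^sub>R u, ctr + \<tau> *\<^sub>R w)"] pt[OF \<tau>] sc
        unfolding hess_eq by (simp add: g'_def algebra_simps)
      also have "\<dots> \<le> e * (s * c)" using pt[OF \<tau>] e by (intro mult_left_mono) auto
      finally show "norm (h *\<^sub>R g' \<tau>) \<le> e * (s * c) * norm h"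
        by (simp add: mult.commute mult_left_mono)
    qed
    have "norm (g s - g 0) \<le> e * (s * c) * norm (s - 0)"
      by (rule differentiable_bound[OF _ der on]) (use s in auto)
    moreover have "g s - g 0 = mm (s *\<^sub>R u) (s *\<^sub>R w) - s *\<^sub>R u - s *\<^sub>R w - s\<^sup>2 *\<^sub>R hess w (u, 0)"
      using MM(6)[OF su] by (simp add: g_def mm_mu scaleR_add_right power2_eq_square)
    ultimately have "norm (mm (s *\<^sub>R u) (s *\<^sub>R w) - s *\<^sub>R u - s *\<^sub>R w - s\<^sup>2 *\<^sub>R hess w (u, 0)) \<le> (\<epsilon> / 2) * s\<^sup>2"
      using s c by (simp add: e_def power2_eq_square field_simps)
    then have "norm ((mm (s *\<^sub>R u) (s *\<^sub>R w) - s *\<^sub>R u - s *\<^sub>R w - s\<^sup>2 *\<^sub>R hess w (u, 0)) /\<^sub>R s\<^sup>2) \<le> \<epsilon> / 2"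
      using s by (subst norm_divideR_le) simp_all
    moreover have "(mm (s *\<^sub>R u) (s *\<^sub>R w) - s *\<^sub>R u - s *\<^sub>R w - s\<^sup>2 *\<^sub>R hess w (u, 0)) /\<^sub>R s\<^sup>2
      = (mm (s *\<^sub>R u) (s *\<^sub>R w) - s *\<^sub>R u - s *\<^sub>R w) /\<^sub>R s\<^sup>2 - hess w (u, 0)"
      using s by (simp add: scaleR_diff_right)
    ultimately show ?thesis using \<open>0 < \<epsilon>\<close> by (simp add: dist_norm)
  qed
  have "0 < min d d2 / c" using d d2 c by simp
  then show "\<forall>\<^sub>F s in at_right 0. dist ((mm (s *\<^sub>R u) (s *\<^sub>R w) - s *\<^sub>R u - s *\<^sub>R w) /\<^sub>R s\<^sup>2) (hess w (u, 0)) < \<epsilon>"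
    using main unfolding eventually_at_right_field by blast
qed

text \<open>Invariance of domain makes a neighbourhood of 0 part of the image of \<open>xp\<close>;
  \<open>lg\<close> is the logarithm read in the chart.\<close>

lemma xp_local_inverse:
  obtains \<delta> lg where "0 < \<delta>" "\<And>y. norm y < \<delta> \<Longrightarrow> norm (lg y) < r2 \<and> xp (lg y) = y"
proof -
  have "open (xp ` ball 0 r2)"
  proof (rule invariance_of_domain)
    show "continuous_on (ball 0 r2) xp" by (rule continuous_on_subset[OF continuous_xp]) auto
    show "inj_on xp (ball 0 r2)"
    proof (rule inj_onI)
      fix x y assume "x \<in> ball 0 r2" "y \<in> ball 0 r2" "xp x = xp y"
      then show "x = y" using xp_lip(2)[of x y] by auto
    qed
  qed simp
  moreover have "0 \<in> xp ` ball 0 r2" by (rule image_eqI[of _ _ 0]) (use r2 in auto)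
  ultimately obtain \<delta> where \<delta>: "0 < \<delta>" "ball 0 \<delta> \<subseteq> xp ` ball 0 r2" using open_contains_ball by blast
  show ?thesis
  proof (rule that[OF \<delta>(1), of "inv_into (ball 0 r2) xp"])
    fix y :: 'e assume "norm y < \<delta>"
    then have y: "y \<in> xp ` ball 0 r2" using \<delta>(2) by auto
    show "norm (inv_into (ball 0 r2) xp y) < r2 \<and> xp (inv_into (ball 0 r2) xp y) = y"
      using inv_into_into[OF y] f_inv_into_f[OF y] by simp
  qed
qed

lemma xp_second_order: "norm v \<le> r2 \<Longrightarrow> norm (xp v - v) \<le> 4 * snd rK * (norm v)\<^sup>2"
  using xp_est[of v "norm v" 0] by (simp add: power2_eq_square)

text \<open>Expand both sides of x y = y x [x, y] to second order, for x and y with coordinates s u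
  and s w. The commutator is the exponential of the bracket of the logarithms, hence s^2
  \<open>br u w\<close> + o(s^2). The quadratic terms of x y and y x differ by the antisymmetrised
  mixed derivative, which is the chart bracket by \<open>lie_bracket_hess\<close>.\<close>

lemma lie_bracket_br: "lie_bracket N (U, \<phi>) u w = br u w"
proof -
  let ?F = "at_right (0::real)"
  obtain \<delta> lg where lg: "0 < \<delta>" "\<And>y. norm y < \<delta> \<Longrightarrow> norm (lg y) < r2 \<and> xp (lg y) = y"
    using xp_local_inverse by metis
  have K: "0 < snd rK" by (rule K_pos)
  have pos: "\<forall>\<^sub>F s in ?F. 0 < s" by (rule eventually_at_right_less)
  have s0: "((\<lambda>s. s) \<longlongrightarrow> 0) ?F" by (rule tendsto_ident_at)
  have sv: "((\<lambda>s. s *\<^sub>R v) \<longlongrightarrow> 0) ?F" for v :: 'e by (rule tendsto_eq_intros s0 refl)+ simp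
  have ev: "\<forall>\<^sub>F s in ?F. norm (f s) < e" if "(f \<longlongrightarrow> 0) ?F" "0 < e" for f :: "real \<Rightarrow> 'e" and e
    using tendstoD[OF that] by simp
  have lg_lim: "((\<lambda>s. lg (s *\<^sub>R v) /\<^sub>R s) \<longlongrightarrow> v) ?F" for v
  proof (rule LIM_zero_cancel, rule Lim_null_comparison)
    show "((\<lambda>s. 16 * snd rK * (norm v)\<^sup>2 * s) \<longlongrightarrow> 0) ?F" by (rule tendsto_eq_intros s0 refl)+ simp
    show "\<forall>\<^sub>F s in ?F. norm (lg (s *\<^sub>R v) /\<^sub>R s - v) \<le> 16 * snd rK * (norm v)\<^sup>2 * s"
      using pos ev[OF sv lg(1), of v]
    proof eventually_elim
      case (elim s)
      let ?l = "lg (s *\<^sub>R v)"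
      have l: "norm ?l \<le> r2" "xp ?l = s *\<^sub>R v" using lg(2)[OF elim(2)] by auto
      have "norm ?l \<le> 2 * (s * norm v)" using xp_lip(2)[of ?l 0] l elim r2 by simp
      then have "(norm ?l)\<^sup>2 \<le> (2 * (s * norm v))\<^sup>2" by (intro power_mono) auto
      then have "norm (xp ?l - ?l) \<le> 4 * snd rK * (2 * (s * norm v))\<^sup>2"
        using xp_second_order[OF l(1)] K by (meson mult_left_mono order_trans mult_nonneg_nonneg zero_le_numeral less_imp_le)
      then have "norm (?l - s *\<^sub>R v) \<le> 16 * snd rK * (norm v)\<^sup>2 * s * s"
        unfolding l(2) by (simp add: norm_minus_commute power_mult_distrib power2_eq_square mult_ac)
      moreover have "?l /\<^sub>R s - v = (?l - s *\<^sub>R v) /\<^sub>R s" using elim by (simp add: scaleR_diff_right)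
      ultimately show ?case using elim by (simp only: norm_divideR_le)
    qed
  qed
  define \<beta> where "\<beta> = (\<lambda>s. br (lg (s *\<^sub>R u)) (lg (s *\<^sub>R w)))"
  have \<beta>2: "((\<lambda>s. \<beta> s /\<^sub>R s\<^sup>2) \<longlongrightarrow> br u w) ?F"
  proof -
    have "((\<lambda>s. br (lg (s *\<^sub>R u) /\<^sub>R s) (lg (s *\<^sub>R w) /\<^sub>R s)) \<longlongrightarrow> br u w) ?F"
      by (intro b.tendsto lg_lim)
    then show ?thesis by (simp add: \<beta>_def b.scaleR_left b.scaleR_right power2_eq_square)
  qed
  have \<beta>0: "(\<beta> \<longlongrightarrow> 0) ?F"
  proof -
    have "((\<lambda>s. s\<^sup>2 *\<^sub>R (\<beta> s /\<^sub>R s\<^sup>2)) \<longlongrightarrow> 0) ?F"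
      by (rule tendsto_eq_intros s0 \<beta>2 refl)+ simp
    then show ?thesis by (rule Lim_transform_eventually) (use pos in eventually_elim, simp)
  qed
  define c where "c = (\<lambda>s. xp (\<beta> s))"
  have c2: "((\<lambda>s. c s /\<^sub>R s\<^sup>2) \<longlongrightarrow> br u w) ?F"
  proof -
    have "((\<lambda>s. (c s - \<beta> s) /\<^sub>R s\<^sup>2) \<longlongrightarrow> 0) ?F"
    proof (rule Lim_null_comparison)
      show "((\<lambda>s. 4 * snd rK * norm (\<beta> s) * norm (\<beta> s /\<^sub>R s\<^sup>2)) \<longlongrightarrow> 0) ?F"
        by (rule tendsto_eq_intros \<beta>0 \<beta>2 refl)+ simp
      show "\<forall>\<^sub>F s in ?F. norm ((c s - \<beta> s) /\<^sub>R s\<^sup>2) \<le> 4 * snd rK * norm (\<beta> s) * norm (\<beta> s /\<^sub>R s\<^sup>2)"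
        using ev[OF \<beta>0 r2(1)]
      proof eventually_elim
        case (elim s)
        have "norm (c s - \<beta> s) \<le> 4 * snd rK * (norm (\<beta> s))\<^sup>2"
          unfolding c_def using elim by (intro xp_second_order) simp
        then have "\<bar>inverse (s\<^sup>2)\<bar> * norm (c s - \<beta> s) \<le> \<bar>inverse (s\<^sup>2)\<bar> * (4 * snd rK * (norm (\<beta> s))\<^sup>2)"
          by (intro mult_left_mono) auto
        then show ?case unfolding norm_scaleR by (simp only: power2_eq_square mult_ac)
      qed
    qed
    from tendsto_add[OF this \<beta>2] show ?thesis by (simp add: scaleR_diff_right)
  qed
  have c0: "(c \<longlongrightarrow> 0) ?F"
  proof -
    have "((\<lambda>s. s\<^sup>2 *\<^sub>R (c s /\<^sub>R s\<^sup>2)) \<longlongrightarrow> 0) ?F"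
      by (rule tendsto_eq_intros s0 c2 refl)+ simp
    then show ?thesis by (rule Lim_transform_eventually) (use pos in eventually_elim, simp)
  qed
  define q where "q = (\<lambda>s. mm (s *\<^sub>R w) (s *\<^sub>R u))"
  have q0: "(q \<longlongrightarrow> 0) ?F"
  proof -
    have "((\<lambda>s. s\<^sup>2 *\<^sub>R ((q s - s *\<^sub>R w - s *\<^sub>R u) /\<^sub>R s\<^sup>2) + s *\<^sub>R w + s *\<^sub>R u) \<longlongrightarrow> 0) ?F"
      unfolding q_def by (rule tendsto_eq_intros s0 second_order_expansion refl)+ simp
    then show ?thesis by (rule Lim_transform_eventually) (use pos in eventually_elim, simp)
  qed
  \<comment> \<open>Since \<open>mm (q s) 0\<close> is \<open>q s\<close> and the remainder of the
    multiplication has a Lipschitz constant tending to 0, multiplying by \<open>c s\<close>, which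
    is O(s^2), amounts to adding it up to o(s^2).\<close>
  have diff: "((\<lambda>s. (mm (q s) (c s) - q s - c s) /\<^sub>R s\<^sup>2) \<longlongrightarrow> 0) ?F"
  proof (rule Lim_null_comparison)
    show "((\<lambda>s. snd rK * (norm (q s) + norm (c s)) * norm (c s /\<^sub>R s\<^sup>2)) \<longlongrightarrow> 0) ?F"
      by (rule tendsto_eq_intros q0 c0 c2 refl)+ simp
    show "\<forall>\<^sub>F s in ?F. norm ((mm (q s) (c s) - q s - c s) /\<^sub>R s\<^sup>2) \<le> snd rK * (norm (q s) + norm (c s)) * norm (c s /\<^sub>R s\<^sup>2)"
      using ev[OF q0 half_gt_zero[OF r_pos]] ev[OF c0 half_gt_zero[OF r_pos]]
    proof eventually_elim
      case (elim s)
      have "norm (mm (q s) (c s) - mm (q s) 0 - (q s - q s) - (c s - 0)) \<le>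
        snd rK * (norm (q s) + norm (c s)) * (norm (q s - q s) + norm (c s - 0))"
        by (rule m_est) (use elim in auto)
      then have "norm (mm (q s) (c s) - q s - c s) \<le> snd rK * (norm (q s) + norm (c s)) * norm (c s)"
        using elim m_0(1)[of "q s"] r_pos by simp
      then have "norm (mm (q s) (c s) - q s - c s) * inverse (s\<^sup>2) \<le> snd rK * (norm (q s) + norm (c s)) * norm (c s) * inverse (s\<^sup>2)"
        by (intro mult_right_mono) auto
      then show ?case by (simp add: mult_ac)
    qed
  qed
  have "\<forall>\<^sub>F s in ?F. mm (s *\<^sub>R u) (s *\<^sub>R w) = mm (q s) (c s)"
    using ev[OF sv lg(1), of u] ev[OF sv lg(1), of w] ev[OF sv r_pos, of u] ev[OF sv r_pos, of w]
      ev[OF \<beta>0 r2(1)] ev[OF q0 r_pos] ev[OF c0 r_pos]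
  proof eventually_elim
    case (elim s)
    have g: "kk (s *\<^sub>R u) = gexp (lg (s *\<^sub>R u))" "kk (s *\<^sub>R w) = gexp (lg (s *\<^sub>R w))"
      using lg(2)[of "s *\<^sub>R u"] lg(2)[of "s *\<^sub>R w"] elim by (simp_all add: gexp_small)
    have "kk (mm (s *\<^sub>R u) (s *\<^sub>R w)) = kk (s *\<^sub>R u) \<otimes> kk (s *\<^sub>R w)"
      using elim by (simp add: k_m)
    also have "\<dots> = kk (s *\<^sub>R w) \<otimes> kk (s *\<^sub>R u) \<otimes> cm (kk (s *\<^sub>R u)) (kk (s *\<^sub>R w))"
      by (rule swap)
    also have "cm (kk (s *\<^sub>R u)) (kk (s *\<^sub>R w)) = gexp (\<beta> s)"
      unfolding g C_def[symmetric] \<beta>_def by (rule C_eq_br)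
    also have "\<dots> = kk (c s)" using elim by (simp add: gexp_small c_def)
    also have "kk (s *\<^sub>R w) \<otimes> kk (s *\<^sub>R u) = kk (q s)" unfolding q_def using elim by (simp add: k_m)
    also have "kk (q s) \<otimes> kk (c s) = kk (mm (q s) (c s))" using elim by (simp add: k_m)
    finally show ?case
      by (rule inj_onD[OF inj_k]) (use elim in \<open>auto intro: m_D\<close>)
  qed
  then have eq: "\<forall>\<^sub>F s in ?F. (mm (q s) (c s) - q s - c s) /\<^sub>R s\<^sup>2 + c s /\<^sub>R s\<^sup>2 =
      (mm (s *\<^sub>R u) (s *\<^sub>R w) - s *\<^sub>R u - s *\<^sub>R w) /\<^sub>R s\<^sup>2 - (mm (s *\<^sub>R w) (s *\<^sub>R u) - s *\<^sub>R w - s *\<^sub>R u) /\<^sub>R s\<^sup>2"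
    by eventually_elim (simp add: q_def flip: scaleR_diff_right scaleR_add_right)
  have "((\<lambda>s. (mm (s *\<^sub>R u) (s *\<^sub>R w) - s *\<^sub>R u - s *\<^sub>R w) /\<^sub>R s\<^sup>2 - (mm (s *\<^sub>R w) (s *\<^sub>R u) - s *\<^sub>R w - s *\<^sub>R u) /\<^sub>R s\<^sup>2)
      \<longlongrightarrow> 0 + br u w) ?F"
    by (rule Lim_transform_eventually[OF tendsto_add[OF diff c2] eq])
  moreover have "((\<lambda>s. (mm (s *\<^sub>R u) (s *\<^sub>R w) - s *\<^sub>R u - s *\<^sub>R w) /\<^sub>R s\<^sup>2 - (mm (s *\<^sub>R w) (s *\<^sub>R u) - s *\<^sub>R w - s *\<^sub>R u) /\<^sub>R s\<^sup>2)
      \<longlongrightarrow> hess w (u, 0) - hess u (w, 0)) ?F"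
    by (intro tendsto_diff second_order_expansion)
  ultimately show ?thesis
    using tendsto_unique[OF trivial_limit_at_right_real] by (fastforce simp: lie_bracket_hess)
qed

section \<open>Lipschitz comparison of charts with the logarithm\<close>

definition Log :: "'g \<Rightarrow> 'e" where "Log = inv_into UNIV gexp"

lemma Log_gexp [simp]: "Log (gexp v) = v"
  unfolding Log_def using inj_gexp by simp

lemma gexp_Log [simp]: "gexp (Log g) = g"
  unfolding Log_def using surj_gexp by (simp add: f_inv_into_f)

lemma Log_mult: "Log (g \<otimes> h) = mul (Log g) (Log h)"
  by (metis Log_gexp gexp_Log gexp_mul)

lemma Log_inv: "Log (inv g) = - Log g"
  by (metis Log_gexp gexp_Log gexp_minus)

lemma mul_lipschitz: obtains L where "0 < L" "\<And>y z. norm (mul x y - mul x z) \<le> L * norm (y - z)"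
proof -
  obtain B where B: "0 < B" "\<And>u w. norm (br u w) \<le> B * norm u * norm w" using mul_bound by metis
  show ?thesis
  proof (rule that[of "1 + B * norm x"])
    show "0 < 1 + B * norm x" using B by (simp add: add_pos_nonneg)
    fix y z
    have "mul x y - mul x z = (y - z) + (1/2) *\<^sub>R br x (y - z)"
      by (simp add: mul_def b.diff_right scaleR_diff_right)
    also have "norm \<dots> \<le> norm (y - z) + (1/2) * norm (br x (y - z))"
      using norm_triangle_ineq[of "y - z" "(1/2) *\<^sub>R br x (y - z)"] by simp
    also have "\<dots> \<le> (1 + B * norm x) * norm (y - z)"
    proof -
      have "(1/2) * norm (br x (y - z)) \<le> B * norm x * norm (y - z)"
        using B(2)[of x "y - z"] norm_ge_zero[of "br x (y - z)"] by linarith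
      then show ?thesis by (simp add: distrib_right)
    qed
    finally show "norm (mul x y - mul x z) \<le> (1 + B * norm x) * norm (y - z)" .
  qed
qed

lemma continuous_mul: "continuous_on UNIV (mul x)"
  unfolding mul_def[abs_def] by (intro continuous_intros b.continuous_on)

text \<open>Write exp y as exp x times the exponential of \<open>mul (- x) y\<close>. The second
  factor is near the identity, where the chart reads \<open>ctr + xp\<close>; the translation by exp
  x into the chart W is Lipschitz by \<open>mult_lipschitz\<close>.\<close>

lemma chart_gexp_lipschitz:
  assumes W: "(W, \<psi>) \<in> A" "gexp x \<in> W"
  obtains T L where "open T" "x \<in> T" "0 < L" "\<And>y. y \<in> T \<Longrightarrow> gexp y \<in> W"
    "\<And>y z. y \<in> T \<Longrightarrow> z \<in> T \<Longrightarrow> norm (\<psi> (gexp y) - \<psi> (gexp z)) \<le> L * norm (y - z)"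
proof -
  obtain T L where T: "open T" "\<one> \<in> T" "T \<subseteq> U" "0 < L"
    "\<And>g h. g \<in> T \<Longrightarrow> h \<in> T \<Longrightarrow> gexp x \<otimes> g \<in> W \<and> norm (\<psi> (gexp x \<otimes> g) - \<psi> (gexp x \<otimes> h)) \<le> L * norm (\<phi> g - \<phi> h)"
    by (rule mult_lipschitz[OF W(1) chart W(1) W(2) one_U]) (use W in auto)
  obtain L2 where L2: "0 < L2" "\<And>y z. norm (mul (- x) y - mul (- x) z) \<le> L2 * norm (y - z)"
    using mul_lipschitz by blast
  define S where "S = mul (- x) -` (ball 0 r2 \<inter> gexp -` T)"
  have cg: "continuous_on UNIV gexp" by (simp add: continuous_on_eq_continuous_at isCont_gexp)
  have eq: "gexp y = gexp x \<otimes> gexp (mul (- x) y)" for y by (simp flip: gexp_mul)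
  show ?thesis
  proof (rule that)
    show "open S" unfolding S_def
      by (intro continuous_open_vimage continuous_open_preimage open_Int open_ball)
        (use T(1) cg continuous_mul in \<open>auto simp: continuous_on_eq_continuous_at intro: continuous_open_vimage\<close>)
    show "x \<in> S" using T(2) r2 by (simp add: S_def)
    show "0 < L * (2 * L2)" using T L2 by simp
    show "gexp y \<in> W" if "y \<in> S" for y using T(5)[of "gexp (mul (- x) y)" \<one>] T(2) that eq[of y] by (simp add: S_def)
    fix y z assume yz: "y \<in> S" "z \<in> S"
    have "norm (\<psi> (gexp y) - \<psi> (gexp z)) \<le> L * norm (\<phi> (gexp (mul (- x) y)) - \<phi> (gexp (mul (- x) z)))"
      using T(5) yz eq[of y] eq[of z] by (simp add: S_def)
    also have "\<phi> (gexp (mul (- x) y)) - \<phi> (gexp (mul (- x) z)) = xp (mul (- x) y) - xp (mul (- x) z)"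
      using yz by (simp add: S_def phi_gexp)
    also have "L * norm (xp (mul (- x) y) - xp (mul (- x) z)) \<le> L * (2 * norm (mul (- x) y - mul (- x) z))"
      using yz T(4) by (intro mult_left_mono xp_lip) (auto simp: S_def)
    also have "\<dots> \<le> L * (2 * (L2 * norm (y - z)))" using L2(2)[of y z] T(4) by simp
    finally show "norm (\<psi> (gexp y) - \<psi> (gexp z)) \<le> L * (2 * L2) * norm (y - z)" by (simp add: mult_ac)
  qed
qed

text \<open>Translate by the inverse of g to the identity, where the lower bound in
  \<open>xp_lip\<close> controls logarithms by chart distances. Translating back acts on logarithms
  by \<open>mul (Log g)\<close>, which is Lipschitz.\<close>

lemma Log_chart_lipschitz:
  assumes W: "(W, \<psi>) \<in> A" "g \<in> W"
  obtains T L where "open T" "g \<in> T" "T \<subseteq> W" "0 < L"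
    "\<And>h h'. h \<in> T \<Longrightarrow> h' \<in> T \<Longrightarrow> norm (Log h - Log h') \<le> L * norm (\<psi> h - \<psi> h')"
proof -
  obtain W1 \<psi>1 where W1: "(W1, \<psi>1) \<in> A" "inv g \<in> W1" using chart_ex by blast
  obtain T L where T: "open T" "g \<in> T" "T \<subseteq> W" "0 < L"
    "\<And>h h'. h \<in> T \<Longrightarrow> h' \<in> T \<Longrightarrow> inv g \<otimes> h \<in> U \<and> norm (\<phi> (inv g \<otimes> h) - \<phi> (inv g \<otimes> h')) \<le> L * norm (\<psi> h - \<psi> h')"
    by (rule mult_lipschitz[OF W1(1) W(1) chart W1(2) W(2)]) (use one_U in auto)
  obtain L2 where L2: "0 < L2" "\<And>y z. norm (mul (Log g) y - mul (Log g) z) \<le> L2 * norm (y - z)"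
    using mul_lipschitz by blast
  have G: "open (gexp ` ball 0 r2)" by (rule gexp_open_small) auto
  define S where "S = T \<inter> (\<lambda>y. g \<otimes> y) ` (gexp ` ball 0 r2)"
  have S: "h \<in> T" "\<exists>v. norm v < r2 \<and> inv g \<otimes> h = gexp v" if "h \<in> S" for h
    using that unfolding S_def by auto
  show ?thesis
  proof (rule that)
    show "open S" unfolding S_def by (intro open_Int T open_translate G)
    have "g \<otimes> gexp 0 \<in> (\<lambda>y. g \<otimes> y) ` (gexp ` ball 0 r2)" using r2 by (intro imageI) simp
    then show "g \<in> S" using T by (simp add: S_def)
    show "S \<subseteq> W" using T by (auto simp: S_def)
    show "0 < L2 * (2 * L)" using T L2 by simp
    fix h h' assume hh: "h \<in> S" "h' \<in> S"
    obtain v v' where v: "norm v < r2" "inv g \<otimes> h = gexp v" "norm v' < r2" "inv g \<otimes> h' = gexp v'"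
      using S(2)[OF hh(1)] S(2)[OF hh(2)] by blast
    have "h = g \<otimes> gexp v" "h' = g \<otimes> gexp v'" by (simp_all flip: v(2,4))
    then have "norm (Log h - Log h') \<le> L2 * norm (v - v')" using L2(2)[of v v'] by (simp add: Log_mult)
    also have "\<dots> \<le> L2 * (2 * norm (xp v - xp v'))" using xp_lip(2)[of v v'] v L2 by simp
    also have "xp v - xp v' = \<phi> (inv g \<otimes> h) - \<phi> (inv g \<otimes> h')" unfolding v(2,4) using v by (simp add: phi_gexp)
    also have "L2 * (2 * norm (\<phi> (inv g \<otimes> h) - \<phi> (inv g \<otimes> h'))) \<le> L2 * (2 * (L * norm (\<psi> h - \<psi> h')))"
      using T(5)[OF S(1)[OF hh(1)] S(1)[OF hh(2)]] L2(1) by simp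
    finally show "norm (Log h - Log h') \<le> L2 * (2 * L) * norm (\<psi> h - \<psi> h')" by (simp add: mult_ac)
  qed
qed

end

section \<open>Word metrics on the Lie algebra\<close>

text \<open>The data that remain in exponential coordinates. \<open>gen\<close> says that V meets
  every coset of the derived algebra, and \<open>nonsing\<close> that bracketing with any x outside
  the derived algebra maps onto it.\<close>

locale subfinsler_nil2 = nil2 b for b :: "'e::euclidean_space \<Rightarrow> 'e \<Rightarrow> 'e" +
  fixes V :: "'e set" and \<nu> :: "'e \<Rightarrow> real"
  assumes subV: "subspace V" and normV: "norm_on V \<nu>"
    and gen: "\<exists>v\<in>V. \<exists>w\<in>span {b u v |u v. True}. x = v + w"
    and nonsing: "z \<in> span {b u v |u v. True} \<Longrightarrow> x \<notin> span {b u v |u v. True} \<Longrightarrow> \<exists>y. b x y = z"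
begin

definition Z :: "'e set" where "Z = span {b u v |u v. True}"

lemma subZ: "subspace Z" by (simp add: Z_def)

lemma b_in_Z [simp]: "b u v \<in> Z" unfolding Z_def by (rule span_base) blast

lemma b_Z [simp]: "z \<in> Z \<Longrightarrow> b z u = 0"
proof -
  assume "z \<in> Z"
  then show "b z u = 0" unfolding Z_def
    by (induction rule: span_induct_alt) (auto simp: b.add_left b.scaleR_left b.zero_left)
qed

lemma b_Z' [simp]: "z \<in> Z \<Longrightarrow> b u z = 0"
  using b_skew[of z u] by simp

lemma mul_Z: "z \<in> Z \<Longrightarrow> mul x z = x + z" "z \<in> Z \<Longrightarrow> mul z x = x + z"
  by (simp_all add: mul_def)

text \<open>If the derived algebra were everything, its centrality would make the bracket vanish and
  the derived algebra trivial, while a Euclidean space type contains a nonzero vector.\<close>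

lemma Z_not_UNIV: "Z \<noteq> UNIV"
proof
  assume "Z = UNIV"
  then have "b u v = 0" for u v by simp
  then have "Z = {0}" unfolding Z_def by (auto simp: span_empty intro: span_zero dest: subsetD[OF span_mono[of _ "{0}"]])
  moreover obtain i :: 'e where "i \<in> Basis" using nonempty_Basis by blast
  ultimately show False using \<open>Z = UNIV\<close> nonzero_Basis by (metis UNIV_I singletonD)
qed

text \<open>Some linear projection onto \<open>Z\<close>. Its kernel is an arbitrary complement of
  the derived algebra and serves as the layer of degree one for the dilations.\<close>

definition \<zeta> :: "'e \<Rightarrow> 'e" where "\<zeta> = (SOME g. range g \<subseteq> Z \<and> linear g \<and> (\<forall>z\<in>Z. g z = z))"

lemma zeta: "\<zeta> x \<in> Z" "linear \<zeta>" "\<And>z. z \<in> Z \<Longrightarrow> \<zeta> z = z"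
proof -
  have "\<exists>g. range g \<subseteq> Z \<and> linear g \<and> (\<forall>z\<in>Z. g (id z) = z)"
    by (rule linear_exists_left_inverse_on) (auto simp: subZ inj_on_def id_def intro: linear_ident)
  then have "\<exists>g. range g \<subseteq> Z \<and> linear g \<and> (\<forall>z\<in>Z. g z = z)" by simp
  from someI_ex[OF this] show "\<zeta> x \<in> Z" "linear \<zeta>" "\<And>z. z \<in> Z \<Longrightarrow> \<zeta> z = z"
    unfolding \<zeta>_def by (simp_all add: image_subset_iff)
qed

definition pr :: "'e \<Rightarrow> 'e" where "pr x = x - \<zeta> x"

lemma linear_pr: "linear pr"
  unfolding pr_def[abs_def] using linear_compose_sub[OF linear_id zeta(2)] by (simp add: id_def)

sublocale zeta: bounded_linear \<zeta> using zeta(2) by (simp add: linear_conv_bounded_linear)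
sublocale pr: bounded_linear pr using linear_pr by (simp add: linear_conv_bounded_linear)

lemma pr_Z [simp]: "z \<in> Z \<Longrightarrow> pr z = 0" by (simp add: pr_def zeta)
lemma pr_zeta [simp]: "pr (\<zeta> x) = 0" by (simp add: zeta)
lemma zeta_zeta [simp]: "\<zeta> (\<zeta> x) = \<zeta> x" by (simp add: zeta)
lemma zeta_pr [simp]: "\<zeta> (pr x) = 0" by (simp add: pr_def zeta.diff)
lemma pr_pr [simp]: "pr (pr x) = pr x" by (simp add: pr_def zeta.diff)
lemma pr_plus_zeta: "pr x + \<zeta> x = x" by (simp add: pr_def)
lemma pr_0_iff: "pr x = 0 \<longleftrightarrow> x \<in> Z"
  by (metis add_0 pr_Z pr_plus_zeta zeta(1))
lemma zeta_b [simp]: "\<zeta> (b u v) = b u v" by (simp add: zeta)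
lemma pr_b [simp]: "pr (b u v) = 0" by simp
lemma b_pr: "b u v = b (pr u) (pr v)"
  by (simp add: pr_def b.diff_left b.diff_right zeta)
lemma b_pr_left: "b (pr u) v = b u v"
  by (simp add: pr_def b.diff_left zeta)
lemma pr_mul: "pr (mul x y) = pr x + pr y"
  by (simp add: mul_def pr.add pr.scaleR)

lemma gen_Z: "\<exists>v\<in>V. x - v \<in> Z"
  using gen[of x] unfolding Z_def by (metis add_diff_cancel_left')

text \<open>A linear choice, within V, of representatives modulo \<open>Z\<close>. It turns
  solutions of bracket equations into admissible letters, because the bracket depends only on
  classes modulo \<open>Z\<close>.\<close>

lemma V_section:
  obtains \<sigma> K where "linear \<sigma>" "0 < K" "\<And>x. \<sigma> x \<in> V" "\<And>x. x - \<sigma> x \<in> Z" "\<And>x. norm (\<sigma> x) \<le> K * norm x"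
proof -
  obtain f where f: "\<And>x. f x \<in> V" "\<And>x. x - f x \<in> Z" using gen_Z by metis
  define \<sigma> where "\<sigma> = (\<lambda>x. \<Sum>i\<in>Basis. (x \<bullet> i) *\<^sub>R f i)"
  have lin: "linear \<sigma>" unfolding \<sigma>_def
    by (rule linearI) (simp_all add: inner_add_left scaleR_add_left sum.distrib scaleR_sum_right)
  then obtain K where K: "0 < K" "\<And>x. norm (\<sigma> x) \<le> K * norm x" using linear_bounded_pos by blast
  have "x - \<sigma> x \<in> Z" for x
  proof -
    have "x - \<sigma> x = (\<Sum>i\<in>Basis. (x \<bullet> i) *\<^sub>R (i - f i))"
      by (simp add: \<sigma>_def scaleR_diff_right sum_subtractf euclidean_representation)
    also have "\<dots> \<in> Z" by (intro subspace_sum subZ subspace_scale f)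
    finally show ?thesis .
  qed
  moreover have "\<sigma> x \<in> V" for x unfolding \<sigma>_def by (intro subspace_sum subV subspace_scale f)
  ultimately show ?thesis using that lin K by blast
qed

lemma nu:
  "v \<in> V \<Longrightarrow> 0 \<le> \<nu> v" "v \<in> V \<Longrightarrow> \<nu> v = 0 \<longleftrightarrow> v = 0" "v \<in> V \<Longrightarrow> \<nu> (t *\<^sub>R v) = \<bar>t\<bar> * \<nu> v"
  "v \<in> V \<Longrightarrow> w \<in> V \<Longrightarrow> \<nu> (v + w) \<le> \<nu> v + \<nu> w" "\<nu> 0 = 0" "v \<in> V \<Longrightarrow> \<nu> (- v) = \<nu> v"
proof -
  show *: "v \<in> V \<Longrightarrow> 0 \<le> \<nu> v" "v \<in> V \<Longrightarrow> \<nu> v = 0 \<longleftrightarrow> v = 0" "v \<in> V \<Longrightarrow> \<nu> (t *\<^sub>R v) = \<bar>t\<bar> * \<nu> v"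
    "v \<in> V \<Longrightarrow> w \<in> V \<Longrightarrow> \<nu> (v + w) \<le> \<nu> v + \<nu> w" for t v w
    using normV unfolding norm_on_def by blast+
  show "\<nu> 0 = 0" using *(2)[OF subspace_0[OF subV]] by simp
  show "v \<in> V \<Longrightarrow> \<nu> (- v) = \<nu> v" using *(3)[of v "- 1"] by simp
qed

lemma nu_sum: "finite I \<Longrightarrow> (\<And>i. i \<in> I \<Longrightarrow> f i \<in> V) \<Longrightarrow> \<nu> (\<Sum>i\<in>I. f i) \<le> (\<Sum>i\<in>I. \<nu> (f i))"
proof (induction I rule: finite_induct)
  case (insert i I)
  have "\<nu> (f i + sum f I) \<le> \<nu> (f i) + \<nu> (sum f I)"
    using insert by (intro nu(4) subspace_sum subV) auto
  then show ?case using insert by fastforce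
qed (simp add: nu)

lemma nu_upper: obtains K where "0 < K" "\<And>v. v \<in> V \<Longrightarrow> \<nu> v \<le> K * norm v"
proof -
  obtain B where B: "B \<subseteq> V" "pairwise orthogonal B" "\<And>x. x \<in> B \<Longrightarrow> norm x = 1" "independent B" "span B = V"
    using orthonormal_basis_subspace[OF subV] by metis
  have fin: "finite B" using B(4) by (rule independent_imp_finite)
  define K where "K = 1 + (\<Sum>c\<in>B. \<nu> c)"
  have K: "0 < K" using B(1) nu(1) by (auto simp: K_def intro!: add_pos_nonneg sum_nonneg)
  show ?thesis
  proof (rule that[OF K])
    fix v assume v: "v \<in> V"
    have "v = (\<Sum>c\<in>B. (v \<bullet> c) *\<^sub>R c)"
      using orthonormal_basis_expand[OF B(2,3) _ fin, of v] v B(5) by simp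
    then have "\<nu> v \<le> (\<Sum>c\<in>B. \<nu> ((v \<bullet> c) *\<^sub>R c))"
      using nu_sum[OF fin, of "\<lambda>c. (v \<bullet> c) *\<^sub>R c"] B(1) subV by (auto simp: subspace_scale subset_iff)
    also have "\<dots> \<le> (\<Sum>c\<in>B. norm v * \<nu> c)"
    proof (rule sum_mono)
      fix c assume c: "c \<in> B"
      then have cV: "c \<in> V" using B(1) by blast
      have "\<bar>v \<bullet> c\<bar> \<le> norm v" using Cauchy_Schwarz_ineq2[of v c] B(3)[OF c] by simp
      then show "\<nu> ((v \<bullet> c) *\<^sub>R c) \<le> norm v * \<nu> c" using nu(1,3)[OF cV] by (simp add: mult_right_mono)
    qed
    also have "\<dots> \<le> K * norm v" by (simp add: K_def sum_distrib_left[symmetric] algebra_simps)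
    finally show "\<nu> v \<le> K * norm v" .
  qed
qed

lemma continuous_nu: "continuous_on V \<nu>"
proof -
  obtain K where K: "0 < K" "\<And>v. v \<in> V \<Longrightarrow> \<nu> v \<le> K * norm v" using nu_upper by blast
  have "\<bar>\<nu> v - \<nu> w\<bar> \<le> K * norm (v - w)" if "v \<in> V" "w \<in> V" for v w
  proof -
    have d: "v - w \<in> V" "w - v \<in> V" using that subV by (auto intro: subspace_diff)
    have "\<nu> v \<le> \<nu> w + \<nu> (v - w)" "\<nu> w \<le> \<nu> v + \<nu> (w - v)"
      using nu(4)[OF that(2) d(1)] nu(4)[OF that(1) d(2)] by simp_all
    then show ?thesis using K(2)[OF d(1)] K(2)[OF d(2)] by (simp add: norm_minus_commute abs_le_iff)
  qed
  then have "K-lipschitz_on V \<nu>"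
    using K(1) by (intro lipschitz_onI) (auto simp: dist_norm dist_real_def)
  then show ?thesis by (rule lipschitz_on_continuous_on)
qed

lemma nu_lower: obtains K where "0 < K" "\<And>v. v \<in> V \<Longrightarrow> norm v \<le> K * \<nu> v"
proof -
  let ?S = "V \<inter> sphere 0 1"
  have comp: "compact ?S" by (intro closed_Int_compact closed_subspace subV compact_sphere)
  have "\<exists>\<kappa>>0. \<forall>v\<in>?S. \<kappa> \<le> \<nu> v"
  proof (cases "?S = {}")
    case False
    have "continuous_on ?S \<nu>" by (rule continuous_on_subset[OF continuous_nu]) auto
    from continuous_attains_inf[OF comp False this] obtain v0 where v0: "v0 \<in> ?S" "\<forall>v\<in>?S. \<nu> v0 \<le> \<nu> v" by blast
    have "v0 \<noteq> 0" using v0 by auto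
    then have "0 < \<nu> v0" using v0(1) nu(1)[of v0] nu(2)[of v0] by (auto simp: less_le)
    then show ?thesis using v0 by blast
  qed (auto intro: exI[of _ 1])
  then obtain \<kappa> where k: "0 < \<kappa>" "\<And>v. v \<in> ?S \<Longrightarrow> \<kappa> \<le> \<nu> v" by blast
  show ?thesis
  proof (rule that[of "1 / \<kappa>"])
    fix v assume v: "v \<in> V"
    show "norm v \<le> 1 / \<kappa> * \<nu> v"
    proof (cases "v = 0")
      case False
      have "\<kappa> \<le> \<nu> ((1 / norm v) *\<^sub>R v)" using False v subV by (intro k) (auto simp: subspace_scale)
      then show ?thesis using k False nu(3)[OF v, of "1 / norm v"] by (simp add: field_simps)
    qed (simp add: nu)
  qed (use k in simp)
qed

text \<open>Words in \<open>V\<close>, evaluated after shifting every letter by a linear map \<open>\<theta>\<close> into the center: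
  \<open>\<theta> = 0\<close> gives the original metric and \<open>\<theta> = \<zeta>\<close> its asymptotic cone.\<close>

definition adm :: "('e \<Rightarrow> 'e) \<Rightarrow> bool" where "adm \<theta> \<longleftrightarrow> linear \<theta> \<and> range \<theta> \<subseteq> Z"

lemma adm_0: "adm (\<lambda>_. 0)" by (simp add: adm_def subspace_0 subZ linear_zero)
lemma adm_zeta: "adm \<zeta>" using zeta by (auto simp: adm_def)
lemma admD: "adm \<theta> \<Longrightarrow> \<theta> x \<in> Z" "adm \<theta> \<Longrightarrow> linear \<theta>" by (auto simp: adm_def)

primrec P :: "('e \<Rightarrow> 'e) \<Rightarrow> 'e list \<Rightarrow> 'e" where
  "P \<theta> [] = 0"
| "P \<theta> (v # w) = mul (v - \<theta> v) (P \<theta> w)"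

definition cost :: "'e list \<Rightarrow> real" where "cost w = sum_list (map \<nu> w)"

lemma cost_simps [simp]: "cost [] = 0" "cost (v # w) = \<nu> v + cost w" "cost (w @ w') = cost w + cost w'"
  by (simp_all add: cost_def)

lemma cost_nonneg: "set w \<subseteq> V \<Longrightarrow> 0 \<le> cost w"
  by (induction w) (auto simp: nu)

lemma P_append: "P \<theta> (w @ w') = mul (P \<theta> w) (P \<theta> w')"
  by (induction w) (simp_all add: mul_assoc)

definition winv :: "'e list \<Rightarrow> 'e list" where "winv w = rev (map uminus w)"

lemma winv_V: "set w \<subseteq> V \<Longrightarrow> set (winv w) \<subseteq> V"
  using subV by (auto simp: winv_def subspace_neg)

lemma cost_winv: "set w \<subseteq> V \<Longrightarrow> cost (winv w) = cost w"
  by (induction w) (auto simp: winv_def nu)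

lemma P_winv: "adm \<theta> \<Longrightarrow> P \<theta> (winv w) = - P \<theta> w"
  by (induction w) (simp_all add: winv_def P_append minus_mul linear_neg[OF admD(2)])

text \<open>The shifts are central and linear, so they can be collected at the end. Hence the
  products of one word for two choices of \<theta> differ by a central element of size at most
  linear in the cost.\<close>

lemma P_shift: "adm \<theta> \<Longrightarrow> P \<theta> w = P (\<lambda>_. 0) w - \<theta> (sum_list w)"
proof (induction w)
  case Nil
  then show ?case by (simp add: linear_0 admD)
next
  case (Cons v w)
  have "\<theta> v \<in> Z" "\<theta> (sum_list w) \<in> Z" using Cons(2) by (auto simp: admD)
  then show ?case using Cons
    by (simp add: mul_def b.diff_left b.diff_right linear_add[OF admD(2)])
qed

lemma pr_P: "adm \<theta> \<Longrightarrow> pr (P \<theta> w) = pr (sum_list w)"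
  by (induction w) (simp_all add: pr.zero pr_mul pr.diff pr.add admD)

lemma norm_word:
  obtains K where "0 < K" "\<And>w. set w \<subseteq> V \<Longrightarrow> sum_list (map norm w) \<le> K * cost w"
proof -
  obtain K where K: "0 < K" "\<And>v. v \<in> V \<Longrightarrow> norm v \<le> K * \<nu> v" using nu_lower by blast
  have "sum_list (map norm w) \<le> K * cost w" if "set w \<subseteq> V" for w
    using that by (induction w) (auto simp: distrib_left intro!: add_mono K)
  then show ?thesis using that K by blast
qed

lemma norm_sum_list: "norm (sum_list w) \<le> sum_list (map norm w)" for w :: "'e list"
  by (induction w) (auto intro: order_trans[OF norm_triangle_ineq])

lemma adm_bound: "adm \<theta> \<Longrightarrow> \<exists>K>0. \<forall>x. norm (\<theta> x) \<le> K * norm x"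
  using linear_bounded_pos admD(2) by metis

text \<open>Brackets see the letters modulo \<open>Z\<close>, where partial products are plain sums
  of norm at most a multiple of the length so far. The cross terms therefore add up to a quadratic
  bound.\<close>

lemma P_lower:
  assumes \<theta>: "adm \<theta>"
  obtains K where "0 < K" "\<And>w. set w \<subseteq> V \<Longrightarrow> norm (P \<theta> w) \<le> K * (cost w + (cost w)\<^sup>2)"
proof -
  obtain K0 where K0: "0 < K0" "\<And>w. set w \<subseteq> V \<Longrightarrow> sum_list (map norm w) \<le> K0 * cost w" using norm_word by blast
  obtain T where T: "0 < T" "\<And>x. norm (\<theta> x) \<le> T * norm x" using adm_bound[OF \<theta>] by blast
  obtain a where a: "0 < a" "\<And>x. norm (pr x) \<le> norm x * a" using pr.pos_bounded by blast
  obtain B where B: "0 < B" "\<And>u w. norm (b u w) \<le> B * norm u * norm w" using mul_bound by metis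
  let ?L = "\<lambda>w. sum_list (map norm w)"
  have L0: "0 \<le> ?L w" for w :: "'e list" by (rule sum_list_nonneg) auto
  have main: "norm (P \<theta> w) \<le> (1 + T) * ?L w + B * a\<^sup>2 * (?L w)\<^sup>2" for w
  proof (induction w)
    case (Cons v w)
    have bb: "norm (b (v - \<theta> v) (P \<theta> w)) \<le> B * a\<^sup>2 * (norm v * ?L w)"
    proof -
      have "b (v - \<theta> v) (P \<theta> w) = b (pr v) (pr (sum_list w))"
        unfolding b_pr[of "v - \<theta> v"] pr_P[OF \<theta>] by (simp add: pr.diff admD[OF \<theta>])
      then have "norm (b (v - \<theta> v) (P \<theta> w)) \<le> B * norm (pr v) * norm (pr (sum_list w))" using B(2) by simp
      also have "\<dots> \<le> B * (norm v * a) * (?L w * a)"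
        using B(1) a norm_sum_list[of w]
        by (intro mult_mono order_trans[OF a(2)] mult_right_mono) (auto intro!: mult_nonneg_nonneg L0)
      finally show ?thesis by (simp add: power2_eq_square mult_ac)
    qed
    have vv: "norm (v - \<theta> v) \<le> (1 + T) * norm v"
      using norm_triangle_ineq4[of v "\<theta> v"] T(2)[of v] by (simp add: distrib_right)
    have "norm (P \<theta> (v # w)) \<le> norm (v - \<theta> v) + norm (P \<theta> w) + (1/2) * norm (b (v - \<theta> v) (P \<theta> w))"
      using norm_triangle_ineq[of "v - \<theta> v + P \<theta> w" "(1/2) *\<^sub>R b (v - \<theta> v) (P \<theta> w)"]
        norm_triangle_ineq[of "v - \<theta> v" "P \<theta> w"] by (simp add: mul_def)
    also have "\<dots> \<le> (1 + T) * norm v + ((1 + T) * ?L w + B * a\<^sup>2 * (?L w)\<^sup>2) + B * a\<^sup>2 * (2 * norm v * ?L w + (norm v)\<^sup>2)"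
    proof -
      have "0 \<le> B * a\<^sup>2 * (norm v * ?L w)" "0 \<le> B * a\<^sup>2 * (norm v)\<^sup>2" using B(1) L0 by auto
      moreover have "B * a\<^sup>2 * (2 * norm v * ?L w + (norm v)\<^sup>2) = 2 * (B * a\<^sup>2 * (norm v * ?L w)) + B * a\<^sup>2 * (norm v)\<^sup>2"
        by (simp add: distrib_left)
      ultimately show ?thesis using bb vv Cons norm_ge_zero[of "b (v - \<theta> v) (P \<theta> w)"] by linarith
    qed
    also have "\<dots> = (1 + T) * ?L (v # w) + B * a\<^sup>2 * (?L (v # w))\<^sup>2"
      by (simp add: power2_sum algebra_simps)
    finally show ?case .
  qed simp
  define K where "K = (1 + T) * K0 + B * a\<^sup>2 * K0\<^sup>2"
  show ?thesis
  proof (rule that[of K])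
    show "0 < K" using T K0 B a by (simp add: K_def add_pos_pos)
    fix w assume w: "set w \<subseteq> V"
    have "(?L w)\<^sup>2 \<le> (K0 * cost w)\<^sup>2" using K0(2)[OF w] L0 by (intro power_mono) auto
    then have "norm (P \<theta> w) \<le> (1 + T) * (K0 * cost w) + B * a\<^sup>2 * (K0 * cost w)\<^sup>2"
      using main[of w] K0(2)[OF w] T(1) B(1)
      by (smt (verit) mult_left_mono mult_nonneg_nonneg zero_le_power2)
    also have "\<dots> \<le> K * (cost w + (cost w)\<^sup>2)"
    proof -
      have "0 \<le> (1 + T) * K0 * (cost w)\<^sup>2" "0 \<le> B * a\<^sup>2 * K0\<^sup>2 * cost w"
        using T K0 B cost_nonneg[OF w] by auto
      then show ?thesis by (simp add: K_def power_mult_distrib algebra_simps)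
    qed
    finally show "norm (P \<theta> w) \<le> K * (cost w + (cost w)\<^sup>2)" .
  qed
qed

lemma mul_commutator: "mul u (mul v (mul (- u) (- v))) = b u v"
proof -
  have 1: "mul (- u) (- v) = - u - v + (1/2) *\<^sub>R b u v"
    by (simp add: mul_def b.minus_left b.minus_right)
  have "mul v (mul (- u) (- v)) = - u + ((1/2) *\<^sub>R b u v + (1/2) *\<^sub>R b u v)"
    unfolding 1 by (simp add: mul_def b.add_right b.diff_right b.minus_right b.scaleR_right b_skew[of v u])
  also have "(1/2) *\<^sub>R b u v + (1/2) *\<^sub>R b u v = b u v" by (simp flip: scaleR_add_left)
  finally have 2: "mul v (mul (- u) (- v)) = - u + b u v" .
  show ?thesis unfolding 2 by (simp add: mul_def b.diff_right)
qed

lemma commutator_word: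
  assumes "adm \<theta>"
  shows "P \<theta> [u, v, - u, - v] = b u v"
proof -
  have "- u - \<theta> (- u) = - (u - \<theta> u)" "- v - \<theta> (- v) = - (v - \<theta> v)"
    using linear_neg[OF admD(2)[OF assms]] by simp_all
  then have "P \<theta> [u, v, - u, - v] = b (u - \<theta> u) (v - \<theta> v)"
    by (simp only: P.simps mul_0 mul_commutator)
  then show ?thesis by (simp add: b.diff_left b.diff_right admD[OF assms])
qed

text \<open>A ball-box estimate. The letter \<open>\<sigma> (pr x)\<close> reaches x up to a central
  element z, and z is the product of a four-letter commutator word. For a fixed h in V outside
  \<open>Z\<close>, non-singularity provides a linear map \<rho> from Z into V with b h (\<rho> z) =
  z; the letters s h and \<rho> z / s both have cost O(s) when s^2 = |z|.\<close>

lemma P_upper: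
  assumes \<theta>: "adm \<theta>"
  obtains K where "0 < K" "\<And>x. \<exists>w. set w \<subseteq> V \<and> P \<theta> w = x \<and>
    cost w \<le> K * (norm (pr x) + sqrt (norm (pr x)) + sqrt (norm (\<zeta> x)))"
proof -
  obtain \<sigma> S where s: "linear \<sigma>" "0 < S" "\<And>x. \<sigma> x \<in> V" "\<And>x. x - \<sigma> x \<in> Z" "\<And>x. norm (\<sigma> x) \<le> S * norm x"
    by (rule V_section) blast
  obtain T where T: "0 < T" "\<And>x. norm (\<theta> x) \<le> T * norm x" using adm_bound[OF \<theta>] by blast
  obtain K1 where K1: "0 < K1" "\<And>v. v \<in> V \<Longrightarrow> \<nu> v \<le> K1 * norm v" using nu_upper by blast
  obtain x0 where x0: "x0 \<notin> Z" using Z_not_UNIV by blast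
  define h where "h = \<sigma> x0"
  have h: "h \<in> V" "h \<notin> Z" using s(3,4)[of x0] x0 subspace_add[OF subZ, of "x0 - \<sigma> x0" "\<sigma> x0"] by (auto simp: h_def)
  obtain B where B: "B \<subseteq> Z" "pairwise orthogonal B" "\<And>x. x \<in> B \<Longrightarrow> norm x = 1" "independent B" "span B = Z"
    using orthonormal_basis_subspace[OF subZ] by metis
  have fin: "finite B" using B(4) by (rule independent_imp_finite)
  have "\<exists>y\<in>V. b h y = c" if "c \<in> Z" for c
  proof -
    obtain y where y: "b h y = c" using nonsing[of c h, folded Z_def] \<open>c \<in> Z\<close> h(2) by blast
    have "b h (y - \<sigma> y) = 0" using s(4)[of y] by simp
    then have "b h (\<sigma> y) = c" using y by (simp add: b.diff_right)
    then show ?thesis using s(3) by blast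
  qed
  then obtain f where f: "\<And>c. c \<in> Z \<Longrightarrow> f c \<in> V \<and> b h (f c) = c" by metis
  define \<rho> where "\<rho> = (\<lambda>z. \<Sum>c\<in>B. (z \<bullet> c) *\<^sub>R f c)"
  have lin: "linear \<rho>" unfolding \<rho>_def
    by (rule linearI) (simp_all add: inner_add_left scaleR_add_left sum.distrib scaleR_sum_right)
  then obtain R where R: "0 < R" "\<And>x. norm (\<rho> x) \<le> R * norm x" using linear_bounded_pos by blast
  have \<rho>V: "\<rho> z \<in> V" for z unfolding \<rho>_def using f B(1) by (intro subspace_sum subV subspace_scale) blast
  have b_\<rho>: "b h (\<rho> z) = z" if "z \<in> Z" for z
  proof -
    have "b h (\<rho> z) = (\<Sum>c\<in>B. (z \<bullet> c) *\<^sub>R c)"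
      unfolding \<rho>_def b.sum_right using f B(1) by (intro sum.cong) (auto simp: b.scaleR_right)
    also have "\<dots> = z" using orthonormal_basis_expand[OF B(2,3) _ fin, of z] that B(5) by simp
    finally show ?thesis .
  qed
  define M where "M = 2 * \<nu> h + 2 * K1 * R"
  have M: "0 < M" using nu(1)[OF h(1)] K1 R by (simp add: M_def add_nonneg_pos)
  have central: "\<exists>w. set w \<subseteq> V \<and> P \<theta> w = z \<and> cost w \<le> M * sqrt (norm z)" if z: "z \<in> Z" for z
  proof (cases "z = 0")
    case True
    then show ?thesis by (intro exI[of _ "[]"]) simp
  next
    case False
    define s where "s = sqrt (norm z)"
    have s: "0 < s" "s * s = norm z" using False by (simp_all add: s_def)
    let ?u = "s *\<^sub>R h" and ?v = "(1 / s) *\<^sub>R \<rho> z"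
    have uv: "?u \<in> V" "?v \<in> V" using h \<rho>V subV by (auto intro: subspace_scale)
    have "cost [?u, ?v, - ?u, - ?v] = 2 * \<nu> ?u + 2 * \<nu> ?v" using nu(6)[OF uv(1)] nu(6)[OF uv(2)] by simp
    also have "\<nu> ?u = s * \<nu> h" using nu(3)[OF h(1), of s] s by simp
    also have "\<nu> ?v = \<nu> (\<rho> z) / s" using nu(3)[OF \<rho>V, of "1 / s"] s by simp
    also have "\<nu> (\<rho> z) / s \<le> K1 * R * s"
    proof -
      have "\<nu> (\<rho> z) \<le> K1 * (R * norm z)" using K1(2)[OF \<rho>V] R(2)[of z] K1(1) by (meson mult_left_mono order_trans less_imp_le)
      then show ?thesis using s by (simp add: divide_le_eq mult_ac)
    qed
    finally have "cost [?u, ?v, - ?u, - ?v] \<le> M * s" by (simp add: M_def algebra_simps)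
    moreover have "P \<theta> [?u, ?v, - ?u, - ?v] = z"
      unfolding commutator_word[OF \<theta>] using s b_\<rho>[OF z] by (simp add: b.scaleR_left b.scaleR_right)
    moreover have "set [?u, ?v, - ?u, - ?v] \<subseteq> V" using uv subV by (simp add: subspace_neg)
    ultimately show ?thesis unfolding s_def by blast
  qed
  define Q where "Q = 1 + S + T * S"
  have Q: "0 < Q" using T s(2) by (simp add: Q_def add_pos_pos)
  define K where "K = K1 * S + M * sqrt Q + M"
  have K: "0 < K" using K1 s(2) M Q by (simp add: K_def add_pos_pos)
  show ?thesis
  proof (rule that[OF K])
    fix x
    define v where "v = \<sigma> (pr x)"
    \<comment> \<open>Besides \<open>\<zeta> x\<close>, this central defect contains
      \<open>pr x - v\<close> and \<open>\<theta> v\<close>, both bounded by a multiple of |pr x|;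
      they are the origin of the summand \<open>sqrt (norm (pr x))\<close>.\<close>
    define z where "z = x - (v - \<theta> v)"
    have v: "v \<in> V" "pr x - v \<in> Z" "norm v \<le> S * norm (pr x)" using s by (auto simp: v_def)
    have "z = \<zeta> x + (pr x - v) + \<theta> v" by (simp add: z_def pr_def)
    then have z: "z \<in> Z" using v(2) zeta(1) admD(1)[OF \<theta>] subZ by (auto intro: subspace_add)
    have "norm z \<le> norm (\<zeta> x) + norm (pr x) + norm v + norm (\<theta> v)"
      unfolding \<open>z = \<zeta> x + (pr x - v) + \<theta> v\<close>
      using norm_triangle_ineq[of "\<zeta> x + (pr x - v)" "\<theta> v"] norm_triangle_ineq[of "\<zeta> x" "pr x - v"]
        norm_triangle_ineq4[of "pr x" v] by linarith
    also have "\<dots> \<le> norm (\<zeta> x) + Q * norm (pr x)"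
    proof -
      have "T * norm v \<le> T * (S * norm (pr x))" using v(3) T(1) by simp
      then show ?thesis using T(2)[of v] v(3) by (simp add: Q_def algebra_simps)
    qed
    finally have "sqrt (norm z) \<le> sqrt (norm (\<zeta> x) + Q * norm (pr x))" by simp
    also have "\<dots> \<le> sqrt (norm (\<zeta> x)) + sqrt (Q * norm (pr x))"
      using Q by (intro sqrt_add_le_add_sqrt) auto
    finally have sz: "sqrt (norm z) \<le> sqrt (norm (\<zeta> x)) + sqrt Q * sqrt (norm (pr x))" by (simp add: real_sqrt_mult)
    obtain w where w: "set w \<subseteq> V" "P \<theta> w = z" "cost w \<le> M * sqrt (norm z)" using central[OF z] by blast
    have "P \<theta> (v # w) = x" using w(2) z by (simp add: mul_Z) (simp add: z_def)
    moreover have "cost (v # w) \<le> K * (norm (pr x) + sqrt (norm (pr x)) + sqrt (norm (\<zeta> x)))"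
    proof -
      have "\<nu> v \<le> K1 * (S * norm (pr x))" using K1(2)[OF v(1)] v(3) K1(1) by (meson mult_left_mono order_trans less_imp_le)
      moreover have "M * sqrt (norm z) \<le> M * (sqrt (norm (\<zeta> x)) + sqrt Q * sqrt (norm (pr x)))"
        using sz M by simp
      moreover have "0 \<le> (K1 * S) * sqrt (norm (pr x))" "0 \<le> (K1 * S) * sqrt (norm (\<zeta> x))" "0 \<le> M * sqrt Q * norm (pr x)"
        "0 \<le> M * sqrt Q * sqrt (norm (\<zeta> x))" "0 \<le> M * norm (pr x)" "0 \<le> M * sqrt (norm (pr x))"
        using K1 s(2) M Q by auto
      ultimately show ?thesis using w(3) by (simp add: K_def algebra_simps)
    qed
    ultimately show "\<exists>w. set w \<subseteq> V \<and> P \<theta> w = x \<and>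
      cost w \<le> K * (norm (pr x) + sqrt (norm (pr x)) + sqrt (norm (\<zeta> x)))"
      using w(1) v(1) by (intro exI[of _ "v # w"]) auto
  qed
qed

end

section \<open>Comparison of the word metrics for different shifts\<close>

context subfinsler_nil2 begin

lemma mul_conjugate: "mul (mul t x) (- t) = x + b t x"
proof -
  have "b (mul t x) (- t) = b t x"
    by (simp add: mul_def b.add_left b.diff_left b.scaleR_left b.minus_right b_skew[of t x])
  then have "mul (mul t x) (- t) = x + ((1/2) *\<^sub>R b t x + (1/2) *\<^sub>R b t x)"
    by (simp add: mul_def[of "mul t x"]) (simp add: mul_def)
  also have "(1/2) *\<^sub>R b t x + (1/2) *\<^sub>R b t x = b t x" by (simp flip: scaleR_add_left)
  finally show ?thesis .
qed

text \<open>The sum over the basis is the adjoint of u -> b u p, applied to z. For p outside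
  \<open>Z\<close> that map is onto \<open>Z\<close>, so its adjoint is injective on
  \<open>Z\<close>; compactness of the two unit spheres and homogeneity in p and z give a uniform
  constant.\<close>

lemma transpose_bound:
  obtains \<kappa> where "0 < \<kappa>"
    "\<And>p z. z \<in> Z \<Longrightarrow> pr p = p \<Longrightarrow> \<kappa> * norm p * norm z \<le> norm (\<Sum>i\<in>Basis. (b i p \<bullet> z) *\<^sub>R i)"
proof -
  let ?a = "\<lambda>p z. (\<Sum>i\<in>Basis. (b i p \<bullet> z) *\<^sub>R i)"
  have adj: "u \<bullet> ?a p z = b u p \<bullet> z" for u p z
  proof -
    have "u \<bullet> ?a p z = (\<Sum>i\<in>Basis. (u \<bullet> i) * (b i p \<bullet> z))" by (simp add: inner_sum_right mult.commute)
    also have "\<dots> = b (\<Sum>i\<in>Basis. (u \<bullet> i) *\<^sub>R i) p \<bullet> z" by (simp add: b.sum_left b.scaleR_left inner_sum_left)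
    finally show ?thesis by (simp add: euclidean_representation)
  qed
  let ?S = "({p. pr p = p} \<inter> sphere 0 1) \<times> (Z \<inter> sphere 0 1)"
  have cl: "closed {p. pr p = p}" by (intro closed_Collect_eq continuous_intros pr.continuous_on)
  then have comp: "compact ?S" by (intro compact_Times closed_Int_compact cl closed_subspace[OF subZ] compact_sphere)
  have cont: "continuous_on ?S (\<lambda>q. norm (?a (fst q) (snd q)))"
    by (intro continuous_intros b.continuous_on)
  have nz: "?a p z \<noteq> 0" if "pr p = p" "p \<noteq> 0" "z \<in> Z" "z \<noteq> 0" for p z
  proof
    assume 0: "?a p z = 0"
    have "p \<notin> Z" using that(1,2) by auto
    then obtain y where "b p y = z" using nonsing[of z p, folded Z_def] \<open>z \<in> Z\<close> by blast
    then have "b (- y) p = z" using b_skew[of p y] by (simp add: b.minus_left)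
    then have "z \<bullet> z = 0" using adj[of "- y" p z] 0 by simp
    then show False using that by simp
  qed
  have "\<exists>\<kappa>>0. \<forall>q\<in>?S. \<kappa> \<le> norm (?a (fst q) (snd q))"
  proof (cases "?S = {}")
    case False
    from continuous_attains_inf[OF comp False cont] obtain q0 where q0: "q0 \<in> ?S"
      "\<forall>q\<in>?S. norm (?a (fst q0) (snd q0)) \<le> norm (?a (fst q) (snd q))" by blast
    then have "0 < norm (?a (fst q0) (snd q0))" unfolding zero_less_norm_iff by (intro nz) auto
    then show ?thesis using q0 by blast
  qed (auto intro: exI[of _ 1])
  then obtain \<kappa> where k: "0 < \<kappa>" "\<And>q. q \<in> ?S \<Longrightarrow> \<kappa> \<le> norm (?a (fst q) (snd q))" by blast
  show ?thesis
  proof (rule that[OF k(1)])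
    fix p z assume z: "z \<in> Z" and p: "pr p = p"
    show "\<kappa> * norm p * norm z \<le> norm (?a p z)"
    proof (cases "p = 0 \<or> z = 0")
      case False
      have "?a ((1 / norm p) *\<^sub>R p) ((1 / norm z) *\<^sub>R z) = (1 / (norm p * norm z)) *\<^sub>R ?a p z"
        by (simp add: b.scaleR_right scaleR_sum_right mult.commute[of "norm z"])
      moreover have "((1 / norm p) *\<^sub>R p, (1 / norm z) *\<^sub>R z) \<in> ?S"
        using False z p subZ by (auto simp: pr.scaleR subspace_scale)
      ultimately have "\<kappa> \<le> norm ((1 / (norm p * norm z)) *\<^sub>R ?a p z)" using k(2) by fastforce
      then show ?thesis using False by (simp add: field_simps)
    qed (auto simp: b.zero_right)
  qed
qed

text \<open>A least squares solution. If a is the adjoint of u -> b u p, then z -> b (a z) p is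
  bijective on \<open>Z\<close>. The preimage y of z satisfies |a y|^2 = y . z and \<kappa> |p| |y|
  \<le> |a y|, which together give |a y| \<le> |z| / (\<kappa> |p|). Finally \<sigma> moves a y into
  V.\<close>

lemma solve_bracket:
  obtains K where "0 < K" "\<And>p z. z \<in> Z \<Longrightarrow> pr p = p \<Longrightarrow> p \<noteq> 0 \<Longrightarrow> \<exists>u\<in>V. b u p = z \<and> norm u \<le> K * norm z / norm p"
proof -
  obtain \<kappa> where k: "0 < \<kappa>"
    "\<And>p z. z \<in> Z \<Longrightarrow> pr p = p \<Longrightarrow> \<kappa> * norm p * norm z \<le> norm (\<Sum>i\<in>Basis. (b i p \<bullet> z) *\<^sub>R i)"
    using transpose_bound by metis
  obtain \<sigma> S where s: "linear \<sigma>" "0 < S" "\<And>x. \<sigma> x \<in> V" "\<And>x. x - \<sigma> x \<in> Z" "\<And>x. norm (\<sigma> x) \<le> S * norm x"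
    by (rule V_section) blast
  show ?thesis
  proof (rule that[of "S / \<kappa>"])
    show "0 < S / \<kappa>" using s(2) k(1) by simp
    fix p z assume z: "z \<in> Z" and p: "pr p = p" "p \<noteq> 0"
    define a where "a = (\<lambda>z. \<Sum>i\<in>Basis. (b i p \<bullet> z) *\<^sub>R i)"
    have adj: "u \<bullet> a z = b u p \<bullet> z" for u z
    proof -
      have "u \<bullet> a z = (\<Sum>i\<in>Basis. (u \<bullet> i) * (b i p \<bullet> z))" by (simp add: a_def inner_sum_right mult.commute)
      also have "\<dots> = b (\<Sum>i\<in>Basis. (u \<bullet> i) *\<^sub>R i) p \<bullet> z" by (simp add: b.sum_left b.scaleR_left inner_sum_left)
      finally show ?thesis by (simp add: euclidean_representation)
    qed
    have ak: "\<kappa> * norm p * norm z \<le> norm (a z)" if "z \<in> Z" for z using k(2)[OF that p(1)] by (simp add: a_def)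
    define T where "T = (\<lambda>z. b (a z) p)"
    have lin: "linear T" unfolding T_def a_def
      by (rule linearI) (simp_all add: inner_add_right scaleR_add_left sum.distrib b.add_left b.sum_left b.scaleR_left scaleR_sum_right)
    have inj0: "z = 0" if "z \<in> Z" "T z = 0" for z
    proof -
      have "a z \<bullet> a z = 0" using adj[of "a z" z] that(2) by (simp add: T_def)
      then have "\<kappa> * norm p * norm z \<le> 0" using ak[OF that(1)] by simp
      then show ?thesis using k(1) p(2) by (simp add: mult_le_0_iff zero_less_mult_iff)
    qed
    have sp: "span Z = Z" using subZ by (simp add: span_eq_iff)
    have "inj_on T (span Z)"
    proof (rule inj_onI)
      fix x y assume "x \<in> span Z" "y \<in> span Z" "T x = T y"
      then have "x - y \<in> Z" "T (x - y) = 0" using subZ linear_diff[OF lin] by (auto simp: sp subspace_diff)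
      then show "x = y" using inj0 by fastforce
    qed
    then have "dim (T ` Z) = dim Z" using lin by (rule dim_image_eq[rotated])
    moreover have "T ` Z \<subseteq> Z" by (auto simp: T_def)
    moreover have "subspace (T ` Z)" by (rule linear_subspace_image[OF lin subZ])
    ultimately have "T ` Z = Z" using subspace_dim_equal subZ by (metis order_refl)
    then have "z \<in> T ` Z" using z by simp
    then obtain y where y: "y \<in> Z" "T y = z" by (elim imageE) simp
    have "norm (a y) * norm (a y) = y \<bullet> z"
      using adj[of "a y" y] y(2) by (simp add: T_def dot_square_norm power2_eq_square inner_commute)
    also have "\<dots> \<le> norm y * norm z" by (rule norm_cauchy_schwarz)
    finally have 1: "norm (a y) * norm (a y) \<le> norm y * norm z" .
    have "\<kappa> * norm p * norm (a y) \<le> norm z"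
    proof (cases "a y = 0")
      case False
      have "\<kappa> * norm p * (norm (a y) * norm (a y)) \<le> \<kappa> * norm p * (norm y * norm z)"
        using 1 k(1) by (intro mult_left_mono) auto
      also have "\<dots> = (\<kappa> * norm p * norm y) * norm z" by simp
      also have "\<dots> \<le> norm (a y) * norm z" using ak[OF y(1)] by (intro mult_right_mono) auto
      finally have "norm (a y) * (\<kappa> * norm p * norm (a y)) \<le> norm (a y) * norm z" by (simp add: mult_ac)
      then show ?thesis using False by simp
    qed simp
    then have 2: "norm (a y) \<le> norm z / (\<kappa> * norm p)" using k(1) p(2) by (simp add: field_simps)
    have "b (a y - \<sigma> (a y)) p = 0" using s(4) by simp
    then have "b (\<sigma> (a y)) p = z" using y(2) by (simp add: T_def b.diff_left)
    moreover have "norm (\<sigma> (a y)) \<le> S / \<kappa> * norm z / norm p"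
    proof -
      have "norm (\<sigma> (a y)) \<le> S * (norm z / (\<kappa> * norm p))" using s(5)[of "a y"] 2 s(2) by (meson mult_left_mono order_trans less_imp_le)
      then show ?thesis by (simp add: field_simps)
    qed
    ultimately show "\<exists>u\<in>V. b u p = z \<and> norm u \<le> S / \<kappa> * norm z / norm p" using s(3) by blast
  qed
qed

text \<open>Appending a letter v changes the central coordinate by the central part of that letter
  and by half its bracket with the projection of the prefix, thus by O((1 + \<rho>) |v|).\<close>

lemma central_part_bound:
  assumes \<theta>: "adm \<theta>"
  obtains K where "0 < K" "\<And>w \<rho>. set w \<subseteq> V \<Longrightarrow> 0 \<le> \<rho> \<Longrightarrow>
    (\<And>w1 w2. w = w1 @ w2 \<Longrightarrow> norm (pr (P \<theta> w1)) \<le> \<rho>) \<Longrightarrow> norm (\<zeta> (P \<theta> w)) \<le> K * (1 + \<rho>) * cost w"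
proof -
  obtain K0 where K0: "0 < K0" "\<And>w. set w \<subseteq> V \<Longrightarrow> sum_list (map norm w) \<le> K0 * cost w" using norm_word by blast
  obtain T where T: "0 < T" "\<And>x. norm (\<theta> x) \<le> T * norm x" using adm_bound[OF \<theta>] by blast
  obtain a where a: "0 < a" "\<And>x. norm (\<zeta> x) \<le> norm x * a" using zeta.pos_bounded by blast
  obtain B where B: "0 < B" "\<And>u w. norm (b u w) \<le> B * norm u * norm w" using mul_bound by metis
  define M where "M = a * (1 + T) + B * (1 + T)"
  have M: "0 < M" using a B T by (simp add: M_def add_pos_pos)
  have main: "norm (\<zeta> (P \<theta> w)) \<le> M * (1 + \<rho>) * sum_list (map norm w)"
    if "0 \<le> \<rho>" "\<And>w1 w2. w = w1 @ w2 \<Longrightarrow> norm (pr (P \<theta> w1)) \<le> \<rho>" for w \<rho>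
    using that(2)
  proof (induction w rule: rev_induct)
    case Nil
    then show ?case by (simp add: zeta.zero)
  next
    case (snoc v w)
    have pw: "norm (pr (P \<theta> w)) \<le> \<rho>" by (rule snoc(2)[of w "[v]"]) simp
    have IH: "norm (\<zeta> (P \<theta> w)) \<le> M * (1 + \<rho>) * sum_list (map norm w)"
    proof (rule snoc(1))
      fix w1 w2 assume "w = w1 @ w2"
      then show "norm (pr (P \<theta> w1)) \<le> \<rho>" using snoc(2)[of w1 "w2 @ [v]"] by simp
    qed
    have vv: "norm (v - \<theta> v) \<le> (1 + T) * norm v"
      using norm_triangle_ineq4[of v "\<theta> v"] T(2)[of v] by (simp add: distrib_right)
    have "P \<theta> (w @ [v]) = mul (P \<theta> w) (v - \<theta> v)" by (simp add: P_append)
    then have "\<zeta> (P \<theta> (w @ [v])) = \<zeta> (P \<theta> w) + \<zeta> (v - \<theta> v) + (1/2) *\<^sub>R b (pr (P \<theta> w)) (v - \<theta> v)"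
      by (simp add: mul_def zeta.add zeta.scaleR b_pr_left)
    then have "norm (\<zeta> (P \<theta> (w @ [v]))) \<le> norm (\<zeta> (P \<theta> w)) + norm (\<zeta> (v - \<theta> v)) + (1/2) * norm (b (pr (P \<theta> w)) (v - \<theta> v))"
      using norm_triangle_ineq[of "\<zeta> (P \<theta> w) + \<zeta> (v - \<theta> v)" "(1/2) *\<^sub>R b (pr (P \<theta> w)) (v - \<theta> v)"]
        norm_triangle_ineq[of "\<zeta> (P \<theta> w)" "\<zeta> (v - \<theta> v)"] by simp
    moreover have "norm (\<zeta> (v - \<theta> v)) \<le> a * (1 + T) * norm v"
      using a(2)[of "v - \<theta> v"] mult_right_mono[OF vv less_imp_le[OF a(1)]] by (simp add: mult_ac)
    moreover have "norm (b (pr (P \<theta> w)) (v - \<theta> v)) \<le> B * \<rho> * ((1 + T) * norm v)"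
      using B(2)[of "pr (P \<theta> w)" "v - \<theta> v"] pw vv B(1) that(1)
      by (smt (verit) mult_left_mono mult_mono mult_nonneg_nonneg norm_ge_zero)
    moreover have "0 \<le> B * \<rho> * ((1 + T) * norm v)" "0 \<le> a * (1 + T) * \<rho> * norm v" "0 \<le> B * (1 + T) * norm v"
      using B T a that(1) by auto
    moreover have "M * (1 + \<rho>) * sum_list (map norm (w @ [v])) = M * (1 + \<rho>) * sum_list (map norm w) +
        a * (1 + T) * norm v + a * (1 + T) * \<rho> * norm v + B * (1 + T) * norm v + B * \<rho> * ((1 + T) * norm v)"
      by (simp add: M_def algebra_simps)
    ultimately show ?case using IH norm_ge_zero[of "b (pr (P \<theta> w)) (v - \<theta> v)"] by linarith
  qed
  show ?thesis
  proof (rule that[of "M * K0"])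
    show "0 < M * K0" using M K0 by simp
    fix w \<rho> assume w: "set w \<subseteq> V" "0 \<le> \<rho>" "\<And>w1 w2. w = w1 @ w2 \<Longrightarrow> norm (pr (P \<theta> w1)) \<le> \<rho>"
    have "norm (\<zeta> (P \<theta> w)) \<le> M * (1 + \<rho>) * sum_list (map norm w)" by (rule main) (use w in auto)
    also have "\<dots> \<le> M * (1 + \<rho>) * (K0 * cost w)" using K0(2)[OF w(1)] M w(2) by (intro mult_left_mono) auto
    finally show "norm (\<zeta> (P \<theta> w)) \<le> M * K0 * (1 + \<rho>) * cost w" by (simp add: mult_ac)
  qed
qed

definition D :: "('e \<Rightarrow> 'e) \<Rightarrow> 'e \<Rightarrow> real" where
  "D \<theta> x = Inf {cost w |w. set w \<subseteq> V \<and> P \<theta> w = x}"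

lemma words_ex: "adm \<theta> \<Longrightarrow> \<exists>w. set w \<subseteq> V \<and> P \<theta> w = x"
  using P_upper by metis

lemma D_le: "set w \<subseteq> V \<Longrightarrow> D \<theta> (P \<theta> w) \<le> cost w"
  unfolding D_def by (rule cInf_lower) (auto intro!: bdd_belowI[of _ 0] simp: cost_nonneg)

lemma D_approx:
  assumes "adm \<theta>" "0 < e"
  obtains w where "set w \<subseteq> V" "P \<theta> w = x" "cost w < D \<theta> x + e"
proof -
  have "{cost w |w. set w \<subseteq> V \<and> P \<theta> w = x} \<noteq> {}" using words_ex[OF assms(1)] by blast
  from cInf_lessD[OF this, of "D \<theta> x + e"] show ?thesis using that assms(2) unfolding D_def by auto
qed

lemma D_nonneg: "adm \<theta> \<Longrightarrow> 0 \<le> D \<theta> x"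
  unfolding D_def by (rule cInf_greatest) (use words_ex in \<open>auto simp: cost_nonneg\<close>)

lemma D_0 [simp]: "adm \<theta> \<Longrightarrow> D \<theta> 0 = 0"
  using D_le[of "[]" \<theta>] D_nonneg[of \<theta> 0] by simp

lemma D_minus: assumes "adm \<theta>" shows "D \<theta> (- x) = D \<theta> x"
proof -
  have le: "D \<theta> (- x) \<le> D \<theta> x" for x
  proof (rule field_le_epsilon)
    fix e :: real assume "0 < e"
    obtain w where w: "set w \<subseteq> V" "P \<theta> w = x" "cost w < D \<theta> x + e" using D_approx[OF assms \<open>0 < e\<close>] by metis
    show "D \<theta> (- x) \<le> D \<theta> x + e"
      using D_le[OF winv_V[OF w(1)], of \<theta>] w by (simp add: P_winv[OF assms] cost_winv)
  qed
  show ?thesis using le[of x] le[of "- x"] by simp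
qed

lemma D_mul: assumes "adm \<theta>" shows "D \<theta> (mul x y) \<le> D \<theta> x + D \<theta> y"
proof (rule field_le_epsilon)
  fix e :: real assume "0 < e"
  then have "0 < e / 2" by simp
  obtain w where w: "set w \<subseteq> V" "P \<theta> w = x" "cost w < D \<theta> x + e / 2" using D_approx[OF assms \<open>0 < e / 2\<close>] by metis
  obtain w' where w': "set w' \<subseteq> V" "P \<theta> w' = y" "cost w' < D \<theta> y + e / 2" using D_approx[OF assms \<open>0 < e / 2\<close>] by metis
  show "D \<theta> (mul x y) \<le> D \<theta> x + D \<theta> y + e"
    using D_le[of "w @ w'" \<theta>] w w' by (simp add: P_append)
qed

lemma D_lower:
  assumes "adm \<theta>"
  obtains K where "0 < K" "\<And>x. norm x \<le> K * (D \<theta> x + (D \<theta> x)\<^sup>2)"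
proof -
  obtain K where K: "0 < K" "\<And>w. set w \<subseteq> V \<Longrightarrow> norm (P \<theta> w) \<le> K * (cost w + (cost w)\<^sup>2)"
    using P_lower[OF assms] by metis
  have "norm x \<le> K * (D \<theta> x + (D \<theta> x)\<^sup>2)" for x
  proof (rule tendsto_lowerbound)
    show "((\<lambda>e. K * (D \<theta> x + e + (D \<theta> x + e)\<^sup>2)) \<longlongrightarrow> K * (D \<theta> x + (D \<theta> x)\<^sup>2)) (at_right 0)"
      by (auto intro!: tendsto_eq_intros)
    show "\<forall>\<^sub>F e in at_right 0. norm x \<le> K * (D \<theta> x + e + (D \<theta> x + e)\<^sup>2)"
      using eventually_at_right_less[of 0]
    proof eventually_elim
      case (elim e)
      obtain w where w: "set w \<subseteq> V" "P \<theta> w = x" "cost w < D \<theta> x + e" using D_approx[OF assms elim] by metis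
      have "norm x \<le> K * (cost w + (cost w)\<^sup>2)" using K(2)[OF w(1)] w(2) by simp
      also have "\<dots> \<le> K * (D \<theta> x + e + (D \<theta> x + e)\<^sup>2)"
        using w K(1) cost_nonneg[OF w(1)] by (intro mult_left_mono add_mono power_mono) auto
      finally show ?case .
    qed
  qed simp
  then show ?thesis using that K by blast
qed

lemma D_upper:
  assumes "adm \<theta>"
  obtains K where "0 < K" "\<And>x. D \<theta> x \<le> K * (norm (pr x) + sqrt (norm (pr x)) + sqrt (norm (\<zeta> x)))"
proof -
  obtain K where K: "0 < K" "\<And>x. \<exists>w. set w \<subseteq> V \<and> P \<theta> w = x \<and>
    cost w \<le> K * (norm (pr x) + sqrt (norm (pr x)) + sqrt (norm (\<zeta> x)))"
    using P_upper[OF assms] by metis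
  have "D \<theta> x \<le> K * (norm (pr x) + sqrt (norm (pr x)) + sqrt (norm (\<zeta> x)))" for x
    using K(2)[of x] D_le by (metis order_trans)
  then show ?thesis using that K by blast
qed

lemma D_eq_0_iff: "adm \<theta> \<Longrightarrow> D \<theta> x = 0 \<longleftrightarrow> x = 0"
proof
  assume "adm \<theta>" "D \<theta> x = 0"
  then show "x = 0" using D_lower[OF \<open>adm \<theta>\<close>] by (metis add_0 mult_zero_right norm_le_zero_iff power_zero_numeral)
qed simp

lemma D_bounded:
  assumes "adm \<theta>"
  obtains C where "\<And>x::'e. norm x \<le> R \<Longrightarrow> D \<theta> x \<le> C"
proof -
  obtain K where K: "0 < K" "\<And>x. D \<theta> x \<le> K * (norm (pr x) + sqrt (norm (pr x)) + sqrt (norm (\<zeta> x)))"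
    using D_upper[OF assms] by metis
  obtain a where a: "0 < a" "\<And>x. norm (pr x) \<le> norm x * a" using pr.pos_bounded by blast
  obtain c where c: "0 < c" "\<And>x. norm (\<zeta> x) \<le> norm x * c" using zeta.pos_bounded by blast
  show ?thesis
  proof (rule that)
    fix x :: 'e assume x: "norm x \<le> R"
    have "norm (pr x) \<le> R * a" "norm (\<zeta> x) \<le> R * c"
      using a(2)[of x] c(2)[of x] mult_right_mono[OF x] a(1) c(1) by (meson less_imp_le order_trans)+
    then show "D \<theta> x \<le> K * (R * a + sqrt (R * a) + sqrt (R * c))"
      using K(1) by (intro order_trans[OF K(2)] mult_left_mono add_mono real_sqrt_le_mono) auto
  qed
qed

text \<open>Replacing \<open>\<theta>\<close> by \<open>\<theta>'\<close> moves the endpoint of a word by a central element of size at most linear in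
  the cost. Conjugating a prefix, whose projection has size comparable to the cost, by a letter of
  bounded size produces exactly this central correction; this is where non-singularity is used.\<close>

lemma D_comparison:
  assumes \<theta>: "adm \<theta>" and \<theta>': "adm \<theta>'"
  obtains C where "\<And>x. D \<theta>' x \<le> D \<theta> x + C"
proof -
  obtain K0 where K0: "0 < K0" "\<And>w. set w \<subseteq> V \<Longrightarrow> sum_list (map norm w) \<le> K0 * cost w" using norm_word by blast
  obtain Kn where Kn: "0 < Kn" "\<And>v. v \<in> V \<Longrightarrow> \<nu> v \<le> Kn * norm v" using nu_upper by blast
  obtain T where T: "0 < T" "\<And>x. norm (\<theta> x) \<le> T * norm x" using adm_bound[OF \<theta>] by blast
  obtain T' where T': "0 < T'" "\<And>x. norm (\<theta>' x) \<le> T' * norm x" using adm_bound[OF \<theta>'] by blast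
  obtain Ks where Ks: "0 < Ks" "\<And>p z. z \<in> Z \<Longrightarrow> pr p = p \<Longrightarrow> p \<noteq> 0 \<Longrightarrow> \<exists>u\<in>V. b u p = z \<and> norm u \<le> Ks * norm z / norm p"
    using solve_bracket by metis
  obtain Kc where Kc: "0 < Kc" "\<And>w \<rho>. set w \<subseteq> V \<Longrightarrow> 0 \<le> \<rho> \<Longrightarrow>
    (\<And>w1 w2. w = w1 @ w2 \<Longrightarrow> norm (pr (P \<theta> w1)) \<le> \<rho>) \<Longrightarrow> norm (\<zeta> (P \<theta> w)) \<le> Kc * (1 + \<rho>) * cost w"
    using central_part_bound[OF \<theta>] by metis
  obtain Ku where Ku: "0 < Ku" "\<And>x. D \<theta> x \<le> Ku * (norm (pr x) + sqrt (norm (pr x)) + sqrt (norm (\<zeta> x)))"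
    using D_upper[OF \<theta>] by metis
  \<comment> \<open>So small that the two contributions to the box estimate that are linear in the
    cost L, namely \<open>Ku * c * L\<close> and \<open>Ku * sqrt (Kc * c) * L\<close>, are at most
    L / 4 each.\<close>
  define c where "c = min (1 / (4 * Ku)) ((1 / (4 * Ku))\<^sup>2 / Kc)"
  have c: "0 < c" "Ku * c \<le> 1 / 4" "Ku * sqrt (Kc * c) \<le> 1 / 4"
  proof -
    show "0 < c" using Ku Kc by (simp add: c_def)
    have "Ku * c \<le> Ku * (1 / (4 * Ku))" unfolding c_def using Ku by (intro mult_left_mono) auto
    then show "Ku * c \<le> 1 / 4" using Ku by simp
    have "Kc * c \<le> Kc * ((1 / (4 * Ku))\<^sup>2 / Kc)" unfolding c_def using Kc by (intro mult_left_mono) auto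
    then have "sqrt (Kc * c) \<le> sqrt ((1 / (4 * Ku))\<^sup>2)" using Kc by (intro real_sqrt_le_mono) simp
    also have "\<dots> = 1 / (4 * Ku)" using Ku by simp
    finally have "Ku * sqrt (Kc * c) \<le> Ku * (1 / (4 * Ku))" using Ku by (intro mult_left_mono) auto
    then show "Ku * sqrt (Kc * c) \<le> 1 / 4" using Ku by simp
  qed
  define s0 where "s0 = 2 + 2 * Ku * (sqrt c + sqrt Kc)"
  define L0 where "L0 = max 1 (s0\<^sup>2)"
  \<comment> \<open>If all prefixes of an almost optimal word have projection at most c L, then
    \<open>central_part_bound\<close> and the box estimate give L - 1 \<le> L / 2 + O(sqrt L). A
    longer word must have a prefix with larger projection.\<close>
  have big: "cost w \<le> L0"
    if w: "set w \<subseteq> V" "cost w \<le> D \<theta> (P \<theta> w) + 1" "1 \<le> cost w"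
      and pref: "\<And>w1 w2. w = w1 @ w2 \<Longrightarrow> norm (pr (P \<theta> w1)) \<le> c * cost w" for w
  proof -
    let ?L = "cost w" and ?x = "P \<theta> w"
    let ?s = "sqrt ?L"
    have s: "1 \<le> ?s" "?s * ?s = ?L" using w(3) by auto
    have p: "norm (pr ?x) \<le> c * ?L" by (rule pref[of w "[]"]) simp
    have z: "norm (\<zeta> ?x) \<le> Kc * ?L + Kc * c * ?L\<^sup>2"
      using Kc(2)[OF w(1) _ pref] c w(3) by (simp add: algebra_simps power2_eq_square)
    have "sqrt (norm (\<zeta> ?x)) \<le> sqrt (Kc * ?L) + sqrt (Kc * c * ?L\<^sup>2)"
      using z Kc c w(3) by (meson order_trans real_sqrt_le_mono sqrt_add_le_add_sqrt mult_nonneg_nonneg less_imp_le zero_le_power2 zero_le_one)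
    also have "\<dots> = sqrt Kc * ?s + sqrt (Kc * c) * ?L" using w(3) by (simp add: real_sqrt_mult)
    finally have sz: "sqrt (norm (\<zeta> ?x)) \<le> sqrt Kc * ?s + sqrt (Kc * c) * ?L" .
    have sp: "sqrt (norm (pr ?x)) \<le> sqrt c * ?s" using real_sqrt_le_mono[OF p] by (simp add: real_sqrt_mult)
    have "?L - 1 \<le> Ku * (norm (pr ?x) + sqrt (norm (pr ?x)) + sqrt (norm (\<zeta> ?x)))"
      using w(2) Ku(2)[of ?x] by linarith
    also have "\<dots> \<le> Ku * (c * ?L + sqrt c * ?s + (sqrt Kc * ?s + sqrt (Kc * c) * ?L))"
      using p sp sz Ku(1) by (intro mult_left_mono) auto
    also have "\<dots> = (Ku * c) * ?L + (Ku * sqrt (Kc * c)) * ?L + Ku * (sqrt c + sqrt Kc) * ?s" by (simp add: algebra_simps)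
    also have "\<dots> \<le> 1/4 * ?L + 1/4 * ?L + Ku * (sqrt c + sqrt Kc) * ?s"
      using mult_right_mono[OF c(2), of ?L] mult_right_mono[OF c(3), of ?L] w(3) by linarith
    finally have "?L \<le> 2 * 1 + 2 * (Ku * (sqrt c + sqrt Kc) * ?s)" by simp
    also have "\<dots> \<le> 2 * ?s + 2 * (Ku * (sqrt c + sqrt Kc) * ?s)" using s by simp
    also have "\<dots> = s0 * ?s" by (simp add: s0_def algebra_simps)
    finally have "?s * ?s \<le> s0 * ?s" using s by simp
    then have "?s \<le> s0" by (rule mult_right_le_imp_le) (use s in linarith)
    then have "?s\<^sup>2 \<le> s0\<^sup>2" using s by (intro power_mono) auto
    then show ?thesis using s w(3) by (simp add: L0_def)
  qed
  obtain Kp where Kp: "0 < Kp" "\<And>w. set w \<subseteq> V \<Longrightarrow> norm (P \<theta> w) \<le> Kp * (cost w + (cost w)\<^sup>2)"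
    using P_lower[OF \<theta>] by metis
  obtain C1 where C1: "\<And>x. norm x \<le> Kp * (L0 + L0\<^sup>2) \<Longrightarrow> D \<theta>' x \<le> C1" using D_bounded[OF \<theta>'] by metis
  define C2 where "C2 = 2 * Kn * (Ks * ((T + T') * K0) / c)"
  have C2: "0 \<le> C2" using Kn Ks T T' K0 c by (auto simp: C2_def intro!: divide_nonneg_pos mult_nonneg_nonneg)
  show ?thesis
  proof (rule that[of "1 + \<bar>C1\<bar> + C2"])
    fix x
    obtain w where w: "set w \<subseteq> V" "P \<theta> w = x" "cost w < D \<theta> x + 1" using D_approx[OF \<theta> zero_less_one] by metis
    show "D \<theta>' x \<le> D \<theta> x + (1 + \<bar>C1\<bar> + C2)"
    proof (cases "cost w \<le> L0")
      case True
      \<comment> \<open>Short words end in a fixed bounded set, on which the other metric is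
        bounded.\<close>
      have "norm x \<le> Kp * (cost w + (cost w)\<^sup>2)" using Kp(2)[OF w(1)] w(2) by simp
      also have "\<dots> \<le> Kp * (L0 + L0\<^sup>2)" using True Kp(1) cost_nonneg[OF w(1)] by (intro mult_left_mono add_mono power_mono) auto
      finally have "D \<theta>' x \<le> C1" by (rule C1)
      then show ?thesis using D_nonneg[OF \<theta>, of x] C2 by linarith
    next
      case False
      then have L1: "1 \<le> cost w" by (simp add: L0_def)
      with False big[of w] w obtain w1 w2 where w12: "w = w1 @ w2" "c * cost w < norm (pr (P \<theta> w1))"
        by (metis less_imp_le not_le)
      define p where "p = pr (P \<theta> w1)"
      have p: "pr p = p" "c * cost w < norm p" "p \<noteq> 0" using w12 mult_pos_pos[OF c(1), of "cost w"] L1 by (auto simp: p_def)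
      have p': "pr (P \<theta>' w1) = p" by (simp add: p_def pr_P \<theta> \<theta>')
      define z where "z = P \<theta>' w - x"
      have z_eq: "z = \<theta> (sum_list w) - \<theta>' (sum_list w)" using P_shift[OF \<theta>, of w] P_shift[OF \<theta>', of w] w(2) by (simp add: z_def)
      then have z: "z \<in> Z" using subZ admD(1) \<theta> \<theta>' by (auto intro: subspace_diff)
      have "norm z \<le> (T + T') * norm (sum_list w)"
        unfolding z_eq using norm_triangle_ineq4[of "\<theta> (sum_list w)" "\<theta>' (sum_list w)"] T(2)[of "sum_list w"] T'(2)[of "sum_list w"]
        by (simp add: distrib_right)
      also have "\<dots> \<le> (T + T') * (K0 * cost w)"
        using order_trans[OF norm_sum_list K0(2)[OF w(1)]] T T' by (intro mult_left_mono) auto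
      finally have nz: "norm z \<le> (T + T') * K0 * cost w" by simp
      \<comment> \<open>Conjugating \<open>w1\<close> by the letter u adds b u p to the product, and
        b u p = -z removes the defect. As z is O(L) and |p| exceeds c L, the size of u is bounded
        independently of the word.\<close>
      obtain u where u: "u \<in> V" "b u p = - z" "norm u \<le> Ks * norm z / norm p"
        using Ks(2)[of "- z" p] z p subZ by (auto simp: subspace_neg)
      have "Ks * norm z / norm p \<le> Ks * ((T + T') * K0 * cost w) / (c * cost w)"
        using nz p(2) Ks(1) c(1) L1 T(1) T'(1) K0(1) by (intro frac_le mult_left_mono) (auto intro!: mult_nonneg_nonneg)
      also have "\<dots> = Ks * ((T + T') * K0) / c" using L1 by simp
      finally have nu_u: "\<nu> u \<le> Kn * (Ks * ((T + T') * K0) / c)" using u(3) Kn(2)[OF u(1)] Kn(1) by (meson mult_left_mono order_trans less_imp_le)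
      let ?w = "[u] @ w1 @ [- u] @ w2"
      have wV: "set ?w \<subseteq> V" using w(1) w12(1) u(1) subV by (auto simp: subspace_neg)
      have "cost ?w = cost w + 2 * \<nu> u" using w12(1) nu(6)[OF u(1)] by simp
      also have "\<dots> \<le> D \<theta> x + 1 + C2" using w(3) nu_u by (simp add: C2_def)
      finally have cw: "cost ?w \<le> D \<theta> x + 1 + C2" .
      define t where "t = u - \<theta>' u"
      have "\<theta>' (- u) = - \<theta>' u" using linear_neg[OF admD(2)[OF \<theta>']] .
      then have mt: "- u - \<theta>' (- u) = - t" by (simp add: t_def)
      have "b t (P \<theta>' w1) = b u p"
        unfolding b_pr[of t] p' b_pr[of u p] p(1) by (simp add: t_def pr.diff admD[OF \<theta>'])
      then have bt: "b t (P \<theta>' w1) = - z" using u(2) by simp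
      have conj: "mul (mul t (P \<theta>' w1)) (- t) = P \<theta>' w1 - z"
        using mul_conjugate[of t "P \<theta>' w1"] bt by simp
      have "P \<theta>' ?w = mul (mul (mul t (P \<theta>' w1)) (- t)) (P \<theta>' w2)"
        by (simp add: P_append mul_assoc mt t_def[symmetric])
      also have "\<dots> = mul (P \<theta>' w1) (P \<theta>' w2) - z"
        unfolding conj using z by (simp add: mul_def b.diff_left)
      also have "\<dots> = x" using w12(1) by (simp add: z_def P_append)
      finally have "D \<theta>' x \<le> cost ?w" using D_le[OF wV, of \<theta>'] by simp
      then show ?thesis using cw by linarith
    qed
  qed
qed

end

section \<open>Gromov-Hausdorff distance and asymptotic cones\<close>

lemma hausdorff_dist_le:
  assumes "0 \<le> r" "\<And>x. x \<in> S \<Longrightarrow> \<exists>y\<in>T. d x y \<le> r" "\<And>y. y \<in> T \<Longrightarrow> \<exists>x\<in>S. d x y \<le> r"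
  shows "hausdorff_dist d S T \<le> r"
  unfolding hausdorff_dist_def
  by (rule cInf_lower) (use assms in \<open>auto intro!: bdd_belowI[of _ 0]\<close>)

text \<open>Ensures that the infima in the Hausdorff and Gromov-Hausdorff distances run over
  nonempty sets that are bounded below, so that they have the intended values.\<close>

definition bounded_by :: "'a set \<Rightarrow> ('a \<Rightarrow> 'a \<Rightarrow> real) \<Rightarrow> real \<Rightarrow> bool" where
  "bounded_by X d B \<longleftrightarrow> X \<noteq> {} \<and> (\<forall>x\<in>X. \<forall>y\<in>X. d x y \<le> B)"

lemma hausdorff_dist_feasible:
  assumes "Metric_space Z dZ" "isometric_embedding X dX Z dZ f" "isometric_embedding Y dY Z dZ g"
    and "bounded_by X dX B" "bounded_by Y dY B'"
  shows "\<exists>r\<ge>0. (\<forall>x \<in> f ` X. \<exists>y \<in> g ` Y. dZ x y \<le> r) \<and> (\<forall>y \<in> g ` Y. \<exists>x \<in> f ` X. dZ x y \<le> r)"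
proof -
  interpret Z: Metric_space Z dZ by fact
  obtain x0 y0 where x0: "x0 \<in> X" and y0: "y0 \<in> Y" using assms(4,5) by (auto simp: bounded_by_def)
  have fX: "\<And>x. x \<in> X \<Longrightarrow> f x \<in> Z" "\<And>x x'. x \<in> X \<Longrightarrow> x' \<in> X \<Longrightarrow> dZ (f x) (f x') = dX x x'"
    and gY: "\<And>x. x \<in> Y \<Longrightarrow> g x \<in> Z" "\<And>x x'. x \<in> Y \<Longrightarrow> x' \<in> Y \<Longrightarrow> dZ (g x) (g x') = dY x x'"
    using assms(2,3) by (auto simp: isometric_embedding_def)
  define r where "r = \<bar>B\<bar> + \<bar>B'\<bar> + dZ (f x0) (g y0)"
  have 1: "dZ (f x) (g y0) \<le> r" if "x \<in> X" for x
    using Z.triangle[of "f x" "f x0" "g y0"] fX that x0 y0 gY(1) assms(4) unfolding bounded_by_def r_def by force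
  have 2: "dZ (f x0) (g y) \<le> r" if "y \<in> Y" for y
    using Z.triangle[of "f x0" "g y0" "g y"] fX that x0 y0 gY assms(5) unfolding bounded_by_def r_def by force
  have "0 \<le> r" by (simp add: r_def)
  then show ?thesis using 1 2 x0 y0 by (intro exI[of _ r]) auto
qed

lemma hausdorff_dist_nonneg:
  assumes "Metric_space Z dZ" "isometric_embedding X dX Z dZ f" "isometric_embedding Y dY Z dZ g"
    and "bounded_by X dX B" "bounded_by Y dY B'"
  shows "0 \<le> hausdorff_dist dZ (f ` X) (g ` Y)"
  unfolding hausdorff_dist_def
  by (rule cInf_greatest) (use hausdorff_dist_feasible[OF assms] in auto)

text \<open>The distance from x to y in the disjoint union is the infimum over x' of dX x x' + dY (f
  x') y, plus \<epsilon> / 2. Triangle inequalities that pass through the other space lose at most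
  the distortion \<epsilon> of f, which the two offsets absorb; the offset also separates the
  copies.\<close>

lemma gluing:
  fixes X :: "'a set" and Y :: "'b set"
  assumes X: "Metric_space X dX" and Y: "Metric_space Y dY" and ne: "X \<noteq> {}" and eps: "0 < \<epsilon>"
    and fXY: "\<And>x. x \<in> X \<Longrightarrow> f x \<in> Y"
    and dist: "\<And>x x'. x \<in> X \<Longrightarrow> x' \<in> X \<Longrightarrow> \<bar>dY (f x) (f x') - dX x x'\<bar> \<le> \<epsilon>"
    and onto: "\<And>y. y \<in> Y \<Longrightarrow> \<exists>x\<in>X. dY y (f x) \<le> \<epsilon>"
  obtains dZ where "Metric_space (Inl ` X \<union> Inr ` Y) dZ"
    "isometric_embedding X dX (Inl ` X \<union> Inr ` Y) dZ Inl" "isometric_embedding Y dY (Inl ` X \<union> Inr ` Y) dZ Inr"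
    "hausdorff_dist dZ (Inl ` X) (Inr ` Y) \<le> 2 * \<epsilon>"
proof -
  interpret X: Metric_space X dX by fact
  interpret Y: Metric_space Y dY by fact
  define I where "I = (\<lambda>x y. (INF x'\<in>X. dX x x' + dY (f x') y))"
  have bdd: "bdd_below ((\<lambda>x'. dX x x' + dY (f x') y) ` X)" for x y
    by (rule bdd_belowI[of _ 0]) (auto intro: add_nonneg_nonneg)
  have I_le: "I x y \<le> dX x x' + dY (f x') y" if "x' \<in> X" for x y x'
    unfolding I_def by (rule cINF_lower[OF bdd that])
  have I_ge: "c \<le> I x y" if "\<And>x'. x' \<in> X \<Longrightarrow> c \<le> dX x x' + dY (f x') y" for c x y
    unfolding I_def by (rule cINF_greatest[OF ne that])
  have I0: "0 \<le> I x y" for x y by (rule I_ge) (simp add: add_nonneg_nonneg)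
  have T1: "I x y \<le> dX x x2 + I x2 y" if "x \<in> X" "x2 \<in> X" for x x2 y
  proof -
    have "I x y - dX x x2 \<le> I x2 y"
      by (rule I_ge) (use I_le[of _ x y] X.triangle[OF that] in \<open>fastforce intro: order_trans\<close>)
    then show ?thesis by simp
  qed
  have T2: "I x y2 \<le> I x y + dY y y2" if "y \<in> Y" "y2 \<in> Y" for x y y2
  proof -
    have "I x y2 - dY y y2 \<le> I x y"
    proof (rule I_ge)
      fix x' assume "x' \<in> X"
      then show "I x y2 - dY y y2 \<le> dX x x' + dY (f x') y"
        using I_le[of x' x y2] Y.triangle[of "f x'" y y2] fXY that by fastforce
    qed
    then show ?thesis by simp
  qed
  have T3: "dX x x2 \<le> I x y + I x2 y + \<epsilon>" if "x \<in> X" "x2 \<in> X" "y \<in> Y" for x x2 y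
  proof -
    have "dX x x2 - \<epsilon> - I x2 y \<le> I x y"
    proof (rule I_ge)
      fix x' assume x': "x' \<in> X"
      have "dX x x2 - \<epsilon> - (dX x x' + dY (f x') y) \<le> I x2 y"
      proof (rule I_ge)
        fix x'' assume x'': "x'' \<in> X"
        have "dX x x2 \<le> dX x x' + dX x' x'' + dX x2 x''"
          using X.triangle[of x x' x2] X.triangle[of x' x'' x2] X.commute[of x2 x''] that x' x'' by simp
        moreover have "dX x' x'' \<le> dY (f x') (f x'') + \<epsilon>" using dist[OF x' x''] by linarith
        moreover have "dY (f x') (f x'') \<le> dY (f x') y + dY (f x'') y"
          using Y.triangle[of "f x'" y "f x''"] Y.commute[of y "f x''"] fXY x' x'' that by simp
        ultimately show "dX x x2 - \<epsilon> - (dX x x' + dY (f x') y) \<le> dX x2 x'' + dY (f x'') y" by linarith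
      qed
      then show "dX x x2 - \<epsilon> - I x2 y \<le> dX x x' + dY (f x') y" by linarith
    qed
    then show ?thesis by linarith
  qed
  have T4: "dY y y2 \<le> I x y + I x y2 + \<epsilon>" if "x \<in> X" "y \<in> Y" "y2 \<in> Y" for x y y2
  proof -
    have "dY y y2 - \<epsilon> - I x y2 \<le> I x y"
    proof (rule I_ge)
      fix x' assume x': "x' \<in> X"
      have "dY y y2 - \<epsilon> - (dX x x' + dY (f x') y) \<le> I x y2"
      proof (rule I_ge)
        fix x'' assume x'': "x'' \<in> X"
        have "dY y y2 \<le> dY (f x') y + dY (f x') (f x'') + dY (f x'') y2"
          using Y.triangle[of y "f x'" y2] Y.triangle[of "f x'" "f x''" y2] Y.commute[of y "f x'"] fXY x' x'' that by simp
        moreover have "dY (f x') (f x'') \<le> dX x' x'' + \<epsilon>" using dist[OF x' x''] by linarith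
        moreover have "dX x' x'' \<le> dX x x' + dX x x''"
          using X.triangle[of x' x x''] X.commute[of x x'] x' x'' that by simp
        ultimately show "dY y y2 - \<epsilon> - (dX x x' + dY (f x') y) \<le> dX x x'' + dY (f x'') y2" by linarith
      qed
      then show "dY y y2 - \<epsilon> - I x y2 \<le> dX x x' + dY (f x') y" by linarith
    qed
    then show ?thesis by linarith
  qed
  define dZ where "dZ = (\<lambda>p q. case p of
      Inl x \<Rightarrow> (case q of Inl x' \<Rightarrow> dX x x' | Inr y \<Rightarrow> I x y + \<epsilon> / 2)
    | Inr y \<Rightarrow> (case q of Inl x \<Rightarrow> I x y + \<epsilon> / 2 | Inr y' \<Rightarrow> dY y y'))"
  have dZ [simp]: "dZ (Inl x) (Inl x') = dX x x'" "dZ (Inr y) (Inr y') = dY y y'"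
    "dZ (Inl x) (Inr y) = I x y + \<epsilon> / 2" "dZ (Inr y) (Inl x) = I x y + \<epsilon> / 2" for x x' y y'
    by (simp_all add: dZ_def)
  have I_pos: "0 < I x y + \<epsilon> / 2" for x y using I0[of x y] eps by simp
  show ?thesis
  proof (rule that)
    show "Metric_space (Inl ` X \<union> Inr ` Y) dZ"
    proof
      fix p q
      show "0 \<le> dZ p q" by (cases p; cases q) (auto intro: less_imp_le[OF I_pos])
      show "dZ p q = dZ q p" by (cases p; cases q) (auto simp: X.commute Y.commute)
    next
      fix p q assume "p \<in> Inl ` X \<union> Inr ` Y" "q \<in> Inl ` X \<union> Inr ` Y"
      then show "dZ p q = 0 \<longleftrightarrow> p = q" using less_imp_neq[OF I_pos] by (auto simp: X.zero Y.zero dest: sym)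
    next
      fix p q s assume "p \<in> Inl ` X \<union> Inr ` Y" "q \<in> Inl ` X \<union> Inr ` Y" "s \<in> Inl ` X \<union> Inr ` Y"
      moreover have "I x' y \<le> I x y + dX x x'" if "x \<in> X" "x' \<in> X" for x x' y
        using T1[of x' x y] X.commute[of x x'] that by simp
      moreover have "I x y \<le> dY y y' + I x y'" if "y \<in> Y" "y' \<in> Y" for x y y'
        using T2[of y' y x] Y.commute[of y y'] that by simp
      moreover have "dX x x2 \<le> I x y + \<epsilon> / 2 + (I x2 y + \<epsilon> / 2)" if "x \<in> X" "x2 \<in> X" "y \<in> Y" for x x2 y
        using T3[OF that] by simp
      moreover have "dY y y2 \<le> I x y + \<epsilon> / 2 + (I x y2 + \<epsilon> / 2)" if "x \<in> X" "y \<in> Y" "y2 \<in> Y" for x y y2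
        using T4[OF that] by simp
      ultimately show "dZ p s \<le> dZ p q + dZ q s"
        using X.triangle Y.triangle T1 T2 by (elim UnE imageE) simp_all
    qed
    show "isometric_embedding X dX (Inl ` X \<union> Inr ` Y) dZ Inl" "isometric_embedding Y dY (Inl ` X \<union> Inr ` Y) dZ Inr"
      by (auto simp: isometric_embedding_def)
    show "hausdorff_dist dZ (Inl ` X) (Inr ` Y) \<le> 2 * \<epsilon>"
    proof (rule hausdorff_dist_le)
      show "0 \<le> 2 * \<epsilon>" using eps by simp
      fix p :: "'a + 'b" assume "p \<in> Inl ` X"
      then obtain x where x: "x \<in> X" "p = Inl x" by blast
      have "I x (f x) \<le> 0" using I_le[OF x(1), of x "f x"] x fXY by simp
      then show "\<exists>q\<in>Inr ` Y. dZ p q \<le> 2 * \<epsilon>" using x fXY eps by (intro bexI[of _ "Inr (f x)"]) auto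
    next
      fix q :: "'a + 'b" assume "q \<in> Inr ` Y"
      then obtain y where y: "y \<in> Y" "q = Inr y" by blast
      obtain x where x: "x \<in> X" "dY y (f x) \<le> \<epsilon>" using onto[OF y(1)] by blast
      have "I x y \<le> \<epsilon>" using I_le[OF x(1), of x y] x Y.commute[of y "f x"] by simp
      then show "\<exists>p\<in>Inl ` X. dZ p q \<le> 2 * \<epsilon>" using x y eps by (intro bexI[of _ "Inl x"]) auto
    qed
  qed
qed

context
  fixes X :: "'a set" and dX and Y :: "'b set" and dY and B B' :: real
  assumes X: "Metric_space X dX" and Y: "Metric_space Y dY"
    and bX: "bounded_by X dX B" and bY: "bounded_by Y dY B'"
begin

lemma gromov_hausdorff_dist_le:
  assumes "0 < \<epsilon>" "\<And>x. x \<in> X \<Longrightarrow> f x \<in> Y"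
    "\<And>x x'. x \<in> X \<Longrightarrow> x' \<in> X \<Longrightarrow> \<bar>dY (f x) (f x') - dX x x'\<bar> \<le> \<epsilon>"
    "\<And>y. y \<in> Y \<Longrightarrow> \<exists>x\<in>X. dY y (f x) \<le> \<epsilon>"
  shows "gromov_hausdorff_dist X dX Y dY \<le> 2 * \<epsilon>"
proof -
  have ne: "X \<noteq> {}" using bX by (simp add: bounded_by_def)
  obtain dZ where dZ: "Metric_space (Inl ` X \<union> Inr ` Y) dZ"
    "isometric_embedding X dX (Inl ` X \<union> Inr ` Y) dZ Inl" "isometric_embedding Y dY (Inl ` X \<union> Inr ` Y) dZ Inr"
    "hausdorff_dist dZ (Inl ` X) (Inr ` Y) \<le> 2 * \<epsilon>"
    using gluing[OF X Y ne assms] by metis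
  have "gromov_hausdorff_dist X dX Y dY \<le> hausdorff_dist dZ (Inl ` X) (Inr ` Y)"
    unfolding gromov_hausdorff_dist_def
  proof (rule cInf_lower)
    show "bdd_below {hausdorff_dist dZ (f ` X) (g ` Y) |(Z :: ('a + 'b) set) dZ f g.
       Metric_space Z dZ \<and> isometric_embedding X dX Z dZ f \<and> isometric_embedding Y dY Z dZ g}"
      by (rule bdd_belowI[of _ 0]) (use hausdorff_dist_nonneg bX bY in blast)
  qed (use dZ in blast)
  then show ?thesis using dZ(4) by linarith
qed

text \<open>A constant map is an \<epsilon>-approximation once \<epsilon> exceeds both diameter
  bounds, so gluing along it produces a common ambient space.\<close>

lemma gromov_hausdorff_set_nonempty:
  "{hausdorff_dist dZ (f ` X) (g ` Y) |(Z :: ('a + 'b) set) dZ f g.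
       Metric_space Z dZ \<and> isometric_embedding X dX Z dZ f \<and> isometric_embedding Y dY Z dZ g} \<noteq> {}"
proof -
  interpret X: Metric_space X dX by (rule X)
  interpret Y: Metric_space Y dY by (rule Y)
  have ne: "X \<noteq> {}" using bX by (simp add: bounded_by_def)
  then obtain x0 where x0: "x0 \<in> X" by blast
  obtain y0 where y0: "y0 \<in> Y" using bY by (auto simp: bounded_by_def)
  obtain dZ where dZ: "Metric_space (Inl ` X \<union> Inr ` Y) dZ"
    "isometric_embedding X dX (Inl ` X \<union> Inr ` Y) dZ Inl" "isometric_embedding Y dY (Inl ` X \<union> Inr ` Y) dZ Inr"
  proof (rule gluing[OF X Y ne, of "\<bar>B\<bar> + \<bar>B'\<bar> + 1" "\<lambda>_. y0"])
    fix x x' assume "x \<in> X" "x' \<in> X"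
    then have "dX x x' \<le> B" using bX by (auto simp: bounded_by_def)
    then show "\<bar>dY y0 y0 - dX x x'\<bar> \<le> \<bar>B\<bar> + \<bar>B'\<bar> + 1" using y0 by simp
  next
    fix y assume "y \<in> Y"
    then have "dY y y0 \<le> B'" using bY y0 by (auto simp: bounded_by_def)
    then show "\<exists>x\<in>X. dY y y0 \<le> \<bar>B\<bar> + \<bar>B'\<bar> + 1" using x0 by (intro bexI[of _ x0]) auto
  qed (use y0 in auto)
  then show ?thesis by blast
qed

lemma gromov_hausdorff_dist_nonneg: "0 \<le> gromov_hausdorff_dist X dX Y dY"
  unfolding gromov_hausdorff_dist_def
  by (rule cInf_greatest[OF gromov_hausdorff_set_nonempty]) (use hausdorff_dist_nonneg bX bY in blast)

text \<open>Send x to a point of Y that is less than \<epsilon> away in some common ambient space; a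
  distance then changes by less than \<epsilon> at each of its two ends.\<close>

lemma gromov_hausdorff_approximation:
  assumes "gromov_hausdorff_dist X dX Y dY < \<epsilon>"
  obtains f where "\<And>x. x \<in> X \<Longrightarrow> f x \<in> Y"
    "\<And>x x'. x \<in> X \<Longrightarrow> x' \<in> X \<Longrightarrow> \<bar>dY (f x) (f x') - dX x x'\<bar> \<le> 2 * \<epsilon>"
    "\<And>y. y \<in> Y \<Longrightarrow> \<exists>x\<in>X. dY y (f x) \<le> 2 * \<epsilon>"
proof -
  obtain Z :: "('a + 'b) set" and dZ f0 g0 where Z: "Metric_space Z dZ" "isometric_embedding X dX Z dZ f0"
    "isometric_embedding Y dY Z dZ g0" "hausdorff_dist dZ (f0 ` X) (g0 ` Y) < \<epsilon>"
    using cInf_lessD[OF gromov_hausdorff_set_nonempty assms[unfolded gromov_hausdorff_dist_def]] by blast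
  interpret Z: Metric_space Z dZ by fact
  have fX: "\<And>x. x \<in> X \<Longrightarrow> f0 x \<in> Z" "\<And>x x'. x \<in> X \<Longrightarrow> x' \<in> X \<Longrightarrow> dZ (f0 x) (f0 x') = dX x x'"
    and gY: "\<And>x. x \<in> Y \<Longrightarrow> g0 x \<in> Z" "\<And>x x'. x \<in> Y \<Longrightarrow> x' \<in> Y \<Longrightarrow> dZ (g0 x) (g0 x') = dY x x'"
    using Z(2,3) by (auto simp: isometric_embedding_def)
  have "{r. 0 \<le> r \<and> (\<forall>x \<in> f0 ` X. \<exists>y \<in> g0 ` Y. dZ x y \<le> r) \<and> (\<forall>y \<in> g0 ` Y. \<exists>x \<in> f0 ` X. dZ x y \<le> r)} \<noteq> {}"
    using hausdorff_dist_feasible[OF Z(1-3) bX bY] by blast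
  from cInf_lessD[OF this Z(4)[unfolded hausdorff_dist_def]] obtain r where r: "0 \<le> r" "r < \<epsilon>"
    "\<And>x. x \<in> X \<Longrightarrow> \<exists>y\<in>Y. dZ (f0 x) (g0 y) \<le> r" "\<And>y. y \<in> Y \<Longrightarrow> \<exists>x\<in>X. dZ (f0 x) (g0 y) \<le> r"
    by auto
  obtain f where f: "\<And>x. x \<in> X \<Longrightarrow> f x \<in> Y" "\<And>x. x \<in> X \<Longrightarrow> dZ (f0 x) (g0 (f x)) \<le> r" using r(3) by metis
  show ?thesis
  proof (rule that[OF f(1)])
    fix x x' assume x: "x \<in> X" "x' \<in> X"
    have "dX x x' \<le> r + dY (f x) (f x') + r"
      using Z.triangle[of "f0 x" "g0 (f x)" "f0 x'"] Z.triangle[of "g0 (f x)" "g0 (f x')" "f0 x'"]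
        Z.commute[of "f0 x'" "g0 (f x')"] f[OF x(1)] f[OF x(2)] fX gY x by fastforce
    moreover have "dY (f x) (f x') \<le> r + dX x x' + r"
      using Z.triangle[of "g0 (f x)" "f0 x" "g0 (f x')"] Z.triangle[of "f0 x" "f0 x'" "g0 (f x')"]
        Z.commute[of "f0 x" "g0 (f x)"] f[OF x(1)] f[OF x(2)] fX gY x by fastforce
    ultimately show "\<bar>dY (f x) (f x') - dX x x'\<bar> \<le> 2 * \<epsilon>" using r by linarith
  next
    fix y assume y: "y \<in> Y"
    obtain x where x: "x \<in> X" "dZ (f0 x) (g0 y) \<le> r" using r(4)[OF y] by blast
    have "dY y (f x) \<le> dZ (g0 y) (f0 x) + dZ (f0 x) (g0 (f x))"
      using Z.triangle[of "g0 y" "f0 x" "g0 (f x)"] f[OF x(1)] fX gY x y by fastforce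
    then have "dY y (f x) \<le> r + r" using x f(2)[OF x(1)] Z.commute[of "f0 x" "g0 y"] by simp
    then show "\<exists>x\<in>X. dY y (f x) \<le> 2 * \<epsilon>" using r x by (intro bexI[of _ x]) auto
  qed
qed

end

text \<open>\<open>s n\<close> models the dilation by 1 / n into the cone: it is onto, respects base
  points and distorts d / n by at most C / n. \<open>cut\<close> is an approximate length property,
  by which a ball of slightly larger radius stays close to the given ball; convergence of the balls
  rests on it.\<close>

locale conical_approximation =
  fixes X :: "'a set" and d p and Y :: "'b set" and e q and s :: "nat \<Rightarrow> 'a \<Rightarrow> 'b" and C :: real
  assumes properX: "proper_metric_space X d" and properY: "proper_metric_space Y e"
    and pX: "p \<in> X" and qY: "q \<in> Y" and C_pos: "0 < C"
    and s_onto: "\<And>n. 1 \<le> n \<Longrightarrow> s n ` X = Y" and s_base: "\<And>n. 1 \<le> n \<Longrightarrow> s n p = q"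
    and s_est: "\<And>n x x'. 1 \<le> n \<Longrightarrow> x \<in> X \<Longrightarrow> x' \<in> X \<Longrightarrow> \<bar>d x x' / real n - e (s n x) (s n x')\<bar> \<le> C / real n"
    and cut: "\<And>y R \<eta>. y \<in> Y \<Longrightarrow> 0 \<le> R \<Longrightarrow> 0 < \<eta> \<Longrightarrow> e q y \<le> R + \<eta> \<Longrightarrow> \<exists>y'\<in>Y. e q y' \<le> R \<and> e y' y \<le> 2 * \<eta>"
begin

sublocale X: Metric_space X d using properX by (simp add: proper_metric_space_def)
sublocale Y: Metric_space Y e using properY by (simp add: proper_metric_space_def)

abbreviation "dn n \<equiv> (\<lambda>x y. d x y / real n)"

lemma metric_dn: "1 \<le> n \<Longrightarrow> Metric_space X (dn n)"
  by unfold_locales (auto simp: X.commute divide_right_mono add_divide_distrib[symmetric] X.triangle)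

definition Bn :: "nat \<Rightarrow> real \<Rightarrow> 'a set" where "Bn n R = {x \<in> X. d p x / real n \<le> R}"
definition BY :: "real \<Rightarrow> 'b set" where "BY R = {y \<in> Y. e q y \<le> R}"

lemma mcball_dn: "1 \<le> n \<Longrightarrow> Metric_space.mcball X (dn n) p R = Bn n R"
  unfolding Metric_space.mcball_def[OF metric_dn] Bn_def using pX by auto

lemma mcball_Y: "Y.mcball q R = BY R"
  unfolding Y.mcball_def BY_def using qY by auto

lemma near_Y:
  assumes n: "1 \<le> n" and R: "0 < R" and x: "x \<in> Bn n R"
  shows "\<exists>y\<in>BY R. e y (s n x) \<le> 2 * C / real n"
proof -
  have xX: "x \<in> X" using x by (simp add: Bn_def)
  have sx: "s n x \<in> Y" using s_onto[OF n] xX by blast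
  have "e q (s n x) \<le> R + C / real n"
    using s_est[OF n pX xX] s_base[OF n] x by (auto simp: Bn_def abs_le_iff)
  from cut[OF sx _ _ this] show ?thesis using R C_pos n by (auto simp: BY_def)
qed

lemma near_X:
  assumes n: "1 \<le> n" and R: "C / real n \<le> R" and y: "y \<in> BY R"
  shows "\<exists>x\<in>Bn n R. e y (s n x) \<le> 2 * C / real n"
proof -
  have yY: "y \<in> Y" "e q y \<le> R" using y by (auto simp: BY_def)
  \<comment> \<open>Cutting at the smaller radius R - C / n leaves room for the distortion, so that
    the preimage under \<open>s n\<close> lies in the ball of radius R.\<close>
  have "e q y \<le> (R - C / real n) + C / real n" using yY by simp
  from cut[OF yY(1) _ _ this] obtain y' where y': "y' \<in> Y" "e q y' \<le> R - C / real n" "e y' y \<le> 2 * (C / real n)"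
    using R C_pos n by auto
  obtain x where x: "x \<in> X" "s n x = y'" using s_onto[OF n] y'(1) by blast
  have "d p x / real n \<le> R" using s_est[OF n pX x(1)] s_base[OF n] x(2) y'(2) by (simp add: abs_le_iff)
  then show ?thesis using x y' Y.commute[of y y'] by (intro bexI[of _ x]) (auto simp: Bn_def)
qed

lemma dn_e_est:
  assumes "1 \<le> n" "x \<in> X" "x' \<in> X" "y \<in> Y" "y' \<in> Y" "e y (s n x) \<le> 2 * C / real n" "e y' (s n x') \<le> 2 * C / real n"
  shows "\<bar>e y y' - d x x' / real n\<bar> \<le> 5 * C / real n"
proof -
  have sY: "s n x \<in> Y" "s n x' \<in> Y" using s_onto[OF assms(1)] assms by blast+
  have "e y y' \<le> e y (s n x) + e (s n x) (s n x') + e y' (s n x')"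
    using Y.triangle[of y "s n x" y'] Y.triangle[of "s n x" "s n x'" y'] Y.commute[of y' "s n x'"] sY assms by simp
  moreover have "e (s n x) (s n x') \<le> e y (s n x) + e y y' + e y' (s n x')"
    using Y.triangle[of "s n x" y "s n x'"] Y.triangle[of y y' "s n x'"] Y.commute[of y "s n x"] sY assms by simp
  ultimately have "\<bar>e y y' - e (s n x) (s n x')\<bar> \<le> 2 * C / real n + 2 * C / real n"
    using assms(6,7) by linarith
  moreover have "2 * C / real n + 2 * C / real n + C / real n = 5 * C / real n" by (simp add: field_simps)
  ultimately show ?thesis using s_est[OF assms(1-3)] by linarith
qed

lemma bounded_balls: "1 \<le> n \<Longrightarrow> 0 < R \<Longrightarrow> bounded_by (Bn n R) (dn n) (2 * R)" "0 < R \<Longrightarrow> bounded_by (BY R) e (2 * R)"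
proof -
  assume n: "1 \<le> n" and R: "0 < R"
  interpret D: Metric_space X "dn n" by (rule metric_dn[OF n])
  have "d x y / real n \<le> 2 * R" if "x \<in> Bn n R" "y \<in> Bn n R" for x y
    using D.triangle[of x p y] that pX X.commute[of x p] by (auto simp: Bn_def)
  moreover have "p \<in> Bn n R" using pX R by (simp add: Bn_def)
  ultimately show "bounded_by (Bn n R) (dn n) (2 * R)" unfolding bounded_by_def by blast
next
  assume R: "0 < R"
  have "e x y \<le> 2 * R" if "x \<in> BY R" "y \<in> BY R" for x y
    using Y.triangle[of x q y] that qY Y.commute[of x q] by (auto simp: BY_def)
  moreover have "q \<in> BY R" using qY R by (simp add: BY_def)
  ultimately show "bounded_by (BY R) e (2 * R)" unfolding bounded_by_def by blast
qed

lemma metric_balls: "1 \<le> n \<Longrightarrow> Metric_space (Bn n R) (dn n)" "Metric_space (BY R) e"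
  by (auto intro: Metric_space.subspace[OF metric_dn] Y.subspace simp: Bn_def BY_def)

lemma is_asymptotic_cone: "asymptotic_cone X d p Y e q"
  unfolding asymptotic_cone_def
proof (intro conjI allI impI properX properY pX qY)
  fix R :: real assume R: "0 < R"
  let ?gh = "\<lambda>n. gromov_hausdorff_dist (Metric_space.mcball X (dn n) p R) (dn n) (Y.mcball q R) e"
  have lim0: "(\<lambda>n. c / real n) \<longlonglongrightarrow> 0" for c by (rule lim_const_over_n)
  have ev: "\<forall>\<^sub>F n in sequentially. 1 \<le> n \<and> C / real n < R"
    using eventually_ge_at_top[of 1] order_tendstoD(2)[OF lim0 R] by eventually_elim simp
  show "?gh \<longlonglongrightarrow> 0"
  proof (rule tendsto_sandwich)
    show "\<forall>\<^sub>F n in sequentially. 0 \<le> ?gh n"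
      using ev by eventually_elim
        (simp add: mcball_dn mcball_Y gromov_hausdorff_dist_nonneg[OF metric_balls bounded_balls] R)
    show "\<forall>\<^sub>F n in sequentially. ?gh n \<le> 2 * (5 * C / real n)"
      using ev
    proof eventually_elim
      case (elim n)
      then have n: "1 \<le> n" by simp
      obtain f where f: "\<And>x. x \<in> Bn n R \<Longrightarrow> f x \<in> BY R \<and> e (f x) (s n x) \<le> 2 * C / real n"
        using near_Y[OF n R] by metis
      have "gromov_hausdorff_dist (Bn n R) (dn n) (BY R) e \<le> 2 * (5 * C / real n)"
      proof (rule gromov_hausdorff_dist_le[OF metric_balls bounded_balls])
        show "0 < 5 * C / real n" using C_pos n by simp
        show "f x \<in> BY R" if "x \<in> Bn n R" for x using f[OF that] by blast
        show "\<bar>e (f x) (f x') - d x x' / real n\<bar> \<le> 5 * C / real n" if "x \<in> Bn n R" "x' \<in> Bn n R" for x x'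
          using f[OF that(1)] f[OF that(2)] that n by (intro dn_e_est) (auto simp: Bn_def BY_def)
        fix y assume y: "y \<in> BY R"
        obtain x where x: "x \<in> Bn n R" "e y (s n x) \<le> 2 * C / real n" using near_X[OF n _ y] elim by force
        have "\<bar>e y (f x) - d x x / real n\<bar> \<le> 5 * C / real n"
          using f[OF x(1)] x y n by (intro dn_e_est) (auto simp: Bn_def BY_def)
        then show "\<exists>x\<in>Bn n R. e y (f x) \<le> 5 * C / real n" using x(1) by (intro bexI[of _ x]) (auto simp: Bn_def)
      qed (use n R in auto)
      then show ?case using n by (simp add: mcball_dn mcball_Y)
    qed
    show "(\<lambda>n. 2 * (5 * C / real n)) \<longlonglongrightarrow> 0" using tendsto_mult_right_zero[OF lim0] .
  qed simp
qed

end

text \<open>\<open>base\<close> is the rigidity needed because approximations may ignore base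
  points: a point from which the ball of radius m looks almost like a centred ball is near q. The
  term \<open>2 / (real m + 1)\<close> is twice the error allowed in the approximations below, and
  \<open>S\<close> is a countable net for a diagonal argument.\<close>

locale rigid_conical_approximation = conical_approximation X d p Y e q s C
  for X :: "'a set" and d p and Y :: "'b set" and e q and s :: "nat \<Rightarrow> 'a \<Rightarrow> 'b" and C :: real +
  fixes M :: real and S :: "'b set"
  assumes base: "\<And>m a. 1 \<le> m \<Longrightarrow> a \<in> Y \<Longrightarrow> e q a \<le> real m \<Longrightarrow>
      (\<And>y. y \<in> Y \<Longrightarrow> e q y \<le> real m \<Longrightarrow> e a y \<le> real m + 2 / (real m + 1)) \<Longrightarrow> e q a \<le> M"
    and S: "countable S" "S \<subseteq> Y" "\<And>y. y \<in> Y \<Longrightarrow> \<exists>z\<in>S. e y z < 1"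
begin

text \<open>Compose a Gromov-Hausdorff approximation of the ball of radius m at scale n with an
  approximate inverse of \<open>s n\<close>. A scale n chosen large in terms of m makes the total
  error at most \<open>1 / (real m + 1)\<close>.\<close>

lemma approximations:
  assumes cone: "asymptotic_cone X d p W dW w0" and m: "1 \<le> m"
  obtains G where "\<And>y. y \<in> BY (real m) \<Longrightarrow> G y \<in> W \<and> dW w0 (G y) \<le> real m"
    "\<And>y y'. y \<in> BY (real m) \<Longrightarrow> y' \<in> BY (real m) \<Longrightarrow> \<bar>dW (G y) (G y') - e y y'\<bar> \<le> 1 / (real m + 1)"
    "\<And>w. w \<in> W \<Longrightarrow> dW w0 w \<le> real m \<Longrightarrow> \<exists>y\<in>BY (real m). dW w (G y) \<le> 1 / (real m + 1)"
proof -
  have W: "proper_metric_space W dW" "w0 \<in> W" using cone by (auto simp: asymptotic_cone_def)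
  interpret W: Metric_space W dW using W(1) by (simp add: proper_metric_space_def)
  define R where "R = real m"
  have R: "0 < R" using m by (simp add: R_def)
  define BW where "BW = {w \<in> W. dW w0 w \<le> R}"
  have mcW: "W.mcball w0 R = BW" unfolding W.mcball_def BW_def using W(2) by auto
  define \<delta> where "\<delta> = 1 / (real m + 1)"
  have \<delta>: "0 < \<delta>" by (simp add: \<delta>_def)
  let ?gh = "\<lambda>n. gromov_hausdorff_dist (Metric_space.mcball X (dn n) p R) (dn n) (W.mcball w0 R) dW"
  have "?gh \<longlonglongrightarrow> 0" using cone R unfolding asymptotic_cone_def by blast
  then have "\<forall>\<^sub>F n in sequentially. ?gh n < \<delta> / 8" using \<delta> by (intro order_tendstoD(2)) auto
  moreover have "\<forall>\<^sub>F n in sequentially. (5 * C) / real n < \<delta> / 4"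
    using \<delta> by (intro order_tendstoD(2)[OF lim_const_over_n]) auto
  moreover have "\<forall>\<^sub>F n in sequentially. C / real n < R"
    using R by (intro order_tendstoD(2)[OF lim_const_over_n])
  ultimately have "\<forall>\<^sub>F n in sequentially. 1 \<le> n \<and> ?gh n < \<delta> / 8 \<and> (5 * C) / real n < \<delta> / 4 \<and> C / real n < R"
    using eventually_ge_at_top[of 1] by eventually_elim simp
  then obtain n where n: "1 \<le> n" "?gh n < \<delta> / 8" "(5 * C) / real n < \<delta> / 4" "C / real n < R"
    by (auto simp: eventually_sequentially)
  have mW: "Metric_space BW dW" by (rule W.subspace) (auto simp: BW_def)
  have bW: "bounded_by BW dW (2 * R)"
  proof -
    have "dW x y \<le> 2 * R" if "x \<in> BW" "y \<in> BW" for x y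
      using W.triangle[of x w0 y] that W(2) W.commute[of x w0] by (auto simp: BW_def)
    moreover have "w0 \<in> BW" using W(2) R by (simp add: BW_def)
    ultimately show ?thesis unfolding bounded_by_def by blast
  qed
  have "gromov_hausdorff_dist (Bn n R) (dn n) BW dW < \<delta> / 8" using n(1,2) by (simp add: mcball_dn mcW)
  from gromov_hausdorff_approximation[OF metric_balls(1)[OF n(1)] mW bounded_balls(1)[OF n(1) R] bW this]
  obtain F where F: "\<And>x. x \<in> Bn n R \<Longrightarrow> F x \<in> BW"
    "\<And>x x'. x \<in> Bn n R \<Longrightarrow> x' \<in> Bn n R \<Longrightarrow> \<bar>dW (F x) (F x') - d x x' / real n\<bar> \<le> 2 * (\<delta> / 8)"
    "\<And>w. w \<in> BW \<Longrightarrow> \<exists>x\<in>Bn n R. dW w (F x) \<le> 2 * (\<delta> / 8)"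
    by metis
  obtain t where t: "\<And>y. y \<in> BY R \<Longrightarrow> t y \<in> Bn n R \<and> e y (s n (t y)) \<le> 2 * C / real n"
    using near_X[OF n(1) less_imp_le[OF n(4)]] by metis
  show ?thesis
  proof (rule that[of "F \<circ> t"])
    fix y assume "y \<in> BY (real m)"
    then have "F (t y) \<in> BW" using t F(1) by (simp add: R_def)
    then show "(F \<circ> t) y \<in> W \<and> dW w0 ((F \<circ> t) y) \<le> real m" by (simp add: BW_def R_def)
  next
    fix y y' assume "y \<in> BY (real m)" "y' \<in> BY (real m)"
    then have y: "y \<in> BY R" "y' \<in> BY R" by (simp_all add: R_def)
    have "\<bar>e y y' - d (t y) (t y') / real n\<bar> \<le> 5 * C / real n"
      using t[OF y(1)] t[OF y(2)] y n by (intro dn_e_est) (auto simp: Bn_def BY_def)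
    moreover have "\<bar>dW (F (t y)) (F (t y')) - d (t y) (t y') / real n\<bar> \<le> 2 * (\<delta> / 8)"
      using t y by (intro F(2)) auto
    ultimately show "\<bar>dW ((F \<circ> t) y) ((F \<circ> t) y') - e y y'\<bar> \<le> 1 / (real m + 1)"
      using n(3) \<delta> unfolding \<delta>_def[symmetric] comp_def by linarith
  next
    fix w assume "w \<in> W" "dW w0 w \<le> real m"
    then have w: "w \<in> BW" by (simp add: BW_def R_def)
    obtain x where x: "x \<in> Bn n R" "dW w (F x) \<le> 2 * (\<delta> / 8)" using F(3)[OF w] by blast
    obtain y where y: "y \<in> BY R" "e y (s n x) \<le> 2 * C / real n" using near_Y[OF n(1) R x(1)] by blast
    have "\<bar>e y y - d x (t y) / real n\<bar> \<le> 5 * C / real n"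
      using t[OF y(1)] x y n by (intro dn_e_est) (auto simp: Bn_def BY_def)
    moreover have "e y y = 0" using y(1) by (simp add: BY_def)
    moreover have "\<bar>dW (F x) (F (t y)) - d x (t y) / real n\<bar> \<le> 2 * (\<delta> / 8)"
      using t x y by (intro F(2)) auto
    moreover have "dW w (F (t y)) \<le> dW w (F x) + dW (F x) (F (t y))"
      using w F(1)[OF x(1)] F(1)[of "t y"] t[OF y(1)] by (intro W.triangle) (auto simp: BW_def)
    ultimately have "dW w (F (t y)) \<le> \<delta>" using x(2) n(3) \<delta> by linarith
    then show "\<exists>y\<in>BY (real m). dW w ((F \<circ> t) y) \<le> 1 / (real m + 1)" using y(1) by (auto simp: R_def \<delta>_def)
  qed
qed

text \<open>The almost isometries \<open>G m\<close> of the balls of radius \<open>m\<close> move the base point by a bounded amount, by the assumption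
  \<open>base\<close>. As the cone is proper, a diagonal subsequence converges on the countable net \<open>S\<close>, isometrically.\<close>

theorem quasi_isometric_cone:
  assumes cone: "asymptotic_cone X d p W dW w0"
  shows "\<exists>C'>0. quasi_isometric_1 C' X d W dW"
proof -
  have W: "proper_metric_space W dW" "w0 \<in> W" using cone by (auto simp: asymptotic_cone_def)
  interpret W: Metric_space W dW using W(1) by (simp add: proper_metric_space_def)
  let ?\<delta> = "\<lambda>m::nat. 1 / (real m + 1)"
  have "\<forall>m. \<exists>G. 1 \<le> m \<longrightarrow> (\<forall>y\<in>BY (real m). G y \<in> W \<and> dW w0 (G y) \<le> real m) \<and>
    (\<forall>y\<in>BY (real m). \<forall>y'\<in>BY (real m). \<bar>dW (G y) (G y') - e y y'\<bar> \<le> ?\<delta> m) \<and>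
    (\<forall>w\<in>W. dW w0 w \<le> real m \<longrightarrow> (\<exists>y\<in>BY (real m). dW w (G y) \<le> ?\<delta> m))"
  proof
    fix m :: nat
    show "\<exists>G. 1 \<le> m \<longrightarrow> (\<forall>y\<in>BY (real m). G y \<in> W \<and> dW w0 (G y) \<le> real m) \<and>
    (\<forall>y\<in>BY (real m). \<forall>y'\<in>BY (real m). \<bar>dW (G y) (G y') - e y y'\<bar> \<le> ?\<delta> m) \<and>
    (\<forall>w\<in>W. dW w0 w \<le> real m \<longrightarrow> (\<exists>y\<in>BY (real m). dW w (G y) \<le> ?\<delta> m))"
    proof (cases "1 \<le> m")
      case True
      show ?thesis by (rule approximations[OF cone True]) blast
    qed simp
  qed
  from choice[OF this] obtain G where G: "\<And>m y. 1 \<le> m \<Longrightarrow> y \<in> BY (real m) \<Longrightarrow> G m y \<in> W \<and> dW w0 (G m y) \<le> real m"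
    "\<And>m y y'. 1 \<le> m \<Longrightarrow> y \<in> BY (real m) \<Longrightarrow> y' \<in> BY (real m) \<Longrightarrow> \<bar>dW (G m y) (G m y') - e y y'\<bar> \<le> ?\<delta> m"
    "\<And>m w. 1 \<le> m \<Longrightarrow> w \<in> W \<Longrightarrow> dW w0 w \<le> real m \<Longrightarrow> \<exists>y\<in>BY (real m). dW w (G m y) \<le> ?\<delta> m"
    by metis
  have \<delta>1: "?\<delta> m \<le> 1" "0 < ?\<delta> m" for m by (simp_all add: divide_le_eq)
  have qB: "q \<in> BY (real m)" for m using qY by (simp add: BY_def)
  \<comment> \<open>A point a that is sent near \<open>w0\<close> sees the whole ball of radius m
    within about m, because all images lie within m of \<open>w0\<close>. So \<open>base\<close>
    puts a near q, and \<open>G m q\<close> is near \<open>w0\<close>.\<close>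
  have Gq: "dW w0 (G m q) \<le> M + 2" if m: "1 \<le> m" for m
  proof -
    obtain a where a: "a \<in> BY (real m)" "dW w0 (G m a) \<le> ?\<delta> m" using G(3)[OF m W(2)] W(2) by auto
    have aY: "a \<in> Y" "e q a \<le> real m" using a(1) by (auto simp: BY_def)
    have "e q a \<le> M"
    proof (rule base[OF m aY])
      fix y assume "y \<in> Y" "e q y \<le> real m"
      then have y: "y \<in> BY (real m)" by (simp add: BY_def)
      have "e a y \<le> dW (G m a) (G m y) + ?\<delta> m" using G(2)[OF m a(1) y] by linarith
      moreover have "dW (G m a) (G m y) \<le> dW w0 (G m a) + dW w0 (G m y)"
        using W.triangle[of "G m a" w0 "G m y"] W.commute[of w0 "G m a"] G(1)[OF m a(1)] G(1)[OF m y] W(2) by simp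
      ultimately show "e a y \<le> real m + 2 / (real m + 1)" using a(2) G(1)[OF m y] by simp
    qed
    moreover have "dW (G m a) (G m q) \<le> e a q + ?\<delta> m" using G(2)[OF m a(1) qB] by linarith
    moreover have "dW w0 (G m q) \<le> dW w0 (G m a) + dW (G m a) (G m q)"
      using G(1)[OF m a(1)] G(1)[OF m qB] W(2) by (intro W.triangle) auto
    ultimately show ?thesis using a(2) \<delta>1(1)[of m] Y.commute[of a q] by linarith
  qed
  have Gy: "dW w0 (G m y) \<le> e q y + M + 3" if m: "1 \<le> m" and y: "y \<in> BY (real m)" for m y
  proof -
    have "dW w0 (G m y) \<le> dW w0 (G m q) + dW (G m q) (G m y)"
      using G(1)[OF m y] G(1)[OF m qB] W(2) by (intro W.triangle) auto
    then show ?thesis using Gq[OF m] G(2)[OF m qB y] \<delta>1(1)[of m] by linarith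
  qed
  have Sne: "S \<noteq> {}" using S(3)[OF qY] by blast
  define z where "z = from_nat_into S"
  have zY: "z i \<in> Y" for i using from_nat_into[OF Sne] S(2) by (auto simp: z_def)
  have z_dense: "\<exists>i. e y (z i) < 1" if "y \<in> Y" for y
    using S(3)[OF that] from_nat_into_surj[OF S(1)] unfolding z_def by metis
  \<comment> \<open>The default \<open>w0\<close> makes the sequence total; for each i it occurs for
    finitely many m.\<close>
  define H where "H = (\<lambda>m i. if 1 \<le> m \<and> e q (z i) \<le> real m then G m (z i) else w0)"
  define R where "R = (\<lambda>i. \<bar>e q (z i) + M + 3\<bar>)"
  have H_ball: "H m i \<in> W.mcball w0 (R i)" for m i
  proof (cases "1 \<le> m \<and> e q (z i) \<le> real m")
    case True
    then have zB: "z i \<in> BY (real m)" using zY by (simp add: BY_def)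
    show ?thesis using True G(1)[OF _ zB] Gy[OF _ zB] W(2) by (auto simp: H_def R_def)
  next
    case False
    then show ?thesis using W(2) by (auto simp: H_def R_def)
  qed
  interpret subseqs "\<lambda>i r. \<exists>l\<in>W. (\<lambda>k. dW (H (r k) i) l) \<longlonglongrightarrow> 0"
  proof
    fix i and r :: "nat \<Rightarrow> nat" assume "strict_mono r"
    have "compactin W.mtopology (W.mcball w0 (R i))" using W by (simp add: proper_metric_space_def)
    moreover have "range (\<lambda>k. H (r k) i) \<subseteq> W.mcball w0 (R i)" using H_ball by blast
    ultimately obtain l r' where "l \<in> W.mcball w0 (R i)" "strict_mono r'" "limitin W.mtopology ((\<lambda>k. H (r k) i) \<circ> r') l sequentially"
      unfolding W.compactin_sequentially by blast
    then show "\<exists>r'. strict_mono r' \<and> (\<exists>l\<in>W. (\<lambda>k. dW (H ((r \<circ> r') k) i) l) \<longlonglongrightarrow> 0)"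
      by (intro exI[of _ r']) (auto simp: W.limitin_metric_dist_null comp_def)
  qed
  define \<sigma> where "\<sigma> = diagseq"
  have \<sigma>: "strict_mono \<sigma>" unfolding \<sigma>_def by (rule subseq_diagseq)
  have "\<exists>l\<in>W. (\<lambda>k. dW (H (\<sigma> k) i) l) \<longlonglongrightarrow> 0" for i
  proof -
    have "\<exists>l\<in>W. (\<lambda>k. dW (H ((diagseq \<circ> ((+) (Suc i))) k) i) l) \<longlonglongrightarrow> 0"
    proof (rule diagseq_holds)
      fix r s :: "nat \<Rightarrow> nat" and n assume "strict_mono r" "\<exists>l\<in>W. (\<lambda>k. dW (H (s k) n) l) \<longlonglongrightarrow> 0"
      then show "\<exists>l\<in>W. (\<lambda>k. dW (H ((s \<circ> r) k) n) l) \<longlonglongrightarrow> 0"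
        using LIMSEQ_subseq_LIMSEQ[of "\<lambda>k. dW (H (s k) n) _" 0 r] by (auto simp: comp_def)
    qed
    then obtain l where l: "l \<in> W" "(\<lambda>k. dW (H (\<sigma> (k + Suc i)) i) l) \<longlonglongrightarrow> 0" by (auto simp: \<sigma>_def add.commute)
    from LIMSEQ_offset[OF l(2)] l(1) show ?thesis by blast
  qed
  then obtain L where L: "\<And>i. L i \<in> W" "\<And>i. (\<lambda>k. dW (H (\<sigma> k) i) (L i)) \<longlonglongrightarrow> 0" by metis
  have \<sigma>_large: "\<forall>\<^sub>F k in sequentially. c \<le> real (\<sigma> k)" for c :: real
  proof -
    have "filterlim (\<lambda>k. real (\<sigma> k)) at_top sequentially"
      by (intro filterlim_compose[OF filterlim_real_sequentially] filterlim_subseq \<sigma>)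
    then show ?thesis by (simp add: filterlim_at_top)
  qed
  have H_eq: "\<forall>\<^sub>F k in sequentially. 1 \<le> \<sigma> k \<and> z i \<in> BY (real (\<sigma> k)) \<and> H (\<sigma> k) i = G (\<sigma> k) (z i)" for i
    using \<sigma>_large[of 1] \<sigma>_large[of "e q (z i)"] by eventually_elim (simp add: H_def BY_def zY)
  have \<delta>0: "(\<lambda>k. ?\<delta> (\<sigma> k)) \<longlonglongrightarrow> 0"
    using LIMSEQ_subseq_LIMSEQ[OF LIMSEQ_inverse_real_of_nat \<sigma>] by (simp add: comp_def inverse_eq_divide add.commute)
  have L_iso: "dW (L i) (L j) = e (z i) (z j)" for i j
  proof -
    have "(\<lambda>k. dW (H (\<sigma> k) i) (L i) + dW (H (\<sigma> k) j) (L j) + ?\<delta> (\<sigma> k)) \<longlonglongrightarrow> 0 + 0 + 0"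
      by (intro tendsto_add L \<delta>0)
    then have "\<bar>dW (L i) (L j) - e (z i) (z j)\<bar> \<le> 0 + 0 + 0"
    proof (rule tendsto_lowerbound)
      show "\<forall>\<^sub>F k in sequentially. \<bar>dW (L i) (L j) - e (z i) (z j)\<bar> \<le> dW (H (\<sigma> k) i) (L i) + dW (H (\<sigma> k) j) (L j) + ?\<delta> (\<sigma> k)"
        using H_eq[of i] H_eq[of j]
      proof eventually_elim
        case (elim k)
        let ?a = "H (\<sigma> k) i" and ?b = "H (\<sigma> k) j"
        have ab: "?a \<in> W" "?b \<in> W" "\<bar>dW ?a ?b - e (z i) (z j)\<bar> \<le> ?\<delta> (\<sigma> k)"
          using elim G(1,2) by auto
        have "dW (L i) (L j) \<le> dW ?a (L i) + dW ?a ?b + dW ?b (L j)"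
          using W.triangle[of "L i" ?a "L j"] W.triangle[of ?a ?b "L j"] W.commute[of "L i" ?a] ab L(1) by simp
        moreover have "dW ?a ?b \<le> dW ?a (L i) + dW (L i) (L j) + dW ?b (L j)"
          using W.triangle[of ?a "L i" ?b] W.triangle[of "L i" "L j" ?b] W.commute[of "L j" ?b] ab L(1) by simp
        ultimately show ?case using ab(3) by linarith
      qed
    qed simp
    then show ?thesis by simp
  qed
  \<comment> \<open>Points \<open>y m\<close> with \<open>G m (y m)\<close> near w stay in a bounded
    ball, so properness of Y gives a limit l of a subsequence. A net point near l is sent by the
    limit map to within 4 of w.\<close>
  have L_onto: "\<exists>i. dW w (L i) \<le> 4" if w: "w \<in> W" for w
  proof -
    have "\<exists>y. 1 \<le> m \<longrightarrow> dW w0 w \<le> real m \<longrightarrow> y \<in> BY (real m) \<and> dW w (G m y) \<le> ?\<delta> m" for m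
      using G(3)[OF _ w] by blast
    then obtain y where y: "\<And>m. 1 \<le> m \<Longrightarrow> dW w0 w \<le> real m \<Longrightarrow> y m \<in> BY (real m) \<and> dW w (G m (y m)) \<le> ?\<delta> m"
      by metis
    define \<rho> where "\<rho> = \<bar>M + 2 + dW w0 w + 2\<bar>"
    define y' where "y' = (\<lambda>k. if 1 \<le> \<sigma> k \<and> dW w0 w \<le> real (\<sigma> k) then y (\<sigma> k) else q)"
    have y'_ball: "y' k \<in> Y.mcball q \<rho>" for k
    proof (cases "1 \<le> \<sigma> k \<and> dW w0 w \<le> real (\<sigma> k)")
      case True
      let ?m = "\<sigma> k"
      have m: "1 \<le> ?m" and yB: "y ?m \<in> BY (real ?m)" "dW w (G ?m (y ?m)) \<le> ?\<delta> ?m" using True y by auto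
      have "e q (y ?m) \<le> dW (G ?m q) (G ?m (y ?m)) + ?\<delta> ?m" using G(2)[OF m qB yB(1)] by linarith
      moreover have "dW (G ?m q) (G ?m (y ?m)) \<le> dW w0 (G ?m q) + dW w0 w + dW w (G ?m (y ?m))"
        using W.triangle[of "G ?m q" w0 "G ?m (y ?m)"] W.triangle[of w0 w "G ?m (y ?m)"] W.commute[of w0 "G ?m q"]
          G(1)[OF m qB] G(1)[OF m yB(1)] W(2) w by simp
      ultimately have "e q (y ?m) \<le> \<rho>" using Gq[OF m] yB(2) \<delta>1(1)[of ?m] unfolding \<rho>_def by linarith
      then show ?thesis using True yB(1) qY by (simp add: y'_def BY_def)
    next
      case False
      then have "y' k = q" unfolding y'_def by (rule if_not_P)
      then show ?thesis using qY by (simp add: \<rho>_def)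
    qed
    have "compactin Y.mtopology (Y.mcball q \<rho>)" using properY qY by (simp add: proper_metric_space_def)
    moreover have "range y' \<subseteq> Y.mcball q \<rho>" using y'_ball by blast
    ultimately obtain l r where l: "l \<in> Y.mcball q \<rho>" "strict_mono r" "limitin Y.mtopology (y' \<circ> r) l sequentially"
      unfolding Y.compactin_sequentially by blast
    have lY: "l \<in> Y" and lim: "(\<lambda>k. e (y' (r k)) l) \<longlonglongrightarrow> 0" using l by (auto simp: Y.limitin_metric_dist_null comp_def)
    obtain i where i: "e l (z i) < 1" using z_dense[OF lY] by blast
    have "(\<lambda>k. dW (H (\<sigma> (r k)) i) (L i)) \<longlonglongrightarrow> 0"
      using LIMSEQ_subseq_LIMSEQ[OF L(2) l(2)] by (simp add: comp_def)
    then have ev1: "\<forall>\<^sub>F k in sequentially. dW (H (\<sigma> (r k)) i) (L i) < 1/2" by (rule order_tendstoD(2)) simp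
    have ev2: "\<forall>\<^sub>F k in sequentially. e (y' (r k)) l < 1/2" by (rule order_tendstoD(2)[OF lim]) simp
    have ev3: "\<forall>\<^sub>F k in sequentially. 1 \<le> \<sigma> (r k) \<and> z i \<in> BY (real (\<sigma> (r k))) \<and> H (\<sigma> (r k)) i = G (\<sigma> (r k)) (z i)"
      using eventually_subseq[OF l(2) H_eq[of i]] .
    have ev4: "\<forall>\<^sub>F k in sequentially. dW w0 w \<le> real (\<sigma> (r k))"
      using eventually_subseq[OF l(2) \<sigma>_large[of "dW w0 w"]] .
    have "\<forall>\<^sub>F k in sequentially. dW w (L i) \<le> 4"
      using ev1 ev2 ev3 ev4
    proof eventually_elim
      case (elim k)
      let ?m = "\<sigma> (r k)"
      have m: "1 \<le> ?m" and yB: "y ?m \<in> BY (real ?m)" "dW w (G ?m (y ?m)) \<le> ?\<delta> ?m" "y' (r k) = y ?m"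
        using elim y by (auto simp: y'_def)
      have yY: "y ?m \<in> Y" using yB(1) by (simp add: BY_def)
      have zB: "z i \<in> BY (real ?m)" using elim by blast
      have "e (y ?m) (z i) \<le> e (y ?m) l + e l (z i)" using yY lY zY by (intro Y.triangle) auto
      moreover have "dW (G ?m (y ?m)) (G ?m (z i)) \<le> e (y ?m) (z i) + ?\<delta> ?m" using G(2)[OF m yB(1) zB] by linarith
      moreover have "dW w (L i) \<le> dW w (G ?m (y ?m)) + dW (G ?m (y ?m)) (G ?m (z i)) + dW (G ?m (z i)) (L i)"
        using W.triangle[of w "G ?m (y ?m)" "L i"] W.triangle[of "G ?m (y ?m)" "G ?m (z i)" "L i"]
          G(1)[OF m yB(1)] G(1)[OF m zB] L(1) w by simp
      moreover have "dW (G ?m (z i)) (L i) < 1/2" "e (y ?m) l < 1/2" using elim yB(3) by auto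
      ultimately show ?case using i yB(2) \<delta>1(1)[of ?m] by linarith
    qed
    then show ?thesis by (auto simp: eventually_sequentially)
  qed
  have one: "s 1 ` X = Y" by (rule s_onto) simp
  have "\<exists>i. x \<in> X \<longrightarrow> e (s 1 x) (z i) < 1" for x using z_dense[of "s 1 x"] one by blast
  then obtain idx where idx: "\<And>x. x \<in> X \<Longrightarrow> e (s 1 x) (z (idx x)) < 1" by metis
  show ?thesis
  \<comment> \<open>C is the distortion of \<open>s 1\<close>, moving two points to the net costs at
    most 2, and surjectivity holds up to 4 + 1; the constant covers all of these.\<close>
  proof (intro exI[of _ "C + 6"] conjI)
    show "0 < C + 6" using C_pos by simp
    show "quasi_isometric_1 (C + 6) X d W dW"
      unfolding quasi_isometric_1_def
    proof (intro exI[of _ "\<lambda>x. L (idx x)"] conjI ballI)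
      show "(\<lambda>x. L (idx x)) ` X \<subseteq> W" using L(1) by blast
      fix x x' assume x: "x \<in> X" "x' \<in> X"
      have sY: "s 1 x \<in> Y" "s 1 x' \<in> Y" using one x by blast+
      let ?a = "z (idx x)" and ?b = "z (idx x')"
      have "e ?a ?b \<le> e (s 1 x) ?a + e (s 1 x) (s 1 x') + e (s 1 x') ?b"
        using Y.triangle[of ?a "s 1 x" ?b] Y.triangle[of "s 1 x" "s 1 x'" ?b] Y.commute[of ?a "s 1 x"] sY zY by simp
      moreover have "e (s 1 x) (s 1 x') \<le> e (s 1 x) ?a + e ?a ?b + e (s 1 x') ?b"
        using Y.triangle[of "s 1 x" ?a "s 1 x'"] Y.triangle[of ?a ?b "s 1 x'"] Y.commute[of ?b "s 1 x'"] sY zY by simp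
      ultimately show "\<bar>dW (L (idx x)) (L (idx x')) - d x x'\<bar> \<le> C + 6"
        unfolding L_iso using idx[OF x(1)] idx[OF x(2)] s_est[of 1 x x'] x by simp
    next
      fix w assume w: "w \<in> W"
      obtain i where i: "dW w (L i) \<le> 4" using L_onto[OF w] by blast
      have "z i \<in> s 1 ` X" using one zY by simp
      then obtain x where x: "x \<in> X" "s 1 x = z i" by (elim imageE) simp
      have "dW (L i) (L (idx x)) < 1" unfolding L_iso using idx[OF x(1)] x(2) by simp
      moreover have "dW w (L (idx x)) \<le> dW w (L i) + dW (L i) (L (idx x))" using w L(1) by (intro W.triangle) auto
      ultimately show "\<exists>x\<in>X. dW w (L (idx x)) \<le> C + 6" using i x(1) C_pos by (intro bexI[of _ x]) auto
    qed
  qed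
qed

end

section \<open>The metrics on the group\<close>

context subfinsler_nil2 begin

definition dm :: "('e \<Rightarrow> 'e) \<Rightarrow> 'e \<Rightarrow> 'e \<Rightarrow> real" where "dm \<theta> x y = D \<theta> (mul (- x) y)"

lemma dm_nonneg: "adm \<theta> \<Longrightarrow> 0 \<le> dm \<theta> x y"
  by (simp add: dm_def D_nonneg)

lemma dm_commute: "adm \<theta> \<Longrightarrow> dm \<theta> x y = dm \<theta> y x"
  using D_minus[of \<theta> "mul (- x) y"] by (simp add: dm_def minus_mul)

lemma dm_triangle: "adm \<theta> \<Longrightarrow> dm \<theta> x z \<le> dm \<theta> x y + dm \<theta> y z"
  using D_mul[of \<theta> "mul (- x) y" "mul (- y) z"] by (simp add: dm_def mul_assoc)

lemma dm_0: "dm \<theta> 0 x = D \<theta> x"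
  by (simp add: dm_def)

lemma dm_eq_0: "adm \<theta> \<Longrightarrow> dm \<theta> x y = 0 \<longleftrightarrow> x = y"
proof -
  assume "adm \<theta>"
  then have "dm \<theta> x y = 0 \<longleftrightarrow> mul (- x) y = 0" by (simp add: dm_def D_eq_0_iff)
  also have "\<dots> \<longleftrightarrow> x = y" by (metis mul_0(1) mul_cancel(1) mul_minus(2))
  finally show ?thesis .
qed

lemma continuous_mul: "continuous_on UNIV (mul x)"
  unfolding mul_def[abs_def] by (intro continuous_intros b.continuous_on)

text \<open>The box estimate bounds the distance by a continuous function of y that vanishes at x,
  so the metric topology is no finer than the Euclidean one.\<close>

lemma dm_nhd:
  assumes \<theta>: "adm \<theta>" and "0 < \<epsilon>"
  obtains U where "open U" "x \<in> U" "\<And>y. y \<in> U \<Longrightarrow> dm \<theta> x y < \<epsilon>"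
proof -
  obtain K where K: "\<And>x. D \<theta> x \<le> K * (norm (pr x) + sqrt (norm (pr x)) + sqrt (norm (\<zeta> x)))"
    using D_upper[OF \<theta>] by metis
  define F where "F = (\<lambda>y. K * (norm (pr (mul (- x) y)) + sqrt (norm (pr (mul (- x) y))) + sqrt (norm (\<zeta> (mul (- x) y)))))"
  have "continuous_on UNIV F"
    unfolding F_def by (intro continuous_intros pr.continuous_on zeta.continuous_on continuous_mul)
  then have "open (F -` {..<\<epsilon>})" by (intro continuous_open_vimage) (auto simp: continuous_on_eq_continuous_at)
  moreover have "x \<in> F -` {..<\<epsilon>}" using assms(2) by (simp add: F_def pr.zero zeta.zero)
  moreover have "dm \<theta> x y < \<epsilon>" if "y \<in> F -` {..<\<epsilon>}" for y
    using that K[of "mul (- x) y"] by (simp add: dm_def F_def)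
  ultimately show ?thesis using that by blast
qed

lemma closed_dm_ball: assumes \<theta>: "adm \<theta>" shows "closed {y. dm \<theta> x y \<le> R}"
  unfolding closed_def
proof (subst open_subopen, intro ballI)
  fix y assume "y \<in> - {y. dm \<theta> x y \<le> R}"
  then have "0 < dm \<theta> x y - R" by simp
  then obtain U where U: "open U" "y \<in> U" "\<And>z. z \<in> U \<Longrightarrow> dm \<theta> y z < dm \<theta> x y - R" using dm_nhd[OF \<theta>] by metis
  have "U \<subseteq> - {y. dm \<theta> x y \<le> R}"
  proof
    fix z assume "z \<in> U"
    then have "dm \<theta> y z < dm \<theta> x y - R" by (rule U)
    then show "z \<in> - {y. dm \<theta> x y \<le> R}" using dm_triangle[OF \<theta>, of x y z] dm_commute[OF \<theta>, of y z] by simp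
  qed
  then show "\<exists>T. open T \<and> y \<in> T \<and> T \<subseteq> - {y. dm \<theta> x y \<le> R}" using U by blast
qed

lemma compact_dm_ball: assumes \<theta>: "adm \<theta>" shows "compact {y. dm \<theta> x y \<le> R}"
proof -
  obtain K where K: "0 < K" "\<And>x. norm x \<le> K * (D \<theta> x + (D \<theta> x)\<^sup>2)" using D_lower[OF \<theta>] by metis
  have "{y. dm \<theta> x y \<le> R} \<subseteq> mul x ` cball 0 (K * (R + R\<^sup>2))"
  proof
    fix y assume "y \<in> {y. dm \<theta> x y \<le> R}"
    then have y: "D \<theta> (mul (- x) y) \<le> R" by (simp add: dm_def)
    have "norm (mul (- x) y) \<le> K * (D \<theta> (mul (- x) y) + (D \<theta> (mul (- x) y))\<^sup>2)" by (rule K)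
    also have "\<dots> \<le> K * (R + R\<^sup>2)" using y K(1) D_nonneg[OF \<theta>] by (intro mult_left_mono add_mono power_mono) auto
    finally show "y \<in> mul x ` cball 0 (K * (R + R\<^sup>2))" by (intro image_eqI[of _ _ "mul (- x) y"]) auto
  qed
  moreover have "compact (mul x ` cball 0 (K * (R + R\<^sup>2)))"
    by (intro compact_continuous_image continuous_on_subset[OF continuous_mul]) auto
  ultimately show ?thesis
    using closed_dm_ball[OF \<theta>, of x R] by (metis compact_Int_closed inf.absorb_iff2)
qed

text \<open>The inverse of L is continuous from the Euclidean topology to the metric one, so it
  carries the closed balls of \<open>dm\<close>, which are Euclidean compact, to compact metric
  balls.\<close>

lemma proper_dm:
  fixes L :: "'g \<Rightarrow> 'e"
  assumes \<theta>: "adm \<theta>" and L: "bij L"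
  shows "proper_metric_space (UNIV :: 'g set) (\<lambda>g h. dm \<theta> (L g) (L h))"
proof -
  interpret M: Metric_space "UNIV :: 'g set" "\<lambda>g h. dm \<theta> (L g) (L h)"
    by unfold_locales
      (auto simp: dm_nonneg \<theta> dm_eq_0 dm_triangle inj_eq[OF bij_is_inj[OF L]] intro: dm_commute)
  have L_inv: "L (inv_into UNIV L x) = x" "inv_into UNIV L (L g) = g" for x g using L by (simp_all add: bij_is_surj surj_f_inv_f bij_is_inj)
  have cont: "continuous_map euclidean M.mtopology (inv_into UNIV L)"
    unfolding M.continuous_map_to_metric
  proof (intro ballI allI impI)
    fix x and \<epsilon> :: real assume "0 < \<epsilon>"
    then obtain U where U: "open U" "x \<in> U" "\<And>y. y \<in> U \<Longrightarrow> dm \<theta> x y < \<epsilon>" using dm_nhd[OF \<theta>] by metis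
    then show "\<exists>U. openin euclidean U \<and> x \<in> U \<and> (\<forall>y\<in>U. inv_into UNIV L y \<in> M.mball (inv_into UNIV L x) \<epsilon>)"
      by (intro exI[of _ U]) (simp add: L_inv)
  qed
  have "compactin M.mtopology (M.mcball g R)" for g R
  proof -
    have "compactin euclidean {y. dm \<theta> (L g) y \<le> R}" using compact_dm_ball[OF \<theta>] by simp
    from image_compactin[OF this cont] have "compactin M.mtopology (inv_into UNIV L ` {y. dm \<theta> (L g) y \<le> R})" .
    moreover have "inv_into UNIV L ` {y. dm \<theta> (L g) y \<le> R} = M.mcball g R"
    proof (intro equalityI subsetI)
      fix h assume "h \<in> M.mcball g R"
      then show "h \<in> inv_into UNIV L ` {y. dm \<theta> (L g) y \<le> R}" by (intro image_eqI[of _ _ "L h"]) (simp_all add: L_inv)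
    qed (auto simp: L_inv)
    ultimately show ?thesis by simp
  qed
  then show ?thesis by (simp add: proper_metric_space_def M.Metric_space_axioms)
qed

lemma scale_letter: "adm \<theta> \<Longrightarrow> t *\<^sub>R v - \<theta> (t *\<^sub>R v) = t *\<^sub>R (v - \<theta> v)"
  by (simp add: linear_scale[OF admD(2)] scaleR_diff_right)

lemma word_cut:
  assumes \<theta>: "adm \<theta>" and "set w \<subseteq> V" "0 \<le> R" "R \<le> cost w"
  shows "\<exists>w1 w2. set w1 \<subseteq> V \<and> set w2 \<subseteq> V \<and> mul (P \<theta> w1) (P \<theta> w2) = P \<theta> w \<and> cost w1 = R \<and> cost w2 = cost w - R"
  using assms(2-4)
proof (induction w arbitrary: R)
  case Nil
  then show ?case by (intro exI[of _ "[]"]) auto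
next
  case (Cons v w)
  have v: "v \<in> V" "set w \<subseteq> V" using Cons.prems by auto
  show ?case
  proof (cases "R \<le> \<nu> v")
    case False
    then obtain w1 w2 where w: "set w1 \<subseteq> V" "set w2 \<subseteq> V" "mul (P \<theta> w1) (P \<theta> w2) = P \<theta> w"
      "cost w1 = R - \<nu> v" "cost w2 = cost w - (R - \<nu> v)"
      using Cons.IH[OF v(2), of "R - \<nu> v"] Cons.prems by auto
    then show ?thesis using v by (intro exI[of _ "v # w1"] exI[of _ w2]) (auto simp: mul_assoc)
  next
    case True
    show ?thesis
    proof (cases "\<nu> v = 0")
      case True
      then have "R = 0" using \<open>R \<le> \<nu> v\<close> Cons.prems by simp
      then show ?thesis using Cons.prems by (intro exI[of _ "[]"] exI[of _ "v # w"]) auto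
    next
      case False
      then have pos: "0 < \<nu> v" using nu(1)[OF v(1)] by simp
      define t where "t = R / \<nu> v"
      have t: "0 \<le> t" "t \<le> 1" "t * \<nu> v = R" using True pos Cons.prems by (auto simp: t_def divide_le_eq)
      have "mul (t *\<^sub>R v - \<theta> (t *\<^sub>R v)) ((1 - t) *\<^sub>R v - \<theta> ((1 - t) *\<^sub>R v)) = v - \<theta> v"
        unfolding scale_letter[OF \<theta>] mul_scale_same by simp
      then have "mul (P \<theta> [t *\<^sub>R v]) (P \<theta> ((1 - t) *\<^sub>R v # w)) = P \<theta> (v # w)" by (simp flip: mul_assoc)
      moreover have "cost [t *\<^sub>R v] = R" "cost ((1 - t) *\<^sub>R v # w) = cost (v # w) - R"
        using nu(3)[OF v(1), of t] nu(3)[OF v(1), of "1 - t"] t by (simp_all add: left_diff_distrib)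
      ultimately show ?thesis using v subV
        by (intro exI[of _ "[t *\<^sub>R v]"] exI[of _ "(1 - t) *\<^sub>R v # w"]) (simp add: subspace_scale)
    qed
  qed
qed

text \<open>Cut an almost optimal word after cost R, where a letter v may be split as t v followed
  by (1 - t) v. The prefix ends in the ball of radius R and the suffix has cost below 2
  \<eta>.\<close>

lemma D_cut:
  assumes \<theta>: "adm \<theta>" and "0 \<le> R" "0 < \<eta>" "D \<theta> x \<le> R + \<eta>"
  shows "\<exists>y. D \<theta> y \<le> R \<and> dm \<theta> y x \<le> 2 * \<eta>"
proof -
  obtain w where w: "set w \<subseteq> V" "P \<theta> w = x" "cost w < D \<theta> x + \<eta>" using D_approx[OF \<theta> assms(3)] by metis
  show ?thesis
  proof (cases "R \<le> cost w")
    case True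
    obtain w1 w2 where c: "set w1 \<subseteq> V" "set w2 \<subseteq> V" "mul (P \<theta> w1) (P \<theta> w2) = P \<theta> w" "cost w1 = R" "cost w2 = cost w - R"
      using word_cut[OF \<theta> w(1) assms(2) True] by blast
    have "mul (- P \<theta> w1) x = P \<theta> w2" using c(3) w(2) by (metis mul_cancel(2))
    then have "dm \<theta> (P \<theta> w1) x \<le> 2 * \<eta>" using D_le[OF c(2), of \<theta>] c(5) w(3) assms(4) by (simp add: dm_def)
    then show ?thesis using D_le[OF c(1), of \<theta>] c(4) by auto
  next
    case False
    then have "D \<theta> x \<le> R" using D_le[OF w(1), of \<theta>] w(2) by simp
    moreover have "dm \<theta> x x = 0" using dm_eq_0[OF \<theta>] by simp
    ultimately show ?thesis using assms(3) by (intro exI[of _ x]) auto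
  qed
qed

lemma dm_cut:
  assumes \<theta>: "adm \<theta>" and "0 \<le> R" "0 < \<eta>" "dm \<theta> 0 x \<le> R + \<eta>"
  shows "\<exists>y. dm \<theta> 0 y \<le> R \<and> dm \<theta> y x \<le> 2 * \<eta>"
  using D_cut[OF assms(1-3)] assms(4) by (simp add: dm_0)

text \<open>A point \<open>a\<close> from which the whole ball of radius \<open>m\<close> is almost contained in a ball of the same
  radius is close to the center: left translation by \<open>- a\<close> can be iterated.\<close>

lemma dm_base:
  assumes \<theta>: "adm \<theta>"
  obtains M where "\<And>(m::nat) a. (\<And>y. D \<theta> y \<le> real m \<Longrightarrow> dm \<theta> a y \<le> real m + 2 / (real m + 1)) \<Longrightarrow> D \<theta> a \<le> M"
proof -
  obtain K where K: "0 < K" "\<And>x. norm x \<le> K * (D \<theta> x + (D \<theta> x)\<^sup>2)" using D_lower[OF \<theta>] by metis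
  obtain C where C: "\<And>x. norm x \<le> 30 * K \<Longrightarrow> D \<theta> x \<le> C" using D_bounded[OF \<theta>] by metis
  show ?thesis
  proof (rule that)
    fix m :: nat and a
    assume a: "\<And>y. D \<theta> y \<le> real m \<Longrightarrow> dm \<theta> a y \<le> real m + 2 / (real m + 1)"
    define \<eta> where "\<eta> = 2 / (real m + 1)"
    have \<eta>: "0 < \<eta>" by (simp add: \<eta>_def)
    \<comment> \<open>A translation by the inverse of a moves a point of the ball out by at most
      \<eta>; \<open>D_cut\<close> returns it to the ball at a cost of 2 \<eta>, and the next
      translation applies. The losses add up to 2 \<eta> per step.\<close>
    have it: "D \<theta> (mul (- (real k *\<^sub>R a)) y) \<le> real m + real k * (2 * \<eta>)" if "D \<theta> y \<le> real m" for k y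
      using that
    proof (induction k arbitrary: y)
      case (Suc k)
      have "D \<theta> (mul (- a) y) \<le> real m + \<eta>" using a[OF Suc.prems] by (simp add: dm_def \<eta>_def)
      from D_cut[OF \<theta> _ \<eta> this] obtain y' where y': "D \<theta> y' \<le> real m" "dm \<theta> y' (mul (- a) y) \<le> 2 * \<eta>" by auto
      have "- (real (Suc k) *\<^sub>R a) = mul (- (real k *\<^sub>R a)) (- a)"
        using mul_scale_same[of "real k" "- a" 1] by (simp add: algebra_simps)
      then have "mul (- (real (Suc k) *\<^sub>R a)) y = mul (mul (- (real k *\<^sub>R a)) y') (mul (- y') (mul (- a) y))"
        by (simp add: mul_assoc)
      then have "D \<theta> (mul (- (real (Suc k) *\<^sub>R a)) y) \<le> D \<theta> (mul (- (real k *\<^sub>R a)) y') + dm \<theta> y' (mul (- a) y)"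
        using D_mul[OF \<theta>] by (simp add: dm_def)
      also have "\<dots> \<le> real m + real k * (2 * \<eta>) + 2 * \<eta>" using Suc.IH[OF y'(1)] y'(2) by linarith
      finally show ?case by (simp add: algebra_simps)
    qed simp
    \<comment> \<open>The k-th power of a is k a. For k = (m + 1)^2 its distance from 0 is O(m + 1),
      and the norm is at most quadratic in large distances. So k |a| \<le> 30 K k, which bounds a
      independently of m.\<close>
    define k where "k = (m + 1)\<^sup>2"
    let ?c = "real m + 1"
    have k: "real k = ?c * ?c" by (simp add: k_def power2_eq_square algebra_simps)
    have "D \<theta> (real k *\<^sub>R a) \<le> real m + real k * (2 * \<eta>)" using it[of 0 k] D_minus[OF \<theta>, of "real k *\<^sub>R a"] \<theta> by simp
    also have "real k * (2 * \<eta>) = 4 * ?c" unfolding k \<eta>_def by (simp add: field_simps)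
    finally have Dk: "D \<theta> (real k *\<^sub>R a) \<le> 5 * ?c" by simp
    have "norm (real k *\<^sub>R a) \<le> K * (D \<theta> (real k *\<^sub>R a) + (D \<theta> (real k *\<^sub>R a))\<^sup>2)" by (rule K)
    also have "\<dots> \<le> K * (5 * ?c + (5 * ?c)\<^sup>2)" using Dk K(1) D_nonneg[OF \<theta>] by (intro mult_left_mono add_mono power_mono) auto
    also have "\<dots> \<le> K * (30 * (?c * ?c))"
    proof (rule mult_left_mono)
      have "5 * c + (5 * c)\<^sup>2 \<le> 30 * (c * c)" if "1 \<le> c" for c :: real
        using mult_left_mono[of 1 c c] that by (simp add: power2_eq_square)
      from this[of ?c] show "5 * ?c + (5 * ?c)\<^sup>2 \<le> 30 * (?c * ?c)" by simp
    qed (use K(1) in simp)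
    finally have "real k * norm a \<le> real k * (30 * K)" unfolding k by (simp add: mult_ac)
    then have "norm a \<le> 30 * K" unfolding k by (subst (asm) mult_le_cancel_left) (auto simp: add_pos_nonneg)
    then show "D \<theta> a \<le> C" by (rule C)
  qed
qed

section \<open>Dilations and the self-similar metric\<close>

definition dil :: "real \<Rightarrow> 'e \<Rightarrow> 'e" where "dil t x = t *\<^sub>R pr x + t\<^sup>2 *\<^sub>R \<zeta> x"

text \<open>Dilations are automorphisms because the bracket depends on the projections alone and
  takes values in \<open>Z\<close>, where the dilation is multiplication by t^2.\<close>

lemma dil_mul: "dil t (mul x y) = mul (dil t x) (dil t y)"
proof -
  have "\<zeta> (mul x y) = \<zeta> x + \<zeta> y + (1/2) *\<^sub>R b x y" by (simp add: mul_def zeta.add zeta.scaleR)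
  moreover have "b (dil t x) (dil t y) = t\<^sup>2 *\<^sub>R b x y"
    unfolding dil_def b.add_left b.add_right b.scaleR_left b.scaleR_right
    using zeta(1) by (simp add: b_pr[symmetric] power2_eq_square)
  ultimately show ?thesis
    unfolding dil_def pr_mul by (simp add: mul_def dil_def scaleR_add_right algebra_simps)
qed

lemma dil_minus: "dil t (- x) = - dil t x"
  by (simp add: dil_def pr.neg zeta.neg)

lemma dil_dil: "dil s (dil t x) = dil (s * t) x"
  by (simp add: dil_def pr.add zeta.add pr.scaleR zeta.scaleR power_mult_distrib)

lemma dil_1: "dil 1 x = x"
  by (simp add: dil_def pr_plus_zeta)

text \<open>The reason for the shift by \<zeta>: the letter \<open>v - \<zeta> v\<close> lies in the
  kernel of \<zeta>, where the dilation is multiplication by t, so dilating it gives the shifted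
  letter of t v.\<close>

lemma P_dil: "dil t (P \<zeta> w) = P \<zeta> (map (\<lambda>v. t *\<^sub>R v) w)"
proof (induction w)
  case (Cons v w)
  have "dil t (v - \<zeta> v) = t *\<^sub>R v - \<zeta> (t *\<^sub>R v)"
    by (simp add: dil_def pr.diff zeta.diff zeta.scaleR scaleR_diff_right pr_def)
  then show ?case using Cons by (simp add: dil_mul)
qed (simp add: dil_def pr.zero zeta.zero)

lemma D_dil_le: assumes "0 < t" shows "D \<zeta> (dil t x) \<le> t * D \<zeta> x"
proof (rule field_le_epsilon)
  fix e :: real assume "0 < e"
  then have "0 < e / t" using assms by simp
  then obtain w where w: "set w \<subseteq> V" "P \<zeta> w = x" "cost w < D \<zeta> x + e / t" using D_approx[OF adm_zeta] by metis
  have "set (map (\<lambda>v. t *\<^sub>R v) w) \<subseteq> V" using w(1) subV by (auto intro: subspace_scale)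
  from D_le[OF this, of \<zeta>] have "D \<zeta> (dil t x) \<le> cost (map (\<lambda>v. t *\<^sub>R v) w)" by (simp add: P_dil[symmetric] w(2))
  also have "cost (map (\<lambda>v. t *\<^sub>R v) w) = t * cost w"
    using w(1) assms by (induction w) (auto simp: nu distrib_left)
  also have "\<dots> \<le> t * (D \<zeta> x + e / t)" using w(3) assms by simp
  finally show "D \<zeta> (dil t x) \<le> t * D \<zeta> x + e" using assms by (simp add: distrib_left)
qed

lemma dm_dil: assumes "0 < t" shows "dm \<zeta> (dil t x) (dil t y) = t * dm \<zeta> x y"
proof -
  have le: "dm \<zeta> (dil t x) (dil t y) \<le> t * dm \<zeta> x y" if "0 < t" for t x y
    using D_dil_le[OF that, of "mul (- x) y"] by (simp add: dm_def dil_mul dil_minus)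
  have "dm \<zeta> x y \<le> (1 / t) * dm \<zeta> (dil t x) (dil t y)"
    using le[of "1 / t" "dil t x" "dil t y"] assms by (simp add: dil_dil dil_1)
  then show ?thesis using le[OF assms, of x y] assms by (simp add: field_simps)
qed

text \<open>The cone lives on the same set, with the \<zeta>-metric, and the scaling maps are the
  dilations by 1 / n. These scale the \<zeta>-metric exactly, so the distortion C / n is the bounded
  difference of the two metrics divided by n.\<close>

theorem rigid_conical:
  fixes L :: "'g \<Rightarrow> 'e"
  assumes L: "bij L"
  obtains C M S where "rigid_conical_approximation (UNIV :: 'g set) (\<lambda>g h. dm (\<lambda>_. 0) (L g) (L h)) (inv_into UNIV L 0)
    (UNIV :: 'g set) (\<lambda>g h. dm \<zeta> (L g) (L h)) (inv_into UNIV L 0) (\<lambda>n g. inv_into UNIV L (dil (1 / real n) (L g))) C M S"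
proof -
  have L_inv: "L (inv_into UNIV L x) = x" "inv_into UNIV L (L g) = g" for x g using L by (simp_all add: bij_is_surj surj_f_inv_f bij_is_inj)
  obtain C1 where C1: "\<And>x. D \<zeta> x \<le> D (\<lambda>_. 0) x + C1" using D_comparison[OF adm_0 adm_zeta] by metis
  obtain C2 where C2: "\<And>x. D (\<lambda>_. 0) x \<le> D \<zeta> x + C2" using D_comparison[OF adm_zeta adm_0] by metis
  define C where "C = \<bar>C1\<bar> + \<bar>C2\<bar> + 1"
  have C: "\<bar>dm (\<lambda>_. 0) x y - dm \<zeta> x y\<bar> \<le> C" for x y
    using C1[of "mul (- x) y"] C2[of "mul (- x) y"] unfolding dm_def C_def by linarith
  obtain M where M: "\<And>(m::nat) a. (\<And>y. D \<zeta> y \<le> real m \<Longrightarrow> dm \<zeta> a y \<le> real m + 2 / (real m + 1)) \<Longrightarrow> D \<zeta> a \<le> M"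
    using dm_base[OF adm_zeta] by metis
  obtain S :: "'e set" where S: "countable S" "\<And>X. open X \<Longrightarrow> X \<noteq> {} \<Longrightarrow> \<exists>d\<in>S. d \<in> X"
    using countable_dense_setE by metis
  show ?thesis
  proof (rule that[of C M "inv_into UNIV L ` S"], unfold_locales)
    show "proper_metric_space UNIV (\<lambda>g h. dm (\<lambda>_. 0) (L g) (L h))" by (rule proper_dm[OF adm_0 L])
    show "proper_metric_space UNIV (\<lambda>g h. dm \<zeta> (L g) (L h))" by (rule proper_dm[OF adm_zeta L])
    show "0 < C" by (simp add: C_def)
    show "countable (inv_into UNIV L ` S)" using S(1) by simp
  next
    fix n :: nat assume n: "1 \<le> n"
    have "g \<in> range (\<lambda>g. inv_into UNIV L (dil (1 / real n) (L g)))" for g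
      by (rule image_eqI[of _ _ "inv_into UNIV L (dil (real n) (L g))"]) (use n in \<open>simp_all add: L_inv dil_dil dil_1\<close>)
    then show "range (\<lambda>g. inv_into UNIV L (dil (1 / real n) (L g))) = UNIV" by blast
    show "inv_into UNIV L (dil (1 / real n) (L (inv_into UNIV L 0))) = inv_into UNIV L 0" by (simp add: L_inv dil_def pr.zero zeta.zero)
    fix x x' :: 'g
    have "dm \<zeta> (L (inv_into UNIV L (dil (1 / real n) (L x)))) (L (inv_into UNIV L (dil (1 / real n) (L x')))) = dm \<zeta> (L x) (L x') / real n"
      using n by (simp add: L_inv dm_dil)
    then show "\<bar>dm (\<lambda>_. 0) (L x) (L x') / real n - dm \<zeta> (L (inv_into UNIV L (dil (1 / real n) (L x)))) (L (inv_into UNIV L (dil (1 / real n) (L x'))))\<bar> \<le> C / real n"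
      using C[of "L x" "L x'"] n by (simp add: divide_right_mono flip: diff_divide_distrib)
  next
    fix g :: 'g and R \<eta> :: real
    assume "0 \<le> R" "0 < \<eta>" "dm \<zeta> (L (inv_into UNIV L 0)) (L g) \<le> R + \<eta>"
    from dm_cut[OF adm_zeta this(1,2)] this(3) obtain y where "dm \<zeta> 0 y \<le> R" "dm \<zeta> y (L g) \<le> 2 * \<eta>" by (auto simp: L_inv)
    then show "\<exists>y'\<in>UNIV. dm \<zeta> (L (inv_into UNIV L 0)) (L y') \<le> R \<and> dm \<zeta> (L y') (L g) \<le> 2 * \<eta>"
      by (intro bexI[of _ "inv_into UNIV L y"]) (simp_all add: L_inv)
  next
    fix m :: nat and a :: 'g
    assume a: "\<And>y. y \<in> UNIV \<Longrightarrow> dm \<zeta> (L (inv_into UNIV L 0)) (L y) \<le> real m \<Longrightarrow> dm \<zeta> (L a) (L y) \<le> real m + 2 / (real m + 1)"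
    have "D \<zeta> (L a) \<le> M"
    proof (rule M)
      fix y assume "D \<zeta> y \<le> real m"
      then show "dm \<zeta> (L a) y \<le> real m + 2 / (real m + 1)" using a[of "inv_into UNIV L y"] by (simp add: L_inv dm_0)
    qed
    then show "dm \<zeta> (L (inv_into UNIV L 0)) (L a) \<le> M" by (simp add: L_inv dm_0)
  next
    fix g :: 'g
    obtain U where U: "open U" "L g \<in> U" "\<And>y. y \<in> U \<Longrightarrow> dm \<zeta> (L g) y < 1" using dm_nhd[OF adm_zeta zero_less_one] by metis
    then obtain y where "y \<in> S" "y \<in> U" using S(2)[of U] by blast
    then show "\<exists>z\<in>inv_into UNIV L ` S. dm \<zeta> (L g) (L z) < 1" using U(3) by (intro bexI[of _ "inv_into UNIV L y"]) (simp_all add: L_inv)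
  qed auto
qed

end

section \<open>Absolutely continuous curves\<close>

text \<open>The definition indexes intervals by an initial segment of the naturals; tagged divisions
  are finite sets of pairs, so the condition is reindexed.\<close>

lemma absolutely_continuous_curve_set:
  assumes ac: "absolutely_continuous_curve a b f" and "0 < \<epsilon>"
  shows "\<exists>\<delta>>0. \<forall>(I :: 'i set) s t. finite I \<longrightarrow> (\<forall>i\<in>I. a \<le> s i \<and> s i \<le> t i \<and> t i \<le> b) \<longrightarrow>
     disjoint_family_on (\<lambda>i. {s i<..<t i}) I \<longrightarrow> (\<Sum>i\<in>I. t i - s i) < \<delta> \<longrightarrow> (\<Sum>i\<in>I. norm (f (t i) - f (s i))) < \<epsilon>"
proof -
  from ac assms(2) obtain \<delta> where \<delta>: "0 < \<delta>" "\<forall>(n::nat) s t.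
        (\<forall>i<n. a \<le> s i \<and> s i \<le> t i \<and> t i \<le> b) \<and> disjoint_family_on (\<lambda>i. {s i<..<t i}) {..<n} \<and>
        (\<Sum>i<n. t i - s i) < \<delta> \<longrightarrow> (\<Sum>i<n. norm (f (t i) - f (s i))) < \<epsilon>"
    unfolding absolutely_continuous_curve_def by blast
  show ?thesis
  proof (intro exI[of _ \<delta>] conjI \<delta>(1) allI impI)
    fix I :: "'i set" and s t
    assume I: "finite I" "\<forall>i\<in>I. a \<le> s i \<and> s i \<le> t i \<and> t i \<le> b"
      "disjoint_family_on (\<lambda>i. {s i<..<t i}) I" "(\<Sum>i\<in>I. t i - s i) < \<delta>"
    obtain h where h: "bij_betw h {..<card I} I" using ex_bij_betw_nat_finite[OF I(1)] by (auto simp: atLeast0LessThan)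
    have hI: "h i \<in> I" if "i < card I" for i using h that by (auto simp: bij_betw_def)
    have "disjoint_family_on (\<lambda>i. {s (h i)<..<t (h i)}) {..<card I}"
      unfolding disjoint_family_on_def
    proof (intro ballI impI)
      fix i j assume ij: "i \<in> {..<card I}" "j \<in> {..<card I}" "i \<noteq> j"
      then have "h i \<noteq> h j" using h by (auto simp: bij_betw_def dest: inj_onD)
      then show "{s (h i)<..<t (h i)} \<inter> {s (h j)<..<t (h j)} = {}"
        using I(3) hI ij unfolding disjoint_family_on_def by simp
    qed
    moreover have "(\<Sum>i<card I. t (h i) - s (h i)) = (\<Sum>i\<in>I. t i - s i)"
      by (rule sum.reindex_bij_betw[OF h])
    ultimately have "(\<Sum>i<card I. norm (f (t (h i)) - f (s (h i)))) < \<epsilon>"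
      using \<delta>(2)[rule_format, of "card I" "\<lambda>i. s (h i)" "\<lambda>i. t (h i)"] I hI by simp
    then show "(\<Sum>i\<in>I. norm (f (t i) - f (s i))) < \<epsilon>"
      using sum.reindex_bij_betw[OF h, of "\<lambda>i. norm (f (t i) - f (s i))"] by simp
  qed
qed

lemma absolutely_continuous_curve_subinterval:
  assumes "absolutely_continuous_curve a b f" "a \<le> a'" "b' \<le> b"
  shows "absolutely_continuous_curve a' b' f"
  unfolding absolutely_continuous_curve_def
proof (intro allI impI)
  fix \<epsilon> :: real assume "0 < \<epsilon>"
  then obtain \<delta> where \<delta>: "0 < \<delta>" "\<forall>(n::nat) s t.
        (\<forall>i<n. a \<le> s i \<and> s i \<le> t i \<and> t i \<le> b) \<and> disjoint_family_on (\<lambda>i. {s i<..<t i}) {..<n} \<and>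
        (\<Sum>i<n. t i - s i) < \<delta> \<longrightarrow> (\<Sum>i<n. norm (f (t i) - f (s i))) < \<epsilon>"
    using assms(1) unfolding absolutely_continuous_curve_def by blast
  show "\<exists>\<delta>>0. \<forall>(n::nat) s t.
        (\<forall>i<n. a' \<le> s i \<and> s i \<le> t i \<and> t i \<le> b') \<and> disjoint_family_on (\<lambda>i. {s i<..<t i}) {..<n} \<and>
        (\<Sum>i<n. t i - s i) < \<delta> \<longrightarrow> (\<Sum>i<n. norm (f (t i) - f (s i))) < \<epsilon>"
  proof (intro exI[of _ \<delta>] conjI \<delta>(1) allI impI)
    fix n :: nat and s t
    assume "(\<forall>i<n. a' \<le> s i \<and> s i \<le> t i \<and> t i \<le> b') \<and> disjoint_family_on (\<lambda>i. {s i<..<t i}) {..<n} \<and> (\<Sum>i<n. t i - s i) < \<delta>"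
    then show "(\<Sum>i<n. norm (f (t i) - f (s i))) < \<epsilon>"
      using assms(2,3) by (intro \<delta>(2)[rule_format]) (auto intro: order_trans)
  qed
qed

lemma absolutely_continuous_curve_lipschitz:
  assumes ac: "absolutely_continuous_curve a b f" and L: "0 < L"
    and lip: "\<And>s t. s \<in> {a..b} \<Longrightarrow> t \<in> {a..b} \<Longrightarrow> norm (g t - g s) \<le> L * norm (f t - f s)"
  shows "absolutely_continuous_curve a b g"
  unfolding absolutely_continuous_curve_def
proof (intro allI impI)
  fix \<epsilon> :: real assume "0 < \<epsilon>"
  then have "0 < \<epsilon> / L" using L by simp
  then obtain \<delta> where \<delta>: "0 < \<delta>" "\<forall>(n::nat) s t.
        (\<forall>i<n. a \<le> s i \<and> s i \<le> t i \<and> t i \<le> b) \<and> disjoint_family_on (\<lambda>i. {s i<..<t i}) {..<n} \<and>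
        (\<Sum>i<n. t i - s i) < \<delta> \<longrightarrow> (\<Sum>i<n. norm (f (t i) - f (s i))) < \<epsilon> / L"
    using ac unfolding absolutely_continuous_curve_def by blast
  show "\<exists>\<delta>>0. \<forall>(n::nat) s t.
        (\<forall>i<n. a \<le> s i \<and> s i \<le> t i \<and> t i \<le> b) \<and> disjoint_family_on (\<lambda>i. {s i<..<t i}) {..<n} \<and>
        (\<Sum>i<n. t i - s i) < \<delta> \<longrightarrow> (\<Sum>i<n. norm (g (t i) - g (s i))) < \<epsilon>"
  proof (intro exI[of _ \<delta>] conjI \<delta>(1) allI impI)
    fix n :: nat and s t
    assume *: "(\<forall>i<n. a \<le> s i \<and> s i \<le> t i \<and> t i \<le> b) \<and> disjoint_family_on (\<lambda>i. {s i<..<t i}) {..<n} \<and> (\<Sum>i<n. t i - s i) < \<delta>"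
    have "(\<Sum>i<n. norm (g (t i) - g (s i))) \<le> (\<Sum>i<n. L * norm (f (t i) - f (s i)))"
      by (intro sum_mono lip) (use * in \<open>auto intro: order_trans\<close>)
    also have "\<dots> = L * (\<Sum>i<n. norm (f (t i) - f (s i)))" by (simp add: sum_distrib_left)
    also have "\<dots> < L * (\<epsilon> / L)" using \<delta>(2)[rule_format, OF *] L by (intro mult_strict_left_mono)
    finally show "(\<Sum>i<n. norm (g (t i) - g (s i))) < \<epsilon>" using L by simp
  qed
qed

lemma absolutely_continuous_curve_id: "absolutely_continuous_curve a b (\<lambda>t::real. t)"
  unfolding absolutely_continuous_curve_def
proof (intro allI impI)
  fix \<epsilon> :: real assume "0 < \<epsilon>"
  then show "\<exists>\<delta>>0. \<forall>(n::nat) s t.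
        (\<forall>i<n. a \<le> s i \<and> s i \<le> t i \<and> t i \<le> b) \<and> disjoint_family_on (\<lambda>i. {s i<..<t i}) {..<n} \<and>
        (\<Sum>i<n. t i - s i) < \<delta> \<longrightarrow> (\<Sum>i<n. norm (t i - s i)) < \<epsilon>"
    by (intro exI[of _ \<epsilon>]) (auto cong: sum.cong_simp)
qed

text \<open>A finite cover assigns every short interval to one centre. The number of centres is
  fixed in advance, so \<epsilon> can be distributed evenly over them.\<close>

lemma absolutely_continuous_curve_local:
  assumes loc: "\<And>t. t \<in> {a..b} \<Longrightarrow> \<exists>\<delta>>0. \<forall>a' b'. a \<le> a' \<longrightarrow> a' \<le> b' \<longrightarrow> b' \<le> b \<longrightarrow> {a'..b'} \<subseteq> ball t \<delta> \<longrightarrow>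
      absolutely_continuous_curve a' b' f"
  shows "absolutely_continuous_curve a b f"
  unfolding absolutely_continuous_curve_def
proof (intro allI impI)
  fix \<epsilon> :: real assume \<epsilon>: "0 < \<epsilon>"
  have "\<forall>t. \<exists>\<delta>>0. t \<in> {a..b} \<longrightarrow> (\<forall>a' b'. a \<le> a' \<longrightarrow> a' \<le> b' \<longrightarrow> b' \<le> b \<longrightarrow> {a'..b'} \<subseteq> ball t \<delta> \<longrightarrow>
      absolutely_continuous_curve a' b' f)"
    using loc zero_less_one by blast
  from choice[OF this] obtain r where r: "\<And>t. 0 < r t"
    "\<And>t a' b'. t \<in> {a..b} \<Longrightarrow> a \<le> a' \<Longrightarrow> a' \<le> b' \<Longrightarrow> b' \<le> b \<Longrightarrow> {a'..b'} \<subseteq> ball t (r t) \<Longrightarrow> absolutely_continuous_curve a' b' f"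
    by metis
  have "{a..b} \<subseteq> (\<Union>t\<in>{a..b}. ball t (r t / 2))" using r(1) by fastforce
  then obtain T where T: "T \<subseteq> {a..b}" "finite T" "{a..b} \<subseteq> (\<Union>t\<in>T. ball t (r t / 2))"
    using compactE_image[of "{a..b}" "{a..b}" "\<lambda>t. ball t (r t / 2)"] by auto
  \<comment> \<open>An interval that begins within r / 2 of a centre and is shorter than r / 4 stays
    within 3 r / 4, hence inside the ball where absolute continuity is known.\<close>
  define l where "l = (\<lambda>t. max a (t - 3/4 * r t))"
  define u where "u = (\<lambda>t. min b (t + 3/4 * r t))"
  define e where "e = \<epsilon> / (real (card T) + 1)"
  have e: "0 < e" using \<epsilon> by (simp add: e_def)
  have "\<exists>\<delta>>0. t \<in> T \<longrightarrow> (\<forall>(n::nat) s s'.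
        (\<forall>i<n. l t \<le> s i \<and> s i \<le> s' i \<and> s' i \<le> u t) \<and> disjoint_family_on (\<lambda>i. {s i<..<s' i}) {..<n} \<and>
        (\<Sum>i<n. s' i - s i) < \<delta> \<longrightarrow> (\<Sum>i<n. norm (f (s' i) - f (s i))) < e)" for t
  proof (cases "t \<in> T")
    case True
    have tr: "0 < r t" "t \<in> {a..b}" using r(1) T(1) True by auto
    have "absolutely_continuous_curve (l t) (u t) f"
    proof (rule r(2)[OF tr(2)])
      show "a \<le> l t" "l t \<le> u t" "u t \<le> b" using tr by (auto simp: l_def u_def)
      show "{l t..u t} \<subseteq> ball t (r t)" using tr by (auto simp: l_def u_def dist_real_def)
    qed
    then show ?thesis using e unfolding absolutely_continuous_curve_def by blast
  qed (auto intro: exI[of _ 1])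
  then have "\<forall>t. \<exists>\<delta>. 0 < \<delta> \<and> (t \<in> T \<longrightarrow> (\<forall>(n::nat) s s'.
        (\<forall>i<n. l t \<le> s i \<and> s i \<le> s' i \<and> s' i \<le> u t) \<and> disjoint_family_on (\<lambda>i. {s i<..<s' i}) {..<n} \<and>
        (\<Sum>i<n. s' i - s i) < \<delta> \<longrightarrow> (\<Sum>i<n. norm (f (s' i) - f (s i))) < e))" by blast
  from choice[OF this] obtain d where dd: "\<forall>t. 0 < d t \<and> (t \<in> T \<longrightarrow> (\<forall>(n::nat) s s'.
        (\<forall>i<n. l t \<le> s i \<and> s i \<le> s' i \<and> s' i \<le> u t) \<and> disjoint_family_on (\<lambda>i. {s i<..<s' i}) {..<n} \<and>
        (\<Sum>i<n. s' i - s i) < d t \<longrightarrow> (\<Sum>i<n. norm (f (s' i) - f (s i))) < e))" ..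
  have d: "\<And>t. 0 < d t" using dd by blast
  note d2 = dd[rule_format, THEN conjunct2, rule_format]
  define \<delta> where "\<delta> = Min (insert 1 ((\<lambda>t. min (d t) (r t / 4)) ` T))"
  have \<delta>: "0 < \<delta>" unfolding \<delta>_def using T(2) d r(1) by (subst Min_gr_iff) auto
  have \<delta>_le: "\<delta> \<le> d t" "\<delta> \<le> r t / 4" if "t \<in> T" for t
  proof -
    have "\<delta> \<le> min (d t) (r t / 4)" unfolding \<delta>_def using T(2) that by (intro Min_le) auto
    then show "\<delta> \<le> d t" "\<delta> \<le> r t / 4" by auto
  qed
  show "\<exists>\<delta>>0. \<forall>(n::nat) s t.
        (\<forall>i<n. a \<le> s i \<and> s i \<le> t i \<and> t i \<le> b) \<and> disjoint_family_on (\<lambda>i. {s i<..<t i}) {..<n} \<and>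
        (\<Sum>i<n. t i - s i) < \<delta> \<longrightarrow> (\<Sum>i<n. norm (f (t i) - f (s i))) < \<epsilon>"
  proof (intro exI[of _ \<delta>] conjI \<delta> allI impI, elim conjE)
    fix n :: nat and s t
    assume st: "\<forall>i<n. a \<le> s i \<and> s i \<le> t i \<and> t i \<le> b" and disj: "disjoint_family_on (\<lambda>i. {s i<..<t i}) {..<n}"
      and small: "(\<Sum>i<n. t i - s i) < \<delta>"
    have "\<exists>c\<in>T. dist c (s i) < r c / 2" if "i < n" for i
    proof -
      have "s i \<in> {a..b}" using st that order_trans by fastforce
      then show ?thesis using T(3) by (auto simp: subset_iff)
    qed
    then obtain c where c: "\<And>i. i < n \<Longrightarrow> c i \<in> T \<and> dist (c i) (s i) < r (c i) / 2" by metis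
    have len: "t i - s i < \<delta>" if "i < n" for i
    proof -
      have "t i - s i \<le> (\<Sum>i<n. t i - s i)" by (rule member_le_sum) (use st that in auto)
      then show ?thesis using small by simp
    qed
    have "(\<Sum>i<n. norm (f (t i) - f (s i))) = (\<Sum>x\<in>T. \<Sum>i\<in>{i \<in> {..<n}. c i = x}. norm (f (t i) - f (s i)))"
      by (rule sum.group[symmetric]) (use T(2) c in auto)
    also have "\<dots> \<le> (\<Sum>x\<in>T. e)"
    proof (rule sum_mono)
      fix x assume x: "x \<in> T"
      \<comment> \<open>Intervals assigned to other centres are collapsed to the point
        \<open>l x\<close>; they contribute nothing, and the family keeps its index set.\<close>
      define s' where "s' = (\<lambda>i. if c i = x then s i else l x)"
      define t' where "t' = (\<lambda>i. if c i = x then t i else l x)"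
      have lu: "l x \<le> u x" using r(1)[of x] T(1) x by (auto simp: l_def u_def)
      have "(\<Sum>i<n. norm (f (t' i) - f (s' i))) < e"
      proof (rule d2[OF x], intro conjI allI impI)
        fix i assume i: "i < n"
        have "l x \<le> s' i \<and> s' i \<le> t' i \<and> t' i \<le> u x"
        proof (cases "c i = x")
          case True
          then have "dist x (s i) < r x / 2" "t i - s i < r x / 4" using c[OF i] len[OF i] \<delta>_le(2)[OF x] by auto
          then have "\<bar>x - s i\<bar> < r x / 2" "t i - s i < r x / 4" by (simp_all add: dist_real_def)
          moreover have sti: "a \<le> s i" "s i \<le> t i" "t i \<le> b" using st i by auto
          ultimately have "l x \<le> s i" "t i \<le> u x"
            unfolding l_def u_def by (intro max.boundedI min.boundedI; linarith)+
          then show ?thesis using True sti by (simp add: s'_def t'_def)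
        qed (use lu in \<open>auto simp: s'_def t'_def\<close>)
        then show "l x \<le> s' i" "s' i \<le> t' i" "t' i \<le> u x" by auto
      next
        show "disjoint_family_on (\<lambda>i. {s' i<..<t' i}) {..<n}"
          using disj by (fastforce simp: disjoint_family_on_def s'_def t'_def)
        have "(\<Sum>i<n. t' i - s' i) \<le> (\<Sum>i<n. t i - s i)"
          by (rule sum_mono) (use st in \<open>auto simp: s'_def t'_def\<close>)
        then show "(\<Sum>i<n. t' i - s' i) < d x" using small \<delta>_le(1)[OF x] by linarith
      qed
      moreover have "(\<Sum>i\<in>{i \<in> {..<n}. c i = x}. norm (f (t i) - f (s i))) = (\<Sum>i<n. norm (f (t' i) - f (s' i)))"
        by (rule sum.mono_neutral_cong_left) (auto simp: s'_def t'_def)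
      ultimately show "(\<Sum>i\<in>{i \<in> {..<n}. c i = x}. norm (f (t i) - f (s i))) \<le> e" by simp
    qed
    also have "\<dots> < \<epsilon>" using \<epsilon> by (simp add: e_def divide_less_eq algebra_simps)
    finally show "(\<Sum>i<n. norm (f (t i) - f (s i))) < \<epsilon>" .
  qed
qed

text \<open>Intervals tagged in the null set lie in an open set of small measure, so absolute continuity
  bounds their contribution; the remaining ones are controlled by the derivative at the tag.\<close>

lemma absolutely_continuous_has_integral:
  fixes f :: "real \<Rightarrow> 'e::euclidean_space"
  assumes ab: "a \<le> b" and ac: "absolutely_continuous_curve a b f" and neg: "negligible S"
    and der: "\<And>t. t \<in> {a..b} - S \<Longrightarrow> (f has_vector_derivative f' t) (at t within {a..b})"
  shows "((\<lambda>t. if t \<in> S then 0 else f' t) has_integral (f b - f a)) {a..b}"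
  unfolding has_integral_real
proof (intro allI impI)
  fix \<epsilon> :: real assume \<epsilon>: "0 < \<epsilon>"
  define e where "e = \<epsilon> / (4 * (b - a + 1))"
  have e: "0 < e" using \<epsilon> ab by (simp add: e_def)
  obtain \<delta> where \<delta>: "0 < \<delta>" "\<forall>(I :: (real \<times> real set) set) s t. finite I \<longrightarrow> (\<forall>i\<in>I. a \<le> s i \<and> s i \<le> t i \<and> t i \<le> b) \<longrightarrow>
     disjoint_family_on (\<lambda>i. {s i<..<t i}) I \<longrightarrow> (\<Sum>i\<in>I. t i - s i) < \<delta> \<longrightarrow> (\<Sum>i\<in>I. norm (f (t i) - f (s i))) < \<epsilon> / 2"
    using absolutely_continuous_curve_set[OF ac half_gt_zero[OF \<epsilon>], where 'i = "real \<times> real set"] by blast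
  obtain O' where O': "open O'" "S \<subseteq> O'" "emeasure lebesgue O' < ennreal \<delta>"
  proof -
    have "S \<in> sets lebesgue" using neg by (rule negligible_imp_sets)
    from sets_lebesgue_outer_open[OF this \<delta>(1)] obtain T where T: "open T" "S \<subseteq> T" "T - S \<in> lmeasurable" "emeasure lebesgue (T - S) < ennreal \<delta>" by metis
    have "emeasure lebesgue T \<le> emeasure lebesgue (S \<union> (T - S))"
      by (rule emeasure_mono) (use T neg in \<open>auto intro: negligible_imp_sets\<close>)
    also have "\<dots> \<le> emeasure lebesgue S + emeasure lebesgue (T - S)"
      using neg T by (intro emeasure_subadditive) (auto intro: negligible_imp_sets)
    also have "emeasure lebesgue S = 0" using neg by (simp add: negligible_iff_null_sets null_setsD1)
    finally show ?thesis using that T by auto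
  qed
  have "\<exists>r>0. (t \<in> {a..b} - S \<longrightarrow> (\<forall>y\<in>{a..b}. \<bar>y - t\<bar> < r \<longrightarrow> norm (f y - f t - (y - t) *\<^sub>R f' t) \<le> e * \<bar>y - t\<bar>)) \<and>
      (t \<in> S \<longrightarrow> ball t r \<subseteq> O')" for t
  proof (cases "t \<in> S")
    case True
    then show ?thesis using O' open_contains_ball by (metis DiffD2 subsetD)
  next
    case False
    show ?thesis
    proof (cases "t \<in> {a..b}")
      case True
      with False der[of t] have "(f has_derivative (\<lambda>h. h *\<^sub>R f' t)) (at t within {a..b})" by (simp add: has_vector_derivative_def)
      then obtain d where "0 < d" "\<forall>y\<in>{a..b}. norm (y - t) < d \<longrightarrow> norm (f y - f t - (y - t) *\<^sub>R f' t) \<le> e * norm (y - t)"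
        using e unfolding has_derivative_within_alt by blast
      then show ?thesis using False by auto
    qed (use False in \<open>auto intro: exI[of _ 1]\<close>)
  qed
  then obtain r where r: "\<And>t. 0 < r t"
    "\<And>t y. t \<in> {a..b} - S \<Longrightarrow> y \<in> {a..b} \<Longrightarrow> \<bar>y - t\<bar> < r t \<Longrightarrow> norm (f y - f t - (y - t) *\<^sub>R f' t) \<le> e * \<bar>y - t\<bar>"
    "\<And>t. t \<in> S \<Longrightarrow> ball t (r t) \<subseteq> O'"
    by metis
  let ?g = "\<lambda>t. if t \<in> S then 0 else f' t"
  show "\<exists>\<gamma>. gauge \<gamma> \<and> (\<forall>\<D>. \<D> tagged_division_of {a..b} \<and> \<gamma> fine \<D> \<longrightarrow>
      norm ((\<Sum>(x, k)\<in>\<D>. measure lborel k *\<^sub>R ?g x) - (f b - f a)) < \<epsilon>)"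
  proof (intro exI[of _ "\<lambda>t. ball t (r t)"] conjI allI impI)
    show "gauge (\<lambda>t. ball t (r t))" by (rule gauge_ball_dependent) (use r(1) in auto)
    fix \<D> assume "\<D> tagged_division_of {a..b} \<and> (\<lambda>t. ball t (r t)) fine \<D>"
    then have D: "\<D> tagged_division_of {a..b}" and fine: "(\<lambda>t. ball t (r t)) fine \<D>" by blast+
    note tD = tagged_division_ofD[OF D]
    have fin: "finite \<D>" by (rule tD(1))
    have k: "\<exists>u v. k = {u..v} \<and> a \<le> u \<and> u \<le> x \<and> x \<le> v \<and> v \<le> b \<and> Inf k = u \<and> Sup k = v \<and> measure lborel k = v - u \<and> {u..v} \<subseteq> ball x (r x)"
      if xk: "(x, k) \<in> \<D>" for x k
    proof -
      obtain u v where uv: "k = cbox u v" using tD(4)[OF xk] by blast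
      have "x \<in> {u..v}" "{u..v} \<subseteq> {a..b}" using tD(2,3)[OF xk] uv by auto
      moreover have "k \<subseteq> ball x (r x)" using fineD[OF fine xk] .
      ultimately show ?thesis using uv by (intro exI[of _ u] exI[of _ v]) auto
    qed
    have sum_f: "(\<Sum>(x, k)\<in>\<D>. f (Sup k) - f (Inf k)) = f b - f a"
      by (rule additive_tagged_division_1[OF ab D])
    let ?t = "\<lambda>p :: real \<times> real set. norm (measure lborel (snd p) *\<^sub>R ?g (fst p) - (f (Sup (snd p)) - f (Inf (snd p))))"
    define DS where "DS = {p \<in> \<D>. fst p \<in> S}"
    define DN where "DN = {p \<in> \<D>. fst p \<notin> S}"
    have split: "\<D> = DS \<union> DN" "DS \<inter> DN = {}" "finite DS" "finite DN" using fin by (auto simp: DS_def DN_def)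
    have "(\<Sum>p\<in>DN. ?t p) \<le> (\<Sum>p\<in>DN. e * measure lborel (snd p))"
    proof (rule sum_mono)
      fix p assume p: "p \<in> DN"
      obtain x k' where xk: "p = (x, k')" by force
      then have D': "(x, k') \<in> \<D>" "x \<notin> S" using p by (auto simp: DN_def)
      obtain u v where uv: "k' = {u..v}" "a \<le> u" "u \<le> x" "x \<le> v" "v \<le> b" "Inf k' = u" "Sup k' = v" "measure lborel k' = v - u" "{u..v} \<subseteq> ball x (r x)"
        using k[OF D'(1)] by blast
      have "u \<in> {u..v}" "v \<in> {u..v}" using uv(3,4) by simp_all
      then have "u \<in> ball x (r x)" "v \<in> ball x (r x)" using uv(9) by blast+
      then have d: "\<bar>u - x\<bar> < r x" "\<bar>v - x\<bar> < r x" by (auto simp: dist_real_def)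
      have xn: "x \<in> {a..b} - S" using uv D' by auto
      have n1: "norm (f v - f x - (v - x) *\<^sub>R f' x) \<le> e * (v - x)" using r(2)[OF xn _ d(2)] uv by auto
      have n2: "norm (f u - f x - (u - x) *\<^sub>R f' x) \<le> e * (x - u)" using r(2)[OF xn _ d(1)] uv by auto
      \<comment> \<open>The tag lies between the endpoints, so the errors e (x - u) and e (v - x)
        add up to exactly e (v - u).\<close>
      have eq: "(v - u) *\<^sub>R f' x - (f v - f u) = (f u - f x - (u - x) *\<^sub>R f' x) - (f v - f x - (v - x) *\<^sub>R f' x)"
        by (simp add: algebra_simps)
      have "norm ((v - u) *\<^sub>R f' x - (f v - f u)) \<le> e * (x - u) + e * (v - x)"
        unfolding eq using n1 n2
          norm_triangle_ineq4[of "f u - f x - (u - x) *\<^sub>R f' x" "f v - f x - (v - x) *\<^sub>R f' x"] by linarith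
      also have "\<dots> = e * (v - u)" by (simp add: algebra_simps)
      finally show "?t p \<le> e * measure lborel (snd p)" using D' uv by (simp add: xk)
    qed
    also have "\<dots> = e * (\<Sum>p\<in>DN. measure lborel (snd p))" by (simp add: sum_distrib_left)
    also have "\<dots> \<le> e * (\<Sum>p\<in>\<D>. measure lborel (snd p))"
      using e fin split(1) by (intro mult_left_mono sum_mono2) auto
    also have "(\<Sum>p\<in>\<D>. measure lborel (snd p)) = b - a"
      using additive_content_tagged_division[of \<D> a b] D ab by (simp add: split_def)
    also have "e * (b - a) < \<epsilon> / 2"
    proof -
      have quarter: "\<epsilon> / (4 * c) * c = \<epsilon> / 4" if "0 < c" for c using that by simp
      have "e * (b - a + 1) = \<epsilon> / 4" unfolding e_def by (rule quarter) (use ab in linarith)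
      moreover have "e * (b - a) \<le> e * (b - a + 1)" using e by (intro mult_left_mono) auto
      ultimately show ?thesis using \<epsilon> by linarith
    qed
    finally have 1: "(\<Sum>p\<in>DN. ?t p) < \<epsilon> / 2" .
    have DSk: "a \<le> Inf (snd p) \<and> Inf (snd p) \<le> Sup (snd p) \<and> Sup (snd p) \<le> b \<and> snd p = {Inf (snd p)..Sup (snd p)} \<and> {Inf (snd p)<..<Sup (snd p)} \<subseteq> O'"
      if "p \<in> DS" for p
    proof -
      obtain x k' where xk: "p = (x, k')" by force
      then have D': "(x, k') \<in> \<D>" "x \<in> S" using that by (auto simp: DS_def)
      obtain u v where uv: "k' = {u..v}" "a \<le> u" "u \<le> x" "x \<le> v" "v \<le> b" "Inf k' = u" "Sup k' = v" "measure lborel k' = v - u" "{u..v} \<subseteq> ball x (r x)"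
        using k[OF D'(1)] by blast
      have "{u<..<v} \<subseteq> {u..v}" by auto
      then have "{u<..<v} \<subseteq> O'" using uv(9) r(3)[OF D'(2)] by blast
      then show ?thesis using uv by (simp add: xk)
    qed
    have disj: "disjoint_family_on (\<lambda>p. {Inf (snd p)<..<Sup (snd p)}) DS"
      unfolding disjoint_family_on_def
    proof (intro ballI impI)
      fix p q assume pq: "p \<in> DS" "q \<in> DS" "p \<noteq> q"
      have int: "interior (snd p) \<inter> interior (snd q) = {}"
        using tD(5)[of "fst p" "snd p" "fst q" "snd q"] pq by (auto simp: DS_def)
      have "interior (snd p') = {Inf (snd p')<..<Sup (snd p')}" if "p' \<in> DS" for p'
        using DSk[OF that] interior_atLeastAtMost_real by metis
      then show "{Inf (snd p)<..<Sup (snd p)} \<inter> {Inf (snd q)<..<Sup (snd q)} = {}" using int pq by simp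
    qed
    have "(\<Sum>p\<in>DS. Sup (snd p) - Inf (snd p)) < \<delta>"
    proof -
      have "ennreal (\<Sum>p\<in>DS. Sup (snd p) - Inf (snd p)) = (\<Sum>p\<in>DS. emeasure lebesgue {Inf (snd p)<..<Sup (snd p)})"
        using DSk by (subst sum_ennreal[symmetric]) (auto intro!: sum.cong)
      also have "\<dots> = emeasure lebesgue (\<Union>p\<in>DS. {Inf (snd p)<..<Sup (snd p)})"
        by (rule sum_emeasure) (use disj split in auto)
      also have "\<dots> \<le> emeasure lebesgue O'" using DSk O'(1) by (intro emeasure_mono) auto
      also have "\<dots> < ennreal \<delta>" by (rule O'(3))
      finally have "ennreal (\<Sum>p\<in>DS. Sup (snd p) - Inf (snd p)) < ennreal \<delta>" .
      moreover have "0 \<le> (\<Sum>p\<in>DS. Sup (snd p) - Inf (snd p))" using DSk by (intro sum_nonneg) auto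
      ultimately show ?thesis by (simp add: ennreal_less_iff)
    qed
    then have "(\<Sum>p\<in>DS. norm (f (Sup (snd p)) - f (Inf (snd p)))) < \<epsilon> / 2"
      using DSk disj split(3) by (intro \<delta>(2)[rule_format]) auto
    moreover have "(\<Sum>p\<in>DS. ?t p) = (\<Sum>p\<in>DS. norm (f (Sup (snd p)) - f (Inf (snd p))))"
      by (rule sum.cong) (auto simp: DS_def norm_minus_commute)
    ultimately have 2: "(\<Sum>p\<in>DS. ?t p) < \<epsilon> / 2" by simp
    have "(\<Sum>(x, k)\<in>\<D>. measure lborel k *\<^sub>R ?g x) - (f b - f a) = (\<Sum>p\<in>\<D>. measure lborel (snd p) *\<^sub>R ?g (fst p) - (f (Sup (snd p)) - f (Inf (snd p))))"
      unfolding sum_f[symmetric] sum_subtractf[symmetric] by (simp add: split_def)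
    also have "norm \<dots> \<le> (\<Sum>p\<in>\<D>. ?t p)" by (rule norm_sum)
    also have "\<dots> = (\<Sum>p\<in>DS. ?t p) + (\<Sum>p\<in>DN. ?t p)"
      unfolding split(1) by (rule sum.union_disjoint) (use split in auto)
    also have "\<dots> < \<epsilon>" using 1 2 by simp
    finally show "norm ((\<Sum>(x, k)\<in>\<D>. measure lborel k *\<^sub>R ?g x) - (f b - f a)) < \<epsilon>" .
  qed
qed

section \<open>Words and horizontal curves in exponential coordinates\<close>

context subfinsler_nil2 begin

text \<open>For Riemann sums over a common tagged division the inequality is subadditivity of the
  norm. It passes to the limit because V is closed and \<nu> is bounded by a multiple of the
  Euclidean norm on V.\<close>

lemma nu_has_integral_le:
  assumes f: "(f has_integral I) {a..c::real}" "\<And>t. f t \<in> V" and h: "(h has_integral J) {a..c}"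
    and le: "\<And>t. t \<in> {a..c} \<Longrightarrow> \<nu> (f t) \<le> h t"
  shows "I \<in> V" "\<nu> I \<le> J"
proof -
  have approx: "\<exists>S\<in>V. norm (S - I) < e \<and> \<nu> S \<le> J + e" if e: "0 < e" for e
  proof -
    obtain \<gamma>1 where g1: "gauge \<gamma>1" and g1': "\<forall>\<D>. \<D> tagged_division_of {a..c} \<and> \<gamma>1 fine \<D> \<longrightarrow>
        norm ((\<Sum>(x,k)\<in>\<D>. measure lborel k *\<^sub>R f x) - I) < e"
      using f(1)[unfolded has_integral_real, THEN spec, THEN mp, OF e] by (elim exE conjE)
    obtain \<gamma>2 where g2: "gauge \<gamma>2" and g2': "\<forall>\<D>. \<D> tagged_division_of {a..c} \<and> \<gamma>2 fine \<D> \<longrightarrow>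
        norm ((\<Sum>(x,k)\<in>\<D>. measure lborel k *\<^sub>R h x) - J) < e"
      using h[unfolded has_integral_real, THEN spec, THEN mp, OF e] by (elim exE conjE)
    obtain \<D> where D: "\<D> tagged_division_of {a..c}" "(\<lambda>x. \<gamma>1 x \<inter> \<gamma>2 x) fine \<D>"
      using fine_division_exists_real[OF gauge_Int[OF g1 g2]] by blast
    have fine: "\<gamma>1 fine \<D>" "\<gamma>2 fine \<D>" using D(2) by (auto simp: fine_Int)
    let ?S = "\<Sum>(x,k)\<in>\<D>. measure lborel k *\<^sub>R f x"
    have fin: "finite \<D>" using D(1) by (rule tagged_division_of_finite)
    have V: "?S \<in> V" by (intro subspace_sum subV) (auto intro: subspace_scale[OF subV] f(2))
    have "\<nu> ?S \<le> (\<Sum>p\<in>\<D>. \<nu> (case p of (x,k) \<Rightarrow> measure lborel k *\<^sub>R f x))"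
      by (rule nu_sum[OF fin]) (auto intro: subspace_scale[OF subV] f(2))
    also have "\<dots> \<le> (\<Sum>(x,k)\<in>\<D>. measure lborel k *\<^sub>R h x)"
    proof (rule sum_mono)
      fix p assume p: "p \<in> \<D>"
      obtain x k where xk: "p = (x, k)" by force
      have "x \<in> {a..c}" using tagged_division_ofD(2,3)[OF D(1), of x k] p xk by blast
      then have "measure lborel k * \<nu> (f x) \<le> measure lborel k * h x" by (intro mult_left_mono le) auto
      then show "\<nu> (case p of (x,k) \<Rightarrow> measure lborel k *\<^sub>R f x) \<le> (case p of (x,k) \<Rightarrow> measure lborel k *\<^sub>R h x)"
        using nu(3)[OF f(2)] by (simp add: xk)
    qed
    also have "\<dots> \<le> J + e" using g2'[THEN spec, THEN mp, OF conjI[OF D(1) fine(2)]] by (simp add: abs_less_iff)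
    finally show ?thesis using V g1'[THEN spec, THEN mp, OF conjI[OF D(1) fine(1)]] by (intro bexI[of _ ?S] conjI)
  qed
  have "I \<in> closure V"
    unfolding closure_approachable dist_norm using approx by blast
  then show I: "I \<in> V" using closed_subspace[OF subV] by simp
  obtain K where K: "0 < K" "\<And>v. v \<in> V \<Longrightarrow> \<nu> v \<le> K * norm v" using nu_upper by blast
  show "\<nu> I \<le> J"
  proof (rule field_le_epsilon)
    fix \<epsilon> :: real assume "0 < \<epsilon>"
    then have "0 < \<epsilon> / (1 + K)" using K by simp
    from approx[OF this] obtain S where S: "S \<in> V" "norm (S - I) < \<epsilon> / (1 + K)" "\<nu> S \<le> J + \<epsilon> / (1 + K)" by blast
    have IS: "I - S \<in> V" using I S(1) subV by (auto intro: subspace_diff)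
    have "\<nu> I \<le> \<nu> S + \<nu> (I - S)" using nu(4)[OF S(1) IS] by simp
    also have "\<nu> (I - S) \<le> K * (\<epsilon> / (1 + K))"
      using K(2)[OF IS] S(2) K(1) by (smt (verit) mult_left_mono norm_minus_commute)
    finally have "\<nu> I \<le> J + (\<epsilon> / (1 + K) + K * (\<epsilon> / (1 + K)))" using S(3) by linarith
    also have "\<epsilon> / (1 + K) + K * (\<epsilon> / (1 + K)) = \<epsilon>"
    proof -
      have "\<epsilon> / (1 + K) + K * (\<epsilon> / (1 + K)) = (1 + K) * (\<epsilon> / (1 + K))" by (simp only: distrib_right mult_1_left)
      then show ?thesis using K(1) by simp
    qed
    finally show "\<nu> I \<le> J + \<epsilon>" .
  qed
qed

text \<open>The values of \<nu> are constrained on V only. Composing with a linear projection onto V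
  gives a continuous function on the whole space, as measurability arguments require.\<close>

lemma nu_extension:
  obtains \<nu>' where "continuous_on UNIV \<nu>'" "\<And>v. v \<in> V \<Longrightarrow> \<nu>' v = \<nu> v"
proof -
  have "\<exists>g. range g \<subseteq> V \<and> linear g \<and> (\<forall>v\<in>V. g (id v) = v)"
    by (rule linear_exists_left_inverse_on) (auto simp: subV inj_on_def id_def intro: linear_ident)
  then obtain g where g: "range g \<subseteq> V" "linear g" "\<forall>v\<in>V. g v = v" by auto
  show ?thesis
  proof (rule that[of "\<lambda>x. \<nu> (g x)"])
    show "continuous_on UNIV (\<lambda>x. \<nu> (g x))"
      by (rule continuous_on_compose2[OF continuous_nu linear_continuous_on[OF linear_conv_bounded_linear[THEN iffD1, OF g(2)]]])
        (use g(1) in auto)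
  qed (use g(3) in simp)
qed

text \<open>Subdivide the curve and replace each piece by the letter that is the integral of v over
  it. The error on a piece is central and at most M \<omega> times the length of the piece, where
  \<omega> bounds the oscillation of \<gamma>. A central element z has distance O(sqrt |z|) from 0,
  so the total error vanishes as \<omega> tends to 0.\<close>

lemma D_le_curve_length:
  assumes ab: "a \<le> c" and ac: "absolutely_continuous_curve a c \<gamma>" and cont: "continuous_on {a..c} \<gamma>"
    and neg: "negligible S" and vV: "\<And>t. t \<in> {a..c} - S \<Longrightarrow> v t \<in> V"
    and der: "\<And>t. t \<in> {a..c} - S \<Longrightarrow> (\<gamma> has_vector_derivative (v t + (1/2) *\<^sub>R b (\<gamma> t) (v t))) (at t within {a..c})"
  shows "ennreal (D (\<lambda>_. 0) (mul (- \<gamma> a) (\<gamma> c))) \<le> (\<integral>\<^sup>+ t \<in> {a..c}. ennreal (\<nu> (v t)) \<partial>lebesgue)"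
proof (cases "(\<integral>\<^sup>+ t \<in> {a..c}. ennreal (\<nu> (v t)) \<partial>lebesgue) = \<infinity>")
  case False
  define u where "u = (\<lambda>t. if t \<in> {a..c} - S then v t else 0)"
  define g where "g = (\<lambda>t. u t + (1/2) *\<^sub>R b (\<gamma> t) (u t))"
  have uV: "u t \<in> V" for t using vV subspace_0[OF subV] by (simp add: u_def)
  have g_int: "(g has_integral (\<gamma> t - \<gamma> s)) {s..t}" if st: "a \<le> s" "s \<le> t" "t \<le> c" for s t
  proof -
    have "((\<lambda>\<tau>. if \<tau> \<in> S then 0 else v \<tau> + (1/2) *\<^sub>R b (\<gamma> \<tau>) (v \<tau>)) has_integral (\<gamma> t - \<gamma> s)) {s..t}"
    proof (rule absolutely_continuous_has_integral[OF st(2) _ neg])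
      show "absolutely_continuous_curve s t \<gamma>" by (rule absolutely_continuous_curve_subinterval[OF ac st(1,3)])
      fix \<tau> assume "\<tau> \<in> {s..t} - S"
      then show "(\<gamma> has_vector_derivative (v \<tau> + (1/2) *\<^sub>R b (\<gamma> \<tau>) (v \<tau>))) (at \<tau> within {s..t})"
        using st by (intro has_vector_derivative_within_subset[OF der]) auto
    qed
    then show ?thesis
      by (rule has_integral_eq[rotated]) (use st in \<open>auto simp: g_def u_def b.zero_right\<close>)
  qed
  \<comment> \<open>Measurability of \<open>u\<close> comes from that of \<open>g\<close>: brackets
    are central, so g = u + b \<gamma> u / 2 can be solved for u in terms of g and \<gamma>.\<close>
  have u_g: "u t = indicator {a..c} t *\<^sub>R g t - (1/2) *\<^sub>R b (indicator {a..c} t *\<^sub>R \<gamma> t) (indicator {a..c} t *\<^sub>R g t)" for t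
    by (cases "t \<in> {a..c}") (auto simp: g_def u_def b.add_right b.scaleR_right b.zero_right b.zero_left)
  have [measurable]: "(\<lambda>t. indicator {a..c} t *\<^sub>R g t) \<in> borel_measurable lebesgue"
    by (rule has_integral_implies_lebesgue_measurable[OF g_int[OF order_refl ab order_refl]])
  have "(\<lambda>t. indicator {a..c} t *\<^sub>R \<gamma> t) \<in> borel_measurable borel"
    by (rule borel_measurable_continuous_on_indicator[OF _ cont]) simp
  then have [measurable]: "(\<lambda>t. indicator {a..c} t *\<^sub>R \<gamma> t) \<in> borel_measurable lebesgue"
    by (simp add: measurable_completion)
  have [measurable]: "(\<lambda>t. b (indicator {a..c} t *\<^sub>R \<gamma> t) (indicator {a..c} t *\<^sub>R g t)) \<in> borel_measurable lebesgue"
    by (rule borel_measurable_continuous_Pair) (auto intro!: b.continuous_on continuous_intros)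
  have u_meas [measurable]: "u \<in> borel_measurable lebesgue"
    unfolding u_g[abs_def] by measurable
  obtain \<nu>' where nu': "continuous_on UNIV \<nu>'" "\<And>v. v \<in> V \<Longrightarrow> \<nu>' v = \<nu> v" by (rule nu_extension) blast
  define h where "h = (\<lambda>t. \<nu> (u t))"
  have h0: "0 \<le> h t" for t using nu(1)[OF uV] by (simp add: h_def)
  have h_eq: "h = (\<lambda>t. \<nu>' (u t))" using nu'(2)[OF uV] by (simp add: h_def)
  have "\<nu>' \<in> borel_measurable borel" using nu'(1) by (rule borel_measurable_continuous_onI)
  then have h_meas [measurable]: "h \<in> borel_measurable lebesgue"
    unfolding h_eq using u_meas by (rule measurable_compose[rotated])
  define J where "J = enn2real (\<integral>\<^sup>+ t \<in> {a..c}. ennreal (\<nu> (v t)) \<partial>lebesgue)"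
  have J_eq: "(\<integral>\<^sup>+ t \<in> {a..c}. ennreal (\<nu> (v t)) \<partial>lebesgue) = ennreal J"
    using False by (simp add: J_def less_top)
  have "(\<integral>\<^sup>+ t. ennreal (h t) \<partial>lebesgue) = (\<integral>\<^sup>+ t \<in> {a..c}. ennreal (\<nu> (v t)) \<partial>lebesgue)"
  proof (rule nn_integral_cong_AE)
    have "AE t in lebesgue. t \<notin> S" using neg by (simp add: AE_not_in negligible_iff_null_sets)
    then show "AE t in lebesgue. ennreal (h t) = ennreal (\<nu> (v t)) * indicator {a..c} t"
      by eventually_elim (auto simp: h_def u_def nu indicator_def)
  qed
  also note J_eq
  finally have "(h has_integral J) UNIV"
    unfolding has_integral_iff_nn_integral_lebesgue[OF h0] using h_meas by (simp add: J_def)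
  moreover have "h = (\<lambda>t. if t \<in> {a..c} then h t else 0)" by (auto simp: h_def u_def nu fun_eq_iff)
  ultimately have hJ: "(h has_integral J) {a..c}" using has_integral_restrict_UNIV[of "{a..c}" h J] by metis
  then have h_int: "h integrable_on {a..c}" by blast
  obtain K where K: "0 < K" "\<And>v. v \<in> V \<Longrightarrow> norm v \<le> K * \<nu> v" using nu_lower by blast
  have u_int: "u integrable_on {a..c}"
  proof (rule measurable_bounded_by_integrable_imp_integrable)
    show "u \<in> borel_measurable (lebesgue_on {a..c})" using u_meas by (rule measurable_restrict_space1)
    show "(\<lambda>t. K * h t) integrable_on {a..c}" using h_int by (rule integrable_on_mult_right)
    show "norm (u t) \<le> K * h t" for t using K(2)[OF uV] by (simp add: h_def)
  qed simp
  obtain B where B: "0 < B" "\<And>u w. norm (b u w) \<le> B * norm u * norm w" using mul_bound by metis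
  define M where "M = B * K"
  have M: "0 < M" using B K by (simp add: M_def)
  have step: "integral {s..t} u \<in> V \<and> \<nu> (integral {s..t} u) \<le> integral {s..t} h \<and>
      mul (- \<gamma> s) (\<gamma> t) - integral {s..t} u \<in> Z \<and>
      norm (mul (- \<gamma> s) (\<gamma> t) - integral {s..t} u) \<le> M * \<omega> * integral {s..t} h"
    if st: "a \<le> s" "s \<le> t" "t \<le> c" and osc: "0 \<le> \<omega>" "\<And>\<tau>. \<tau> \<in> {s..t} \<Longrightarrow> norm (\<gamma> \<tau> - \<gamma> s) \<le> \<omega>" for s t \<omega>
  proof -
    have sub: "{s..t} \<subseteq> {a..c}" using st by auto
    have ui: "(u has_integral integral {s..t} u) {s..t}" and hi: "(h has_integral integral {s..t} h) {s..t}"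
      using integrable_subinterval_real[OF u_int sub] integrable_subinterval_real[OF h_int sub] by (auto intro: integrable_integral)
    have 1: "integral {s..t} u \<in> V" "\<nu> (integral {s..t} u) \<le> integral {s..t} h"
      using nu_has_integral_le[OF ui uV hi] by (auto simp: h_def)
    \<comment> \<open>This linear map describes the effect of left translation by - \<gamma> s on
      increments. Applied to \<open>g\<close> it gives u plus half the bracket of \<gamma> \<tau> -
      \<gamma> s with u; the second part is central and small.\<close>
    have bl: "bounded_linear (\<lambda>x. x - (1/2) *\<^sub>R b (\<gamma> s) x)"
      by (intro bounded_linear_sub bounded_linear_ident bounded_linear_compose[OF bounded_linear_scaleR_right] b.bounded_linear_right)
    have "mul (- \<gamma> s) (\<gamma> t) = (\<gamma> t - \<gamma> s) - (1/2) *\<^sub>R b (\<gamma> s) (\<gamma> t - \<gamma> s)"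
      by (simp add: mul_def b.minus_left b.diff_right)
    then have "((\<lambda>x. x - (1/2) *\<^sub>R b (\<gamma> s) x) \<circ> g has_integral mul (- \<gamma> s) (\<gamma> t)) {s..t}"
      using has_integral_linear[OF g_int[OF st] bl] by simp
    from has_integral_diff[OF this ui]
    have "((\<lambda>\<tau>. ((\<lambda>x. x - (1/2) *\<^sub>R b (\<gamma> s) x) \<circ> g) \<tau> - u \<tau>) has_integral (mul (- \<gamma> s) (\<gamma> t) - integral {s..t} u)) {s..t}" .
    moreover have "((\<lambda>x. x - (1/2) *\<^sub>R b (\<gamma> s) x) \<circ> g) \<tau> - u \<tau> = (1/2) *\<^sub>R b (\<gamma> \<tau> - \<gamma> s) (u \<tau>)" for \<tau>
      by (simp add: g_def b.add_right b.scaleR_right b.diff_left scaleR_diff_right)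
    ultimately have ci: "((\<lambda>\<tau>. (1/2) *\<^sub>R b (\<gamma> \<tau> - \<gamma> s) (u \<tau>)) has_integral (mul (- \<gamma> s) (\<gamma> t) - integral {s..t} u)) {s..t}" by simp
    have "((pr \<circ> (\<lambda>\<tau>. (1/2) *\<^sub>R b (\<gamma> \<tau> - \<gamma> s) (u \<tau>))) has_integral pr (mul (- \<gamma> s) (\<gamma> t) - integral {s..t} u)) {s..t}"
      by (rule has_integral_linear[OF ci pr.bounded_linear_axioms])
    then have "((\<lambda>_. 0) has_integral pr (mul (- \<gamma> s) (\<gamma> t) - integral {s..t} u)) {s..t}"
      by (simp add: comp_def pr.scaleR)
    then have 2: "mul (- \<gamma> s) (\<gamma> t) - integral {s..t} u \<in> Z"
      using has_integral_unique[OF _ has_integral_0] by (metis pr_0_iff)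
    have "norm (integral {s..t} (\<lambda>\<tau>. (1/2) *\<^sub>R b (\<gamma> \<tau> - \<gamma> s) (u \<tau>))) \<le> integral {s..t} (\<lambda>\<tau>. M * \<omega> * h \<tau>)"
    proof (rule Henstock_Kurzweil_Integration.integral_norm_bound_integral)
      show "(\<lambda>\<tau>. (1/2) *\<^sub>R b (\<gamma> \<tau> - \<gamma> s) (u \<tau>)) integrable_on {s..t}" using ci by blast
      show "(\<lambda>\<tau>. M * \<omega> * h \<tau>) integrable_on {s..t}" using hi by (intro integrable_on_mult_right) blast
      fix \<tau> assume \<tau>: "\<tau> \<in> {s..t}"
      have "norm (b (\<gamma> \<tau> - \<gamma> s) (u \<tau>)) \<le> B * norm (\<gamma> \<tau> - \<gamma> s) * norm (u \<tau>)" by (rule B)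
      also have "\<dots> \<le> B * \<omega> * (K * h \<tau>)"
        using osc(2)[OF \<tau>] osc(1) K(2)[OF uV[of \<tau>]] B(1) by (intro mult_mono) (auto simp: h_def)
      finally have "norm (b (\<gamma> \<tau> - \<gamma> s) (u \<tau>)) \<le> M * \<omega> * h \<tau>" by (simp add: M_def mult_ac)
      then show "norm ((1/2) *\<^sub>R b (\<gamma> \<tau> - \<gamma> s) (u \<tau>)) \<le> M * \<omega> * h \<tau>"
        using norm_ge_zero[of "b (\<gamma> \<tau> - \<gamma> s) (u \<tau>)"] by (simp only: norm_scaleR)
    qed
    then have 3: "norm (mul (- \<gamma> s) (\<gamma> t) - integral {s..t} u) \<le> M * \<omega> * integral {s..t} h"
      by (simp only: integral_unique[OF ci] Henstock_Kurzweil_Integration.integral_mult_right)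
    show ?thesis using 1 2 3 by blast
  qed
  have h_nonneg: "0 \<le> integral {s..t} h" if "a \<le> s" "t \<le> c" for s t
    by (rule Henstock_Kurzweil_Integration.integral_nonneg) (use h0 integrable_subinterval_real[OF h_int] that in auto)
  obtain Ku where Ku: "0 < Ku" "\<And>x. D (\<lambda>_. 0) x \<le> Ku * (norm (pr x) + sqrt (norm (pr x)) + sqrt (norm (\<zeta> x)))"
    using D_upper[OF adm_0] by metis
  have J0: "0 \<le> J" by (simp add: J_def)
  have main: "D (\<lambda>_. 0) (mul (- \<gamma> a) (\<gamma> c)) \<le> J + Ku * sqrt (M * \<omega> * J)" if \<omega>: "0 < \<omega>" for \<omega>
  proof -
    have "uniformly_continuous_on {a..c} \<gamma>" by (rule compact_uniformly_continuous[OF cont]) simp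
    then obtain d where d: "0 < d" "\<And>s t. s \<in> {a..c} \<Longrightarrow> t \<in> {a..c} \<Longrightarrow> dist t s < d \<Longrightarrow> dist (\<gamma> t) (\<gamma> s) < \<omega>"
      using \<omega> unfolding uniformly_continuous_on_def by metis
    obtain n where n: "(c - a) / d < real n" using reals_Archimedean2 by blast
    have npos: "0 < real n" using n ab d(1) by (meson divide_nonneg_pos le_less_trans diff_ge_0_iff_ge)
    have nd: "(c - a) / real n < d" using n d(1) npos by (simp add: field_simps)
    define p where "p = (\<lambda>i. a + real i * ((c - a) / real n))"
    have p_step: "p (Suc i) - p i = (c - a) / real n" for i by (simp add: p_def distrib_right add_divide_distrib)
    have "0 \<le> (c - a) / real n" using ab by simp
    then have p_mono: "p i \<le> p (Suc i)" for i using p_step[of i] by linarith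
    have p_in: "a \<le> p i" for i using ab npos by (simp add: p_def)
    have p_n: "p n = c" using npos by (simp add: p_def)
    have p_le: "p i \<le> c" if "i \<le> n" for i
      using lift_Suc_mono_le[of p, OF p_mono that] p_n by simp
    have "\<exists>w. set w \<subseteq> V \<and> cost w \<le> integral {a..p k} h \<and> mul (- \<gamma> a) (\<gamma> (p k)) - P (\<lambda>_. 0) w \<in> Z \<and>
        norm (mul (- \<gamma> a) (\<gamma> (p k)) - P (\<lambda>_. 0) w) \<le> M * \<omega> * integral {a..p k} h" if "k \<le> n" for k
      using that
    proof (induction k)
      case 0
      then show ?case by (intro exI[of _ "[]"]) (simp add: p_def subspace_0 subZ)
    next
      case (Suc k)
      then obtain w where w: "set w \<subseteq> V" "cost w \<le> integral {a..p k} h" "mul (- \<gamma> a) (\<gamma> (p k)) - P (\<lambda>_. 0) w \<in> Z"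
        "norm (mul (- \<gamma> a) (\<gamma> (p k)) - P (\<lambda>_. 0) w) \<le> M * \<omega> * integral {a..p k} h" by auto
      let ?I = "integral {p k..p (Suc k)} u"
      have osc: "norm (\<gamma> \<tau> - \<gamma> (p k)) \<le> \<omega>" if "\<tau> \<in> {p k..p (Suc k)}" for \<tau>
      proof -
        have "dist \<tau> (p k) < d" using that p_step[of k] nd by (simp add: dist_real_def)
        moreover have "\<tau> \<in> {a..c}" "p k \<in> {a..c}" using that p_in[of k] p_le[OF Suc.prems] p_le[of k] Suc.prems by auto
        ultimately show ?thesis using d(2)[of "p k" \<tau>] by (simp add: dist_norm less_imp_le)
      qed
      have s: "?I \<in> V" "\<nu> ?I \<le> integral {p k..p (Suc k)} h" "mul (- \<gamma> (p k)) (\<gamma> (p (Suc k))) - ?I \<in> Z"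
        "norm (mul (- \<gamma> (p k)) (\<gamma> (p (Suc k))) - ?I) \<le> M * \<omega> * integral {p k..p (Suc k)} h"
        using step[OF p_in p_mono p_le[OF Suc.prems] _ osc] \<omega> by auto
      have comb: "integral {a..p (Suc k)} h = integral {a..p k} h + integral {p k..p (Suc k)} h"
        using Henstock_Kurzweil_Integration.integral_combine[of a "p k" "p (Suc k)" h] p_in p_mono
          integrable_subinterval_real[OF h_int, of a "p (Suc k)"] p_le[OF Suc.prems] by simp
      define z1 where "z1 = mul (- \<gamma> a) (\<gamma> (p k)) - P (\<lambda>_. 0) w"
      define z2 where "z2 = mul (- \<gamma> (p k)) (\<gamma> (p (Suc k))) - ?I"
      have z: "z1 \<in> Z" "z2 \<in> Z" using w(3) s(3) by (simp_all add: z1_def z2_def)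
      have "mul (- \<gamma> a) (\<gamma> (p (Suc k))) = mul (mul (- \<gamma> a) (\<gamma> (p k))) (mul (- \<gamma> (p k)) (\<gamma> (p (Suc k))))"
        by (simp add: mul_assoc)
      also have "\<dots> = mul (P (\<lambda>_. 0) w + z1) (?I + z2)" by (simp add: z1_def z2_def)
      also have "\<dots> = mul (P (\<lambda>_. 0) w) ?I + (z1 + z2)" using z by (simp add: mul_def b.add_left b.add_right)
      also have "mul (P (\<lambda>_. 0) w) ?I = P (\<lambda>_. 0) (w @ [?I])" by (simp add: P_append)
      finally have eq: "mul (- \<gamma> a) (\<gamma> (p (Suc k))) - P (\<lambda>_. 0) (w @ [?I]) = z1 + z2" by simp
      have "norm (z1 + z2) \<le> M * \<omega> * integral {a..p (Suc k)} h"
        unfolding comb distrib_left using norm_triangle_ineq[of z1 z2] w(4) s(4) by (simp add: z1_def z2_def)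
      then show ?case
        using w s comb z subZ by (intro exI[of _ "w @ [?I]"]) (auto simp: eq intro: subspace_add)
    qed
    from this[of n] obtain w where w: "set w \<subseteq> V" "cost w \<le> J" "mul (- \<gamma> a) (\<gamma> c) - P (\<lambda>_. 0) w \<in> Z"
      "norm (mul (- \<gamma> a) (\<gamma> c) - P (\<lambda>_. 0) w) \<le> M * \<omega> * J"
      using hJ by (auto simp: p_n integral_unique)
    define z where "z = mul (- \<gamma> a) (\<gamma> c) - P (\<lambda>_. 0) w"
    have z: "z \<in> Z" "norm z \<le> M * \<omega> * J" using w by (simp_all add: z_def)
    have "mul (- \<gamma> a) (\<gamma> c) = mul (P (\<lambda>_. 0) w) z" using z(1) by (simp add: mul_Z) (simp add: z_def)
    then have "D (\<lambda>_. 0) (mul (- \<gamma> a) (\<gamma> c)) \<le> cost w + D (\<lambda>_. 0) z"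
      using D_mul[OF adm_0, of "P (\<lambda>_. 0) w" z] D_le[OF w(1), of "\<lambda>_. 0"] by simp
    also have "D (\<lambda>_. 0) z \<le> Ku * sqrt (norm z)" using Ku(2)[of z] z(1) by (simp add: zeta(3))
    also have "\<dots> \<le> Ku * sqrt (M * \<omega> * J)" using z(2) Ku(1) by simp
    finally show ?thesis using w(2) by linarith
  qed
  have "((\<lambda>\<omega>. J + Ku * sqrt (M * \<omega> * J)) \<longlongrightarrow> J + Ku * sqrt (M * 0 * J)) (at_right 0)"
    by (intro tendsto_intros)
  then have "D (\<lambda>_. 0) (mul (- \<gamma> a) (\<gamma> c)) \<le> J + Ku * sqrt (M * 0 * J)"
    by (rule tendsto_lowerbound) (use main eventually_at_right_less[of 0] in \<open>auto elim: eventually_mono\<close>)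
  then show ?thesis unfolding J_eq by (intro ennreal_leI) simp
qed simp

text \<open>Each letter x becomes the arc t -> mul (\<gamma> n) (t x) over a unit interval, which is
  a straight segment in exponential coordinates. The Lipschitz bound is recorded for absolute
  continuity, and measurability because lengths are added in the induction.\<close>

lemma curve_of_word:
  assumes "set w \<subseteq> V"
  shows "\<exists>\<gamma> v F K. \<gamma> 0 = x0 \<and> \<gamma> (real (length w)) = mul x0 (P (\<lambda>_. 0) w) \<and> K-lipschitz_on {0..real (length w)} \<gamma> \<and>
    finite F \<and> (\<forall>t\<in>{0..real (length w)} - F. v t \<in> V \<and> (\<gamma> has_vector_derivative (v t + (1/2) *\<^sub>R b (\<gamma> t) (v t))) (at t)) \<and>
    (\<lambda>t. ennreal (\<nu> (v t)) * indicator {0..real (length w)} t) \<in> borel_measurable lebesgue \<and>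
    (\<integral>\<^sup>+ t \<in> {0..real (length w)}. ennreal (\<nu> (v t)) \<partial>lebesgue) = ennreal (cost w)"
  using assms
proof (induction w rule: rev_induct)
  case Nil
  have "(\<integral>\<^sup>+ t \<in> {0..0::real}. ennreal (\<nu> ((\<lambda>_. 0) t)) \<partial>lebesgue) = 0" by (simp add: nu)
  moreover have "0-lipschitz_on {0..0::real} (\<lambda>_. x0)" by (simp add: lipschitz_on_def)
  ultimately show ?case
    by (intro exI[of _ "\<lambda>_. x0"] exI[of _ "\<lambda>_. 0"] exI[of _ "{0}"] exI[of _ 0]) (simp add: nu)
next
  case (snoc x w)
  define n where "n = real (length w)"
  have xV: "x \<in> V" and wV: "set w \<subseteq> V" using snoc.prems by auto
  obtain \<gamma> v F K where IH: "\<gamma> 0 = x0" "\<gamma> n = mul x0 (P (\<lambda>_. 0) w)" "K-lipschitz_on {0..n} \<gamma>" "finite F"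
    "\<And>t. t \<in> {0..n} - F \<Longrightarrow> v t \<in> V \<and> (\<gamma> has_vector_derivative (v t + (1/2) *\<^sub>R b (\<gamma> t) (v t))) (at t)"
    "(\<lambda>t. ennreal (\<nu> (v t)) * indicator {0..n} t) \<in> borel_measurable lebesgue"
    "(\<integral>\<^sup>+ t \<in> {0..n}. ennreal (\<nu> (v t)) \<partial>lebesgue) = ennreal (cost w)"
    using snoc.IH[OF wV] unfolding n_def by blast
  have n0: "0 \<le> n" by (simp add: n_def)
  have len: "real (length (w @ [x])) = n + 1" by (simp add: n_def)
  define e where "e = x + (1/2) *\<^sub>R b (\<gamma> n) x"
  define \<gamma>1 where "\<gamma>1 = (\<lambda>t. \<gamma> n + (t - n) *\<^sub>R e)"
  define \<gamma>' where "\<gamma>' = (\<lambda>t. if t \<le> n then \<gamma> t else \<gamma>1 t)"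
  define v' where "v' = (\<lambda>t. if t \<le> n then v t else x)"
  have "(norm e)-lipschitz_on {n..n+1} \<gamma>1"
    by (rule lipschitz_onI) (auto simp: \<gamma>1_def dist_norm dist_real_def simp flip: scaleR_diff_left)
  then have lip: "(max K (norm e))-lipschitz_on {0..n+1} \<gamma>'"
    unfolding \<gamma>'_def using IH(3)
    by (intro lipschitz_on_concat) (auto intro: lipschitz_on_le simp: \<gamma>1_def)
  have end_eq: "\<gamma>' (n + 1) = mul x0 (P (\<lambda>_. 0) (w @ [x]))"
  proof -
    have "\<gamma>' (n + 1) = mul (\<gamma> n) x" by (simp add: \<gamma>'_def \<gamma>1_def e_def mul_def)
    then show ?thesis by (simp add: IH(2) P_append mul_assoc)
  qed
  have der: "v' t \<in> V \<and> (\<gamma>' has_vector_derivative (v' t + (1/2) *\<^sub>R b (\<gamma>' t) (v' t))) (at t)"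
    if t: "t \<in> {0..n+1} - insert n F" for t
  proof (cases "t < n")
    case True
    then have "v t \<in> V \<and> (\<gamma> has_vector_derivative (v t + (1/2) *\<^sub>R b (\<gamma> t) (v t))) (at t)" using IH(5)[of t] t by auto
    moreover have "(\<gamma>' has_vector_derivative (v t + (1/2) *\<^sub>R b (\<gamma> t) (v t))) (at t)"
      by (rule has_vector_derivative_transform_within_open[of \<gamma> _ t "{..<n}"]) (use True calculation in \<open>auto simp: \<gamma>'_def\<close>)
    ultimately show ?thesis using True by (simp add: v'_def \<gamma>'_def)
  next
    case False
    then have tn: "n < t" using t by auto
    have "(\<gamma>1 has_vector_derivative e) (at t)" unfolding \<gamma>1_def by (auto intro!: derivative_eq_intros)
    then have "(\<gamma>' has_vector_derivative e) (at t)"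
      by (rule has_vector_derivative_transform_within_open[of _ _ t "{n<..}"]) (use tn in \<open>auto simp: \<gamma>'_def\<close>)
    moreover have "b (\<gamma>1 t) x = b (\<gamma> n) x" by (simp add: \<gamma>1_def e_def b.add_left b.scaleR_left)
    ultimately show ?thesis using tn xV by (simp add: v'_def \<gamma>'_def e_def)
  qed
  have split: "ennreal (\<nu> (v' t)) * indicator {0..n+1} t = ennreal (\<nu> (v t)) * indicator {0..n} t + ennreal (\<nu> x) * indicator {n<..n+1} t" for t
    using n0 by (auto simp: v'_def indicator_def)
  have m2: "(\<lambda>t. ennreal (\<nu> x) * indicator {n<..n+1} t) \<in> borel_measurable lebesgue"
    by (intro borel_measurable_times_ennreal borel_measurable_const borel_measurable_indicator) simp
  have meas: "(\<lambda>t. ennreal (\<nu> (v' t)) * indicator {0..n+1} t) \<in> borel_measurable lebesgue"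
    unfolding split using IH(6) m2 by (rule borel_measurable_add)
  have "(\<integral>\<^sup>+ t \<in> {0..n+1}. ennreal (\<nu> (v' t)) \<partial>lebesgue) = ennreal (cost w) + ennreal (\<nu> x)"
    unfolding split using nn_integral_add[OF IH(6) m2] by (simp add: IH(7) nn_integral_cmult_indicator)
  also have "\<dots> = ennreal (cost (w @ [x]))" using cost_nonneg[OF wV] nu(1)[OF xV] by (simp add: ennreal_plus)
  finally have int: "(\<integral>\<^sup>+ t \<in> {0..n+1}. ennreal (\<nu> (v' t)) \<partial>lebesgue) = ennreal (cost (w @ [x]))" .
  have "\<gamma>' 0 = x0" using n0 IH(1) by (simp add: \<gamma>'_def)
  then show ?case unfolding len using end_eq lip der meas int IH(4)
    by (intro exI[of _ \<gamma>'] exI[of _ v'] exI[of _ "insert n F"] exI[of _ "max K (norm e)"]) simp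
qed

end

section \<open>The subFinsler distance\<close>

lemma absolutely_continuous_curve_continuous:
  assumes "absolutely_continuous_curve a b f"
  shows "continuous_on {a..b} f"
  unfolding continuous_on_iff
proof (intro ballI allI impI)
  fix x and \<epsilon> :: real assume x: "x \<in> {a..b}" and "0 < \<epsilon>"
  then obtain \<delta> where \<delta>: "0 < \<delta>" "\<forall>(n::nat) s t.
        (\<forall>i<n. a \<le> s i \<and> s i \<le> t i \<and> t i \<le> b) \<and> disjoint_family_on (\<lambda>i. {s i<..<t i}) {..<n} \<and>
        (\<Sum>i<n. t i - s i) < \<delta> \<longrightarrow> (\<Sum>i<n. norm (f (t i) - f (s i))) < \<epsilon>"
    using assms unfolding absolutely_continuous_curve_def by blast
  have le: "norm (f t - f s) < \<epsilon>" if "a \<le> s" "s \<le> t" "t \<le> b" "t - s < \<delta>" for s t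
    using \<delta>(2)[rule_format, of 1 "\<lambda>_. s" "\<lambda>_. t"] that by (simp add: disjoint_family_on_def)
  show "\<exists>d>0. \<forall>x'\<in>{a..b}. dist x' x < d \<longrightarrow> dist (f x') (f x) < \<epsilon>"
  proof (intro exI[of _ \<delta>] conjI \<delta>(1) ballI impI)
    fix x' assume "x' \<in> {a..b}" "dist x' x < \<delta>"
    then show "dist (f x') (f x) < \<epsilon>"
      using le[of x x'] le[of x' x] x by (cases "x \<le> x'") (auto simp: dist_real_def dist_norm norm_minus_commute)
  qed
qed

lemma has_derivative_identity_at_0:
  fixes f :: "'e::real_normed_vector \<Rightarrow> 'e"
  assumes d: "0 < d" and est: "\<And>y. norm y < d \<Longrightarrow> norm (f y - y) \<le> K * (norm y)\<^sup>2"
  shows "(f has_derivative (\<lambda>x. x)) (at 0)"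
proof -
  have f0: "f 0 = 0" using est[of 0] d by simp
  have lim: "((\<lambda>h::'e. K * norm h) \<longlongrightarrow> 0) (at 0)"
    by (intro tendsto_mult_right_zero tendsto_norm_zero tendsto_ident_at)
  have "((\<lambda>h. norm (f (0 + h) - f 0 - h) / norm h) \<longlongrightarrow> 0) (at 0)"
  proof (rule tendsto_sandwich[OF _ _ tendsto_const lim])
    show "\<forall>\<^sub>F h in at 0. norm (f (0 + h) - f 0 - h) / norm h \<le> K * norm h"
      unfolding eventually_at
    proof (intro exI[of _ d] conjI d ballI impI)
      fix h :: 'e assume "h \<noteq> 0 \<and> dist h 0 < d"
      then have "norm (f h - h) \<le> K * norm h * norm h" "0 < norm h" using est[of h] by (simp_all add: power2_eq_square mult.assoc)
      then show "norm (f (0 + h) - f 0 - h) / norm h \<le> K * norm h" by (simp add: f0 pos_divide_le_eq)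
    qed
  qed simp
  then show ?thesis by (simp add: has_derivative_at bounded_linear_ident)
qed

lemma has_vector_derivative_identity_at_0:
  fixes f :: "'e::real_normed_vector \<Rightarrow> 'e"
  assumes f: "(f has_derivative (\<lambda>x. x)) (at 0)" and q: "(q has_vector_derivative v) (at t within S)" "q t = 0"
  shows "((\<lambda>s. f (q s)) has_vector_derivative v) (at t within S)"
proof -
  have "(f has_derivative (\<lambda>x. x)) (at (q t))" using f q(2) by simp
  from has_derivative_compose[OF q(1)[unfolded has_vector_derivative_def] this]
  show ?thesis unfolding has_vector_derivative_def .
qed

lemma has_vector_derivative_shift:
  "((\<lambda>s. k + f s) has_vector_derivative v) F \<longleftrightarrow> (f has_vector_derivative v) F"
proof
  show "((\<lambda>s. k + f s) has_vector_derivative v) F" if "(f has_vector_derivative v) F" for f k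
    using has_vector_derivative_add[OF has_vector_derivative_const[of k] that] by simp
  from this[of "\<lambda>s. k + f s" "- k"]
  show "((\<lambda>s. k + f s) has_vector_derivative v) F \<Longrightarrow> (f has_vector_derivative v) F" by simp
qed

section \<open>Group notions in exponential coordinates\<close>

context two_step_lie_group begin

lemma gexp_add_span:
  assumes "z \<in> span {br u w |u w. True}"
  shows "gexp (x + z) = gexp x \<otimes> gexp z"
proof -
  have "br x z = 0"
  proof (rule span_induct[OF assms])
    show "subspace {z. br x z = 0}" by (auto simp: subspace_def b.add_right b.scaleR_right b.zero_right)
  qed auto
  then show ?thesis by (simp add: gexp_mult)
qed

lemma commutator_gexp: "x \<otimes> y \<otimes> inv x \<otimes> inv y = gexp (br (Log x) (Log y))"
proof -
  have "(1/2) *\<^sub>R v + (1/2) *\<^sub>R v = v" for v :: 'e by (simp flip: scaleR_add_left)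
  then have "Log (x \<otimes> y \<otimes> inv x \<otimes> inv y) = br (Log x) (Log y)"
    by (simp add: Log_mult Log_inv mul_def b.add_left b.add_right b.minus_left b.minus_right b.scaleR_left b_skew[of "Log y"])
  then show ?thesis by (metis gexp_Log)
qed

text \<open>The span of the brackets is central, so exp is a homomorphism on it. Conversely, a
  multiple of a bracket is again a bracket, with the factor moved into the first argument, so its
  exponential is a commutator.\<close>

lemma derived_eq_gexp: "derived N (carrier N) = gexp ` span {br u w |u w. True}"
proof
  show "derived N (carrier N) \<subseteq> gexp ` span {br u w |u w. True}"
  proof
    fix g assume "g \<in> derived N (carrier N)"
    then have "\<exists>z\<in>span {br u w |u w. True}. g = gexp z"
      unfolding derived_def
    proof (induction rule: generate.induct)
      case one
      show ?case by (rule bexI[of _ 0]) (simp_all add: span_zero)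
    next
      case (incl h)
      then obtain h1 h2 where "h = h1 \<otimes> h2 \<otimes> inv h1 \<otimes> inv h2" by blast
      then have "h = gexp (br (Log h1) (Log h2))"
        by (simp add: commutator_gexp)
      then show ?case by (auto intro: span_base)
    next
      case (inv h)
      then obtain h1 h2 where "h = h1 \<otimes> h2 \<otimes> inv h1 \<otimes> inv h2" by blast
      then have "inv h = gexp (- br (Log h1) (Log h2))"
        by (simp add: commutator_gexp gexp_minus)
      then show ?case by (auto intro!: span_neg intro: span_base)
    next
      case (eng h1 h2)
      then obtain z1 z2 where "z1 \<in> span {br u w |u w. True}" "z2 \<in> span {br u w |u w. True}" "h1 = gexp z1" "h2 = gexp z2" by blast
      then show ?case using gexp_add_span[of z2 z1] by (intro bexI[of _ "z1 + z2"]) (simp_all add: span_add)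
    qed
    then show "g \<in> gexp ` span {br u w |u w. True}" by blast
  qed
  show "gexp ` span {br u w |u w. True} \<subseteq> derived N (carrier N)"
  proof
    fix g assume "g \<in> gexp ` span {br u w |u w. True}"
    then obtain z where z: "z \<in> span {br u w |u w. True}" "g = gexp z" by blast
    have "gexp z \<in> derived N (carrier N)"
    proof (rule span_induct_alt[OF z(1)])
      show "gexp 0 \<in> derived N (carrier N)" unfolding derived_def by (simp add: generate.one)
      fix c x y assume x: "x \<in> {br u w |u w. True}" and y: "gexp y \<in> derived N (carrier N)"
      then obtain u w where uw: "x = br u w" by blast
      have "c *\<^sub>R x = br (c *\<^sub>R u) w" by (simp add: uw b.scaleR_left)
      then have "gexp (y + c *\<^sub>R x) = gexp y \<otimes> commutator N (gexp (c *\<^sub>R u)) (gexp w)"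
        using gexp_add_br[of y c u w] by (simp flip: C_eq_br add: C_def uw)
      also have "\<dots> \<in> derived N (carrier N)"
        using generate.eng[OF y[unfolded derived_def] commutator_in_derived[unfolded derived_def]] unfolding derived_def .
      finally show "gexp (c *\<^sub>R x + y) \<in> derived N (carrier N)" by (simp only: add.commute)
    qed
    then show "g \<in> derived N (carrier N)" using z by simp
  qed
qed

text \<open>\<open>lie_bracket_br\<close> turns the generating condition in the chart into one for
  \<open>br\<close>, and injectivity of exp turns commutator equations in the group into bracket
  equations.\<close>

lemma subfinsler_nil2:
  assumes "non_singular N" "subspace V" "bracket_generating N (U, \<phi>) V" "norm_on V \<nu>"
  shows "subfinsler_nil2 br V \<nu>"
proof
  show "subspace V" "norm_on V \<nu>" by fact+
  fix x
  have "span {br u u' |u u'. u \<in> V \<and> u' \<in> V} \<subseteq> span {br u w |u w. True}" by (rule span_mono) blast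
  then show "\<exists>v\<in>V. \<exists>w\<in>span {br u w |u w. True}. x = v + w"
    using assms(3) unfolding bracket_generating_def lie_bracket_br by blast
next
  fix z x assume z: "z \<in> span {br u w |u w. True}" and x: "x \<notin> span {br u w |u w. True}"
  have "gexp z \<in> derived N (carrier N)" unfolding derived_eq_gexp using z by (rule imageI)
  moreover have "gexp x \<in> carrier N - derived N (carrier N)" unfolding derived_eq_gexp using x inj_gexp by (auto simp: inj_eq)
  ultimately obtain g where "commutator N (gexp x) g = gexp z" using assms(1) unfolding non_singular_def by blast
  then have "gexp (br x (Log g)) = gexp z" by (simp flip: C_eq_br add: C_def)
  then show "\<exists>y. br x y = z" using inj_gexp by (auto simp: inj_eq)
qed

lemma xp_has_derivative: "(xp has_derivative (\<lambda>x. x)) (at 0)"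
  using r2 by (intro has_derivative_identity_at_0[of r2 _ "4 * snd rK"] xp_second_order) auto

text \<open>The left translated curve is \<open>ctr + xp (q s)\<close> near t, where q is its
  logarithm. Both \<open>xp\<close> and its local inverse are tangent to the identity at 0, so this
  curve and q have the same derivatives at t. The curves q and \<gamma> determine each other by
  affine maps, whose linear parts are the identity minus or plus half the bracket with \<gamma>
  t.\<close>

lemma left_translated_derivative_iff:
  fixes \<gamma> :: "real \<Rightarrow> 'e"
  assumes t: "t \<in> S" and cont: "continuous (at t within S) \<gamma>"
  shows "(left_translated N (U, \<phi>) (\<lambda>s. gexp (\<gamma> s)) t has_vector_derivative v) (at t within S) \<longleftrightarrow>
    (\<gamma> has_vector_derivative (v + (1/2) *\<^sub>R br (\<gamma> t) v)) (at t within S)"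
proof -
  define q where "q = (\<lambda>s. mul (- \<gamma> t) (\<gamma> s))"
  have q0: "q t = 0" by (simp add: q_def)
  have "continuous (at t within S) q"
    unfolding q_def mul_def by (intro continuous_intros cont b.continuous)
  then have q_lim: "(q \<longlongrightarrow> 0) (at t within S)" unfolding continuous_within q0 .
  have small: "\<forall>\<^sub>F s in at t within S. norm (q s) < r" if "0 < r" for r
    using tendstoD[OF q_lim that] by (simp add: dist_norm)
  have "((\<lambda>s. xp (q s)) has_vector_derivative v) (at t within S) \<longleftrightarrow> (q has_vector_derivative v) (at t within S)"
  proof
    assume "(q has_vector_derivative v) (at t within S)"
    then show "((\<lambda>s. xp (q s)) has_vector_derivative v) (at t within S)"
      by (rule has_vector_derivative_identity_at_0[where q = q, OF xp_has_derivative _ q0])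
  next
    assume x: "((\<lambda>s. xp (q s)) has_vector_derivative v) (at t within S)"
    obtain \<delta> lg where lg: "0 < \<delta>" "\<And>y. norm y < \<delta> \<Longrightarrow> norm (lg y) < r2 \<and> xp (lg y) = y"
      using xp_local_inverse by blast
    have K0: "0 \<le> snd rK" using K_pos by simp
    have "(lg has_derivative (\<lambda>x. x)) (at 0)"
    proof (rule has_derivative_identity_at_0[OF lg(1)])
      fix y :: 'e assume y: "norm y < \<delta>"
      have l: "norm (lg y) < r2" "xp (lg y) = y" using lg(2)[OF y] by auto
      have "norm (lg y) \<le> 2 * norm y" using xp_lip(2)[of "lg y" 0] l r2 by simp
      then have "(norm (lg y))\<^sup>2 \<le> (2 * norm y)\<^sup>2" by (intro power_mono) auto
      then have "4 * snd rK * (norm (lg y))\<^sup>2 \<le> 4 * snd rK * (2 * norm y)\<^sup>2" using K0 by (intro mult_left_mono) auto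
      then show "norm (lg y - y) \<le> (16 * snd rK) * (norm y)\<^sup>2"
        using xp_second_order[of "lg y"] l by (simp add: norm_minus_commute power_mult_distrib)
    qed
    from has_vector_derivative_identity_at_0[OF this x]
    have lgq: "((\<lambda>s. lg (xp (q s))) has_vector_derivative v) (at t within S)" by (simp add: q0)
    have eq: "lg (xp (q s)) = q s" if "norm (q s) < min r2 (\<delta> / 2)" for s
    proof -
      have "norm (xp (q s)) \<le> 2 * norm (q s)" using xp_lip(1)[of "q s" 0] that r2 by simp
      then have l: "norm (lg (xp (q s))) < r2" "xp (lg (xp (q s))) = xp (q s)" using lg(2)[of "xp (q s)"] that by auto
      show ?thesis using xp_lip(2)[of "lg (xp (q s))" "q s"] l that by simp
    qed
    have ev: "\<forall>\<^sub>F s in at t within S. lg (xp (q s)) = q s"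
      using small[of "min r2 (\<delta> / 2)"] r2 lg(1) by (auto elim!: eventually_mono intro: eq)
    show "(q has_vector_derivative v) (at t within S)"
      using has_derivative_transform_eventually[OF _ ev _ t] lgq eq[of t] q0 r2 lg(1)
      by (simp add: has_vector_derivative_def)
  qed
  also have "((\<lambda>s. xp (q s)) has_vector_derivative v) (at t within S) \<longleftrightarrow>
      (left_translated N (U, \<phi>) (\<lambda>s. gexp (\<gamma> s)) t has_vector_derivative v) (at t within S)"
  proof -
    have lt: "left_translated N (U, \<phi>) (\<lambda>s. gexp (\<gamma> s)) t s = ctr + xp (q s)" if "norm (q s) < r2" for s
      using phi_gexp(2)[of "q s"] that by (simp add: left_translated_def q_def gexp_mul gexp_minus)
    have ev: "\<forall>\<^sub>F s in at t within S. left_translated N (U, \<phi>) (\<lambda>s. gexp (\<gamma> s)) t s = ctr + xp (q s)"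
      using small[of r2] r2 by (auto elim!: eventually_mono intro: lt)
    have ev_sym: "\<forall>\<^sub>F s in at t within S. ctr + xp (q s) = left_translated N (U, \<phi>) (\<lambda>s. gexp (\<gamma> s)) t s"
      using ev by eventually_elim simp
    have ltt: "left_translated N (U, \<phi>) (\<lambda>s. gexp (\<gamma> s)) t t = ctr + xp (q t)" using q0 r2 by (intro lt) simp
    have "(left_translated N (U, \<phi>) (\<lambda>s. gexp (\<gamma> s)) t has_vector_derivative v) (at t within S) \<longleftrightarrow>
        ((\<lambda>s. ctr + xp (q s)) has_vector_derivative v) (at t within S)"
      unfolding has_vector_derivative_def
      using has_derivative_transform_eventually[OF _ ev ltt t] has_derivative_transform_eventually[OF _ ev_sym ltt[symmetric] t]
      by blast
    also have "\<dots> \<longleftrightarrow> ((\<lambda>s. xp (q s)) has_vector_derivative v) (at t within S)"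
      by (simp only: has_vector_derivative_shift)
    finally show ?thesis by simp
  qed
  finally have 1: "(left_translated N (U, \<phi>) (\<lambda>s. gexp (\<gamma> s)) t has_vector_derivative v) (at t within S) \<longleftrightarrow>
      (q has_vector_derivative v) (at t within S)" by simp
  have "(q has_vector_derivative v) (at t within S) \<longleftrightarrow> (\<gamma> has_vector_derivative (v + (1/2) *\<^sub>R br (\<gamma> t) v)) (at t within S)"
  proof
    assume q: "(q has_vector_derivative v) (at t within S)"
    have eq: "\<gamma> s = \<gamma> t + (q s + (1/2) *\<^sub>R br (\<gamma> t) (q s))" for s
      using mul_cancel(1)[of "\<gamma> t" "\<gamma> s"] by (simp add: q_def mul_def add.assoc)
    have "bounded_linear (\<lambda>x. x + (1/2) *\<^sub>R br (\<gamma> t) x)"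
      by (intro bounded_linear_add bounded_linear_ident bounded_linear_compose[OF bounded_linear_scaleR_right] b.bounded_linear_right)
    from bounded_linear.has_vector_derivative[OF this q]
    have "((\<lambda>s. \<gamma> t + (q s + (1/2) *\<^sub>R br (\<gamma> t) (q s))) has_vector_derivative (v + (1/2) *\<^sub>R br (\<gamma> t) v)) (at t within S)"
      by (simp only: has_vector_derivative_shift)
    then show "(\<gamma> has_vector_derivative (v + (1/2) *\<^sub>R br (\<gamma> t) v)) (at t within S)"
      unfolding eq[symmetric] .
  next
    assume g: "(\<gamma> has_vector_derivative (v + (1/2) *\<^sub>R br (\<gamma> t) v)) (at t within S)"
    have eq: "q = (\<lambda>s. - \<gamma> t + (\<gamma> s - (1/2) *\<^sub>R br (\<gamma> t) (\<gamma> s)))"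
      by (simp add: q_def mul_def fun_eq_iff b.minus_left)
    have "bounded_linear (\<lambda>x. x - (1/2) *\<^sub>R br (\<gamma> t) x)"
      by (intro bounded_linear_sub bounded_linear_ident bounded_linear_compose[OF bounded_linear_scaleR_right] b.bounded_linear_right)
    from bounded_linear.has_vector_derivative[OF this g]
    have "(q has_vector_derivative (v + (1/2) *\<^sub>R br (\<gamma> t) v - (1/2) *\<^sub>R br (\<gamma> t) (v + (1/2) *\<^sub>R br (\<gamma> t) v))) (at t within S)"
      unfolding eq by (simp only: has_vector_derivative_shift)
    then show "(q has_vector_derivative v) (at t within S)" by (simp add: b.add_right b.scaleR_right)
  qed
  with 1 show ?thesis by simp
qed

text \<open>Near each parameter, the logarithm is a Lipschitz function of a chart coordinate, in
  which the curve is absolutely continuous; the local statements are then joined.\<close>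

lemma absolutely_continuous_Log:
  assumes "absolutely_continuous_in A a b c"
  shows "absolutely_continuous_curve a b (\<lambda>t. Log (c t))"
proof (rule absolutely_continuous_curve_local)
  fix t assume t: "t \<in> {a..b}"
  have cont: "continuous_on {a..b} c" using assms by (simp add: absolutely_continuous_in_def)
  obtain W \<psi> where W: "(W, \<psi>) \<in> A" "c t \<in> W" using chart_ex by blast
  obtain T L where T: "open T" "c t \<in> T" "T \<subseteq> W" "0 < L"
    "\<And>h h'. h \<in> T \<Longrightarrow> h' \<in> T \<Longrightarrow> norm (Log h - Log h') \<le> L * norm (\<psi> h - \<psi> h')"
    using Log_chart_lipschitz[OF W] by metis
  have "\<forall>\<^sub>F s in at t within {a..b}. c s \<in> T"
    using cont t T(1,2) by (auto simp: continuous_on_def intro: topological_tendstoD)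
  then obtain \<delta> where \<delta>: "0 < \<delta>" "\<And>s. s \<in> {a..b} \<Longrightarrow> s \<noteq> t \<Longrightarrow> dist s t < \<delta> \<Longrightarrow> c s \<in> T"
    unfolding eventually_at by blast
  show "\<exists>\<delta>>0. \<forall>a' b'. a \<le> a' \<longrightarrow> a' \<le> b' \<longrightarrow> b' \<le> b \<longrightarrow> {a'..b'} \<subseteq> ball t \<delta> \<longrightarrow>
      absolutely_continuous_curve a' b' (\<lambda>t. Log (c t))"
  proof (intro exI[of _ \<delta>] conjI \<delta>(1) allI impI)
    fix a' b' assume ab: "a \<le> a'" "a' \<le> b'" "b' \<le> b" "{a'..b'} \<subseteq> ball t \<delta>"
    have cT: "c s \<in> T" if "s \<in> {a'..b'}" for s
    proof (cases "s = t")
      case False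
      have "s \<in> ball t \<delta>" using that ab(4) by blast
      then show ?thesis using \<delta>(2)[of s] that ab(1,3) False by (simp add: dist_commute)
    qed (use T(2) in simp)
    then have "c ` {a'..b'} \<subseteq> W" using T(3) by blast
    then have "absolutely_continuous_curve a' b' (\<psi> \<circ> c)"
      using assms W(1) ab(1-3) unfolding absolutely_continuous_in_def by blast
    then show "absolutely_continuous_curve a' b' (\<lambda>t. Log (c t))"
      by (rule absolutely_continuous_curve_lipschitz[OF _ T(4)]) (use T(5) cT in simp)
  qed
qed

lemma absolutely_continuous_gexp:
  assumes lip: "K-lipschitz_on {a..b} \<gamma>"
  shows "absolutely_continuous_in A a b (\<lambda>t. gexp (\<gamma> t))"
  unfolding absolutely_continuous_in_def
proof (intro conjI)
  have cont: "continuous_on {a..b} \<gamma>" using lip by (rule lipschitz_on_continuous_on)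
  have cg: "continuous_on UNIV gexp" by (simp add: continuous_on_eq_continuous_at isCont_gexp)
  show "continuous_on {a..b} (\<lambda>t. gexp (\<gamma> t))" by (rule continuous_on_compose2[OF cg cont]) simp
  have "absolutely_continuous_curve a' b' (\<psi> \<circ> (\<lambda>t. gexp (\<gamma> t)))"
    if W: "(W, \<psi>) \<in> A" and ab: "a \<le> a'" "a' \<le> b'" "b' \<le> b" and sub: "(\<lambda>t. gexp (\<gamma> t)) ` {a'..b'} \<subseteq> W" for W \<psi> a' b'
  proof (rule absolutely_continuous_curve_local)
    fix t assume t: "t \<in> {a'..b'}"
    then have "gexp (\<gamma> t) \<in> W" using sub by blast
    then obtain T L where T: "open T" "\<gamma> t \<in> T" "0 < L"
      "\<And>y z. y \<in> T \<Longrightarrow> z \<in> T \<Longrightarrow> norm (\<psi> (gexp y) - \<psi> (gexp z)) \<le> L * norm (y - z)"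
      using chart_gexp_lipschitz[OF W] by metis
    have tab: "t \<in> {a..b}" using t ab by auto
    have "\<forall>\<^sub>F s in at t within {a..b}. \<gamma> s \<in> T"
      using cont tab T(1,2) by (auto simp: continuous_on_def intro: topological_tendstoD)
    then obtain \<delta> where \<delta>: "0 < \<delta>" "\<And>s. s \<in> {a..b} \<Longrightarrow> s \<noteq> t \<Longrightarrow> dist s t < \<delta> \<Longrightarrow> \<gamma> s \<in> T"
      unfolding eventually_at by blast
    show "\<exists>\<delta>>0. \<forall>a'' b''. a' \<le> a'' \<longrightarrow> a'' \<le> b'' \<longrightarrow> b'' \<le> b' \<longrightarrow> {a''..b''} \<subseteq> ball t \<delta> \<longrightarrow>
        absolutely_continuous_curve a'' b'' (\<psi> \<circ> (\<lambda>t. gexp (\<gamma> t)))"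
    proof (intro exI[of _ \<delta>] conjI \<delta>(1) allI impI)
      fix a'' b'' assume ab': "a' \<le> a''" "a'' \<le> b''" "b'' \<le> b'" "{a''..b''} \<subseteq> ball t \<delta>"
      have in_ab: "s \<in> {a..b}" if "s \<in> {a''..b''}" for s using that ab ab' by auto
      have gT: "\<gamma> s \<in> T" if "s \<in> {a''..b''}" for s
      proof (cases "s = t")
        case False
        have "s \<in> ball t \<delta>" using that ab'(4) by blast
        then show ?thesis using \<delta>(2)[OF in_ab[OF that] False] by (simp add: dist_commute)
      qed (use T(2) in simp)
      have K0: "0 \<le> K" using lip by (rule lipschitz_on_nonneg)
      show "absolutely_continuous_curve a'' b'' (\<psi> \<circ> (\<lambda>t. gexp (\<gamma> t)))"
      proof (rule absolutely_continuous_curve_lipschitz[OF absolutely_continuous_curve_id])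
        show "0 < L * (K + 1)" using T(3) K0 by simp
        fix s u assume su: "s \<in> {a''..b''}" "u \<in> {a''..b''}"
        have "norm (\<psi> (gexp (\<gamma> u)) - \<psi> (gexp (\<gamma> s))) \<le> L * norm (\<gamma> u - \<gamma> s)" using T(4) gT su by blast
        also have "norm (\<gamma> u - \<gamma> s) \<le> K * norm (u - s)"
          using lipschitz_onD[OF lip in_ab[OF su(2)] in_ab[OF su(1)]] by (simp add: dist_norm)
        also have "\<dots> \<le> (K + 1) * norm (u - s)" by (intro mult_right_mono) auto
        finally show "norm ((\<psi> \<circ> (\<lambda>t. gexp (\<gamma> t))) u - (\<psi> \<circ> (\<lambda>t. gexp (\<gamma> t))) s) \<le> L * (K + 1) * norm (u - s)"
          using T(3) by (simp add: mult.assoc)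
      qed
    qed
  qed
  note * = this
  show "\<forall>(W, \<psi>)\<in>A. \<forall>a' b'. a \<le> a' \<and> a' \<le> b' \<and> b' \<le> b \<and> (\<lambda>t. gexp (\<gamma> t)) ` {a'..b'} \<subseteq> W \<longrightarrow>
      absolutely_continuous_curve a' b' (\<psi> \<circ> (\<lambda>t. gexp (\<gamma> t)))"
  proof (intro ballI)
    fix p assume p: "p \<in> A"
    obtain W \<psi> where "p = (W, \<psi>)" by (rule prod.exhaust)
    with p * show "case p of (W, \<psi>) \<Rightarrow> \<forall>a' b'. a \<le> a' \<and> a' \<le> b' \<and> b' \<le> b \<and> (\<lambda>t. gexp (\<gamma> t)) ` {a'..b'} \<subseteq> W \<longrightarrow>
      absolutely_continuous_curve a' b' (\<psi> \<circ> (\<lambda>t. gexp (\<gamma> t)))" by simp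
  qed
qed

end

section \<open>The subFinsler distance as a word metric\<close>

locale subfinsler_group = two_step_lie_group N A U \<phi> + subfinsler_nil2 br V \<nu>
  for N :: "'g::{t2_space, second_countable_topology} monoid" (structure)
    and A :: "('g, 'e::euclidean_space) chart set" and U :: "'g set" and \<phi> :: "'g \<Rightarrow> 'e"
    and V :: "'e set" and \<nu> :: "'e \<Rightarrow> real"
begin

lemma D_le_horizontal_length:
  assumes ab: "a < b" and hor: "horizontal_curve N A (U, \<phi>) V a b c"
  shows "ennreal (D (\<lambda>_. 0) (mul (- Log (c a)) (Log (c b)))) \<le> curve_length N (U, \<phi>) \<nu> a b c"
proof -
  let ?\<gamma> = "\<lambda>t. Log (c t)"
  have ac: "absolutely_continuous_curve a b ?\<gamma>"
    using hor absolutely_continuous_Log unfolding horizontal_curve_def by blast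
  have cont: "continuous_on {a..b} ?\<gamma>" by (rule absolutely_continuous_curve_continuous[OF ac])
  have c_eq: "c = (\<lambda>t. gexp (?\<gamma> t))" by simp
  have "AE t in lebesgue. t \<in> {a..b} \<longrightarrow>
        (\<exists>v \<in> V. (left_translated N (U, \<phi>) c t has_vector_derivative v) (at t within {a..b}))"
    using hor unfolding horizontal_curve_def by blast
  then obtain S where S: "S \<in> null_sets lebesgue" "{t. \<not> (t \<in> {a..b} \<longrightarrow>
        (\<exists>v \<in> V. (left_translated N (U, \<phi>) c t has_vector_derivative v) (at t within {a..b})))} \<subseteq> S"
    unfolding eventually_ae_filter by auto
  define v where "v = (\<lambda>t. vector_derivative (left_translated N (U, \<phi>) c t) (at t within {a..b}))"
  have v: "v t \<in> V" "(left_translated N (U, \<phi>) c t has_vector_derivative v t) (at t within {a..b})"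
    if t: "t \<in> {a..b} - S" for t
  proof -
    obtain w where w: "w \<in> V" "(left_translated N (U, \<phi>) c t has_vector_derivative w) (at t within {a..b})"
      using t S(2) by blast
    have "v t = w" unfolding v_def using vector_derivative_within_cbox[OF ab, unfolded box_real, OF _ w(2)] t by simp
    then show "v t \<in> V" "(left_translated N (U, \<phi>) c t has_vector_derivative v t) (at t within {a..b})"
      using w by simp_all
  qed
  have "ennreal (D (\<lambda>_. 0) (mul (- ?\<gamma> a) (?\<gamma> b))) \<le> (\<integral>\<^sup>+ t \<in> {a..b}. ennreal (\<nu> (v t)) \<partial>lebesgue)"
  proof (rule D_le_curve_length[OF less_imp_le[OF ab] ac cont])
    show "negligible S" using S(1) by (simp add: negligible_iff_null_sets)
    fix t assume t: "t \<in> {a..b} - S"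
    show "v t \<in> V" by (rule v(1)[OF t])
    have ct: "continuous (at t within {a..b}) ?\<gamma>"
      using cont t by (simp add: continuous_on_eq_continuous_within)
    show "(?\<gamma> has_vector_derivative (v t + (1/2) *\<^sub>R br (?\<gamma> t) (v t))) (at t within {a..b})"
      using left_translated_derivative_iff[OF _ ct, of "v t"] v(2)[OF t] t by (simp flip: c_eq)
  qed
  then show ?thesis unfolding curve_length_def v_def .
qed

text \<open>The parameter interval has length \<open>length w\<close>, and the distance is taken
  over curves on intervals with a < b; hence the word is nonempty.\<close>

lemma horizontal_curve_of_word:
  assumes w: "set w \<subseteq> V" "w \<noteq> []"
  shows "\<exists>c. horizontal_curve N A (U, \<phi>) V 0 (real (length w)) c \<and> c 0 = g \<and>
    c (real (length w)) = g \<otimes> gexp (P (\<lambda>_. 0) w) \<and>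
    curve_length N (U, \<phi>) \<nu> 0 (real (length w)) c = ennreal (cost w)"
proof -
  let ?n = "real (length w)"
  have n: "0 < ?n" using w(2) by simp
  obtain \<gamma> v F K where \<gamma>: "\<gamma> 0 = Log g" "\<gamma> ?n = mul (Log g) (P (\<lambda>_. 0) w)" "K-lipschitz_on {0..?n} \<gamma>" "finite F"
    "\<And>t. t \<in> {0..?n} - F \<Longrightarrow> v t \<in> V \<and> (\<gamma> has_vector_derivative (v t + (1/2) *\<^sub>R br (\<gamma> t) (v t))) (at t)"
    "(\<integral>\<^sup>+ t \<in> {0..?n}. ennreal (\<nu> (v t)) \<partial>lebesgue) = ennreal (cost w)"
    using curve_of_word[OF w(1), of "Log g"] by blast
  define c where "c = (\<lambda>t. gexp (\<gamma> t))"
  have der: "(left_translated N (U, \<phi>) c t has_vector_derivative v t) (at t within {0..?n})"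
    if t: "t \<in> {0..?n} - F" for t
  proof -
    have "(\<gamma> has_vector_derivative (v t + (1/2) *\<^sub>R br (\<gamma> t) (v t))) (at t within {0..?n})"
      using \<gamma>(5)[OF t] by (blast intro: has_vector_derivative_at_within)
    then show ?thesis
      unfolding c_def using t has_vector_derivative_continuous left_translated_derivative_iff[of t "{0..?n}" \<gamma> "v t"] by blast
  qed
  have "F \<in> null_sets lebesgue" using negligible_finite[OF \<gamma>(4)] by (simp add: negligible_iff_null_sets)
  then have AE_F: "AE t in lebesgue. t \<notin> F" by (rule AE_not_in)
  have "horizontal_curve N A (U, \<phi>) V 0 ?n c"
    unfolding horizontal_curve_def
  proof
    show "absolutely_continuous_in A 0 ?n c" unfolding c_def by (rule absolutely_continuous_gexp[OF \<gamma>(3)])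
    show "AE t in lebesgue. t \<in> {0..?n} \<longrightarrow>
        (\<exists>v\<in>V. (left_translated N (U, \<phi>) c t has_vector_derivative v) (at t within {0..?n}))"
      using AE_F by eventually_elim (use der \<gamma>(5) in blast)
  qed
  moreover have "curve_length N (U, \<phi>) \<nu> 0 ?n c = ennreal (cost w)"
    unfolding curve_length_def \<gamma>(6)[symmetric]
  proof (rule nn_integral_cong_AE)
    show "AE t in lebesgue. ennreal (\<nu> (vector_derivative (left_translated N (U, \<phi>) c t) (at t within {0..?n}))) * indicator {0..?n} t =
        ennreal (\<nu> (v t)) * indicator {0..?n} t"
      using AE_F
    proof eventually_elim
      case (elim t)
      show ?case
      proof (cases "t \<in> {0..?n}")
        case True
        have "vector_derivative (left_translated N (U, \<phi>) c t) (at t within {0..?n}) = v t"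
          using vector_derivative_within_cbox[OF n, unfolded box_real, OF _ der[of t]] True elim by simp
        then show ?thesis by simp
      qed simp
    qed
  qed
  ultimately show ?thesis
    by (intro exI[of _ c]) (simp add: c_def \<gamma>(1,2) gexp_mul)
qed

text \<open>No horizontal curve is shorter than the word distance of its endpoints, and every
  nonempty word is traced by a curve whose length is its cost. In particular the infimum is finite,
  so its conversion to a real loses nothing.\<close>

lemma subFinsler_dist_eq_dm: "subFinsler_dist N A (U, \<phi>) V \<nu> g h = dm (\<lambda>_. 0) (Log g) (Log h)"
proof -
  let ?S = "{curve_length N (U, \<phi>) \<nu> a b c |a b c. a < b \<and> horizontal_curve N A (U, \<phi>) V a b c \<and> c a = g \<and> c b = h}"
  have "Inf ?S = ennreal (dm (\<lambda>_. 0) (Log g) (Log h))"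
  proof (rule antisym)
    show "Inf ?S \<le> ennreal (dm (\<lambda>_. 0) (Log g) (Log h))"
    proof (rule ennreal_le_epsilon)
      fix e :: real assume e: "0 < e"
      obtain w where w: "set w \<subseteq> V" "P (\<lambda>_. 0) w = mul (- Log g) (Log h)" "cost w < dm (\<lambda>_. 0) (Log g) (Log h) + e"
        unfolding dm_def by (rule D_approx[OF adm_0 e])
      \<comment> \<open>The letter 0 makes the word nonempty and changes neither product nor
        cost.\<close>
      let ?w = "w @ [0]"
      have w': "set ?w \<subseteq> V" "?w \<noteq> []" "P (\<lambda>_. 0) ?w = mul (- Log g) (Log h)" "cost ?w = cost w"
        using w(1,2) subspace_0[OF subV] by (simp_all add: P_append nu)
      obtain c where c: "horizontal_curve N A (U, \<phi>) V 0 (real (length ?w)) c" "c 0 = g"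
        "c (real (length ?w)) = g \<otimes> gexp (P (\<lambda>_. 0) ?w)" "curve_length N (U, \<phi>) \<nu> 0 (real (length ?w)) c = ennreal (cost ?w)"
        using horizontal_curve_of_word[OF w'(1,2), of g] by blast
      have "g \<otimes> gexp (P (\<lambda>_. 0) ?w) = gexp (mul (Log g) (mul (- Log g) (Log h)))"
        unfolding w'(3) gexp_mul gexp_Log ..
      also have "\<dots> = h" by simp
      finally have "c (real (length ?w)) = h" using c(3) by simp
      then have "ennreal (cost ?w) \<in> ?S"
        using c by (intro CollectI exI[of _ 0] exI[of _ "real (length ?w)"] exI[of _ c]) simp
      then have "Inf ?S \<le> ennreal (cost ?w)" by (rule Inf_lower)
      also have "\<dots> \<le> ennreal (dm (\<lambda>_. 0) (Log g) (Log h) + e)" unfolding w'(4) using w(3) by (intro ennreal_leI) simp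
      also have "\<dots> = ennreal (dm (\<lambda>_. 0) (Log g) (Log h)) + ennreal e"
        using e dm_nonneg[OF adm_0] by (simp add: ennreal_plus)
      finally show "Inf ?S \<le> ennreal (dm (\<lambda>_. 0) (Log g) (Log h)) + ennreal e" .
    qed
    show "ennreal (dm (\<lambda>_. 0) (Log g) (Log h)) \<le> Inf ?S"
      using D_le_horizontal_length by (intro Inf_greatest) (auto simp: dm_def)
  qed
  then show ?thesis using dm_nonneg[OF adm_0] by (simp add: subFinsler_dist_def)
qed

lemma bij_Log: "bij Log"
  by (rule bij_betwI'[of UNIV Log UNIV]) (metis gexp_Log, simp, metis Log_gexp UNIV_I)

lemma inv_Log_0: "inv_into UNIV Log 0 = \<one>"
  by (metis bij_Log bij_is_surj gexp_0 gexp_Log surj_f_inv_f)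

text \<open>Existence is witnessed by N itself with the \<zeta>-metric. The second statement handles
  every limit space W, of whatever type, as it starts from the defining convergence of
  balls.\<close>

theorem asymptotic_cone_quasi_isometric:
  "\<exists>(X :: 'g set) dX p. asymptotic_cone UNIV (subFinsler_dist N A (U, \<phi>) V \<nu>) \<one> X dX p"
  "asymptotic_cone UNIV (subFinsler_dist N A (U, \<phi>) V \<nu>) \<one> W dW w0 \<Longrightarrow>
    \<exists>C>0. quasi_isometric_1 C (UNIV :: 'g set) (subFinsler_dist N A (U, \<phi>) V \<nu>) W dW"
proof -
  obtain K M S where "rigid_conical_approximation (UNIV :: 'g set) (\<lambda>g h. dm (\<lambda>_. 0) (Log g) (Log h)) \<one>
    (UNIV :: 'g set) (\<lambda>g h. dm \<zeta> (Log g) (Log h)) \<one> (\<lambda>n g. inv_into UNIV Log (dil (1 / real n) (Log g))) K M S"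
    using rigid_conical[OF bij_Log] unfolding inv_Log_0 by metis
  moreover have "subFinsler_dist N A (U, \<phi>) V \<nu> = (\<lambda>g h. dm (\<lambda>_. 0) (Log g) (Log h))"
    by (intro ext subFinsler_dist_eq_dm)
  ultimately interpret R: rigid_conical_approximation "UNIV :: 'g set" "subFinsler_dist N A (U, \<phi>) V \<nu>" \<one>
    "UNIV :: 'g set" "\<lambda>g h. dm \<zeta> (Log g) (Log h)" \<one> "\<lambda>n g. inv_into UNIV Log (dil (1 / real n) (Log g))" K M S by simp
  show "\<exists>(X :: 'g set) dX p. asymptotic_cone UNIV (subFinsler_dist N A (U, \<phi>) V \<nu>) \<one> X dX p"
    using R.is_asymptotic_cone by blast
  show "asymptotic_cone UNIV (subFinsler_dist N A (U, \<phi>) V \<nu>) \<one> W dW w0 \<Longrightarrow>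
    \<exists>C>0. quasi_isometric_1 C (UNIV :: 'g set) (subFinsler_dist N A (U, \<phi>) V \<nu>) W dW"
    by (rule R.quasi_isometric_cone)
qed

end

theorem theorem1p2:
  fixes N :: "'g::{t2_space, second_countable_topology} monoid"
    and A :: "('g, 'e::euclidean_space) chart set"
    and U :: "'g set" and \<phi> :: "'g \<Rightarrow> 'e"
    and V :: "'e set" and \<nu> :: "'e \<Rightarrow> real"
  assumes "lie_group N A"
    and "simply_connected (UNIV :: 'g set)"
    and "two_step_nilpotent N"
    and "non_singular N"
    and "(U, \<phi>) \<in> A" and "\<one>\<^bsub>N\<^esub> \<in> U"
    and "subspace V" and "bracket_generating N (U, \<phi>) V" and "norm_on V \<nu>"
  shows "let d = subFinsler_dist N A (U, \<phi>) V \<nu> in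
      (\<exists>(X :: 'g set) dX p. asymptotic_cone (UNIV :: 'g set) d \<one>\<^bsub>N\<^esub> X dX p) \<and>
      (\<forall>(X :: 'c set) dX p. asymptotic_cone (UNIV :: 'g set) d \<one>\<^bsub>N\<^esub> X dX p
         \<longrightarrow> (\<exists>C>0. quasi_isometric_1 C (UNIV :: 'g set) d X dX))"
proof -
  interpret two_step_lie_group N A U \<phi>
    by unfold_locales (use assms in \<open>auto simp: lie_group_def\<close>)
  interpret subfinsler_nil2 br V \<nu>
    by (rule subfinsler_nil2[OF assms(4,7,8,9)])
  interpret subfinsler_group N A U \<phi> V \<nu> ..
  show ?thesis
    using asymptotic_cone_quasi_isometric unfolding Let_def by blast
qed

end
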